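(* Let $q$ be a complex-valued function on $\mathbb{R}$ with $q\in L_1[0,1]$, $\int_0^1 q(x)\,dx=0$, $q(x+1)=q(x)$ and $\overline{q(-x)}=q(x)$. Let $N$, $\lambda_n(t)$, $\Gamma_n$, $A_n$ be as defined in the context, and let $n\ge N$. (a) If $\lambda_n(0)$ is an SR eigenvalue, then $\lambda_{-n}(0)$ is also an SR eigenvalue, $\lambda_{-n}(0)<\lambda_n(0)$, and $(\lambda_{-n}(0),\lambda_n(0))$ is the gap of $\sigma(L)\cap[A_{-N},\infty)$ lying between $\operatorname{Re}(\Gamma_{-n})$ and $\operatorname{Re}(\Gamma_n)$. If $\lambda_n(\pi)$ is an SR eigenvalue, then $\lambda_{-n-1}(\pi)$ is also an SR eigenvalue, $\lambda_n(\pi)<\lambda_{-n-1}(\pi)$, and $(\lambda_n(\pi),\lambda_{-n-1}(\pi))$ is the gap of $\sigma(L)\cap[A_{-N},\infty)$ lying between $\operatorname{Re}(\Gamma_n)$ and $\operatorname{Re}(\Gamma_{-n-1})$. (b) If $\lambda_n(0)$ is not an SR eigenvalue, then there is no gap between $\operatorname{Re}(\Gamma_{-n})$ and $\operatorname{Re}(\Gamma_n)$. If $\lambda_n(\pi)$ is not an SR eigenvalue, then there is no gap between $\operatorname{Re}(\Gamma_n)$ and $\operatorname{Re}(\Gamma_{-n-1})$. (c) The potential $q$ is finite-zone if and only if the total number of SR periodic and SR antiperiodic eigenvalues is finite.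
   Context: $L=L(q)$ is the operator generated in $L_2(-\infty,\infty)$ by the expression $-y''(x)+q(x)y(x)$, and $\sigma(L)$ is its spectrum. For $t\in(-\pi,\pi]$, $L_t$ is the operator generated in $L_2[0,1]$ by $-y''+qy$ and the boundary conditions $y(1)=e^{it}y(0)$, $y'(1)=e^{it}y'(0)$. One has $\sigma(L)=\bigcup_{t\in(-\pi,\pi]}\sigma(L_t)$, and each $\sigma(L_t)$ consists of eigenvalues. Multiplicity of an eigenvalue means algebraic multiplicity. The eigenvalues of $L_0$ and $L_\pi$ are called periodic and antiperiodic eigenvalues respectively. Numbering of eigenvalues. The eigenvalues of $L_t$, counted with multiplicity, are numbered as $\{\lambda_n(t):n\in\mathbb{Z}\}$ so that each $\lambda_n$ is continuous on $[0,\pi]$ and $\lambda_n(-t)=\lambda_n(t)$. Put $h=\frac{1}{20\pi}$. $N$ is a fixed, sufficiently large positive integer (depending only on $q$) such that, with this numbering, for all $n\in\mathbb{Z}$ with $|n|\ge N$: - for $t\in[h,\pi-h]$: $\lambda_n(t)$ is a simple eigenvalue, is real, satisfies $|\lambda_n(t)-(2\pi n+t)^2|\le|n|^{-1/2}$, and $|\lambda_n(t)-\lambda_k(t)|>2\pi^2|n|$ for all $k\ne n,-n,-n-1$; - for $t\in[0,h]$: $\lambda_n(t)$ and $\lambda_{-n}(t)$ are exactly the two eigenvalues (counting multiplicity) of $L_t$ satisfying $|\lambda-(2\pi n+t)^2|<|n|$, and $|\lambda_{\pm n}(t)-\lambda_k(t)|>2\pi^2|n|$ for all $k\neq\pm n$;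 - for $t\in[\pi-h,\pi]$: $\lambda_n(t)$ and $\lambda_{-n-1}(t)$ are exactly the two eigenvalues (counting multiplicity) of $L_t$ satisfying $|\lambda-(2\pi n+t)^2|<|n|$, and their distance to $\lambda_k(t)$ is greater than $2\pi^2|n|$ for all $k\ne n,-(n+1)$. The band $\Gamma_n$ is $\Gamma_n=\{\lambda_n(t):t\in[0,\pi]\}$, and $\operatorname{Re}(\Gamma_n):=\Gamma_n\cap\mathbb{R}$; $\sigma(L)=\bigcup_{n\in\mathbb{Z}}\Gamma_n$. Put $a_{-N}=\sup\{t\in[\pi-h,\pi]:\lambda_{-N}(t)\in\mathbb{R}\}$ and $A_{-N}=\lambda_{-N}(a_{-N})$ (a real number). $\lambda_n(t)$ is called an SR eigenvalue if it is a simple eigenvalue of $L_t$ and a real number. A gap of a closed subset of the real line (or of a half-line) is a nonempty bounded open interval that is a connected component of its complement in the line (half-line). The real part of the spectrum is $\operatorname{Re}(\sigma(L(q))):=\sigma(L(q))\cap\mathbb{R}$. The potential $q$ is called finite-zone if $\operatorname{Re}(\sigma(L(q)))$ contains a half-line $[R,\infty)$ for some number $R$ (which implies that the number of gaps in $\operatorname{Re}(\sigma(L(q)))$ is finite). *)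

theory Defs
  imports "HOL-Analysis.Analysis" "HOL-Library.Function_Algebras"
begin

section \<open>The operators \<open>L\<close> and \<open>L\<^sub>t\<close>\<close>

definition L2_on :: "real set \<Rightarrow> (real \<Rightarrow> complex) \<Rightarrow> bool" where
  "L2_on S f \<longleftrightarrow> f \<in> borel_measurable (lebesgue_on S) \<and>
     integrable (lebesgue_on S) (\<lambda>x. (cmod (f x))\<^sup>2)"

definition L2_norm :: "(real \<Rightarrow> complex) \<Rightarrow> real" where
  "L2_norm f = sqrt (\<integral>x. (cmod (f x))\<^sup>2 \<partial>lebesgue)"

text \<open>\<open>- y'' + q y = f\<close> almost everywhere on the interval \<open>S\<close>, where \<open>y\<close> is
  continuously differentiable with derivative \<open>y1\<close>, and \<open>y1\<close> is locally absolutely continuous,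
  i.e. an indefinite integral of the locally integrable function \<open>q y - f\<close>.\<close>

definition sl_equation ::
  "(real \<Rightarrow> complex) \<Rightarrow> real set \<Rightarrow> (real \<Rightarrow> complex) \<Rightarrow> (real \<Rightarrow> complex) \<Rightarrow> (real \<Rightarrow> complex) \<Rightarrow> bool"
where
  "sl_equation q S y y1 f \<longleftrightarrow>
     (\<forall>x\<in>S. (y has_vector_derivative y1 x) (at x within S)) \<and>
     (\<forall>a b. a \<le> b \<longrightarrow> {a..b} \<subseteq> S \<longrightarrow>
        (\<lambda>x. q x * y x - f x) absolutely_integrable_on {a..b} \<and>
        y1 b - y1 a = integral {a..b} (\<lambda>x. q x * y x - f x))"

text \<open>Operators are given by their graphs.  An element of the domain is represented by its
  continuous representative; the image \<open>f\<close> matters only up to null sets.\<close>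

definition hill_op :: "(real \<Rightarrow> complex) \<Rightarrow> ((real \<Rightarrow> complex) \<times> (real \<Rightarrow> complex)) set" where
  "hill_op q = {(y, f). L2_on UNIV y \<and> L2_on UNIV f \<and> (\<exists>y1. sl_equation q UNIV y y1 f)}"

text \<open>Elements of the domain of \<open>L\<^sub>t\<close> are functions on \<open>[0,1]\<close>, represented by functions on the
  line that vanish off \<open>[0,1]\<close>.\<close>

definition bloch_op ::
  "(real \<Rightarrow> complex) \<Rightarrow> real \<Rightarrow> ((real \<Rightarrow> complex) \<times> (real \<Rightarrow> complex)) set" where
  "bloch_op q t = {(y, f). (\<forall>x. x \<notin> {0..1} \<longrightarrow> y x = 0) \<and> L2_on {0..1} y \<and> L2_on {0..1} f \<and>
     (\<exists>y1. sl_equation q {0..1} y y1 f \<and> y 1 = cis t * y 0 \<and> y1 1 = cis t * y1 0)}"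

text \<open>The graph of \<open>T - z\<close>.\<close>

definition shift_op ::
  "((real \<Rightarrow> complex) \<times> (real \<Rightarrow> complex)) set \<Rightarrow> complex \<Rightarrow>
   ((real \<Rightarrow> complex) \<times> (real \<Rightarrow> complex)) set" where
  "shift_op T z = {(y, g). (y, \<lambda>x. g x + z * y x) \<in> T}"

text \<open>\<open>z\<close> is in the resolvent set iff \<open>L - z\<close> is a bijection from the domain of \<open>L\<close> onto
  \<open>L\<^sub>2\<close> with bounded inverse.\<close>

definition hill_resolvent_set :: "(real \<Rightarrow> complex) \<Rightarrow> complex set" where
  "hill_resolvent_set q = {z. \<exists>C. \<forall>f. L2_on UNIV f \<longrightarrow>
     (\<exists>!y. (y, f) \<in> shift_op (hill_op q) z) \<and>
     (\<forall>y. (y, f) \<in> shift_op (hill_op q) z \<longrightarrow> L2_norm y \<le> C * L2_norm f)}"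

definition hill_spectrum :: "(real \<Rightarrow> complex) \<Rightarrow> complex set" where
  "hill_spectrum q = - hill_resolvent_set q"

section \<open>Eigenvalues of \<open>L\<^sub>t\<close>\<close>

interpretation cfun: vector_space "\<lambda>(c::complex) (f::real \<Rightarrow> complex) x. c * f x"
  by unfold_locales (auto simp: fun_eq_iff algebra_simps)

definition eigenvalue :: "(real \<Rightarrow> complex) \<Rightarrow> real \<Rightarrow> complex \<Rightarrow> bool" where
  "eigenvalue q t z \<longleftrightarrow> (\<exists>y. y \<noteq> (\<lambda>x. 0) \<and> (y, \<lambda>x. z * y x) \<in> bloch_op q t)"

definition root_space :: "(real \<Rightarrow> complex) \<Rightarrow> real \<Rightarrow> complex \<Rightarrow> (real \<Rightarrow> complex) set" where
  "root_space q t z = {y. \<exists>k. (y, \<lambda>x. 0) \<in> shift_op (bloch_op q t) z ^^ k}"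

definition alg_mult :: "(real \<Rightarrow> complex) \<Rightarrow> real \<Rightarrow> complex \<Rightarrow> nat" where
  "alg_mult q t z = cfun.dim (root_space q t z)"

definition SR_eigenvalue :: "(real \<Rightarrow> complex) \<Rightarrow> real \<Rightarrow> complex \<Rightarrow> bool" where
  "SR_eigenvalue q t z \<longleftrightarrow> eigenvalue q t z \<and> alg_mult q t z = 1 \<and> z \<in> \<real>"

text \<open>\<open>\<lambda>\<^sub>n(t)\<close> is \<open>lam n t\<close>.  Each complex number is listed as often as its algebraic multiplicity
  says, so numbers that are not eigenvalues (root space \<open>{0}\<close>) are not listed.\<close>

definition hill_numbering :: "(real \<Rightarrow> complex) \<Rightarrow> (int \<Rightarrow> real \<Rightarrow> complex) \<Rightarrow> bool" where
  "hill_numbering q lam \<longleftrightarrow>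
     (\<forall>t\<in>{-pi<..pi}. \<forall>z. finite {n. lam n t = z} \<and> card {n. lam n t = z} = alg_mult q t z) \<and>
     (\<forall>n. continuous_on {0..pi} (lam n)) \<and>
     (\<forall>n. \<forall>t\<in>{-pi<..<pi}. lam n (- t) = lam n t)"

definition hstep :: real where
  "hstep = 1 / (20 * pi)"

text \<open>As \<open>lam\<close> lists eigenvalues with multiplicity, "exactly the two eigenvalues, counting
  multiplicity, in a disc" is a statement about the set of indices \<open>k\<close> with \<open>lam k t\<close> in it.\<close>

definition numbering_threshold ::
  "(real \<Rightarrow> complex) \<Rightarrow> (int \<Rightarrow> real \<Rightarrow> complex) \<Rightarrow> int \<Rightarrow> bool" where
  "numbering_threshold q lam N \<longleftrightarrow> N > 0 \<and> (\<forall>n. \<bar>n\<bar> \<ge> N \<longrightarrow>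
     (\<forall>t\<in>{hstep..pi - hstep}.
        SR_eigenvalue q t (lam n t) \<and>
        cmod (lam n t - of_real ((2 * pi * of_int n + t)\<^sup>2)) \<le> real_of_int \<bar>n\<bar> powr (- 1 / 2) \<and>
        (\<forall>k. k \<notin> {n, - n, - n - 1} \<longrightarrow> cmod (lam n t - lam k t) > 2 * pi\<^sup>2 * of_int \<bar>n\<bar>)) \<and>
     (\<forall>t\<in>{0..hstep}.
        {k. cmod (lam k t - of_real ((2 * pi * of_int n + t)\<^sup>2)) < of_int \<bar>n\<bar>} = {n, - n} \<and>
        (\<forall>k. k \<notin> {n, - n} \<longrightarrow>
           cmod (lam n t - lam k t) > 2 * pi\<^sup>2 * of_int \<bar>n\<bar> \<and>
           cmod (lam (- n) t - lam k t) > 2 * pi\<^sup>2 * of_int \<bar>n\<bar>)) \<and>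
     (\<forall>t\<in>{pi - hstep..pi}.
        {k. cmod (lam k t - of_real ((2 * pi * of_int n + t)\<^sup>2)) < of_int \<bar>n\<bar>} = {n, - n - 1} \<and>
        (\<forall>k. k \<notin> {n, - n - 1} \<longrightarrow>
           cmod (lam n t - lam k t) > 2 * pi\<^sup>2 * of_int \<bar>n\<bar> \<and>
           cmod (lam (- n - 1) t - lam k t) > 2 * pi\<^sup>2 * of_int \<bar>n\<bar>)))"

section \<open>Bands and gaps\<close>

definition re_part :: "complex set \<Rightarrow> real set" where
  "re_part S = {x. complex_of_real x \<in> S}"

definition band :: "(int \<Rightarrow> real \<Rightarrow> complex) \<Rightarrow> int \<Rightarrow> complex set" where
  "band lam n = lam n ` {0..pi}"

text \<open>With \<open>n = -N\<close> this is \<open>A\<^sub>-\<^sub>N\<close>; there the eigenvalue is real, and \<open>Re\<close> only converts the type.\<close>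

definition band_start :: "(int \<Rightarrow> real \<Rightarrow> complex) \<Rightarrow> int \<Rightarrow> real" where
  "band_start lam n = Re (lam n (Sup {t \<in> {pi - hstep..pi}. lam n t \<in> \<real>}))"

definition is_gap :: "real set \<Rightarrow> real set \<Rightarrow> real set \<Rightarrow> bool" where
  "is_gap H S I \<longleftrightarrow> (\<exists>a b. a < b \<and> I = {a<..<b}) \<and> I \<in> components (H - S)"

definition lies_between :: "real set \<Rightarrow> real set \<Rightarrow> real set \<Rightarrow> bool" where
  "lies_between I X Y \<longleftrightarrow>
     (\<forall>x\<in>X. \<forall>g\<in>I. \<forall>y\<in>Y. x < g \<and> g < y) \<or> (\<forall>x\<in>X. \<forall>g\<in>I. \<forall>y\<in>Y. y < g \<and> g < x)"

text \<open>\<open>I\<close> is a gap of \<open>\<sigma>(L) \<inter> [A\<^sub>-\<^sub>N,\<infinity>)\<close> between the real parts of the bands \<open>m\<close> and \<open>n\<close>.\<close>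

definition gap_between ::
  "(real \<Rightarrow> complex) \<Rightarrow> (int \<Rightarrow> real \<Rightarrow> complex) \<Rightarrow> int \<Rightarrow> int \<Rightarrow> int \<Rightarrow> real set \<Rightarrow> bool" where
  "gap_between q lam N m n I \<longleftrightarrow>
     (let H = {band_start lam (- N)..} in is_gap H (re_part (hill_spectrum q) \<inter> H) I) \<and>
     lies_between I (re_part (band lam m)) (re_part (band lam n))"

definition finite_zone :: "(real \<Rightarrow> complex) \<Rightarrow> bool" where
  "finite_zone q \<longleftrightarrow> (\<exists>R. {R..} \<subseteq> re_part (hill_spectrum q))"

end

theory Submission
  imports Defs "HOL-Complex_Analysis.Complex_Analysis"
begin

text \<open>Let \<open>F\<close> be the trace of the monodromy matrix of \<open>- y'' + q y = z y\<close>. Then \<open>z\<close> is an eigenvalue of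
  \<open>L\<^sub>t\<close> iff \<open>F z = 2 cos t\<close>, a simple eigenvalue is not a critical point of \<open>F\<close>, and a real \<open>z\<close> belongs
  to \<open>\<sigma>(L)\<close> iff \<open>\<bar>F z\<bar> \<le> 2\<close>, because the symmetry of \<open>q\<close> makes \<open>F\<close> real on the real axis.
  For large \<open>n\<close> the eigenvalues \<open>\<lambda>\<^sub>-\<^sub>n(t) < \<lambda>\<^sub>n(t)\<close> start at \<open>t = h\<close> from two real solutions of
  \<open>F = 2 cos h\<close> and are the only solutions of \<open>F = 2 cos t\<close> between these as \<open>t\<close> decreases to \<open>0\<close>.
  If \<open>F\<close> exceeds \<open>2\<close> between them, they stay real and the set \<open>F > 2\<close> between \<open>\<lambda>\<^sub>-\<^sub>n(0)\<close> and \<open>\<lambda>\<^sub>n(0)\<close> is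
  a gap; otherwise the whole interval is in the spectrum, and at \<open>t = 0\<close> the two eigenvalues coincide or
  are not real. The same happens at \<open>t = \<pi>\<close> with \<open>- F\<close>.\<close>

text \<open>The spectrum of \<open>L\<close> is defined by a bounded resolvent, so the criterion by
  \<open>F\<close> needs analysis both ways. For \<open>\<bar>F\<bar> \<le> 2\<close> cut-off
  Floquet solutions contradict a bounded inverse; for \<open>\<bar>F\<bar> > 2\<close> the monodromy
  matrix has one eigenvalue inside and one outside the unit circle, and solving
  \<open>(L - z) y = g\<close> becomes a recursion for the values at the integers. Algebraic
  multiplicity is a dimension, and an infinite dimension counts as 0; root spaces are therefore
  shown to be finite-dimensional, through the finite order of the zeros of
  \<open>F - 2 cos t\<close>. \<open>F\<close> is not expanded asymptotically: positions of
  eigenvalues come from the threshold alone, with error 1 at \<open>t = h\<close> and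
  \<open>t = \<pi> - h\<close> and error \<open>n\<close> near the ends. These errors may exceed the
  distance of paired eigenvalues, so their order comes from simplicity and the intermediate value
  theorem. Near the ends the branches may leave the real axis; what decides is the real graph of
  \<open>F\<close>. A real simple eigenvalue at \<open>t = 0\<close> is not critical for
  \<open>F\<close>, yet it would be a maximum if \<open>F\<close> stayed below 2.\<close>

section \<open>Calculus with a merely integrable coefficient\<close>

text \<open>On a partition into \<open>n + 1\<close> equal pieces the increments of \<open>G\<close>
  telescope, which bounds \<open>norm (D b - D a)\<close> by
  \<open>(b - a) * (G b - G a) / (n + 1)\<close> for every \<open>n\<close>.\<close>

lemma eq_if_increments_small:
  fixes D :: "real \<Rightarrow> 'a::real_normed_vector" and G :: "real \<Rightarrow> real"
  assumes "a \<le> b"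
    and incr: "\<And>x y. a \<le> x \<Longrightarrow> x \<le> y \<Longrightarrow> y \<le> b \<Longrightarrow> norm (D y - D x) \<le> (y - x) * (G y - G x)"
  shows "D b = D a"
proof -
  have *: "norm (D b - D a) \<le> (b - a) * (G b - G a) * inverse (real (Suc n))" for n
  proof -
    define x where "x i = a + (b - a) * real i / real (Suc n)" for i
    have x0: "x 0 = a" by (simp add: x_def)
    have xn: "x (Suc n) = b"
      unfolding x_def by (subst nonzero_mult_div_cancel_right[OF of_nat_neq_0]) simp
    have xs: "x (Suc i) - x i = (b - a) / real (Suc n)" for i
    proof -
      have "real (Suc i) - real i = 1" by simp
      then show ?thesis
        unfolding x_def by (metis add_diff_cancel_left diff_divide_distrib mult.right_neutral right_diff_distrib)
    qed
    have mono: "x i \<le> x j" if "i \<le> j" for i j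
      using that assms(1) by (auto simp: x_def intro!: divide_right_mono mult_left_mono)
    have rng: "a \<le> x i" "x i \<le> b" if "i \<le> Suc n" for i
      using mono[of 0 i] mono[of i "Suc n"] that x0 xn by auto
    have "D b - D a = (\<Sum>i<Suc n. D (x (Suc i)) - D (x i))"
      by (subst sum_lessThan_telescope) (simp add: x0 xn)
    also have "norm \<dots> \<le> (\<Sum>i<Suc n. (b - a) / real (Suc n) * (G (x (Suc i)) - G (x i)))"
    proof (rule sum_norm_le)
      fix i assume "i \<in> {..<Suc n}"
      then show "norm (D (x (Suc i)) - D (x i)) \<le> (b - a) / real (Suc n) * (G (x (Suc i)) - G (x i))"
        using incr[OF rng(1) mono rng(2), of i "Suc i"] by (simp only: xs) auto
    qed
    also have "\<dots> = (b - a) / real (Suc n) * (G b - G a)"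
      by (subst sum_distrib_left[symmetric], subst sum_lessThan_telescope) (simp add: x0 xn)
    finally show ?thesis by (simp add: field_simps)
  qed
  have "(\<lambda>n. (b - a) * (G b - G a) * inverse (real (Suc n))) \<longlonglongrightarrow> (b - a) * (G b - G a) * 0"
    by (intro tendsto_intros LIMSEQ_inverse_real_of_nat)
  then have "norm (D b - D a) \<le> (b - a) * (G b - G a) * 0"
    using * by (intro tendsto_lowerbound[of _ _ sequentially]) auto
  then show ?thesis by simp
qed

lemma integral_norm_le_diff:
  fixes f :: "real \<Rightarrow> 'a::euclidean_space"
  assumes f: "f absolutely_integrable_on {a..b}" and "a \<le> x" "x \<le> y" "y \<le> b"
  shows "f absolutely_integrable_on {x..y}"
    "norm (integral {x..y} f) \<le> integral {a..y} (\<lambda>s. norm (f s)) - integral {a..x} (\<lambda>s. norm (f s))"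
    "integral {a..y} f - integral {a..x} f = integral {x..y} f"
proof -
  have sub: "f absolutely_integrable_on {c..d}" if "a \<le> c" "d \<le> b" for c d
    using f that by (rule_tac absolutely_integrable_on_subinterval) auto
  show "f absolutely_integrable_on {x..y}" using assms sub by auto
  have i: "f integrable_on {c..d}" "(\<lambda>s. norm (f s)) integrable_on {c..d}" if "a \<le> c" "d \<le> b" for c d
    using sub[OF that] by (auto simp: absolutely_integrable_on_def)
  show "integral {a..y} f - integral {a..x} f = integral {x..y} f"
    using Henstock_Kurzweil_Integration.integral_combine[of a x y f] i[of a y] assms by (simp add: algebra_simps)
  have "norm (integral {x..y} f) \<le> integral {x..y} (\<lambda>s. norm (f s))"
    using assms by (intro integral_norm_bound_integral i) auto
  also have "\<dots> = integral {a..y} (\<lambda>s. norm (f s)) - integral {a..x} (\<lambda>s. norm (f s))"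
    using Henstock_Kurzweil_Integration.integral_combine[of a x y "\<lambda>s. norm (f s)"] i[of a y] assms by (simp add: algebra_simps)
  finally show "norm (integral {x..y} f) \<le> \<dots>" .
qed

lemma absolutely_integrable_mult_continuous:
  fixes f g :: "real \<Rightarrow> complex"
  assumes "f absolutely_integrable_on {a..b}" "continuous_on {a..b} g"
  shows "(\<lambda>x. f x * g x) absolutely_integrable_on {a..b}"
proof (rule absolutely_integrable_bounded_measurable_product[of "\<lambda>x y. y * x"])
  show "g \<in> borel_measurable (lebesgue_on {a..b})"
    using assms by (intro continuous_imp_measurable_on_sets_lebesgue) auto
  show "bounded (g ` {a..b})"
    using assms by (intro compact_imp_bounded compact_continuous_image) auto
  show "bilinear (\<lambda>x y. y * x :: complex)"
    by (auto simp: bilinear_def linear_iff algebra_simps)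
qed (use assms in auto)

text \<open>The defect of the formula over \<open>[x, y]\<close> is of second order, i.e. \<open>y - x\<close> times the variation of
  an increasing function, so no differentiation theorem for \<open>L\<^sub>1\<close> functions is needed.\<close>

lemma integral_mult_by_parts:
  fixes q u :: "real \<Rightarrow> complex"
  assumes "a \<le> b" and q: "q absolutely_integrable_on {a..b}"
    and u: "\<And>x. x \<in> {a..b} \<Longrightarrow> (u has_vector_derivative u' x) (at x within {a..b})"
    and u': "continuous_on {a..b} u'"
  shows "integral {a..b} (\<lambda>x. q x * u x) =
     integral {a..b} q * u b - integral {a..b} (\<lambda>x. integral {a..x} q * u' x)"
proof -
  define Q where "Q x = integral {a..x} q" for x
  define G where "G x = integral {a..x} (\<lambda>s. norm (q s))" for x
  have cu: "continuous_on {a..b} u"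
    using u by (rule continuous_on_vector_derivative)
  have qi: "q integrable_on {a..b}" using q absolutely_integrable_on_def by blast
  have cQ: "continuous_on {a..b} Q" unfolding Q_def using qi by (intro indefinite_integral_continuous_1) auto
  obtain L where L: "\<And>x. x \<in> {a..b} \<Longrightarrow> norm (u' x) \<le> L" and L0: "L > 0"
    using compact_imp_bounded[OF compact_continuous_image[OF u' compact_Icc]]
    unfolding bounded_pos by blast
  have quai: "(\<lambda>x. q x * u x) absolutely_integrable_on {a..b}"
    by (intro absolutely_integrable_mult_continuous q cu)
  have cQu: "continuous_on {a..b} (\<lambda>x. Q x * u' x)" by (intro continuous_intros cQ u')
  then have Quai: "(\<lambda>x. Q x * u' x) absolutely_integrable_on {a..b}"
    by (rule absolutely_integrable_continuous_real)
  have lip: "norm (u t - u s) \<le> L * (t - s)" if "a \<le> s" "s \<le> t" "t \<le> b" for s t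
  proof -
    have "(u' has_integral (u t - u s)) {s..t}"
      by (rule fundamental_theorem_of_calculus) (use that in \<open>auto intro!: has_vector_derivative_within_subset[OF u]\<close>)
    moreover have "norm (integral {s..t} u') \<le> integral {s..t} (\<lambda>_. L)"
      by (rule integral_norm_bound_integral)
        (use that L in \<open>auto intro!: integrable_continuous_interval continuous_on_subset[OF u']\<close>)
    ultimately have "norm (u t - u s) \<le> L * (t - s)"
      using that by (simp add: integral_unique mult.commute)
    then show ?thesis using that by simp
  qed
  \<comment> \<open>\<open>D\<close> is the defect of the formula on \<open>[a, x]\<close>, and
    \<open>D a = 0\<close>.\<close>
  define D where "D x = integral {a..x} (\<lambda>x. q x * u x) - Q x * u x + integral {a..x} (\<lambda>x. Q x * u' x)" for x
  have "D b = D a"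
  proof (rule eq_if_increments_small[where G = "\<lambda>x. 2 * L * G x", OF assms(1)])
    fix s t assume st: "a \<le> s" "s \<le> t" "t \<le> b"
    note dq = integral_norm_le_diff[OF q] and dqu = integral_norm_le_diff[OF quai] and dQu = integral_norm_le_diff[OF Quai]
    have G: "integral {s..t} (\<lambda>r. norm (q r)) = G t - G s"
      using integral_norm_le_diff(3)[where f = "\<lambda>r. norm (q r)" and a = a and b = b and x = s and y = t]
        set_integrable_norm[OF q] st by (simp add: G_def)
    have ai1: "(\<lambda>r. q r * (u r - u s)) absolutely_integrable_on {s..t}"
      by (intro absolutely_integrable_mult_continuous dq(1) st continuous_intros continuous_on_subset[OF cu]) (use st in auto)
    have i1: "integral {s..t} (\<lambda>r. q r * (u r - u s)) = integral {s..t} (\<lambda>r. q r * u r) - integral {s..t} q * u s"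
    proof -
      have "integral {s..t} (\<lambda>r. q r * u r - q r * u s) = integral {s..t} (\<lambda>r. q r * u r) - integral {s..t} (\<lambda>r. q r * u s)"
        using dqu(1)[OF st] dq(1)[OF st] 
        by (intro Henstock_Kurzweil_Integration.integral_diff integrable_on_mult_left) (auto simp: absolutely_integrable_on_def)
      then show ?thesis by (simp add: algebra_simps)
    qed
    have b1: "norm (integral {s..t} (\<lambda>r. q r * (u r - u s))) \<le> integral {s..t} (\<lambda>r. norm (q r) * (L * (t - s)))"
    proof (rule integral_norm_bound_integral)
      show "(\<lambda>r. q r * (u r - u s)) integrable_on {s..t}" using ai1 by (auto simp: absolutely_integrable_on_def)
      show "(\<lambda>r. norm (q r) * (L * (t - s))) integrable_on {s..t}" 
        using dq(1)[OF st] by (intro integrable_on_mult_left) (auto simp: absolutely_integrable_on_def)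
      fix r assume r: "r \<in> {s..t}"
      have "norm (u r - u s) \<le> L * (r - s)" using lip[of s r] r st by auto
      also have "\<dots> \<le> L * (t - s)" using r L0 by auto
      finally show "norm (q r * (u r - u s)) \<le> norm (q r) * (L * (t - s))"
        by (simp add: norm_mult mult_left_mono)
    qed
    have b2: "norm (integral {s..t} (\<lambda>r. (Q t - Q r) * u' r)) \<le> integral {s..t} (\<lambda>r. (G t - G s) * L)"
    proof (rule integral_norm_bound_integral)
      show "(\<lambda>r. (Q t - Q r) * u' r) integrable_on {s..t}"
        by (intro integrable_continuous_interval continuous_intros continuous_on_subset[OF cQ] continuous_on_subset[OF u']) (use st in auto)
      fix r assume r: "r \<in> {s..t}"
      have "norm (Q t - Q r) \<le> G t - G r" using dq(2,3)[of r t] r st by (simp add: Q_def G_def)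
      moreover have "norm (Q r - Q s) \<le> G r - G s" using dq(2,3)[of s r] r st by (simp add: Q_def G_def)
      ultimately have "norm (Q t - Q r) \<le> G t - G s" "0 \<le> G t - G s"
        using norm_ge_zero[of "Q r - Q s"] norm_ge_zero[of "Q t - Q r"] by linarith+
      then show "norm ((Q t - Q r) * u' r) \<le> (G t - G s) * L"
        unfolding norm_mult using L[of r] r st by (intro mult_mono) auto
    qed auto
    have i2: "integral {s..t} (\<lambda>r. (Q t - Q r) * u' r) = Q t * (u t - u s) - integral {s..t} (\<lambda>r. Q r * u' r)"
    proof -
      have ftc: "(u' has_integral (u t - u s)) {s..t}"
        by (rule fundamental_theorem_of_calculus) (use st in \<open>auto intro!: has_vector_derivative_within_subset[OF u]\<close>)
      have "integral {s..t} (\<lambda>r. Q t * u' r - Q r * u' r) = integral {s..t} (\<lambda>r. Q t * u' r) - integral {s..t} (\<lambda>r. Q r * u' r)"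
        using ftc dQu(1)[OF st] 
        by (intro Henstock_Kurzweil_Integration.integral_diff integrable_on_mult_right) (auto simp: absolutely_integrable_on_def)
      then show ?thesis using ftc by (simp add: algebra_simps integral_unique)
    qed
    \<comment> \<open>The increment is the integral of \<open>q * (u - u s)\<close> minus that of
      \<open>(Q t - Q) * u'\<close>. The first difference is controlled by the Lipschitz constant
      \<open>L\<close> times \<open>t - s\<close>, the second by the increase of \<open>G\<close>;
      both give a product of the two.\<close>
    have "D t - D s = (integral {s..t} (\<lambda>r. q r * u r) - integral {s..t} q * u s) - (Q t * (u t - u s) - integral {s..t} (\<lambda>r. Q r * u' r))"
      using dqu(3)[OF st] dQu(3)[OF st] dq(3)[OF st, folded Q_def] by (simp add: D_def algebra_simps)
    then have "norm (D t - D s) \<le> norm (integral {s..t} (\<lambda>r. q r * (u r - u s))) + norm (integral {s..t} (\<lambda>r. (Q t - Q r) * u' r))"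
      unfolding i1 i2 by (metis norm_triangle_ineq4)
    also have "\<dots> \<le> (t - s) * (2 * L * G t - 2 * L * G s)"
    proof -
      have "integral {s..t} (\<lambda>r. norm (q r) * (L * (t - s))) = (G t - G s) * (L * (t - s))"
        by (simp only: integral_mult_left G)
      moreover have "integral {s..t} (\<lambda>r. (G t - G s) * L) = (G t - G s) * L * (t - s)"
        using st by simp
      ultimately show ?thesis using add_mono[OF b1 b2] by (simp add: algebra_simps)
    qed
    finally show "norm (D t - D s) \<le> (t - s) * (2 * L * G t - 2 * L * G s)" .
  qed
  then show ?thesis by (simp add: D_def Q_def algebra_simps)
qed

text \<open>Gronwall's inequality in both directions: \<open>exp (- k * x) * E x\<close> does not
  increase and \<open>exp (k * x) * E x\<close> does not decrease, so the reference point
  \<open>s\<close> may lie on either side of \<open>x\<close>.\<close>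

lemma exp_growth_bound:
  fixes E E' :: "real \<Rightarrow> real"
  assumes E: "\<And>x. x \<in> {a..b} \<Longrightarrow> (E has_real_derivative E' x) (at x within {a..b})"
    and E': "\<And>x. x \<in> {a..b} \<Longrightarrow> \<bar>E' x\<bar> \<le> k * E x"
    and xs: "x \<in> {a..b}" "s \<in> {a..b}"
  shows "E x \<le> exp (k * \<bar>x - s\<bar>) * E s"
proof -
  have E_open: "(E has_real_derivative E' y) (at y)" if "a < y" "y < b" for y
    using E[of y] at_within_interior[of y "{a..b}"] that by auto
  have cont: "continuous_on {a..b} E" using E by (rule DERIV_continuous_on)
  show ?thesis
  proof (cases "s \<le> x")
    case True
    have "exp (- k * s) * E s \<ge> exp (- k * x) * E x"
    proof (rule DERIV_nonpos_imp_decreasing_open[OF True])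
      show "continuous_on {s..x} (\<lambda>x. exp (- k * x) * E x)"
        by (intro continuous_intros continuous_on_subset[OF cont]) (use xs in auto)
      fix y assume y: "s < y" "y < x"
      have "((\<lambda>x. exp (- k * x) * E x) has_real_derivative exp (- k * y) * (E' y - k * E y)) (at y)"
        by (rule derivative_eq_intros E_open refl | use y xs in \<open>simp add: algebra_simps\<close>)+
      moreover have "exp (- k * y) * (E' y - k * E y) \<le> 0" using E'[of y] y xs by (simp add: mult_le_0_iff)
      ultimately show "\<exists>d. ((\<lambda>x. exp (- k * x) * E x) has_real_derivative d) (at y) \<and> d \<le> 0" by blast
    qed
    then have "exp (k * x) * (exp (- k * x) * E x) \<le> exp (k * x) * (exp (- k * s) * E s)" by simp
    then have "E x \<le> exp (k * x - k * s) * E s" by (simp add: mult.assoc[symmetric] exp_add[symmetric])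
    then show ?thesis using True by (simp add: algebra_simps)
  next
    case False
    then have "x \<le> s" by simp
    have "exp (k * x) * E x \<le> exp (k * s) * E s"
    proof (rule DERIV_nonneg_imp_increasing_open[OF \<open>x \<le> s\<close>])
      show "continuous_on {x..s} (\<lambda>x. exp (k * x) * E x)"
        by (intro continuous_intros continuous_on_subset[OF cont]) (use xs in auto)
      fix y assume y: "x < y" "y < s"
      have "((\<lambda>x. exp (k * x) * E x) has_real_derivative exp (k * y) * (E' y + k * E y)) (at y)"
        by (rule derivative_eq_intros E_open refl | use y xs in \<open>simp add: algebra_simps\<close>)+
      moreover have "0 \<le> exp (k * y) * (E' y + k * E y)" using E'[of y] y xs by (simp add: zero_le_mult_iff)
      ultimately show "\<exists>d. ((\<lambda>x. exp (k * x) * E x) has_real_derivative d) (at y) \<and> 0 \<le> d" by blast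
    qed
    then have "exp (- k * x) * (exp (k * x) * E x) \<le> exp (- k * x) * (exp (k * s) * E s)" by simp
    then have "E x \<le> exp (k * s - k * x) * E s" by (simp add: mult.assoc[symmetric] exp_add[symmetric])
    then show ?thesis using False by (simp add: algebra_simps abs_if)
  qed
qed

section \<open>Antiderivatives on the whole line and Picard iteration\<close>

text \<open>For negative \<open>x\<close> the interval \<open>{0..x}\<close> is empty and its
  integral is 0, hence the separate branch with the opposite sign.\<close>

definition prim :: "(real \<Rightarrow> 'a::euclidean_space) \<Rightarrow> real \<Rightarrow> 'a" where
  "prim g x = (if 0 \<le> x then integral {0..x} g else - integral {x..0} g)"

lemma prim_0 [simp]: "prim g 0 = 0"
  by (simp add: prim_def)

lemma prim_diff:
  assumes "\<And>a b. g absolutely_integrable_on {a..b}" "a \<le> b"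
  shows "prim g b - prim g a = integral {a..b} g"
proof -
  have i: "g integrable_on {c..d}" for c d using assms(1)[of c d] by (simp add: absolutely_integrable_on_def)
  have c: "integral {c..e} g = integral {c..d} g + integral {d..e} g" if "c \<le> d" "d \<le> e" for c d e
    using Henstock_Kurzweil_Integration.integral_combine[OF that i] by simp
  consider "0 \<le> a" | "a < 0" "0 \<le> b" | "b < 0" by linarith
  then show ?thesis
  proof cases
    case 1
    then show ?thesis using c[of 0 a b] assms(2) by (simp add: prim_def)
  next
    case 2
    then show ?thesis using c[of a 0 b] by (simp add: prim_def)
  next
    case 3
    then show ?thesis using c[of a b 0] assms(2) by (simp add: prim_def)
  qed
qed

lemma prim_has_vector_derivative:
  assumes "continuous_on UNIV g"
  shows "(prim g has_vector_derivative g x) (at x)"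
proof -
  have ai: "g absolutely_integrable_on {a..b}" for a b
    by (intro absolutely_integrable_continuous_real continuous_on_subset[OF assms]) auto
  have *: "prim g y = prim g (x - 1) + integral {x - 1..y} g" if "y \<in> {x-1<..<x+1}" for y
    using prim_diff[OF ai, of "x-1" y] that by (simp add: algebra_simps)
  have "((\<lambda>y. integral {x - 1..y} g) has_vector_derivative g x) (at x within {x-1..x+1})"
    by (intro integral_has_vector_derivative continuous_on_subset[OF assms]) auto
  then have "((\<lambda>y. integral {x - 1..y} g) has_vector_derivative g x) (at x)"
    using at_within_Icc_at[of "x - 1" x "x + 1"] by simp
  then have D: "((\<lambda>y. prim g (x - 1) + integral {x - 1..y} g) has_vector_derivative g x) (at x)"
    using has_vector_derivative_add[OF has_vector_derivative_const[of "prim g (x - 1)"]] by simp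
  show ?thesis
  proof (rule has_vector_derivative_transform_within_open[OF D])
    show "open {x-1<..<x+1}" "x \<in> {x-1<..<x+1}" by auto
    show "prim g (x - 1) + integral {x - 1..y} g = prim g y" if "y \<in> {x-1<..<x+1}" for y
      by (rule *[OF that, symmetric])
  qed
qed

lemma prim_continuous:
  assumes ai: "\<And>a b. g absolutely_integrable_on {a..b}"
  shows "continuous_on UNIV (prim g)"
proof (rule continuous_at_imp_continuous_on, rule ballI)
  fix x :: real
  have "g integrable_on {x-1..x+1}" using ai absolutely_integrable_on_def by blast
  then have "continuous_on {x-1..x+1} (\<lambda>y. integral {x - 1..y} g)"
    by (rule indefinite_integral_continuous_1)
  then have "continuous_on {x-1..x+1} (\<lambda>y. prim g (x - 1) + integral {x - 1..y} g)"
    by (intro continuous_intros)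
  moreover have "prim g (x - 1) + integral {x - 1..y} g = prim g y" if "y \<in> {x-1..x+1}" for y
    using prim_diff[OF ai, of "x-1" y] that by (simp add: algebra_simps)
  ultimately have "continuous_on {x-1..x+1} (prim g)"
    using continuous_on_eq by blast
  then show "isCont (prim g) x"
    by (rule continuous_on_interior) simp
qed

primrec picard :: "(real \<Rightarrow> 'a \<Rightarrow> 'a) \<Rightarrow> 'a \<Rightarrow> nat \<Rightarrow> real \<Rightarrow> 'a::euclidean_space" where
  "picard f u0 0 = (\<lambda>x. u0)"
| "picard f u0 (Suc n) = (\<lambda>x. u0 + prim (\<lambda>s. f s (picard f u0 n s)) x)"

text \<open>One step of the Picard estimate: integrating \<open>\<bar>x\<bar> ^ n\<close> gains the
  factor \<open>1 / (n + 1)\<close> from which the factorials arise. Negative \<open>x\<close> are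
  reduced to positive ones by reflecting \<open>g\<close>.\<close>

lemma norm_le_power_fact_if_derivative_le:
  fixes g :: "real \<Rightarrow> 'a::euclidean_space"
  assumes g: "\<And>x. x \<in> {-R..R} \<Longrightarrow> (g has_vector_derivative g' x) (at x)"
    and g': "\<And>x. x \<in> {-R..R} \<Longrightarrow> norm (g' x) \<le> C * \<bar>x\<bar> ^ n"
    and "g 0 = 0" and x: "x \<in> {-R..R}"
  shows "norm (g x) \<le> C * \<bar>x\<bar> ^ Suc n / real (Suc n)"
proof -
  have *: "norm (h y - h 0) \<le> C * y ^ Suc n / real (Suc n) - C * 0 ^ Suc n / real (Suc n)"
    if h: "\<And>x. x \<in> {0..y} \<Longrightarrow> (h has_vector_derivative h' x) (at x)"
      "\<And>x. x \<in> {0..y} \<Longrightarrow> norm (h' x) \<le> C * x ^ n" and y: "0 \<le> y"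
    for h h' :: "real \<Rightarrow> 'a" and y
  proof (cases "y = 0")
    case False
    show ?thesis
    proof (rule differentiable_bound_general[of 0 y h "\<lambda>y. C * y ^ Suc n / real (Suc n)" h' "\<lambda>x. C * x ^ n"])
      show "continuous_on {0..y} h"
        using h(1) by (meson continuous_at_imp_continuous_on has_vector_derivative_continuous)
      show "((\<lambda>y. C * y ^ Suc n / real (Suc n)) has_vector_derivative C * x ^ n) (at x)" for x
        unfolding has_real_derivative_iff_has_vector_derivative[symmetric]
        by (rule derivative_eq_intros refl | simp del: of_nat_Suc)+
    qed (use h y False in \<open>auto intro!: continuous_intros\<close>)
  qed auto
  show ?thesis
  proof (cases "0 \<le> x")
    case True
    have "norm (g x - g 0) \<le> C * x ^ Suc n / real (Suc n) - C * 0 ^ Suc n / real (Suc n)"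
    proof (rule *[of x g g'])
      fix y assume "y \<in> {0..x}"
      then have y: "y \<in> {-R..R}" "\<bar>y\<bar> = y" using x by auto
      show "(g has_vector_derivative g' y) (at y)" "norm (g' y) \<le> C * y ^ n"
        using g[OF y(1)] g'[OF y(1)] y(2) by simp_all
    qed (rule True)
    then show ?thesis using True assms(3) by simp
  next
    case False
    have "((\<lambda>x. g (- x)) has_vector_derivative - g' (- y)) (at y)" if "y \<in> {0..-x}" for y
    proof -
      have "((\<lambda>x. - x) has_vector_derivative -1) (at y)"
        by (auto intro!: derivative_eq_intros)
      from vector_diff_chain_at[OF this, of g "g' (-y)"] g[of "-y"] that x show ?thesis
        by (simp add: o_def)
    qed
    moreover have "norm (- g' (- y)) \<le> C * y ^ n" if "y \<in> {0..-x}" for y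
    proof -
      have y: "- y \<in> {-R..R}" "\<bar>- y\<bar> = y" using that x by auto
      show ?thesis using g'[OF y(1)] y(2) by simp
    qed
    ultimately have "norm (g (- (- x)) - g (- 0)) \<le> C * (- x) ^ Suc n / real (Suc n) - C * 0 ^ Suc n / real (Suc n)"
      using False by (intro *[of "-x" "\<lambda>x. g (- x)" "\<lambda>x. - g' (- x)"]) auto
    then show ?thesis using False assms(3) by simp
  qed
qed

text \<open>On \<open>[-R, R]\<close> consecutive iterates differ by at most
  \<open>C * K ^ n * \<bar>x\<bar> ^ Suc n / fact (Suc n)\<close>, so the iteration converges on
  intervals of any length. Continuity is stated along curves \<open>X\<close> because the iteration
  integrates \<open>f\<close> along its own iterates.\<close>

proposition Lipschitz_ode_exists:
  fixes f :: "real \<Rightarrow> 'a::euclidean_space \<Rightarrow> 'a"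
  assumes cont: "\<And>X. continuous_on UNIV X \<Longrightarrow> continuous_on UNIV (\<lambda>x. f x (X x))"
    and lip: "\<And>R. \<exists>K. \<forall>x\<in>{-R..R}. \<forall>u w. norm (f x u - f x w) \<le> K * norm (u - w)"
  obtains X where "X 0 = u0" "\<And>x. (X has_vector_derivative f x (X x)) (at x)"
proof -
  let ?P = "picard f u0"
  have cP: "continuous_on UNIV (?P n)" for n
  proof (induction n)
    case (Suc n)
    show ?case unfolding picard.simps
      by (intro continuous_intros prim_continuous absolutely_integrable_continuous_real
          continuous_on_subset[OF cont[OF Suc]]) auto
  qed auto
  have dP: "(?P (Suc n) has_vector_derivative f x (?P n x)) (at x)" for n x
    unfolding picard.simps
    using has_vector_derivative_add[OF has_vector_derivative_const[of u0] prim_has_vector_derivative[OF cont[OF cP]]]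
    by simp
  have P0: "?P n 0 = u0" for n by (cases n) auto
  have "\<exists>X. \<forall>x. X 0 = u0 \<and> (\<lambda>n. ?P n x) \<longlonglongrightarrow> X x \<and> (X has_vector_derivative f x (X x)) (at x)"
  proof -
    have key: "\<exists>X. \<forall>x\<in>{-R<..<R}. X 0 = u0 \<and> (\<lambda>n. ?P n x) \<longlonglongrightarrow> X x \<and> (X has_vector_derivative f x (X x)) (at x)" if R: "R > 0" for R :: real
    proof -
      obtain K0 where K0: "\<And>x u w. x \<in> {-R..R} \<Longrightarrow> norm (f x u - f x w) \<le> K0 * norm (u - w)" using lip by blast
      define K where "K = max K0 1"
      have K: "norm (f x u - f x w) \<le> K * norm (u - w)" if "x \<in> {-R..R}" for x u w
        using K0[OF that, of u w] mult_right_mono[of K0 K "norm (u - w)"] by (auto simp: K_def)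
      have K1: "K > 0" by (auto simp: K_def)
      have "compact ((\<lambda>x. f x u0) ` {-R..R})"
        by (intro compact_continuous_image continuous_on_subset[OF cont[OF continuous_on_const]]) auto
      then obtain C where C: "\<And>x. x \<in> {-R..R} \<Longrightarrow> norm (f x u0) \<le> C" and C0: "C > 0"
        using compact_imp_bounded[of "(\<lambda>x. f x u0) ` {-R..R}"] unfolding bounded_pos by blast
      have bd: "norm (?P (Suc n) x - ?P n x) \<le> C * K ^ n * \<bar>x\<bar> ^ Suc n / fact (Suc n)" if "x \<in> {-R..R}" for n x
        using that
      proof (induction n arbitrary: x)
        case 0
        have "norm (?P (Suc 0) x - u0) \<le> C * \<bar>x\<bar> ^ Suc 0 / real (Suc 0)"
          by (rule norm_le_power_fact_if_derivative_le[of R "\<lambda>x. ?P (Suc 0) x - u0" "\<lambda>x. f x u0"])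
            (use C 0 dP[of 0] P0[of 1] in \<open>auto simp: has_vector_derivative_diff_const simp del: picard.simps(2)\<close>)
        then show ?case by simp
      next
        case (Suc n)
        have "norm (?P (Suc (Suc n)) x - ?P (Suc n) x) \<le> (K * (C * K ^ n / fact (Suc n))) * \<bar>x\<bar> ^ Suc (Suc n) / real (Suc (Suc n))"
        proof (rule norm_le_power_fact_if_derivative_le[of R _ "\<lambda>x. f x (?P (Suc n) x) - f x (?P n x)"])
          fix y assume y: "y \<in> {-R..R}"
          show "((\<lambda>x. ?P (Suc (Suc n)) x - ?P (Suc n) x) has_vector_derivative f y (?P (Suc n) y) - f y (?P n y)) (at y)"
            by (rule has_vector_derivative_diff[OF dP dP])
          have "norm (f y (?P (Suc n) y) - f y (?P n y)) \<le> K * norm (?P (Suc n) y - ?P n y)"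
            by (rule K[OF y])
          also have "\<dots> \<le> K * (C * K ^ n * \<bar>y\<bar> ^ Suc n / fact (Suc n))"
            by (rule mult_left_mono[OF Suc.IH[OF y]]) (use K1 in auto)
          finally show "norm (f y (?P (Suc n) y) - f y (?P n y)) \<le> K * (C * K ^ n / fact (Suc n)) * \<bar>y\<bar> ^ Suc n" by simp
        qed (use Suc.prems P0 in \<open>auto simp del: picard.simps(2)\<close>)
        also have "\<dots> = C * K ^ Suc n * \<bar>x\<bar> ^ Suc (Suc n) / fact (Suc (Suc n))"
          by (simp only: fact_Suc[of "Suc n"]) (simp add: field_simps del: fact_Suc)
        finally show ?case .
      qed
      define M where "M n = C * K ^ n * R ^ Suc n / fact (Suc n)" for n
      have sM: "summable M"
      proof -
        have "summable (\<lambda>n. C / K * ((K * R) ^ Suc n /\<^sub>R fact (Suc n)))"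
          using summable_exp_generic[of "K * R"] by (intro summable_mult) (subst summable_Suc_iff)
        moreover have "C / K * ((K * R) ^ Suc n /\<^sub>R fact (Suc n)) = M n" for n
          using K1 by (simp add: M_def power_mult_distrib field_simps del: fact_Suc)
        ultimately show ?thesis by simp
      qed
      have bM: "norm (?P (Suc n) x - ?P n x) \<le> M n" if "x \<in> {-R..R}" for n x
      proof -
        have "\<bar>x\<bar> ^ Suc n \<le> R ^ Suc n" using that by (intro power_mono) auto
        then show ?thesis using bd[OF that, of n] C0 K1 unfolding M_def
          by (meson divide_right_mono fact_ge_zero mult_left_mono order_trans less_imp_le mult_pos_pos zero_less_power)
      qed
      have U: "uniformly_convergent_on {-R..R} (\<lambda>n x. \<Sum>i<n. (?P (Suc i) x - ?P i x))"
        using bM sM by (rule Weierstrass_m_test')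
      then obtain l where l: "uniform_limit {-R..R} (\<lambda>n x. \<Sum>i<n. (?P (Suc i) x - ?P i x)) l sequentially"
        using uniformly_convergent_on_def by blast
      define X where "X x = u0 + l x" for x
      have tel: "(\<Sum>i<n. (?P (Suc i) x - ?P i x)) = ?P n x - u0" for n x
        by (subst sum_lessThan_telescope) simp
      have UX: "uniform_limit {-R..R} ?P X sequentially"
      proof -
        have "uniform_limit {-R..R} (\<lambda>n x. u0 + (?P n x - u0)) (\<lambda>x. u0 + l x) sequentially"
          using l unfolding tel by (intro uniform_limit_intros)
        then show ?thesis by (simp add: X_def[abs_def])
      qed
      have limX: "(\<lambda>n. ?P n x) \<longlonglongrightarrow> X x" if "x \<in> {-R..R}" for x
        using UX that by (rule tendsto_uniform_limitI)
      have X0: "X 0 = u0"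
        using limX[of 0] R P0 by (simp add: LIMSEQ_const_iff)
      \<comment> \<open>The derivatives \<open>f x (?P n x)\<close> converge uniformly by the
        Lipschitz bound, so the limit can be differentiated. The index is shifted because
        \<open>?P (Suc n)\<close> has its derivative expressed by \<open>?P n\<close>.\<close>
      have "\<exists>g. \<forall>x\<in>{-R..R}. (\<lambda>n. ?P (Suc n) x) \<longlonglongrightarrow> g x \<and> (g has_derivative (\<lambda>h. h *\<^sub>R f x (X x))) (at x within {-R..R})"
      proof (rule has_derivative_sequence)
        show "convex {-R..R}" "0 \<in> {-R..R}" "(\<lambda>n. ?P (Suc n) 0) \<longlonglongrightarrow> u0" using R P0 by (auto simp del: picard.simps)
        show "(?P (Suc n) has_derivative (\<lambda>h. h *\<^sub>R f x (?P n x))) (at x within {-R..R})" for n x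
          using dP[of n x] unfolding has_vector_derivative_def by (rule has_derivative_at_withinI)
        fix e :: real assume e: "e > 0"
        have "\<forall>\<^sub>F n in sequentially. \<forall>x\<in>{-R..R}. dist (?P n x) (X x) < e / K"
          using UX e K1 by (auto simp: uniform_limit_iff)
        then show "\<forall>\<^sub>F n in sequentially. \<forall>x\<in>{-R..R}. \<forall>h::real. norm (h *\<^sub>R f x (?P n x) - h *\<^sub>R f x (X x)) \<le> e * norm h"
        proof (rule eventually_mono, intro ballI allI)
          fix n and x h :: real assume a: "\<forall>x\<in>{-R..R}. dist (?P n x) (X x) < e / K" and x: "x \<in> {-R..R}"
          have "norm (f x (?P n x) - f x (X x)) \<le> K * norm (?P n x - X x)" by (rule K[OF x])
          also have "\<dots> \<le> K * (e / K)" using a x K1 by (intro mult_left_mono) (auto simp: dist_norm intro: less_imp_le)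
          finally have "norm (f x (?P n x) - f x (X x)) \<le> e" using K1 by simp
          then have "norm (f x (?P n x) - f x (X x)) * norm h \<le> e * norm h" by (rule mult_right_mono) simp
          then show "norm (h *\<^sub>R f x (?P n x) - h *\<^sub>R f x (X x)) \<le> e * norm h"
            by (simp add: scaleR_diff_right[symmetric] mult.commute)
        qed
      qed
      then obtain g where g: "\<And>x. x \<in> {-R..R} \<Longrightarrow> (\<lambda>n. ?P (Suc n) x) \<longlonglongrightarrow> g x"
        "\<And>x. x \<in> {-R..R} \<Longrightarrow> (g has_derivative (\<lambda>h. h *\<^sub>R f x (X x))) (at x within {-R..R})" by blast
      have gX: "g x = X x" if "x \<in> {-R..R}" for x
        using LIMSEQ_unique[OF g(1)[OF that] LIMSEQ_Suc[OF limX[OF that]]] .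
      have "(X has_vector_derivative f x (X x)) (at x)" if "x \<in> {-R<..<R}" for x
      proof -
        have "(g has_vector_derivative f x (X x)) (at x within {-R..R})"
          unfolding has_vector_derivative_def using that by (intro g(2)) auto
        then have D: "(g has_vector_derivative f x (X x)) (at x)"
          using that at_within_Icc_at[of "-R" x R] by simp
        show ?thesis
          by (rule has_vector_derivative_transform_within_open[OF D, of "{-R<..<R}"]) (use that gX in auto)
      qed
      then show ?thesis using limX X0 by (intro exI[of _ X]) auto
    qed
    \<comment> \<open>The iterates do not depend on \<open>R\<close>, so the solutions on all
      intervals are the same pointwise limit and glue without a uniqueness argument.\<close>
    define X where "X x = lim (\<lambda>n. ?P n x)" for x
    show ?thesis
    proof (rule exI[of _ X], rule allI)
      fix x :: real
      obtain Y where Y: "\<And>y. y \<in> {-(\<bar>x\<bar>+1)<..<\<bar>x\<bar>+1} \<Longrightarrow> Y 0 = u0 \<and> (\<lambda>n. ?P n y) \<longlonglongrightarrow> Y y \<and> (Y has_vector_derivative f y (Y y)) (at y)"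
        using key[of "\<bar>x\<bar>+1"] by fastforce
      have XY: "X y = Y y" if "y \<in> {-(\<bar>x\<bar>+1)<..<\<bar>x\<bar>+1}" for y
        using Y[OF that] unfolding X_def by (intro limI) auto
      have x: "x \<in> {-(\<bar>x\<bar>+1)<..<\<bar>x\<bar>+1}" by auto
      have zero: "0 \<in> {-(\<bar>x\<bar>+1)<..<\<bar>x\<bar>+1}"
        unfolding greaterThanLessThan_iff using abs_ge_zero[of x] by linarith
      have D: "(Y has_vector_derivative f x (X x)) (at x)" using Y[OF x] XY[OF x] by simp
      have "(X has_vector_derivative f x (X x)) (at x)"
        by (rule has_vector_derivative_transform_within_open[OF D, of "{-(\<bar>x\<bar>+1)<..<\<bar>x\<bar>+1}"]) (use XY in auto)
      then show "X 0 = u0 \<and> (\<lambda>n. ?P n x) \<longlonglongrightarrow> X x \<and> (X has_vector_derivative f x (X x)) (at x)"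
        using Y[OF x] XY[OF x] XY[OF zero] by simp
    qed
  qed
  then show ?thesis using that by blast
qed

section \<open>The periodic potential and its antiderivative\<close>

lemma integrable_on_periodic:
  fixes h :: "real \<Rightarrow> 'a::banach"
  assumes h: "h integrable_on {0..1}" and per: "\<And>x. h (x + 1) = h x"
  shows "h integrable_on {a..b}"
proof -
  have shift: "h integrable_on {c + 1..d + 1} \<longleftrightarrow> h integrable_on {c..d}" for c d
    using has_integral_shift_Icc_real[of h 1 _ c d] by (simp add: integrable_on_def per o_def add.commute)
  have up: "h integrable_on {0..real n}" for n
  proof (induction n)
    case (Suc n)
    have "h integrable_on {real n..real n + 1}"
    proof (induction n)
      case (Suc n)
      then show ?case using shift[of "real n" "real n + 1"] by (simp add: algebra_simps)
    qed (use h in simp)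
    then show ?case using Suc Henstock_Kurzweil_Integration.integrable_combine[of 0 "real n" "real n + 1" h]
      by (simp add: algebra_simps)
  qed (use integrable_on_refl[of h "0::real"] in simp)
  \<comment> \<open>\<open>[- (m + 1), n]\<close> is a translate of \<open>[- m, n + 1]\<close>, so
    the induction on \<open>m\<close> runs with \<open>n\<close> arbitrary.\<close>
  have full: "h integrable_on {- real m..real n}" for m n
  proof (induction m arbitrary: n)
    case (Suc m)
    then show ?case using shift[of "- real (Suc m)" "real n"] Suc[of "Suc n"] by (simp add: algebra_simps)
  qed (use up in simp)
  obtain n where "\<bar>a\<bar> \<le> real n" "\<bar>b\<bar> \<le> real n"
    by (meson dual_order.trans le_cases real_arch_simple)
  then show ?thesis
    by (intro integrable_on_subinterval[OF full[of n n]]) auto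
qed

lemma absolutely_integrable_on_periodic:
  fixes h :: "real \<Rightarrow> complex"
  assumes h: "h absolutely_integrable_on {0..1}" and per: "\<And>x. h (x + 1) = h x"
  shows "h absolutely_integrable_on {a..b}"
  using h integrable_on_periodic[of h a b] integrable_on_periodic[of "\<lambda>x. norm (h x)" a b] per
  by (simp add: absolutely_integrable_on_def)

locale hill =
  fixes q :: "real \<Rightarrow> complex"
  assumes q_int: "q absolutely_integrable_on {0..1}"
    and q_mean: "integral {0..1} q = 0"
    and q_per: "q (x + 1) = q x"
    and q_PT: "cnj (q (- x)) = q x"
begin

definition Q :: "real \<Rightarrow> complex" where "Q = prim q"

lemma q_ai: "q absolutely_integrable_on {a..b}"
  using absolutely_integrable_on_periodic[OF q_int q_per] .

lemma Q_diff: "a \<le> b \<Longrightarrow> Q b - Q a = integral {a..b} q"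
  unfolding Q_def by (rule prim_diff[OF q_ai])

lemma Q_cont: "continuous_on S Q"
  using continuous_on_subset[OF prim_continuous[OF q_ai] subset_UNIV] by (simp add: Q_def)

lemma Q_0 [simp]: "Q 0 = 0" by (simp add: Q_def)

text \<open>The increment of \<open>Q\<close> over a period does not depend on the period, and over
  \<open>[0, 1]\<close> it is the mean value 0 of \<open>q\<close>. Periodicity makes
  \<open>Q\<close> bounded and the regularised system periodic.\<close>

lemma Q_per [simp]: "Q (x + 1) = Q x"
proof -
  have shift: "integral {c + 1..d + 1} q = integral {c..d} q" for c d
  proof -
    have "q integrable_on {c..d}" using q_ai absolutely_integrable_on_def by blast
    then show ?thesis
      using has_integral_shift_Icc_real[of q 1 "integral {c..d} q" c d]
      by (intro integral_unique) (simp add: q_per o_def add.commute integrable_integral)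
  qed
  have "Q (y + 1) - Q y = Q (x + 1) - Q x" if "x \<le> y" for x y
    using Q_diff[OF that] Q_diff[of "x + 1" "y + 1"] that shift[of x y] by (simp add: algebra_simps)
  then have "Q (x + 1) - Q x = Q (0 + 1) - Q 0" by (metis linear)
  also have "\<dots> = 0" using Q_diff[of 0 1] q_mean by simp
  finally show ?thesis by simp
qed

lemma Q_1 [simp]: "Q 1 = 0" using Q_per[of 0] by simp

lemma Q_int_shift: "Q (x + of_int k) = Q x"
proof (induction k arbitrary: x rule: int_induct[of _ 0])
  case (step1 i)
  then show ?case using Q_per[of "x + of_int i"] by (simp add: algebra_simps)
next
  case (step2 i)
  then show ?case using Q_per[of "x + of_int (i - 1)"] by (simp add: algebra_simps)
qed simp

text \<open>The symmetry of \<open>q\<close> in integrated form; it is what makes reflection with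
  conjugation act on solutions of the regularised system.\<close>

lemma Q_minus: "Q (- x) = - cnj (Q x)"
proof -
  have *: "Q (- x) = - cnj (Q x)" if "0 \<le> x" for x
  proof -
    have "integral {- x..0} q = integral {- x..- 0} (\<lambda>s. cnj (q (- s)))"
      by (simp add: q_PT)
    also have "\<dots> = integral {0..x} (\<lambda>s. cnj (q s))"
      by (rule Henstock_Kurzweil_Integration.integral_reflect_real)
    also have "\<dots> = cnj (integral {0..x} q)" by (simp add: Henstock_Kurzweil_Integration.integral_cnj)
    finally have "- Q (- x) = cnj (Q x)" using Q_diff[OF that] Q_diff[of "-x" 0] that by simp
    then show ?thesis by (metis minus_minus)
  qed
  show ?thesis
    using *[of x] *[of "-x"] by (cases "0 \<le> x") auto
qed

text \<open>Some positive bound of \<bar>Q\<bar>, not necessarily the maximum.\<close>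

definition Qmax :: real where
  "Qmax = (SOME K. K > 0 \<and> (\<forall>x. cmod (Q x) \<le> K))"

lemma Qmax_pos: "Qmax > 0" and Q_le_Qmax: "cmod (Q x) \<le> Qmax"
proof -
  have "bounded (Q ` {0..1})"
    by (intro compact_imp_bounded compact_continuous_image Q_cont) auto
  then obtain K where K: "K > 0" "\<And>x. x \<in> {0..1} \<Longrightarrow> norm (Q x) \<le> K"
    unfolding bounded_pos by blast
  have "norm (Q x) \<le> K" for x
    using K(2)[of "frac x"] Q_int_shift[of "frac x" "\<lfloor>x\<rfloor>"] frac_ge_0[of x] frac_lt_1[of x]
    by (auto simp: frac_def)
  then have "\<exists>K>0. \<forall>x. cmod (Q x) \<le> K" using K(1) by blast
  from someI_ex[OF this] show "Qmax > 0" "cmod (Q x) \<le> Qmax"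
    unfolding Qmax_def by blast+
qed

subsection \<open>The regularised first-order system\<close>

text \<open>With the quasi-derivative \<open>v = y' - Q y\<close>, where \<open>Q' = q\<close>, the equation \<open>- y'' + q y = z y\<close>
  becomes a system with continuous coefficients.\<close>

definition solves ::
  "real set \<Rightarrow> complex \<Rightarrow> (real \<Rightarrow> complex) \<Rightarrow> (real \<Rightarrow> complex) \<Rightarrow> (real \<Rightarrow> complex) \<Rightarrow> (real \<Rightarrow> complex) \<Rightarrow> bool"
where
  "solves S z b c y v \<longleftrightarrow> (\<forall>x\<in>S.
     (y has_vector_derivative Q x * y x + v x + b x) (at x within S) \<and>
     (v has_vector_derivative - (z + (Q x)\<^sup>2) * y x - Q x * v x + c x) (at x within S))"

lemma solvesD:
  assumes "solves S z b c y v" "x \<in> S"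
  shows "(y has_vector_derivative Q x * y x + v x + b x) (at x within S)"
    "(v has_vector_derivative - (z + (Q x)\<^sup>2) * y x - Q x * v x + c x) (at x within S)"
  using assms by (auto simp: solves_def)

lemma solves_subset: "solves S z b c y v \<Longrightarrow> T \<subseteq> S \<Longrightarrow> solves T z b c y v"
  unfolding solves_def by (meson has_vector_derivative_within_subset subsetD)

lemma solves_cont:
  assumes "solves S z b c y v"
  shows "continuous_on S y" "continuous_on S v"
  using assms unfolding solves_def by (auto intro: continuous_on_vector_derivative)

lemma solves_cong:
  assumes "\<And>x. x \<in> S \<Longrightarrow> b x = b' x" "\<And>x. x \<in> S \<Longrightarrow> c x = c' x"
    "\<And>x. x \<in> S \<Longrightarrow> y x = y' x" "\<And>x. x \<in> S \<Longrightarrow> v x = v' x"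
  shows "solves S z b c y v \<longleftrightarrow> solves S z b' c' y' v'"
proof -
  have *: "(f has_vector_derivative D) (at x within S) \<longleftrightarrow> (f' has_vector_derivative D) (at x within S)"
    if "x \<in> S" "\<And>x. x \<in> S \<Longrightarrow> f x = f' x" for f f' :: "real \<Rightarrow> complex" and D x
    using that by (metis has_vector_derivative_transform)
  show ?thesis
    unfolding solves_def using assms *[of _ y y'] *[of _ v v'] by (intro ball_cong refl) auto
qed

lemma solves_lincomb:
  assumes "solves S z b1 c1 y1 v1" "solves S z b2 c2 y2 v2"
  shows "solves S z (\<lambda>x. k * b1 x + l * b2 x) (\<lambda>x. k * c1 x + l * c2 x)
    (\<lambda>x. k * y1 x + l * y2 x) (\<lambda>x. k * v1 x + l * v2 x)"
  unfolding solves_def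
proof (intro ballI conjI)
  fix x assume x: "x \<in> S"
  note D = solvesD[OF assms(1) x] solvesD[OF assms(2) x]
  show "((\<lambda>x. k * y1 x + l * y2 x) has_vector_derivative
      Q x * (k * y1 x + l * y2 x) + (k * v1 x + l * v2 x) + (k * b1 x + l * b2 x)) (at x within S)"
    by (rule has_vector_derivative_eq_rhs,
        rule has_vector_derivative_add[OF has_vector_derivative_mult_right[OF D(1)] has_vector_derivative_mult_right[OF D(3)]])
      (simp add: algebra_simps)
  show "((\<lambda>x. k * v1 x + l * v2 x) has_vector_derivative
      - (z + (Q x)\<^sup>2) * (k * y1 x + l * y2 x) - Q x * (k * v1 x + l * v2 x) + (k * c1 x + l * c2 x)) (at x within S)"
    by (rule has_vector_derivative_eq_rhs,
        rule has_vector_derivative_add[OF has_vector_derivative_mult_right[OF D(2)] has_vector_derivative_mult_right[OF D(4)]])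
      (simp add: algebra_simps)
qed

lemma solves_local:
  assumes "\<And>n. solves {- real n..real n} z b c y v"
  shows "solves UNIV z b c y v"
  unfolding solves_def
proof (intro ballI)
  fix x :: real
  obtain n where n: "\<bar>x\<bar> < real n" using reals_Archimedean2 by blast
  then have "at x within {- real n..real n} = at x" by (intro at_within_Icc_at) auto
  then show "(y has_vector_derivative Q x * y x + v x + b x) (at x within UNIV) \<and>
     (v has_vector_derivative - (z + (Q x)\<^sup>2) * y x - Q x * v x + c x) (at x within UNIV)"
    using solvesD[OF assms[of n], of x] n by (simp add: abs_less_iff)
qed

lemma solves_exists:
  assumes b: "continuous_on UNIV b" and c: "continuous_on UNIV c"
  obtains y v where "y 0 = y0" "v 0 = v0" "solves UNIV z b c y v"
proof -
  define K where "K = Qmax"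
  have K: "K > 0" "\<And>x. norm (Q x) \<le> K" by (simp_all add: K_def Qmax_pos Q_le_Qmax)
  define f where "f x u = (Q x * fst u + snd u + b x, - (z + (Q x)\<^sup>2) * fst u - Q x * snd u + c x)" for x and u :: "complex \<times> complex"
  define L where "L = (K + 1) + (norm z + K\<^sup>2 + K)"
  have lip: "norm (f x u - f x w) \<le> L * norm (u - w)" for x u w
  proof -
    have n1: "norm (fst u - fst w) \<le> norm (u - w)" "norm (snd u - snd w) \<le> norm (u - w)"
      using norm_fst_le[of "fst u - fst w" "snd u - snd w"] norm_snd_le[of "snd u - snd w" "fst u - fst w"]
      by (auto simp: prod_eq_iff minus_prod_def)
    have e: "f x u - f x w = (Q x * (fst u - fst w) + (snd u - snd w), - (z + (Q x)\<^sup>2) * (fst u - fst w) - Q x * (snd u - snd w))"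
      by (simp add: f_def algebra_simps)
    have "norm (Q x * (fst u - fst w) + (snd u - snd w)) \<le> norm (Q x) * norm (fst u - fst w) + norm (snd u - snd w)"
      by (metis norm_mult norm_triangle_ineq)
    also have "\<dots> \<le> K * norm (u - w) + norm (u - w)"
      using n1 K by (intro add_mono mult_mono) (auto intro: less_imp_le)
    finally have 1: "norm (Q x * (fst u - fst w) + (snd u - snd w)) \<le> (K + 1) * norm (u - w)" by (simp add: algebra_simps)
    have "norm (- (z + (Q x)\<^sup>2) * (fst u - fst w) - Q x * (snd u - snd w))
       \<le> norm (z + (Q x)\<^sup>2) * norm (fst u - fst w) + norm (Q x) * norm (snd u - snd w)"
      using norm_triangle_ineq4[of "- (z + (Q x)\<^sup>2) * (fst u - fst w)" "Q x * (snd u - snd w)"]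
      by (simp only: norm_mult norm_minus_cancel)
    also have "\<dots> \<le> (norm z + K\<^sup>2) * norm (u - w) + K * norm (u - w)"
    proof (intro add_mono mult_mono n1 K)
      have "norm (z + (Q x)\<^sup>2) \<le> norm z + (norm (Q x))\<^sup>2" by (metis norm_power norm_triangle_ineq)
      also have "\<dots> \<le> norm z + K\<^sup>2" using K by (intro add_left_mono power_mono) auto
      finally show "norm (z + (Q x)\<^sup>2) \<le> norm z + K\<^sup>2" .
    qed (use K in auto)
    finally have 2: "norm (- (z + (Q x)\<^sup>2) * (fst u - fst w) - Q x * (snd u - snd w)) \<le> (norm z + K\<^sup>2 + K) * norm (u - w)"
      by (simp add: algebra_simps)
    show ?thesis
      unfolding e L_def using norm_Pair_le[of "Q x * (fst u - fst w) + (snd u - snd w)" "- (z + (Q x)\<^sup>2) * (fst u - fst w) - Q x * (snd u - snd w)"] 1 2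
      by (simp add: algebra_simps)
  qed
  have cf: "continuous_on UNIV (\<lambda>x. f x (X x))" if "continuous_on UNIV X" for X
    unfolding f_def by (intro continuous_intros that Q_cont b c)
  have "\<exists>K. \<forall>x\<in>{- R..R}. \<forall>u w. norm (f x u - f x w) \<le> K * norm (u - w)" for R
    using lip by blast
  from Lipschitz_ode_exists[OF cf this]
  obtain X where X: "X 0 = (y0, v0)" "\<And>x. (X has_vector_derivative f x (X x)) (at x)" by metis
  have "((\<lambda>x. fst (X x)) has_vector_derivative fst (f x (X x))) (at x)"
    "((\<lambda>x. snd (X x)) has_vector_derivative snd (f x (X x))) (at x)" for x
    using bounded_linear.has_vector_derivative[OF bounded_linear_fst X(2)]
      bounded_linear.has_vector_derivative[OF bounded_linear_snd X(2)] by auto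
  then have "solves UNIV z b c (\<lambda>x. fst (X x)) (\<lambda>x. snd (X x))"
    unfolding solves_def f_def by auto
  with X(1) show ?thesis using that[of "\<lambda>x. fst (X x)" "\<lambda>x. snd (X x)"] by auto
qed

section \<open>Energy estimate and uniqueness for the regularised system\<close>

definition energy :: "(real \<Rightarrow> complex) \<Rightarrow> (real \<Rightarrow> complex) \<Rightarrow> real \<Rightarrow> real" where
  "energy y v x = (cmod (y x))\<^sup>2 + (cmod (v x))\<^sup>2"

lemma energy_nonneg [simp]: "0 \<le> energy y v x" by (simp add: energy_def)

lemma energy_eq_0_iff: "energy y v x = 0 \<longleftrightarrow> y x = 0 \<and> v x = 0"
  by (simp add: energy_def add_nonneg_eq_0_iff)

text \<open>The growth rate of the energy: \<open>2 * Qmax\<close> comes from the diagonal entries,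
  \<open>1 + cmod z + Qmax\<^sup>2\<close> from the off-diagonal ones by
  \<open>2 * Y * V \<le> Y\<^sup>2 + V\<^sup>2\<close>, and the last 2 from the
  inhomogeneities.\<close>

definition kap :: "complex \<Rightarrow> real" where
  "kap z = 2 * Qmax + 1 + cmod z + Qmax\<^sup>2 + 2"

lemma kap_pos: "kap z > 0"
  using Qmax_pos norm_ge_zero[of z] zero_le_power2[of Qmax] unfolding kap_def by linarith

lemma kap_mono: "cmod z \<le> cmod w \<Longrightarrow> kap z \<le> kap w"
  by (simp add: kap_def)

text \<open>Adding \<open>\<beta>\<^sup>2\<close> to the energy absorbs the inhomogeneities, since
  \<open>2 * Y * \<beta> \<le> Y\<^sup>2 + \<beta>\<^sup>2\<close>; the sum then satisfies a
  homogeneous differential inequality, to which Gronwall applies.\<close>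

lemma energy_growth:
  assumes sol: "solves {a..b} z f g y v"
    and fg: "\<And>x. x \<in> {a..b} \<Longrightarrow> cmod (f x) \<le> \<beta> \<and> cmod (g x) \<le> \<beta>"
    and xs: "x \<in> {a..b}" "s \<in> {a..b}"
  shows "energy y v x + \<beta>\<^sup>2 \<le> exp (kap z * \<bar>x - s\<bar>) * (energy y v s + \<beta>\<^sup>2)"
proof -
    define K where "K = Qmax"
    have K: "K > 0" "\<And>x. norm (Q x) \<le> K" by (simp_all add: K_def Qmax_pos Q_le_Qmax)
    have kap_def: "kap z = 2 * K + 1 + cmod z + K\<^sup>2 + 2" by (simp add: kap_def K_def)
    define y' where "y' x = Q x * y x + v x + f x" for x
    define v' where "v' x = - (z + (Q x)\<^sup>2) * y x - Q x * v x + g x" for x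
    define E' where "E' x = 2 * (y x \<bullet> y' x) + 2 * (v x \<bullet> v' x)" for x
    have \<beta>0: "\<beta> \<ge> 0" using fg[OF xs(1)] norm_ge_zero order_trans by blast
    show ?thesis
    proof (rule exp_growth_bound[of a b "\<lambda>x. energy y v x + \<beta>\<^sup>2" E' "kap z", OF _ _ xs])
      fix t assume t: "t \<in> {a..b}"
      have "(y has_derivative (\<lambda>h. h *\<^sub>R y' t)) (at t within {a..b})" "(v has_derivative (\<lambda>h. h *\<^sub>R v' t)) (at t within {a..b})"
        using solvesD[OF sol t] by (auto simp: has_vector_derivative_def y'_def v'_def)
      then have "((\<lambda>x. y x \<bullet> y x + v x \<bullet> v x + \<beta>\<^sup>2) has_derivative (\<lambda>h. h * E' t)) (at t within {a..b})"
        by (auto intro!: derivative_eq_intros simp: E'_def inner_commute algebra_simps)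
      then show "((\<lambda>x. energy y v x + \<beta>\<^sup>2) has_real_derivative E' t) (at t within {a..b})"
        by (simp add: has_field_derivative_def energy_def power2_norm_eq_inner mult.commute[of _ "E' t"])
      define Y V where "Y = cmod (y t)" and "V = cmod (v t)"
      have YV: "Y \<ge> 0" "V \<ge> 0" by (auto simp: Y_def V_def)
      have "cmod (y' t) \<le> cmod (Q t * y t) + cmod (v t) + cmod (f t)"
        unfolding y'_def by (meson norm_triangle_ineq norm_triangle_le order_trans add_right_mono)
      also have "\<dots> \<le> K * Y + V + \<beta>"
        using K fg[OF t] by (auto simp: norm_mult Y_def V_def intro!: add_mono mult_right_mono)
      finally have y': "cmod (y' t) \<le> K * Y + V + \<beta>" .
      have "cmod (v' t) \<le> cmod ((z + (Q t)\<^sup>2) * y t) + cmod (Q t * v t) + cmod (g t)"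
      proof -
        have "cmod (- a - b + g) \<le> cmod a + cmod b + cmod g" for a b g
          using norm_triangle_ineq[of "- a - b" g] norm_triangle_ineq4[of "- a" b] by simp
        then show ?thesis unfolding v'_def mult_minus_left .
      qed
      also have "\<dots> \<le> (cmod z + K\<^sup>2) * Y + K * V + \<beta>"
      proof -
        have "norm (z + (Q t)\<^sup>2) \<le> norm z + (norm (Q t))\<^sup>2" by (metis norm_power norm_triangle_ineq)
        also have "\<dots> \<le> norm z + K\<^sup>2" using K by (intro add_left_mono power_mono) auto
        finally show ?thesis using K fg[OF t] YV
          by (auto simp: norm_mult Y_def V_def intro!: add_mono mult_right_mono)
      qed
      finally have v': "cmod (v' t) \<le> (cmod z + K\<^sup>2) * Y + K * V + \<beta>" .
      have "\<bar>E' t\<bar> \<le> 2 * (Y * cmod (y' t)) + 2 * (V * cmod (v' t))"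
        using Cauchy_Schwarz_ineq2[of "y t" "y' t"] Cauchy_Schwarz_ineq2[of "v t" "v' t"]
        unfolding E'_def Y_def V_def by linarith
      also have "\<dots> \<le> 2 * (Y * (K * Y + V + \<beta>)) + 2 * (V * ((cmod z + K\<^sup>2) * Y + K * V + \<beta>))"
        using y' v' YV by (intro add_mono mult_left_mono) auto
      also have "\<dots> = 2 * K * (Y\<^sup>2 + V\<^sup>2) + (1 + cmod z + K\<^sup>2) * (2 * Y * V) + 2 * Y * \<beta> + 2 * V * \<beta>"
        by (simp add: power2_eq_square algebra_simps)
      also have "\<dots> \<le> 2 * K * (Y\<^sup>2 + V\<^sup>2) + (1 + cmod z + K\<^sup>2) * (Y\<^sup>2 + V\<^sup>2) + (Y\<^sup>2 + \<beta>\<^sup>2) + (V\<^sup>2 + \<beta>\<^sup>2)"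
        using less_imp_le[OF K(1)] by (intro add_mono mult_left_mono sum_squares_bound) auto
      also have "\<dots> \<le> kap z * (energy y v t + \<beta>\<^sup>2)"
      proof -
        have "0 \<le> (2 * K + 1 + cmod z + K\<^sup>2) * \<beta>\<^sup>2 + (Y\<^sup>2 + V\<^sup>2)"
          using less_imp_le[OF K(1)] by (intro add_nonneg_nonneg mult_nonneg_nonneg) auto
        then show ?thesis by (simp add: kap_def energy_def Y_def V_def algebra_simps)
      qed
      finally show "\<bar>E' t\<bar> \<le> kap z * (energy y v t + \<beta>\<^sup>2)" .
    qed
qed

lemma solves_unique:
  assumes "solves {a..b} z f g y v" "solves {a..b} z f g y' v'"
    and "s \<in> {a..b}" "y s = y' s" "v s = v' s" and x: "x \<in> {a..b}"
  shows "y x = y' x" "v x = v' x"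
proof -
  have "solves {a..b} z (\<lambda>x. 1 * f x + (-1) * f x) (\<lambda>x. 1 * g x + (-1) * g x)
    (\<lambda>x. 1 * y x + (-1) * y' x) (\<lambda>x. 1 * v x + (-1) * v' x)"
    by (rule solves_lincomb[OF assms(1,2)])
  from energy_growth[OF this, of 0 x s] assms(3,4,5) x
  have "energy (\<lambda>x. y x - y' x) (\<lambda>x. v x - v' x) x \<le> 0" by (simp add: energy_def)
  then have "energy (\<lambda>x. y x - y' x) (\<lambda>x. v x - v' x) x = 0"
    using energy_nonneg[of "\<lambda>x. y x - y' x" "\<lambda>x. v x - v' x" x] by linarith
  then show "y x = y' x" "v x = v' x" by (auto simp: energy_eq_0_iff)
qed

lemma solves_unique_UNIV:
  assumes "solves UNIV z f g y v" "solves UNIV z f g y' v'"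
    and "y s = y' s" "v s = v' s"
  shows "y x = y' x" "v x = v' x"
  using solves_unique[of "min s x" "max s x" z f g y v y' v' s x] assms solves_subset[OF assms(1)] solves_subset[OF assms(2)]
  by auto

section \<open>Passing between the differential equation and the system\<close>

text \<open>The antiderivative vanishing at \<open>a\<close> is replaced by \<open>Q\<close>, which
  differs from it by the constant \<open>Q a\<close>.\<close>

lemma sl_parts:
  assumes "a \<le> b" and y: "\<And>x. x \<in> {a..b} \<Longrightarrow> (y has_vector_derivative y1 x) (at x within {a..b})"
    and y1: "continuous_on {a..b} y1"
  shows "integral {a..b} (\<lambda>x. q x * y x) = Q b * y b - Q a * y a - integral {a..b} (\<lambda>x. Q x * y1 x)"
proof -
  have ftc: "(y1 has_integral (y b - y a)) {a..b}"
    by (rule fundamental_theorem_of_calculus[OF assms(1) y])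
  have "integral {a..b} (\<lambda>x. integral {a..x} q * y1 x) = integral {a..b} (\<lambda>x. Q x * y1 x - Q a * y1 x)"
    by (rule Henstock_Kurzweil_Integration.integral_cong) (simp add: Q_diff[symmetric] algebra_simps)
  also have "\<dots> = integral {a..b} (\<lambda>x. Q x * y1 x) - integral {a..b} (\<lambda>x. Q a * y1 x)"
    by (intro Henstock_Kurzweil_Integration.integral_diff integrable_continuous_interval continuous_intros Q_cont y1)
  also have "integral {a..b} (\<lambda>x. Q a * y1 x) = Q a * (y b - y a)"
    using ftc by (simp add: integral_unique)
  finally have e: "integral {a..b} (\<lambda>x. integral {a..x} q * y1 x) = integral {a..b} (\<lambda>x. Q x * y1 x) - Q a * (y b - y a)" .
  have parts: "integral {a..b} (\<lambda>x. q x * y x) =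
     integral {a..b} q * y b - integral {a..b} (\<lambda>x. integral {a..x} q * y1 x)"
    by (rule integral_mult_by_parts[OF assms(1) q_ai y y1])
  show ?thesis
    unfolding parts e Q_diff[OF assms(1), symmetric]
    by (simp add: algebra_simps)
qed

text \<open>A merely integrable \<open>g\<close> cannot stand in a system with classical
  derivatives. Its antiderivative \<Gamma> is therefore added to the quasi-derivative:
  \<open>v = y' - Q y + \<Gamma>\<close> has the continuous derivative \<open>- z y - Q y'\<close>,
  and the remaining inhomogeneities \<open>- \<Gamma>\<close> and \<open>Q \<Gamma>\<close> are
  continuous.\<close>

lemma sl_equation_imp_solves:
  assumes sl: "sl_equation q {a..b} y y1 (\<lambda>x. g x + z * y x)"
    and g: "g absolutely_integrable_on {a..b}"
    and \<Gamma>: "\<And>s t. a \<le> s \<Longrightarrow> s \<le> t \<Longrightarrow> t \<le> b \<Longrightarrow> \<Gamma> t - \<Gamma> s = integral {s..t} g"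
  shows "solves {a..b} z (\<lambda>x. - \<Gamma> x) (\<lambda>x. Q x * \<Gamma> x) y (\<lambda>x. y1 x - Q x * y x + \<Gamma> x)"
    and "continuous_on {a..b} y1"
proof -
  let ?v = "\<lambda>x. y1 x - Q x * y x + \<Gamma> x"
  have y: "(y has_vector_derivative y1 x) (at x within {a..b})" if "x \<in> {a..b}" for x
    using sl that by (auto simp: sl_equation_def)
  have i: "(\<lambda>x. q x * y x - (g x + z * y x)) absolutely_integrable_on {a..t}"
    "y1 t - y1 a = integral {a..t} (\<lambda>x. q x * y x - (g x + z * y x))" if "t \<in> {a..b}" for t
    using sl that by (auto simp: sl_equation_def)
  show y1c: "continuous_on {a..b} y1"
  proof (cases "a \<le> b")
    case True
    have "continuous_on {a..b} (\<lambda>t. y1 a + integral {a..t} (\<lambda>x. q x * y x - (g x + z * y x)))"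
      using i(1)[of b] True by (intro continuous_intros indefinite_integral_continuous_1) (auto simp: absolutely_integrable_on_def)
    moreover have "y1 a + integral {a..t} (\<lambda>x. q x * y x - (g x + z * y x)) = y1 t" if "t \<in> {a..b}" for t
      using i(2)[OF that] by (simp add: algebra_simps)
    ultimately show ?thesis using continuous_on_eq by blast
  qed auto
  have yc: "continuous_on {a..b} y" using y by (rule continuous_on_vector_derivative)
  let ?k = "\<lambda>x. - z * y x - Q x * y1 x"
  have kc: "continuous_on {a..b} ?k" by (intro continuous_intros yc Q_cont y1c)
  \<comment> \<open>Integration by parts cancels the terms with \<open>q\<close> and the choice of
    \<Gamma> those with \<open>g\<close>, so \<open>?v\<close> is the integral of a continuous
    function and differentiable at every point.\<close>
  have v: "?v t = ?v a + integral {a..t} ?k" if t: "t \<in> {a..b}" for t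
  proof -
    have sub: "{a..t} \<subseteq> {a..b}" using t by auto
    have gi: "g integrable_on {a..t}"
      using absolutely_integrable_on_subinterval[OF g sub] by (simp add: absolutely_integrable_on_def)
    have qyi: "(\<lambda>x. q x * y x) integrable_on {a..t}"
      using absolutely_integrable_mult_continuous[OF q_ai continuous_on_subset[OF yc sub]] by (simp add: absolutely_integrable_on_def)
    have zyi: "(\<lambda>x. z * y x) integrable_on {a..t}" "(\<lambda>x. Q x * y1 x) integrable_on {a..t}"
      by (intro integrable_continuous_interval continuous_intros Q_cont continuous_on_subset[OF yc sub] continuous_on_subset[OF y1c sub])+
    have "integral {a..t} (\<lambda>x. q x * y x - (g x + z * y x)) =
      integral {a..t} (\<lambda>x. q x * y x) - (integral {a..t} g + integral {a..t} (\<lambda>x. z * y x))"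
      using gi qyi zyi by (simp add: Henstock_Kurzweil_Integration.integral_diff Henstock_Kurzweil_Integration.integral_add integrable_add)
    note e1 = this
    have e2: "integral {a..t} (\<lambda>x. q x * y x) = Q t * y t - Q a * y a - integral {a..t} (\<lambda>x. Q x * y1 x)"
      using t by (intro sl_parts has_vector_derivative_within_subset[OF y] continuous_on_subset[OF y1c]) auto
    have e3: "integral {a..t} ?k = - integral {a..t} (\<lambda>x. z * y x) - integral {a..t} (\<lambda>x. Q x * y1 x)"
      using zyi by (simp add: Henstock_Kurzweil_Integration.integral_diff integrable_neg)
    have e4: "\<Gamma> t - \<Gamma> a = integral {a..t} g" using t by (intro \<Gamma>) auto
    show ?thesis
      unfolding e3 i(2)[OF t, unfolded diff_eq_eq] e4[unfolded diff_eq_eq] e1 e2 by simp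
  qed
  have dv: "(?v has_vector_derivative ?k x) (at x within {a..b})" if x: "x \<in> {a..b}" for x
  proof -
    have "((\<lambda>t. ?v a + integral {a..t} ?k) has_vector_derivative 0 + ?k x) (at x within {a..b})"
      by (rule has_vector_derivative_add[OF has_vector_derivative_const integral_has_vector_derivative[OF kc x]])
    then have "((\<lambda>t. ?v a + integral {a..t} ?k) has_vector_derivative ?k x) (at x within {a..b})" by simp
    then show ?thesis
      using has_vector_derivative_transform[of x "{a..b}" ?v "\<lambda>t. ?v a + integral {a..t} ?k" "?k x"] x v by blast
  qed
  show "solves {a..b} z (\<lambda>x. - \<Gamma> x) (\<lambda>x. Q x * \<Gamma> x) y ?v"
    unfolding solves_def
  proof (intro ballI conjI)
    fix x assume x: "x \<in> {a..b}"
    show "(y has_vector_derivative Q x * y x + ?v x + - \<Gamma> x) (at x within {a..b})"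
      by (rule has_vector_derivative_eq_rhs[OF y[OF x]]) simp
    show "(?v has_vector_derivative - (z + (Q x)\<^sup>2) * y x - Q x * ?v x + Q x * \<Gamma> x) (at x within {a..b})"
      by (rule has_vector_derivative_eq_rhs[OF dv[OF x]]) (simp add: algebra_simps power2_eq_square)
  qed
qed

lemma solves_imp_sl_equation:
  assumes sol: "solves {a..b} z (\<lambda>x. - \<Gamma> x) (\<lambda>x. Q x * \<Gamma> x) y v"
    and g: "g absolutely_integrable_on {a..b}"
    and \<Gamma>: "\<And>s t. a \<le> s \<Longrightarrow> s \<le> t \<Longrightarrow> t \<le> b \<Longrightarrow> \<Gamma> t - \<Gamma> s = integral {s..t} g"
  shows "sl_equation q {a..b} y (\<lambda>x. Q x * y x + v x - \<Gamma> x) (\<lambda>x. g x + z * y x)"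
  unfolding sl_equation_def
proof (intro conjI ballI allI impI)
  let ?y1 = "\<lambda>x. Q x * y x + v x - \<Gamma> x"
  have y: "(y has_vector_derivative ?y1 x) (at x within {a..b})" if "x \<in> {a..b}" for x
    using solvesD(1)[OF sol that] by simp
  then show "(y has_vector_derivative ?y1 x) (at x within {a..b})" if "x \<in> {a..b}" for x using that .
  note yc = solves_cont[OF sol]
  fix s t assume "s \<le> t" and "{s..t} \<subseteq> {a..b}"
  then have st: "a \<le> s" "s \<le> t" "t \<le> b" and sub: "{s..t} \<subseteq> {a..b}" by auto
  have \<Gamma>c: "continuous_on {a..b} \<Gamma>"
  proof -
    have "continuous_on {a..b} (\<lambda>t. \<Gamma> a + integral {a..t} g)"
      using g by (intro continuous_intros indefinite_integral_continuous_1) (auto simp: absolutely_integrable_on_def)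
    moreover have "\<Gamma> a + integral {a..t} g = \<Gamma> t" if "t \<in> {a..b}" for t
      using \<Gamma>[of a t] that by (auto simp: algebra_simps)
    ultimately show ?thesis using continuous_on_eq by blast
  qed
  have y1c: "continuous_on {a..b} ?y1" by (intro continuous_intros Q_cont yc \<Gamma>c)
  have gi: "g absolutely_integrable_on {s..t}"
    using absolutely_integrable_on_subinterval[OF g sub] .
  have qyi: "(\<lambda>x. q x * y x) absolutely_integrable_on {s..t}"
    by (rule absolutely_integrable_mult_continuous[OF q_ai continuous_on_subset[OF yc(1) sub]])
  have zyi: "(\<lambda>x. z * y x) absolutely_integrable_on {s..t}" "(\<lambda>x. Q x * ?y1 x) absolutely_integrable_on {s..t}"
    by (intro absolutely_integrable_continuous_real continuous_intros Q_cont continuous_on_subset[OF yc(1) sub] continuous_on_subset[OF y1c sub])+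
  show "(\<lambda>x. q x * y x - (g x + z * y x)) absolutely_integrable_on {s..t}"
    by (intro set_integral_diff(1) set_integral_add(1) gi qyi zyi)
  let ?k = "\<lambda>x. - z * y x - Q x * ?y1 x"
  have "(?k has_integral v t - v s) {s..t}"
  proof (rule fundamental_theorem_of_calculus[OF st(2)])
    fix x assume x: "x \<in> {s..t}"
    have e: "- (z + (Q x)\<^sup>2) * y x - Q x * v x + Q x * \<Gamma> x = ?k x"
      by (auto simp: algebra_simps power2_eq_square)
    show "(v has_vector_derivative ?k x) (at x within {s..t})"
      by (rule has_vector_derivative_eq_rhs[OF has_vector_derivative_within_subset[OF solvesD(2)[OF sol] sub]])
        (use x sub e in auto)
  qed
  then have "v t - v s = integral {s..t} ?k" by (simp add: integral_unique)
  also have "\<dots> = - integral {s..t} (\<lambda>x. z * y x) - integral {s..t} (\<lambda>x. Q x * ?y1 x)"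
    using zyi by (simp add: Henstock_Kurzweil_Integration.integral_diff integrable_neg absolutely_integrable_on_def)
  finally have v: "v t - v s = - integral {s..t} (\<lambda>x. z * y x) - integral {s..t} (\<lambda>x. Q x * ?y1 x)" .
  have "integral {s..t} (\<lambda>x. q x * y x) = Q t * y t - Q s * y s - integral {s..t} (\<lambda>x. Q x * ?y1 x)"
    using st sub by (intro sl_parts has_vector_derivative_within_subset[OF y] continuous_on_subset[OF y1c]) auto
  note e1 = this
  have e2: "integral {s..t} (\<lambda>x. q x * y x - (g x + z * y x)) =
      integral {s..t} (\<lambda>x. q x * y x) - (integral {s..t} g + integral {s..t} (\<lambda>x. z * y x))"
    using gi qyi zyi by (simp add: absolutely_integrable_on_def Henstock_Kurzweil_Integration.integral_diff Henstock_Kurzweil_Integration.integral_add integrable_add)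
  have ring: "(c - d) + (- Z - J) - G = c - d - J - (G + Z)" for c d Z J G :: complex
    by simp
  have "?y1 t - ?y1 s = (Q t * y t - Q s * y s) + (v t - v s) - (\<Gamma> t - \<Gamma> s)"
    by (simp add: algebra_simps)
  also have "\<dots> = integral {s..t} (\<lambda>x. q x * y x - (g x + z * y x))"
    unfolding v \<Gamma>[OF st] e2 e1 by (rule ring)
  finally show "?y1 t - ?y1 s = integral {s..t} (\<lambda>x. q x * y x - (g x + z * y x))" .
qed

text \<open>For continuous \<open>g\<close> the antiderivative \<Gamma> is differentiable, so
  subtracting it from \<open>v\<close> moves the forcing into the second equation.\<close>

lemma sl_equation_iff_solves:
  assumes g: "continuous_on {a..b} g"
  shows "sl_equation q {a..b} y y1 (\<lambda>x. g x + z * y x) \<longleftrightarrow>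
    solves {a..b} z (\<lambda>x. 0) (\<lambda>x. - g x) y (\<lambda>x. y1 x - Q x * y x)"
proof -
  define \<Gamma> where "\<Gamma> t = integral {a..t} g" for t
  have gi: "g absolutely_integrable_on {a..b}" using g by (rule absolutely_integrable_continuous_real)
  have \<Gamma>: "\<Gamma> t - \<Gamma> s = integral {s..t} g" if "a \<le> s" "s \<le> t" "t \<le> b" for s t
    unfolding \<Gamma>_def by (rule integral_norm_le_diff(3)[OF gi that])
  have d\<Gamma>: "(\<Gamma> has_vector_derivative g x) (at x within {a..b})" if "x \<in> {a..b}" for x
    unfolding \<Gamma>_def[abs_def] by (rule integral_has_vector_derivative[OF g that])
  have *: "solves {a..b} z (\<lambda>x. - \<Gamma> x) (\<lambda>x. Q x * \<Gamma> x) y v \<longleftrightarrow> solves {a..b} z (\<lambda>x. 0) (\<lambda>x. - g x) y (\<lambda>x. v x - \<Gamma> x)"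
    (is "?L \<longleftrightarrow> ?R") for v
  proof -
    have e: "Q x * y x + (v x - \<Gamma> x) + 0 = Q x * y x + v x + - \<Gamma> x"
      "- (z + (Q x)\<^sup>2) * y x - Q x * (v x - \<Gamma> x) + - g x = (- (z + (Q x)\<^sup>2) * y x - Q x * v x + Q x * \<Gamma> x) - g x" for x
      by (auto simp: algebra_simps)
    have "((\<lambda>x. v x - \<Gamma> x) has_vector_derivative D - g x) (at x within {a..b}) \<longleftrightarrow> (v has_vector_derivative D) (at x within {a..b})"
      if "x \<in> {a..b}" for x D
      using has_vector_derivative_diff[OF _ d\<Gamma>[OF that], of v D] has_vector_derivative_add[OF _ d\<Gamma>[OF that], of "\<lambda>x. v x - \<Gamma> x" "D - g x"]
      by auto
    then show ?thesis unfolding solves_def e by (intro ball_cong refl) simp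
  qed
  have "sl_equation q {a..b} y y1 (\<lambda>x. g x + z * y x) \<longleftrightarrow> solves {a..b} z (\<lambda>x. - \<Gamma> x) (\<lambda>x. Q x * \<Gamma> x) y (\<lambda>x. y1 x - Q x * y x + \<Gamma> x)"
  proof
    assume "sl_equation q {a..b} y y1 (\<lambda>x. g x + z * y x)"
    then show "solves {a..b} z (\<lambda>x. - \<Gamma> x) (\<lambda>x. Q x * \<Gamma> x) y (\<lambda>x. y1 x - Q x * y x + \<Gamma> x)"
      by (rule sl_equation_imp_solves(1)[OF _ gi \<Gamma>])
  next
    assume "solves {a..b} z (\<lambda>x. - \<Gamma> x) (\<lambda>x. Q x * \<Gamma> x) y (\<lambda>x. y1 x - Q x * y x + \<Gamma> x)"
    then have S: "sl_equation q {a..b} y (\<lambda>x. Q x * y x + (y1 x - Q x * y x + \<Gamma> x) - \<Gamma> x) (\<lambda>x. g x + z * y x)"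
      by (rule solves_imp_sl_equation[OF _ gi \<Gamma>])
    have eq: "(\<lambda>x. Q x * y x + (y1 x - Q x * y x + \<Gamma> x) - \<Gamma> x) = y1" by (rule ext) simp
    show "sl_equation q {a..b} y y1 (\<lambda>x. g x + z * y x)" using S unfolding eq .
  qed
  also have "\<dots> \<longleftrightarrow> solves {a..b} z (\<lambda>x. 0) (\<lambda>x. - g x) y (\<lambda>x. y1 x - Q x * y x + \<Gamma> x - \<Gamma> x)"
    by (rule *)
  also have "(\<lambda>x. y1 x - Q x * y x + \<Gamma> x - \<Gamma> x) = (\<lambda>x. y1 x - Q x * y x)" by (rule ext) simp
  finally show ?thesis .
qed

subsection \<open>Fundamental solutions and the monodromy matrix\<close>

definition fsol :: "complex \<Rightarrow> complex \<Rightarrow> complex \<Rightarrow> (real \<Rightarrow> complex) \<times> (real \<Rightarrow> complex)" where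
  "fsol z y0 v0 = (SOME (y, v). y 0 = y0 \<and> v 0 = v0 \<and> solves UNIV z (\<lambda>x. 0) (\<lambda>x. 0) y v)"

definition ysol :: "complex \<Rightarrow> complex \<Rightarrow> complex \<Rightarrow> real \<Rightarrow> complex" where
  "ysol z y0 v0 = fst (fsol z y0 v0)"

definition vsol :: "complex \<Rightarrow> complex \<Rightarrow> complex \<Rightarrow> real \<Rightarrow> complex" where
  "vsol z y0 v0 = snd (fsol z y0 v0)"

lemma ysol_0 [simp]: "ysol z y0 v0 0 = y0" and vsol_0 [simp]: "vsol z y0 v0 0 = v0"
  and solves_fsol: "solves UNIV z (\<lambda>x. 0) (\<lambda>x. 0) (ysol z y0 v0) (vsol z y0 v0)"
proof -
  have "\<exists>p. case p of (y, v) \<Rightarrow> y 0 = y0 \<and> v 0 = v0 \<and> solves UNIV z (\<lambda>x. 0) (\<lambda>x. 0) y v"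
  proof (rule solves_exists[of "\<lambda>x. 0" "\<lambda>x. 0" y0 v0 z])
    fix y v :: "real \<Rightarrow> complex"
    assume "y 0 = y0" "v 0 = v0" "solves UNIV z (\<lambda>x. 0) (\<lambda>x. 0) y v"
    then show ?thesis by (intro exI[of _ "(y, v)"]) (simp only: prod.case simp_thms)
  qed (rule continuous_on_const)+
  from someI_ex[OF this]
  have "case fsol z y0 v0 of (y, v) \<Rightarrow> y 0 = y0 \<and> v 0 = v0 \<and> solves UNIV z (\<lambda>x. 0) (\<lambda>x. 0) y v"
    unfolding fsol_def .
  then show "ysol z y0 v0 0 = y0" "vsol z y0 v0 0 = v0" "solves UNIV z (\<lambda>x. 0) (\<lambda>x. 0) (ysol z y0 v0) (vsol z y0 v0)"
    by (simp_all only: ysol_def vsol_def case_prod_beta)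
qed

lemma solves_fsol': "solves S z (\<lambda>x. 0) (\<lambda>x. 0) (ysol z y0 v0) (vsol z y0 v0)"
  using solves_subset[OF solves_fsol] by auto

lemma solves_lincomb_hom:
  assumes "solves S z b c y1 v1" "solves S z (\<lambda>x. 0) (\<lambda>x. 0) y2 v2"
  shows "solves S z b c (\<lambda>x. y1 x + l * y2 x) (\<lambda>x. v1 x + l * v2 x)"
  using solves_lincomb[OF assms, of 1 l] by simp

lemma fsol_decomp:
  "ysol z y0 v0 x = y0 * ysol z 1 0 x + v0 * ysol z 0 1 x"
  "vsol z y0 v0 x = y0 * vsol z 1 0 x + v0 * vsol z 0 1 x"
proof -
  have "solves UNIV z (\<lambda>x. y0 * 0 + v0 * 0) (\<lambda>x. y0 * 0 + v0 * 0)
     (\<lambda>x. y0 * ysol z 1 0 x + v0 * ysol z 0 1 x) (\<lambda>x. y0 * vsol z 1 0 x + v0 * vsol z 0 1 x)"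
    by (rule solves_lincomb[OF solves_fsol solves_fsol])
  then have "solves UNIV z (\<lambda>x. 0) (\<lambda>x. 0)
     (\<lambda>x. y0 * ysol z 1 0 x + v0 * ysol z 0 1 x) (\<lambda>x. y0 * vsol z 1 0 x + v0 * vsol z 0 1 x)" by simp
  from solves_unique_UNIV[OF solves_fsol[of z y0 v0] this, of 0 x] show
    "ysol z y0 v0 x = y0 * ysol z 1 0 x + v0 * ysol z 0 1 x"
    "vsol z y0 v0 x = y0 * vsol z 1 0 x + v0 * vsol z 0 1 x" by auto
qed

lemma solves_hom_eq_fsol:
  assumes "solves {a..b} z (\<lambda>x. 0) (\<lambda>x. 0) y v" "0 \<in> {a..b}" "x \<in> {a..b}"
  shows "y x = ysol z (y 0) (v 0) x" "v x = vsol z (y 0) (v 0) x"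
  using solves_unique[OF assms(1) solves_fsol'[of _ z "y 0" "v 0"], of 0 x] assms(2,3) by auto

lemma solves_shift:
  assumes "solves UNIV z (\<lambda>x. 0) (\<lambda>x. 0) y v"
  shows "solves UNIV z (\<lambda>x. 0) (\<lambda>x. 0) (\<lambda>x. y (x + of_int k)) (\<lambda>x. v (x + of_int k))"
  unfolding solves_def
proof (intro ballI conjI)
  fix x :: real
  have s: "((\<lambda>x. x + of_int k) has_vector_derivative 1) (at x)"
    by (auto intro!: derivative_eq_intros)
  note D = solvesD[OF assms UNIV_I[of "x + of_int k"], unfolded Q_int_shift]
  show "((\<lambda>x. y (x + of_int k)) has_vector_derivative Q x * y (x + of_int k) + v (x + of_int k) + 0) (at x within UNIV)"
    using vector_diff_chain_at[OF s D(1)] by (simp add: o_def)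
  show "((\<lambda>x. v (x + of_int k)) has_vector_derivative - (z + (Q x)\<^sup>2) * y (x + of_int k) - Q x * v (x + of_int k) + 0) (at x within UNIV)"
    using vector_diff_chain_at[OF s D(2)] by (simp add: o_def)
qed

lemma fsol_shift:
  "ysol z y0 v0 (x + of_int k) = ysol z (ysol z y0 v0 (of_int k)) (vsol z y0 v0 (of_int k)) x"
  "vsol z y0 v0 (x + of_int k) = vsol z (ysol z y0 v0 (of_int k)) (vsol z y0 v0 (of_int k)) x"
  using solves_unique_UNIV[OF solves_shift[OF solves_fsol[of z y0 v0], of k]
      solves_fsol[of z "ysol z y0 v0 (of_int k)" "vsol z y0 v0 (of_int k)"], of 0 x] by auto

text \<open>Entries of the monodromy matrix in the coordinates \<open>(y, v)\<close>. As
  \<open>Q\<close> vanishes at 0 and 1, \<open>v\<close> equals \<open>y'\<close> there and this is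
  the usual monodromy matrix.\<close>

abbreviation "m11 z \<equiv> ysol z 1 0 1"
abbreviation "m12 z \<equiv> ysol z 0 1 1"
abbreviation "m21 z \<equiv> vsol z 1 0 1"
abbreviation "m22 z \<equiv> vsol z 0 1 1"

definition F :: "complex \<Rightarrow> complex" where "F z = m11 z + m22 z"

text \<open>Liouville's formula: the coefficient matrix of the system has trace
  \<open>Q x - Q x = 0\<close>.\<close>

lemma wronskian:
  "ysol z 1 0 x * vsol z 0 1 x - ysol z 0 1 x * vsol z 1 0 x = 1"
proof -
  let ?W = "\<lambda>x. ysol z 1 0 x * vsol z 0 1 x - ysol z 0 1 x * vsol z 1 0 x"
  have "(?W has_vector_derivative 0) (at x within UNIV)" for x
  proof -
    note A = solvesD[OF solves_fsol[of z 1 0] UNIV_I[of x]] and B = solvesD[OF solves_fsol[of z 0 1] UNIV_I[of x]]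
    show ?thesis
      by (rule has_vector_derivative_eq_rhs[OF has_vector_derivative_diff[OF
          has_vector_derivative_mult[OF A(1) B(2)] has_vector_derivative_mult[OF B(1) A(2)]]])
        (simp add: algebra_simps)
  qed
  then obtain c where "\<And>x. ?W x = c"
    using has_vector_derivative_zero_constant[of UNIV ?W] by auto
  from this[of x] this[of 0] show ?thesis by simp
qed

lemma monodromy_det: "m11 z * m22 z - m12 z * m21 z = 1"
  using wronskian[of z 1] .

text \<open>Reflection with conjugation carries solutions at \<open>z\<close> to solutions at
  \<open>cnj z\<close> and reverses the direction. So the monodromy matrix at \<open>cnj z\<close>
  is similar to the conjugate of the inverse of the one at \<open>z\<close>, and a two-by-two matrix
  of determinant 1 has the same trace as its inverse.\<close>

lemma F_cnj: "F (cnj z) = cnj (F z)"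
proof -
  have refl: "solves UNIV (cnj z) (\<lambda>x. 0) (\<lambda>x. 0) (\<lambda>x. cnj (y (- x))) (\<lambda>x. - cnj (v (- x)))"
    if "solves UNIV z (\<lambda>x. 0) (\<lambda>x. 0) y v" for y v
    unfolding solves_def
  proof (intro ballI conjI)
    fix x :: real
    have s: "((\<lambda>x. - x) has_vector_derivative - 1) (at x)"
      by (auto intro!: derivative_eq_intros)
    note D = solvesD[OF that UNIV_I[of "- x"], unfolded Q_minus]
    show "((\<lambda>x. cnj (y (- x))) has_vector_derivative Q x * cnj (y (- x)) + - cnj (v (- x)) + 0) (at x within UNIV)"
      using has_vector_derivative_cnj[OF vector_diff_chain_at[OF s D(1)]] by (simp add: o_def)
    show "((\<lambda>x. - cnj (v (- x))) has_vector_derivative - (cnj z + (Q x)\<^sup>2) * cnj (y (- x)) - Q x * - cnj (v (- x)) + 0) (at x within UNIV)"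
      using has_vector_derivative_minus[OF has_vector_derivative_cnj[OF vector_diff_chain_at[OF s D(2)]]]
      by (simp add: o_def algebra_simps)
  qed
  \<comment> \<open>The reflected solution has at \<open>- 1\<close> the data of the original one at
    1, up to conjugation and a sign; one period later it arrives at \<open>(y0, v0)\<close>.\<close>
  have *: "y0 = cnj (ysol z (cnj y0) (- cnj v0) 1) * m11 (cnj z) - cnj (vsol z (cnj y0) (- cnj v0) 1) * m12 (cnj z)"
    "v0 = cnj (ysol z (cnj y0) (- cnj v0) 1) * m21 (cnj z) - cnj (vsol z (cnj y0) (- cnj v0) 1) * m22 (cnj z)" for y0 v0
  proof -
    let ?y = "\<lambda>x. cnj (ysol z (cnj y0) (- cnj v0) (- x))" and ?v = "\<lambda>x. - cnj (vsol z (cnj y0) (- cnj v0) (- x))"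
    have S: "solves UNIV (cnj z) (\<lambda>x. 0) (\<lambda>x. 0) ?y ?v" by (rule refl[OF solves_fsol])
    from solves_unique_UNIV[OF solves_shift[OF S, of "-1"] solves_fsol[of "cnj z" "?y (-1)" "?v (-1)"], of 0 1]
    show "y0 = cnj (ysol z (cnj y0) (- cnj v0) 1) * m11 (cnj z) - cnj (vsol z (cnj y0) (- cnj v0) 1) * m12 (cnj z)"
      "v0 = cnj (ysol z (cnj y0) (- cnj v0) 1) * m21 (cnj z) - cnj (vsol z (cnj y0) (- cnj v0) 1) * m22 (cnj z)"
      using fsol_decomp[of "cnj z" "?y (-1)" "?v (-1)" 1] by auto
  qed
  have e: "ysol z 0 (- 1) 1 = - m12 z" "vsol z 0 (- 1) 1 = - m22 z"
    using fsol_decomp[of z 0 "- 1" 1] by auto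
  define a b c d where "a = cnj (m11 z)" and "b = cnj (m12 z)" and "c = cnj (m21 z)" and "d = cnj (m22 z)"
  define A B C D where "A = m11 (cnj z)" and "B = m12 (cnj z)" and "C = m21 (cnj z)" and "D = m22 (cnj z)"
  have 1: "a * A - c * B = 1" "a * C - c * D = 0" "d * B - b * A = 0" "d * D - b * C = 1"
    using *[of 1 0] *[of 0 1] e by (auto simp: a_def b_def c_def d_def A_def B_def C_def D_def algebra_simps)
  have det: "a * d - b * c = 1"
    using arg_cong[OF monodromy_det[of z], of cnj] by (simp add: a_def b_def c_def d_def)
  have "A = d"
  proof -
    have "d = d * (a * A - c * B) + c * (d * B - b * A)" using 1 by simp
    also have "\<dots> = (a * d - b * c) * A" by (simp add: algebra_simps)
    finally show ?thesis using det by simp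
  qed
  moreover have "D = a"
  proof -
    have "a = a * (d * D - b * C) + b * (a * C - c * D)" using 1 by simp
    also have "\<dots> = (a * d - b * c) * D" by (simp add: algebra_simps)
    finally show ?thesis using det by simp
  qed
  ultimately show ?thesis by (simp add: F_def A_def D_def a_def d_def)
qed

lemma F_real: "F (of_real x) \<in> \<real>"
  using F_cnj[of "of_real x"] by (simp add: Reals_cnj_iff)

end

section \<open>Tools: complex derivatives, two-by-two systems, Horner sums\<close>

lemma has_field_derivative_if_quadratic_error:
  fixes f :: "complex \<Rightarrow> complex"
  assumes "\<And>w. cmod (w - z) \<le> 1 \<Longrightarrow> cmod (f w - f z - (w - z) * d) \<le> K * (cmod (w - z))\<^sup>2"
  shows "(f has_field_derivative d) (at z)"
proof -
  have "((\<lambda>w. (f w - f z) / (w - z) - d) \<longlongrightarrow> 0) (at z)"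
  proof (rule Lim_null_comparison)
    show "((\<lambda>w. K * cmod (w - z)) \<longlongrightarrow> 0) (at z)"
      by (rule tendsto_eq_intros refl | simp)+
    have "\<forall>\<^sub>F w in at z. w \<in> ball z 1 - {z}"
      by (rule eventually_at_in_open) auto
    then show "\<forall>\<^sub>F w in at z. cmod ((f w - f z) / (w - z) - d) \<le> K * cmod (w - z)"
    proof eventually_elim
      case (elim w)
      then have w: "w \<noteq> z" "cmod (w - z) \<le> 1" by (auto simp: dist_norm norm_minus_commute)
      have "(f w - f z) / (w - z) - d = (f w - f z - (w - z) * d) / (w - z)"
        using w by (simp add: field_simps)
      also have "cmod \<dots> \<le> K * (cmod (w - z))\<^sup>2 / cmod (w - z)"
        unfolding norm_divide using assms[OF w(2)] by (intro divide_right_mono) auto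
      also have "\<dots> = K * cmod (w - z)" using w by (simp add: power2_eq_square)
      finally show ?case .
    qed
  qed
  then have "((\<lambda>w. (f w - f z) / (w - z)) \<longlongrightarrow> d) (at z)" by (simp add: LIM_zero_iff)
  then show ?thesis by (simp add: has_field_derivative_iff)
qed

lemma complex_2x2_singular_iff:
  fixes A B C D :: complex
  shows "(\<exists>a b. (a \<noteq> 0 \<or> b \<noteq> 0) \<and> A * a + B * b = 0 \<and> C * a + D * b = 0) \<longleftrightarrow> A * D - B * C = 0"
proof
  assume "\<exists>a b. (a \<noteq> 0 \<or> b \<noteq> 0) \<and> A * a + B * b = 0 \<and> C * a + D * b = 0"
  then obtain a b where ab: "a \<noteq> 0 \<or> b \<noteq> 0" "A * a + B * b = 0" "C * a + D * b = 0" by blast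
  have "(A * D - B * C) * a = D * (A * a + B * b) - B * (C * a + D * b)"
    "(A * D - B * C) * b = A * (C * a + D * b) - C * (A * a + B * b)" by (simp_all add: algebra_simps)
  then show "A * D - B * C = 0" using ab by auto
next
  assume d: "A * D - B * C = 0"
  show "\<exists>a b. (a \<noteq> 0 \<or> b \<noteq> 0) \<and> A * a + B * b = 0 \<and> C * a + D * b = 0"
  proof (cases "A = 0 \<and> B = 0")
    case True
    then show ?thesis
    proof (cases "C = 0 \<and> D = 0")
      case False
      then show ?thesis using True by (intro exI[of _ D] exI[of _ "- C"]) auto
    qed (auto intro: exI[of _ 1])
  next
    case False
    then show ?thesis using d by (intro exI[of _ B] exI[of _ "- A"]) (auto simp: algebra_simps)
  qed
qed

text \<open>A nonzero singular matrix has rank one. The last two conditions are Cramer's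
  determinants; they say that \<open>(p, r)\<close> is parallel to both columns, so dividing by any
  nonzero entry gives a solution.\<close>

lemma complex_2x2_range:
  fixes A B C D p r :: complex
  assumes "A \<noteq> 0 \<or> B \<noteq> 0 \<or> C \<noteq> 0 \<or> D \<noteq> 0" "A * D - B * C = 0" "D * p - B * r = 0" "A * r - C * p = 0"
  shows "\<exists>a b. A * a + B * b = p \<and> C * a + D * b = r"
proof -
  have 1: ?thesis if "A \<noteq> 0"
    using assms that by (intro exI[of _ "p / A"] exI[of _ 0]) (auto simp: field_simps)
  have 2: ?thesis if "B \<noteq> 0"
    using assms that by (intro exI[of _ 0] exI[of _ "p / B"]) (auto simp: field_simps)
  have 3: ?thesis if "C \<noteq> 0"
    using assms that by (intro exI[of _ "r / C"] exI[of _ 0]) (auto simp: field_simps)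
  have 4: ?thesis if "D \<noteq> 0"
    using assms that by (intro exI[of _ 0] exI[of _ "r / D"]) (auto simp: field_simps)
  show ?thesis using assms(1) 1 2 3 4 by blast
qed

lemma L2_on_continuous:
  assumes "continuous_on {a..b} f"
  shows "L2_on {a..b} f"
proof -
  have "(\<lambda>x. (cmod (f x))\<^sup>2) absolutely_integrable_on {a..b}"
    by (intro absolutely_integrable_continuous_real continuous_intros assms)
  then have "integrable (lebesgue_on {a..b}) (\<lambda>x. (cmod (f x))\<^sup>2)"
    by (simp add: absolutely_integrable_on_def integrable_on_def set_integrable_def integrable_restrict_space)
  moreover have "f \<in> borel_measurable (lebesgue_on {a..b})"
    using assms by (intro continuous_imp_measurable_on_sets_lebesgue) auto
  ultimately show ?thesis by (simp add: L2_on_def)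
qed

text \<open>The polynomial \<open>f 0 * \<mu> ^ j + ... + f j\<close> in \<mu>, evaluated by
  Horner's scheme.\<close>

primrec horner :: "(nat \<Rightarrow> real \<Rightarrow> complex) \<Rightarrow> complex \<Rightarrow> nat \<Rightarrow> real \<Rightarrow> complex" where
  "horner f \<mu> 0 = f 0"
| "horner f \<mu> (Suc j) = (\<lambda>x. \<mu> * horner f \<mu> j x + f (Suc j) x)"

lemma horner_tendsto: "((\<lambda>\<mu>. horner f \<mu> j x) \<longlongrightarrow> f j x) (at 0)"
proof (induction j)
  case (Suc j)
  have "((\<lambda>\<mu>. \<mu> * horner f \<mu> j x + f (Suc j) x) \<longlongrightarrow> 0 * f j x + f (Suc j) x) (at 0)"
    by (intro tendsto_intros Suc)
  then show ?case by simp
qed auto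

section \<open>Analytic dependence on the spectral parameter\<close>

context hill begin

lemma solves_bound:
  assumes "solves {0..1} z f g y v" "\<And>x. x \<in> {0..1} \<Longrightarrow> cmod (f x) \<le> \<beta> \<and> cmod (g x) \<le> \<beta>" "x \<in> {0..1}"
    "energy y v 0 + \<beta>\<^sup>2 \<le> m\<^sup>2" "m \<ge> 0"
  shows "cmod (y x) \<le> exp (kap z) * m" "cmod (v x) \<le> exp (kap z) * m"
proof -
  have "energy y v x + \<beta>\<^sup>2 \<le> exp (kap z * \<bar>x - 0\<bar>) * (energy y v 0 + \<beta>\<^sup>2)"
    using assms by (intro energy_growth[of 0 1]) auto
  also have "\<dots> \<le> exp (kap z) * m\<^sup>2"
    using assms kap_pos[of z] by (intro mult_mono) (auto simp: mult_le_cancel_left1)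
  also have "\<dots> \<le> (exp (kap z))\<^sup>2 * m\<^sup>2"
    using kap_pos[of z] by (intro mult_right_mono) (auto simp: power2_eq_square mult_le_cancel_left1)
  finally have "(cmod (y x))\<^sup>2 + (cmod (v x))\<^sup>2 + \<beta>\<^sup>2 \<le> (exp (kap z) * m)\<^sup>2"
    by (simp add: energy_def power_mult_distrib)
  then have "(cmod (y x))\<^sup>2 \<le> (exp (kap z) * m)\<^sup>2" "(cmod (v x))\<^sup>2 \<le> (exp (kap z) * m)\<^sup>2"
    using zero_le_power2[of "cmod (y x)"] zero_le_power2[of "cmod (v x)"] zero_le_power2[of \<beta>] by linarith+
  then show "cmod (y x) \<le> exp (kap z) * m" "cmod (v x) \<le> exp (kap z) * m"
    using assms(5) by (auto intro!: power2_le_imp_le)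
qed

lemma fsol_bound:
  assumes "x \<in> {0..1}"
  shows "cmod (ysol z y0 v0 x) \<le> exp (kap z) * (cmod y0 + cmod v0)"
    "cmod (vsol z y0 v0 x) \<le> exp (kap z) * (cmod y0 + cmod v0)"
  by (rule solves_bound[OF solves_fsol', of 0];
      use assms in \<open>simp add: energy_def power2_eq_square algebra_simps\<close>)+

lemma inhomogeneous_bound:
  assumes "solves {0..1} z (\<lambda>x. 0) c y v" "y 0 = 0" "v 0 = 0" "\<And>x. x \<in> {0..1} \<Longrightarrow> cmod (c x) \<le> \<beta>" "x \<in> {0..1}"
  shows "cmod (y x) \<le> exp (kap z) * \<beta>" "cmod (v x) \<le> exp (kap z) * \<beta>"
proof -
  have "0 \<le> \<beta>" using assms(4)[OF assms(5)] norm_ge_zero order_trans by blast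
  then show "cmod (y x) \<le> exp (kap z) * \<beta>" "cmod (v x) \<le> exp (kap z) * \<beta>"
    using assms by (auto simp: energy_def intro!: solves_bound[OF assms(1), of \<beta>])
qed

lemma solves_change_parameter:
  assumes "solves S z b c y v"
  shows "solves S w b (\<lambda>x. c x + (w - z) * y x) y v"
  using assms unfolding solves_def by (simp add: algebra_simps)

text \<open>\<open>(e, f)\<close> solves the variational equation. The remainder, solution at
  \<open>w\<close> minus solution at \<open>z\<close> minus \<open>(w - z) * e\<close>, starts at
  zero and solves the equation at \<open>z\<close> with forcing \<open>(z - w)\<close> times the
  difference of the two solutions, which is of second order in \<open>w - z\<close>.\<close>

lemma fsol_param_derivative:
  assumes e: "solves {0..1} z (\<lambda>x. 0) (\<lambda>x. - ysol z y0 v0 x) e f" "e 0 = 0" "f 0 = 0"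
  shows "((\<lambda>w. ysol w y0 v0 1) has_field_derivative e 1) (at z)"
    "((\<lambda>w. vsol w y0 v0 1) has_field_derivative f 1) (at z)"
proof -
  define C where "C z = exp (kap z)" for z
  define m where "m = cmod y0 + cmod v0"
  \<comment> \<open>\<open>kap\<close> depends only on the modulus, so the real number
    \<open>cmod z + 1\<close> represents all \<open>w\<close> in the closed unit disc around
    \<open>z\<close>.\<close>
  define C1 where "C1 = C (of_real (cmod z + 1))"
  define K where "K = C z * (C z * (C1 * m))"
  have main: "cmod (ysol w y0 v0 1 - ysol z y0 v0 1 - (w - z) * e 1) \<le> K * (cmod (w - z))\<^sup>2 \<and>
      cmod (vsol w y0 v0 1 - vsol z y0 v0 1 - (w - z) * f 1) \<le> K * (cmod (w - z))\<^sup>2"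
    if w: "cmod (w - z) \<le> 1" for w
  proof -
    let ?y = "ysol w y0 v0" and ?v = "vsol w y0 v0"
    have "cmod w \<le> cmod z + 1" using w norm_triangle_ineq2[of w z] by linarith
    then have Cw: "C w \<le> C1" unfolding C1_def C_def exp_le_cancel_iff by (intro kap_mono) (simp del: of_real_add)
    have yw: "cmod (?y x) \<le> C1 * m" if "x \<in> {0..1}" for x
    proof -
      have "cmod (?y x) \<le> C w * m" using fsol_bound(1)[OF that] by (simp add: m_def C_def)
      also have "\<dots> \<le> C1 * m" using Cw by (intro mult_right_mono) (auto simp: m_def)
      finally show ?thesis .
    qed
    have s1: "solves {0..1} z (\<lambda>x. 0) (\<lambda>x. 0 + (z - w) * ?y x) ?y ?v"
      by (rule solves_change_parameter[OF solves_fsol'])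
    have s2: "solves {0..1} z (\<lambda>x. 0) (\<lambda>x. (z - w) * ?y x) (\<lambda>x. ?y x - ysol z y0 v0 x) (\<lambda>x. ?v x - vsol z y0 v0 x)"
      using solves_lincomb[OF s1 solves_fsol'[of _ z y0 v0], of 1 "-1"] by simp
    have d: "cmod (?y x - ysol z y0 v0 x) \<le> C z * (cmod (w - z) * (C1 * m))" if "x \<in> {0..1}" for x
      unfolding C_def
      by (rule inhomogeneous_bound(1)[OF s2])
        (use yw that in \<open>auto simp: norm_mult norm_minus_commute[of z] intro!: mult_left_mono\<close>)
    have s3: "solves {0..1} z (\<lambda>x. 0) (\<lambda>x. (z - w) * (?y x - ysol z y0 v0 x))
        (\<lambda>x. ?y x - ysol z y0 v0 x - (w - z) * e x) (\<lambda>x. ?v x - vsol z y0 v0 x - (w - z) * f x)"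
      using solves_lincomb[OF s2 e(1), of 1 "z - w"] by (simp add: algebra_simps)
    have c3: "cmod ((z - w) * (?y x - ysol z y0 v0 x)) \<le> cmod (w - z) * (C z * (cmod (w - z) * (C1 * m)))"
      if "x \<in> {0..1}" for x
      using d[OF that] by (simp add: norm_mult norm_minus_commute[of z] mult_left_mono)
    have "cmod (?y 1 - ysol z y0 v0 1 - (w - z) * e 1) \<le> C z * (cmod (w - z) * (C z * (cmod (w - z) * (C1 * m)))) \<and>
       cmod (?v 1 - vsol z y0 v0 1 - (w - z) * f 1) \<le> C z * (cmod (w - z) * (C z * (cmod (w - z) * (C1 * m))))"
      using inhomogeneous_bound[OF s3 _ _ c3, of 1] e by (simp add: C_def)
    then show ?thesis by (simp add: K_def power2_eq_square mult_ac)
  qed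
  show "((\<lambda>w. ysol w y0 v0 1) has_field_derivative e 1) (at z)"
    "((\<lambda>w. vsol w y0 v0 1) has_field_derivative f 1) (at z)"
    using main by (auto intro!: has_field_derivative_if_quadratic_error)
qed

lemma inhomogeneous_exists:
  assumes "continuous_on {0..1} c"
  shows "\<exists>e f. solves {0..1} z (\<lambda>x. 0) c e f \<and> e 0 = 0 \<and> f 0 = 0"
proof -
  \<comment> \<open>The forcing is extended by its boundary values, as the existence theorem is
    stated on the whole line.\<close>
  have "continuous_on UNIV (\<lambda>x. c (max 0 (min 1 x)))"
    by (rule continuous_on_compose2[OF assms]) (auto intro!: continuous_intros)
  then have "\<exists>e f. solves UNIV z (\<lambda>x. 0) (\<lambda>x. c (max 0 (min 1 x))) e f \<and> e 0 = 0 \<and> f 0 = 0"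
    using solves_exists[of "\<lambda>x. 0" "\<lambda>x. c (max 0 (min 1 x))" 0 0 z] continuous_on_const by metis
  then obtain e f where ef: "solves UNIV z (\<lambda>x. 0) (\<lambda>x. c (max 0 (min 1 x))) e f" "e 0 = 0" "f 0 = 0" by blast
  have "solves {0..1} z (\<lambda>x. 0) c e f \<longleftrightarrow> solves {0..1} z (\<lambda>x. 0) (\<lambda>x. c (max 0 (min 1 x))) e f"
    by (rule solves_cong) auto
  then show ?thesis using ef solves_subset[OF ef(1), of "{0..1}"] by auto
qed

lemma ysol_cont: "continuous_on S (ysol z y0 v0)"
  using solves_cont(1)[OF solves_fsol'] .

lemma fsol_param_derivative_ex:
  "\<exists>e f. solves {0..1} z (\<lambda>x. 0) (\<lambda>x. - ysol z y0 v0 x) e f \<and> e 0 = 0 \<and> f 0 = 0 \<and>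
    ((\<lambda>w. ysol w y0 v0 1) has_field_derivative e 1) (at z) \<and>
    ((\<lambda>w. vsol w y0 v0 1) has_field_derivative f 1) (at z)"
proof -
  have "continuous_on {0..1} (\<lambda>x. - ysol z y0 v0 x)" by (intro continuous_intros ysol_cont)
  from inhomogeneous_exists[OF this] fsol_param_derivative show ?thesis by meson
qed

lemma F_holomorphic: "F holomorphic_on S"
proof -
  have "F field_differentiable at z" for z
  proof -
    obtain a b where "(m11 has_field_derivative a) (at z)" "(m22 has_field_derivative b) (at z)"
      using fsol_param_derivative_ex[of z 1 0] fsol_param_derivative_ex[of z 0 1] by blast
    from DERIV_add[OF this] show ?thesis
      unfolding F_def[abs_def] field_differentiable_def by blast
  qed
  then show ?thesis by (simp add: holomorphic_onI field_differentiable_at_within)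
qed

subsection \<open>Eigenvalues and root vectors of the Bloch operators\<close>

lemma bloch_domain:
  assumes "(y, g) \<in> shift_op (bloch_op q t) z"
  shows "continuous_on {0..1} y" "x \<notin> {0..1} \<Longrightarrow> y x = 0"
  using assms by (auto simp: shift_op_def bloch_op_def sl_equation_def intro: continuous_on_vector_derivative)

text \<open>The boundary condition on \<open>y'\<close> may be imposed on
  \<open>v = y' - Q y\<close> instead, because \<open>Q\<close> vanishes at 0 and at 1.\<close>

lemma bloch_iff_solves:
  assumes g: "continuous_on {0..1} g"
  shows "(y, g) \<in> shift_op (bloch_op q t) z \<longleftrightarrow> (\<forall>x. x \<notin> {0..1} \<longrightarrow> y x = 0) \<and>
    (\<exists>v. solves {0..1} z (\<lambda>x. 0) (\<lambda>x. - g x) y v \<and> y 1 = cis t * y 0 \<and> v 1 = cis t * v 0)"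
    (is "?L \<longleftrightarrow> ?V \<and> ?R")
proof
  assume L: ?L
  then obtain y1 where y1: "sl_equation q {0..1} y y1 (\<lambda>x. g x + z * y x)" "y 1 = cis t * y 0" "y1 1 = cis t * y1 0"
    and V: ?V by (auto simp: shift_op_def bloch_op_def)
  show "?V \<and> ?R"
    using V y1 sl_equation_iff_solves[OF g, of y y1 z] by (auto intro!: exI[of _ "\<lambda>x. y1 x - Q x * y x"])
next
  assume R: "?V \<and> ?R"
  then obtain v where v: "solves {0..1} z (\<lambda>x. 0) (\<lambda>x. - g x) y v" "y 1 = cis t * y 0" "v 1 = cis t * v 0" by blast
  let ?y1 = "\<lambda>x. v x + Q x * y x"
  have yc: "continuous_on {0..1} y" by (rule solves_cont[OF v(1)])
  have "(\<lambda>x. ?y1 x - Q x * y x) = v" by (rule ext) simp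
  then have "sl_equation q {0..1} y ?y1 (\<lambda>x. g x + z * y x)"
    using sl_equation_iff_solves[OF g, of y ?y1 z] v(1) by simp
  moreover have "L2_on {0..1} y" "L2_on {0..1} (\<lambda>x. g x + z * y x)"
    by (intro L2_on_continuous continuous_intros yc g)+
  moreover have "?y1 1 = cis t * ?y1 0" using v by simp
  ultimately show ?L
    using R v(2) unfolding shift_op_def bloch_op_def mem_Collect_eq prod.case by blast
qed

definition restr :: "(real \<Rightarrow> complex) \<Rightarrow> real \<Rightarrow> complex" where
  "restr y x = (if x \<in> {0..1} then y x else 0)"

lemma restr_simps [simp]: "x \<in> {0..1} \<Longrightarrow> restr y x = y x" "x \<notin> {0..1} \<Longrightarrow> restr y x = 0"
  by (auto simp: restr_def)

lemma solves_restr [simp]: "solves {0..1} z b c (restr y) v \<longleftrightarrow> solves {0..1} z b c y v"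
  by (rule solves_cong) auto

text \<open>The first equation determines \<open>v\<close> as \<open>y' - Q y\<close>; neither
  \<open>z\<close> nor the forcing of the second equation enters, so they may differ.\<close>

lemma solves_v_unique:
  assumes "solves {0..1} z (\<lambda>x. 0) c y v" "solves {0..1} z' (\<lambda>x. 0) c' y' v'"
    and eq: "\<And>x. x \<in> {0..1} \<Longrightarrow> y x = y' x" and x: "x \<in> {0..1}"
  shows "v x = v' x"
proof -
  have "(y has_vector_derivative Q x * y' x + v' x + 0) (at x within {0..1})"
    by (rule has_vector_derivative_transform[OF x eq solvesD(1)[OF assms(2) x]])
  then have "Q x * y' x + v' x + 0 = Q x * y x + v x + 0"
    by (rule vector_derivative_unique_within_closed_interval[of 0 1, unfolded box_real, OF zero_less_one x _ solvesD(1)[OF assms(1) x]])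
  then show ?thesis using eq[OF x] by simp
qed

text \<open>The characteristic polynomial of the monodromy matrix at \<open>cis t\<close>: the
  determinant is 1, and \<open>1 + cis t * cis t = 2 * cos t * cis t\<close>.\<close>

lemma monodromy_char:
  "(m11 z - cis t) * (m22 z - cis t) - m12 z * m21 z = cis t * (2 * of_real (cos t) - F z)"
proof -
  have c: "cis t * (2 * of_real (cos t)) = 1 + cis t * cis t"
    by (simp add: complex_eq_iff cis.ctr cos_squared_eq[unfolded power2_eq_square] algebra_simps)
  have "(m11 z - cis t) * (m22 z - cis t) - m12 z * m21 z = (m11 z * m22 z - m12 z * m21 z) - cis t * F z + cis t * cis t"
    by (simp add: F_def algebra_simps)
  then show ?thesis using c unfolding monodromy_det by (simp add: algebra_simps)
qed

lemma Floquet_vector_iff: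
  "(\<exists>a b. (a \<noteq> 0 \<or> b \<noteq> 0) \<and> ysol z a b 1 = cis t * a \<and> vsol z a b 1 = cis t * b) \<longleftrightarrow> F z = 2 * of_real (cos t)"
proof -
  have *: "ysol z a b 1 = cis t * a \<and> vsol z a b 1 = cis t * b \<longleftrightarrow>
    (m11 z - cis t) * a + m12 z * b = 0 \<and> m21 z * a + (m22 z - cis t) * b = 0" for a b
    unfolding fsol_decomp[of z a b 1] by (auto simp: algebra_simps)
  show ?thesis
    unfolding * complex_2x2_singular_iff monodromy_char by auto
qed

lemma eigenvalue_iff: "eigenvalue q t z \<longleftrightarrow> F z = 2 * of_real (cos t)"
proof -
  have "eigenvalue q t z \<longleftrightarrow> (\<exists>y. y \<noteq> (\<lambda>x. 0) \<and> (y, \<lambda>x. 0) \<in> shift_op (bloch_op q t) z)"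
    by (simp add: eigenvalue_def shift_op_def)
  also have "\<dots> \<longleftrightarrow> (\<exists>a b. (a \<noteq> 0 \<or> b \<noteq> 0) \<and> ysol z a b 1 = cis t * a \<and> vsol z a b 1 = cis t * b)"
  proof
    assume "\<exists>y. y \<noteq> (\<lambda>x. 0) \<and> (y, \<lambda>x. 0) \<in> shift_op (bloch_op q t) z"
    then obtain y v where y: "y \<noteq> (\<lambda>x. 0)" "\<forall>x. x \<notin> {0..1} \<longrightarrow> y x = 0"
      "solves {0..1} z (\<lambda>x. 0) (\<lambda>x. 0) y v" "y 1 = cis t * y 0" "v 1 = cis t * v 0"
      unfolding bloch_iff_solves[OF continuous_on_const] by auto
    obtain x where "y x \<noteq> 0" using y(1) by auto
    moreover from this have x01: "x \<in> {0..1}" using y(2) by blast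
    ultimately have x: "ysol z (y 0) (v 0) x \<noteq> 0"
      using solves_hom_eq_fsol(1)[OF y(3) _ x01] by auto
    have "y 0 \<noteq> 0 \<or> v 0 \<noteq> 0"
      using x fsol_decomp[of z "y 0" "v 0" x] by auto
    then show "\<exists>a b. (a \<noteq> 0 \<or> b \<noteq> 0) \<and> ysol z a b 1 = cis t * a \<and> vsol z a b 1 = cis t * b"
      using solves_hom_eq_fsol[OF y(3), of 1] y by (intro exI[of _ "y 0"] exI[of _ "v 0"]) auto
  next
    assume "\<exists>a b. (a \<noteq> 0 \<or> b \<noteq> 0) \<and> ysol z a b 1 = cis t * a \<and> vsol z a b 1 = cis t * b"
    then obtain a b where ab: "a \<noteq> 0 \<or> b \<noteq> 0" "ysol z a b 1 = cis t * a" "vsol z a b 1 = cis t * b" by blast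
    let ?y = "restr (ysol z a b)"
    have S: "solves {0..1} z (\<lambda>x. 0) (\<lambda>x. - 0) ?y (vsol z a b)" using solves_fsol'[of _ z a b] by simp
    have "?y \<noteq> (\<lambda>x. 0)"
    proof
      assume y0: "?y = (\<lambda>x. 0)"
      then have z: "ysol z a b x = 0" if "x \<in> {0..1}" for x
        using restr_simps(1)[OF that, of "ysol z a b"] by simp
      have a: "a = 0" using z[of 0] by simp
      have "solves {0..1} z (\<lambda>x. 0) (\<lambda>x. 0) (\<lambda>x. 0) (\<lambda>x. 0)" by (simp add: solves_def)
      then have "vsol z a b 0 = 0"
        using solves_v_unique[OF solves_fsol'] z by (metis atLeastAtMost_iff order_refl zero_le_one)
      then show False using ab a by simp
    qed
    moreover have "(?y, \<lambda>x. 0) \<in> shift_op (bloch_op q t) z"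
      unfolding bloch_iff_solves[OF continuous_on_const] using S ab by (auto intro!: exI[of _ "vsol z a b"])
    ultimately show "\<exists>y. y \<noteq> (\<lambda>x. 0) \<and> (y, \<lambda>x. 0) \<in> shift_op (bloch_op q t) z" by blast
  qed
  also have "\<dots> \<longleftrightarrow> F z = 2 * of_real (cos t)" by (rule Floquet_vector_iff)
  finally show ?thesis .
qed

lemma chain_solves:
  assumes chain: "\<And>i. i < k \<Longrightarrow> (f i, f (Suc i)) \<in> shift_op (bloch_op q t) z" and fk: "f k = (\<lambda>x. 0)"
  obtains v where "\<And>i. i < k \<Longrightarrow> solves {0..1} z (\<lambda>x. 0) (\<lambda>x. - f (Suc i) x) (f i) (v i)"
    "\<And>i. i < k \<Longrightarrow> f i 1 = cis t * f i 0" "\<And>i. i < k \<Longrightarrow> v i 1 = cis t * v i 0"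
    "\<And>i. i \<le> k \<Longrightarrow> continuous_on {0..1} (f i)" "\<And>i x. i \<le> k \<Longrightarrow> x \<notin> {0..1} \<Longrightarrow> f i x = 0"
proof -
  have c: "continuous_on {0..1} (f i)" "x \<notin> {0..1} \<Longrightarrow> f i x = 0" if "i \<le> k" for i x
  proof -
    have "continuous_on {0..1} (f i) \<and> (x \<notin> {0..1} \<longrightarrow> f i x = 0)"
      using bloch_domain(1)[OF chain[of i]] bloch_domain(2)[OF chain[of i], of x] fk that by (cases "i = k") auto
    then show "continuous_on {0..1} (f i)" "x \<notin> {0..1} \<Longrightarrow> f i x = 0" by auto
  qed
  have "\<forall>i\<in>{..<k}. \<exists>v. solves {0..1} z (\<lambda>x. 0) (\<lambda>x. - f (Suc i) x) (f i) v \<and> f i 1 = cis t * f i 0 \<and> v 1 = cis t * v 0"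
  proof
    fix i assume "i \<in> {..<k}"
    then have i: "i < k" "Suc i \<le> k" by auto
    show "\<exists>v. solves {0..1} z (\<lambda>x. 0) (\<lambda>x. - f (Suc i) x) (f i) v \<and> f i 1 = cis t * f i 0 \<and> v 1 = cis t * v 0"
      using chain[OF i(1)] unfolding bloch_iff_solves[OF c(1)[OF i(2)]] by blast
  qed
  from bchoice[OF this] obtain v where "\<forall>i\<in>{..<k}. solves {0..1} z (\<lambda>x. 0) (\<lambda>x. - f (Suc i) x) (f i) (v i) \<and> f i 1 = cis t * f i 0 \<and> v i 1 = cis t * v i 0"
    by blast
  then show ?thesis using c by (intro that[of v]) auto
qed

text \<open>A Jordan chain of length \<open>k\<close> at \<open>z\<close> gives, by Horner's scheme in \<open>\<mu>\<close>, an approximate Floquet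
  solution at \<open>z + \<mu>\<close> with error of order \<open>\<mu>^k\<close>, so \<open>F - 2 cos t\<close> vanishes to order \<open>k\<close> at \<open>z\<close>.\<close>

lemma chain_order:
  assumes chain: "\<And>i. i < k \<Longrightarrow> (f i, f (Suc i)) \<in> shift_op (bloch_op q t) z" and fk: "f k = (\<lambda>x. 0)"
    and k: "k > 0" and ne: "f (k - 1) \<noteq> (\<lambda>x. 0)"
  shows "\<exists>K. \<forall>\<^sub>F \<mu> in at 0. cmod (F (z + \<mu>) - 2 * of_real (cos t)) \<le> K * cmod \<mu> ^ k"
proof -
  obtain v where v: "\<And>i. i < k \<Longrightarrow> solves {0..1} z (\<lambda>x. 0) (\<lambda>x. - f (Suc i) x) (f i) (v i)"
    "\<And>i. i < k \<Longrightarrow> f i 1 = cis t * f i 0" "\<And>i. i < k \<Longrightarrow> v i 1 = cis t * v i 0"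
    "\<And>i. i \<le> k \<Longrightarrow> continuous_on {0..1} (f i)" "\<And>i x. i \<le> k \<Longrightarrow> x \<notin> {0..1} \<Longrightarrow> f i x = 0"
    using chain_solves[OF chain fk] by blast
  \<comment> \<open>Multiplying by \<mu> and adding the next chain element replaces the defect
    \<open>\<mu> ^ Suc j * f 0 - f (Suc j)\<close> by the one with \<open>j + 1\<close>. At
    \<open>j = k - 1\<close> its second term vanishes, as \<open>f k\<close> does.\<close>
  have H: "solves {0..1} (z + \<mu>) (\<lambda>x. 0) (\<lambda>x. \<mu> ^ Suc j * f 0 x - f (Suc j) x) (horner f \<mu> j) (horner v \<mu> j)
      \<and> horner f \<mu> j 1 = cis t * horner f \<mu> j 0 \<and> horner v \<mu> j 1 = cis t * horner v \<mu> j 0" if "j < k" for j \<mu>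
    using that
  proof (induction j)
    case 0
    have "solves {0..1} (z + \<mu>) (\<lambda>x. 0) (\<lambda>x. - f (Suc 0) x + (z + \<mu> - z) * f 0 x) (f 0) (v 0)"
      by (rule solves_change_parameter[OF v(1)[OF 0]])
    then show ?case using v(2,3)[OF 0] by (simp add: algebra_simps)
  next
    case (Suc j)
    then have IH: "solves {0..1} (z + \<mu>) (\<lambda>x. 0) (\<lambda>x. \<mu> ^ Suc j * f 0 x - f (Suc j) x) (horner f \<mu> j) (horner v \<mu> j)"
      "horner f \<mu> j 1 = cis t * horner f \<mu> j 0" "horner v \<mu> j 1 = cis t * horner v \<mu> j 0" by auto
    have "solves {0..1} (z + \<mu>) (\<lambda>x. 0) (\<lambda>x. - f (Suc (Suc j)) x + (z + \<mu> - z) * f (Suc j) x) (f (Suc j)) (v (Suc j))"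
      by (rule solves_change_parameter[OF v(1)[OF Suc.prems]])
    from solves_lincomb[OF IH(1) this, of \<mu> 1]
    have "solves {0..1} (z + \<mu>) (\<lambda>x. 0) (\<lambda>x. \<mu> ^ Suc (Suc j) * f 0 x - f (Suc (Suc j)) x) (horner f \<mu> (Suc j)) (horner v \<mu> (Suc j))"
      by (simp add: algebra_simps)
    then show ?case using v(2,3)[OF Suc.prems] IH(2,3) by (simp add: algebra_simps)
  qed
  define k1 where "k1 = k - 1"
  have k1: "k1 < k" "Suc k1 = k" using k by (auto simp: k1_def)
  define U where "U \<mu> = horner f \<mu> k1" for \<mu>
  define W where "W \<mu> = horner v \<mu> k1" for \<mu>
  have UW: "solves {0..1} (z + \<mu>) (\<lambda>x. 0) (\<lambda>x. \<mu> ^ k * f 0 x) (U \<mu>) (W \<mu>)"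
    "U \<mu> 1 = cis t * U \<mu> 0" "W \<mu> 1 = cis t * W \<mu> 0" for \<mu>
    using H[OF k1(1), of \<mu>] fk k1(2) by (auto simp: U_def W_def)
  \<comment> \<open>The last chain element is a nonzero homogeneous solution, so its initial data
    are nonzero. This keeps the data of the Horner sum away from zero as \<mu> tends to 0.\<close>
  have s0: "f k1 0 \<noteq> 0 \<or> v k1 0 \<noteq> 0"
  proof (rule ccontr)
    assume n: "\<not> (f k1 0 \<noteq> 0 \<or> v k1 0 \<noteq> 0)"
    have S: "solves {0..1} z (\<lambda>x. 0) (\<lambda>x. 0) (f k1) (v k1)"
      using v(1)[OF k1(1)] k1(2) fk by simp
    have "f k1 x = 0" for x
    proof (cases "x \<in> {0..1}")
      case True
      then show ?thesis
        using solves_hom_eq_fsol(1)[OF S _ True] n fsol_decomp(1)[of z 0 0 x] by simp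
    qed (use v(5)[of k1 x] k1 in auto)
    then show False using ne by (auto simp: k1_def)
  qed
  define s where "s = cmod (f k1 0) + cmod (v k1 0)"
  have s: "s > 0" using s0 by (auto simp: s_def add_pos_nonneg add_nonneg_pos)
  have "((\<lambda>\<mu>. cmod (U \<mu> 0) + cmod (W \<mu> 0)) \<longlongrightarrow> s) (at 0)"
    unfolding U_def W_def s_def by (intro tendsto_intros horner_tendsto)
  then have ev1: "\<forall>\<^sub>F \<mu> in at 0. s / 2 < cmod (U \<mu> 0) + cmod (W \<mu> 0)"
    by (rule order_tendstoD(1)) (use s in simp)
  have "bounded (f 0 ` {0..1})"
    by (intro compact_imp_bounded compact_continuous_image v(4)) auto
  then obtain B where B: "B > 0" "\<And>x. x \<in> {0..1} \<Longrightarrow> cmod (f 0 x) \<le> B"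
    unfolding bounded_pos by blast
  define E where "E = exp (kap (of_real (cmod z + 1)))"
  have E: "E > 0" by (simp add: E_def)
  have ev2: "\<forall>\<^sub>F \<mu> in at 0. \<mu> \<in> ball 0 1 - {0::complex}"
    by (rule eventually_at_in_open) auto
  have "\<forall>\<^sub>F \<mu> in at 0. cmod (F (z + \<mu>) - 2 * of_real (cos t)) \<le> 8 * (E + 1) * (E * B) / s * cmod \<mu> ^ k"
    using ev1 ev2
  proof eventually_elim
    case (elim \<mu>)
    have "cmod (z + \<mu>) \<le> cmod z + 1" using elim(2) norm_triangle_ineq[of z \<mu>] by simp
    then have Ez: "exp (kap (z + \<mu>)) \<le> E"
      unfolding E_def exp_le_cancel_iff by (intro kap_mono) (simp del: of_real_add)
    define a b where "a = U \<mu> 0" and "b = W \<mu> 0"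
    define p r where "p = ysol (z + \<mu>) a b 1 - U \<mu> 1" and "r = vsol (z + \<mu>) a b 1 - W \<mu> 1"
    have P: "solves {0..1} (z + \<mu>) (\<lambda>x. 0) (\<lambda>x. - (\<mu> ^ k * f 0 x)) (\<lambda>x. ysol (z + \<mu>) a b x - U \<mu> x) (\<lambda>x. vsol (z + \<mu>) a b x - W \<mu> x)"
      using solves_lincomb[OF solves_fsol'[of _ "z + \<mu>" a b] UW(1), of 1 "-1"] by simp
    have cb: "cmod (- (\<mu> ^ k * f 0 x)) \<le> cmod \<mu> ^ k * B" if "x \<in> {0..1}" for x
      using B(2)[OF that] by (simp add: norm_mult norm_power mult_left_mono)
    have "cmod p \<le> exp (kap (z + \<mu>)) * (cmod \<mu> ^ k * B)" "cmod r \<le> exp (kap (z + \<mu>)) * (cmod \<mu> ^ k * B)"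
      unfolding p_def r_def
      using inhomogeneous_bound[OF P _ _ cb, of 1] by (simp_all add: a_def b_def)
    moreover have "exp (kap (z + \<mu>)) * (cmod \<mu> ^ k * B) \<le> E * (cmod \<mu> ^ k * B)"
      using Ez B(1) by (intro mult_right_mono) auto
    ultimately have pr: "cmod p \<le> E * (cmod \<mu> ^ k * B)" "cmod r \<le> E * (cmod \<mu> ^ k * B)" by linarith+
    define A11 A12 A21 A22 where "A11 = m11 (z + \<mu>) - cis t" and "A12 = m12 (z + \<mu>)"
      and "A21 = m21 (z + \<mu>)" and "A22 = m22 (z + \<mu>) - cis t"
    have M: "cmod (m11 (z + \<mu>)) \<le> E" "cmod (m12 (z + \<mu>)) \<le> E" "cmod (m21 (z + \<mu>)) \<le> E" "cmod (m22 (z + \<mu>)) \<le> E"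
      using fsol_bound[of 1 "z + \<mu>" 1 0] fsol_bound[of 1 "z + \<mu>" 0 1] Ez by auto
    have Ab: "cmod A11 \<le> E + 1" "cmod A12 \<le> E + 1" "cmod A21 \<le> E + 1" "cmod A22 \<le> E + 1"
      unfolding A11_def A12_def A21_def A22_def
      using M norm_triangle_ineq4[of "m11 (z + \<mu>)" "cis t"] norm_triangle_ineq4[of "m22 (z + \<mu>)" "cis t"] by auto
    have eqs: "A11 * a + A12 * b = p" "A21 * a + A22 * b = r"
      using UW(2,3)[of \<mu>] fsol_decomp[of "z + \<mu>" a b 1]
      by (auto simp: p_def r_def A11_def A12_def A21_def A22_def a_def b_def algebra_simps)
    \<comment> \<open>By Cramer's rule \<open>d * a\<close> and \<open>d * b\<close> are
      combinations of the boundary defects \<open>p\<close> and \<open>r\<close>, hence of order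
      \<open>\<mu> ^ k\<close>, whereas \<open>cmod a + cmod b\<close> exceeds \<open>s / 2\<close>.
      By \<open>monodromy_char\<close>, \<open>d\<close> has the modulus of
      \<open>F (z + \<mu>) - 2 cos t\<close>.\<close>
    define d where "d = A11 * A22 - A12 * A21"
    have "d * a = A22 * p - A12 * r" "d * b = A11 * r - A21 * p"
      unfolding eqs[symmetric] d_def by (simp_all add: algebra_simps)
    then have "cmod d * cmod a = cmod (A22 * p - A12 * r)" "cmod d * cmod b = cmod (A11 * r - A21 * p)"
      by (metis norm_mult)+
    moreover have "cmod (A * x - B' * y) \<le> 2 * ((E + 1) * (E * (cmod \<mu> ^ k * B)))"
      if "cmod A \<le> E + 1" "cmod B' \<le> E + 1" "cmod x \<le> E * (cmod \<mu> ^ k * B)" "cmod y \<le> E * (cmod \<mu> ^ k * B)" for A B' x y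
    proof -
      have "cmod (A * x) \<le> (E + 1) * (E * (cmod \<mu> ^ k * B))" "cmod (B' * y) \<le> (E + 1) * (E * (cmod \<mu> ^ k * B))"
        unfolding norm_mult using that E by (intro mult_mono; simp)+
      then show ?thesis using norm_triangle_ineq4[of "A * x" "B' * y"] by linarith
    qed
    ultimately have "cmod d * cmod a \<le> 2 * ((E + 1) * (E * (cmod \<mu> ^ k * B)))" "cmod d * cmod b \<le> 2 * ((E + 1) * (E * (cmod \<mu> ^ k * B)))"
      using Ab pr by metis+
    then have "cmod d * (cmod a + cmod b) \<le> 4 * ((E + 1) * (E * (cmod \<mu> ^ k * B)))" by (simp add: algebra_simps)
    moreover have "cmod d * (s / 2) \<le> cmod d * (cmod a + cmod b)"
      using elim(1) by (intro mult_left_mono) (auto simp: a_def b_def)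
    ultimately have "cmod d * (s / 2) \<le> 4 * ((E + 1) * (E * (cmod \<mu> ^ k * B)))" by linarith
    then have dd: "cmod d \<le> 8 * (E + 1) * (E * B) / s * cmod \<mu> ^ k"
      using s by (simp add: field_simps)
    have "d = cis t * (2 * of_real (cos t) - F (z + \<mu>))"
      using monodromy_char[of "z + \<mu>" t] by (simp add: d_def A11_def A12_def A21_def A22_def)
    then have "cmod d = cmod (F (z + \<mu>) - 2 * of_real (cos t))"
      by (simp add: norm_mult norm_minus_commute)
    then show ?case using dd by simp
  qed
  then show ?thesis by blast
qed

text \<open>A nonconstant entire function takes the value \<open>2 cos t\<close> at \<open>z\<close>
  with some finite order \<open>n\<close>, and by \<open>chain_order\<close> a chain of length
  \<open>k\<close> forces order at least \<open>k\<close>. Where the value is not taken, no chain of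
  positive length exists.\<close>

lemma chain_length_bounded:
  assumes nonconst: "\<not> F constant_on UNIV"
  shows "\<exists>n. \<forall>k f. (\<forall>i<k. (f i, f (Suc i)) \<in> shift_op (bloch_op q t) z) \<longrightarrow> f k = (\<lambda>x. 0) \<longrightarrow>
    k > 0 \<longrightarrow> f (k - 1) \<noteq> (\<lambda>x. 0) \<longrightarrow> k \<le> n"
proof -
  define c where "c = 2 * complex_of_real (cos t)"
  have *: "\<exists>n. \<forall>k K. (\<forall>\<^sub>F \<mu> in at 0. cmod (F (z + \<mu>) - c) \<le> K * cmod \<mu> ^ k) \<longrightarrow> k > 0 \<longrightarrow> k \<le> n"
  proof (cases "F z = c")
    case True
    have hol: "(\<lambda>w. F w - c) holomorphic_on UNIV" by (intro holomorphic_intros F_holomorphic)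
    have F0: "F z - c = 0" using True by simp
    have nc: "\<not> (\<lambda>w. F w - c) constant_on UNIV"
    proof
      assume "(\<lambda>w. F w - c) constant_on UNIV"
      then obtain d where "\<And>w. F w - c = d" by (auto simp: constant_on_def)
      then have "F w = d + c" for w by (metis diff_add_cancel)
      then show False using nonconst by (auto simp: constant_on_def)
    qed
    obtain g r n where g: "0 < n" "0 < r" "ball z r \<subseteq> UNIV" "g holomorphic_on ball z r"
      "\<And>w. w \<in> ball z r \<Longrightarrow> F w - c = (w - z) ^ n * g w" "\<And>w. w \<in> ball z r \<Longrightarrow> g w \<noteq> 0"
      by (rule holomorphic_factor_zero_nonconstant[OF hol open_UNIV connected_UNIV UNIV_I[of z] F0 nc]) (rule that; assumption)
    have "k \<le> n" if K: "\<forall>\<^sub>F \<mu> in at 0. cmod (F (z + \<mu>) - c) \<le> K * cmod \<mu> ^ k" for k K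
    proof (rule ccontr)
      assume "\<not> k \<le> n"
      then obtain m where m: "k = n + Suc m" using less_imp_Suc_add[of n k] by auto
      have "isCont g z"
        using holomorphic_on_imp_continuous_on[OF g(4)] g(2) by (simp add: continuous_on_eq_continuous_at)
      then have "((\<lambda>\<mu>. g (z + \<mu>)) \<longlongrightarrow> g z) (at 0)"
        by (simp add: isCont_def LIM_offset_zero_iff)
      then have t1: "((\<lambda>\<mu>. cmod (g (z + \<mu>))) \<longlongrightarrow> cmod (g z)) (at 0)" by (rule tendsto_norm)
      have t2: "((\<lambda>\<mu>. K * cmod \<mu> ^ Suc m) \<longlongrightarrow> K * cmod 0 ^ Suc m) (at (0::complex))"
        by (intro tendsto_intros)
      have ev2: "\<forall>\<^sub>F \<mu> in at 0. \<mu> \<in> ball 0 r - {0::complex}"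
        by (rule eventually_at_in_open) (use g(2) in auto)
      have "\<forall>\<^sub>F \<mu> in at 0. cmod (g (z + \<mu>)) \<le> K * cmod \<mu> ^ Suc m"
        using K ev2
      proof eventually_elim
        case (elim \<mu>)
        then have "F (z + \<mu>) - c = \<mu> ^ n * g (z + \<mu>)" using g(5)[of "z + \<mu>"] by (simp add: dist_norm)
        then have "cmod \<mu> ^ n * cmod (g (z + \<mu>)) \<le> cmod \<mu> ^ n * (K * cmod \<mu> ^ Suc m)"
          using elim(1) by (simp add: norm_mult norm_power m power_add mult_ac)
        then show ?case using elim(2) by simp
      qed
      from tendsto_le[OF _ t2 t1 this] have "cmod (g z) \<le> 0" by simp
      then show False using g(6)[of z] g(2) by simp
    qed
    then show ?thesis by blast
  next
    case False
    have "\<not> k > 0" if K: "\<forall>\<^sub>F \<mu> in at 0. cmod (F (z + \<mu>) - c) \<le> K * cmod \<mu> ^ k" for k K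
    proof
      assume k: "k > 0"
      have "isCont F z"
        using holomorphic_on_imp_continuous_on[OF F_holomorphic[of UNIV]] by (simp add: continuous_on_eq_continuous_at)
      then have "((\<lambda>\<mu>. F (z + \<mu>)) \<longlongrightarrow> F z) (at 0)"
        by (simp add: isCont_def LIM_offset_zero_iff)
      then have t1: "((\<lambda>\<mu>. cmod (F (z + \<mu>) - c)) \<longlongrightarrow> cmod (F z - c)) (at 0)" by (intro tendsto_intros)
      have t2: "((\<lambda>\<mu>. K * cmod \<mu> ^ k) \<longlongrightarrow> K * cmod 0 ^ k) (at (0::complex))"
        by (intro tendsto_intros)
      from tendsto_le[OF _ t2 t1 K] have "cmod (F z - c) \<le> 0" using k by (simp add: power_0_left)
      then show False using False by simp
    qed
    then show ?thesis by blast
  qed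
  then obtain n where n: "\<And>k K. (\<forall>\<^sub>F \<mu> in at 0. cmod (F (z + \<mu>) - c) \<le> K * cmod \<mu> ^ k) \<Longrightarrow> k > 0 \<Longrightarrow> k \<le> n" by blast
  show ?thesis
  proof (intro exI[of _ n] allI impI)
    fix k f
    assume a: "\<forall>i<k. (f i, f (Suc i)) \<in> shift_op (bloch_op q t) z" "f k = (\<lambda>x. 0)" "k > 0" "f (k - 1) \<noteq> (\<lambda>x. 0)"
    have "\<exists>K. \<forall>\<^sub>F \<mu> in at 0. cmod (F (z + \<mu>) - 2 * of_real (cos t)) \<le> K * cmod \<mu> ^ k"
      by (rule chain_order[OF _ a(2-4)]) (use a(1) in blast)
    with n a(3) show "k \<le> n" unfolding c_def by blast
  qed
qed

section \<open>Root spaces and algebraic multiplicity\<close>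

text \<open>Any solution of \<open>(L\<^sub>t - z) y = g\<close> is a particular solution plus a
  combination of two fundamental solutions. So each further power needs at most one new spanning
  function per old one, plus two. The boundary conditions are ignored here, as only an upper bound
  on the dimension is wanted.\<close>

lemma iterated_kernel_in_span:
  "\<exists>S. finite S \<and> (\<forall>s\<in>S. continuous_on {0..1} s \<and> (\<forall>x. x \<notin> {0..1} \<longrightarrow> s x = 0)) \<and>
     {y. (y, \<lambda>x. 0) \<in> shift_op (bloch_op q t) z ^^ j} \<subseteq> cfun.span S"
proof (induction j)
  case 0
  have "(\<lambda>x. 0) \<in> cfun.span {}" using cfun.span_zero[of "{}"] by (simp add: zero_fun_def)
  then show ?case by (intro exI[of _ "{}"]) auto
next
  case (Suc j)
  then obtain S where S: "finite S" "\<And>s. s \<in> S \<Longrightarrow> continuous_on {0..1} s"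
    "{y. (y, \<lambda>x. 0) \<in> shift_op (bloch_op q t) z ^^ j} \<subseteq> cfun.span S" by blast
  have "\<forall>s\<in>S. \<exists>e. \<exists>f. solves {0..1} z (\<lambda>x. 0) (\<lambda>x. - s x) e f \<and> e 0 = 0 \<and> f 0 = 0"
    using S(2) by (intro ballI inhomogeneous_exists continuous_intros)
  then obtain T where T: "\<And>s. s \<in> S \<Longrightarrow> \<exists>f. solves {0..1} z (\<lambda>x. 0) (\<lambda>x. - s x) (T s) f \<and> T s 0 = 0 \<and> f 0 = 0"
    by metis
  define S' where "S' = insert (restr (ysol z 1 0)) (insert (restr (ysol z 0 1)) ((\<lambda>s. restr (T s)) ` S))"
  \<comment> \<open>The right-hand sides that have a particular solution in the span of
    \<open>S'\<close> form a subspace, so it suffices to solve for the generators in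
    \<open>S\<close>.\<close>
  have sub: "cfun.subspace {g. \<exists>e f. solves {0..1} z (\<lambda>x. 0) (\<lambda>x. - g x) e f \<and> restr e \<in> cfun.span S'}"
  proof (rule cfun.subspaceI)
    have z: "restr (\<lambda>x. 0) = 0" by (rule ext) (simp add: restr_def)
    have "solves {0..1} z (\<lambda>x. 0) (\<lambda>x. - 0) (\<lambda>x. 0) (\<lambda>x. 0)" by (simp add: solves_def)
    then show "0 \<in> {g. \<exists>e f. solves {0..1} z (\<lambda>x. 0) (\<lambda>x. - g x) e f \<and> restr e \<in> cfun.span S'}"
      using cfun.span_zero[of S'] z by (auto intro!: exI[of _ "\<lambda>x. 0"])
  next
    fix g h
    assume "g \<in> {g. \<exists>e f. solves {0..1} z (\<lambda>x. 0) (\<lambda>x. - g x) e f \<and> restr e \<in> cfun.span S'}"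
      "h \<in> {g. \<exists>e f. solves {0..1} z (\<lambda>x. 0) (\<lambda>x. - g x) e f \<and> restr e \<in> cfun.span S'}"
    then obtain e f e' f' where s: "solves {0..1} z (\<lambda>x. 0) (\<lambda>x. - g x) e f" "restr e \<in> cfun.span S'"
      "solves {0..1} z (\<lambda>x. 0) (\<lambda>x. - h x) e' f'" "restr e' \<in> cfun.span S'" by blast
    have "solves {0..1} z (\<lambda>x. 0) (\<lambda>x. - (g + h) x) (\<lambda>x. e x + e' x) (\<lambda>x. f x + f' x)"
      using solves_lincomb[OF s(1,3), of 1 1] by (simp add: algebra_simps)
    moreover have "restr (\<lambda>x. e x + e' x) = restr e + restr e'" by (rule ext) (simp add: restr_def)
    then have "restr (\<lambda>x. e x + e' x) \<in> cfun.span S'" using cfun.span_add[OF s(2,4)] by simp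
    ultimately show "g + h \<in> {g. \<exists>e f. solves {0..1} z (\<lambda>x. 0) (\<lambda>x. - g x) e f \<and> restr e \<in> cfun.span S'}"
      by blast
  next
    fix c g
    assume "g \<in> {g. \<exists>e f. solves {0..1} z (\<lambda>x. 0) (\<lambda>x. - g x) e f \<and> restr e \<in> cfun.span S'}"
    then obtain e f where s: "solves {0..1} z (\<lambda>x. 0) (\<lambda>x. - g x) e f" "restr e \<in> cfun.span S'" by blast
    have "solves {0..1} z (\<lambda>x. 0) (\<lambda>x. - (c * g x)) (\<lambda>x. c * e x) (\<lambda>x. c * f x)"
      using solves_lincomb[OF s(1,1), of c 0] by simp
    moreover have "restr (\<lambda>x. c * e x) = (\<lambda>x. c * restr e x)" by (rule ext) (simp add: restr_def)
    then have "restr (\<lambda>x. c * e x) \<in> cfun.span S'" using cfun.span_scale[OF s(2), of c] by simp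
    ultimately show "(\<lambda>x. c * g x) \<in> {g. \<exists>e f. solves {0..1} z (\<lambda>x. 0) (\<lambda>x. - g x) e f \<and> restr e \<in> cfun.span S'}"
      by blast
  qed
  have "y \<in> cfun.span S'" if y: "(y, \<lambda>x. 0) \<in> shift_op (bloch_op q t) z ^^ Suc j" for y
  proof -
    obtain g where g: "(y, g) \<in> shift_op (bloch_op q t) z" "(g, \<lambda>x. 0) \<in> shift_op (bloch_op q t) z ^^ j"
      using relpow_Suc_D2[OF y] by blast
    have gc: "continuous_on {0..1} g"
    proof (cases j)
      case 0
      then show ?thesis using g(2) by auto
    next
      case (Suc i)
      then show ?thesis using relpow_Suc_D2[of g _ i] g(2) bloch_domain(1) by blast
    qed
    have "g \<in> cfun.span S" using g(2) S(3) by auto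
    then have "\<exists>e f. solves {0..1} z (\<lambda>x. 0) (\<lambda>x. - g x) e f \<and> restr e \<in> cfun.span S'"
    proof (rule cfun.span_induct[OF _ sub])
      fix s assume s: "s \<in> S"
      then show "\<exists>e f. solves {0..1} z (\<lambda>x. 0) (\<lambda>x. - s x) e f \<and> restr e \<in> cfun.span S'"
      proof -
        obtain f where "solves {0..1} z (\<lambda>x. 0) (\<lambda>x. - s x) (T s) f" using T[OF s] by blast
        moreover have "restr (T s) \<in> cfun.span S'" using s by (auto simp: S'_def intro!: cfun.span_base)
        ultimately show ?thesis by blast
      qed
    qed
    then obtain e f where ef: "solves {0..1} z (\<lambda>x. 0) (\<lambda>x. - g x) e f" "restr e \<in> cfun.span S'" by blast
    obtain v where v: "\<And>x. x \<notin> {0..1} \<Longrightarrow> y x = 0" "solves {0..1} z (\<lambda>x. 0) (\<lambda>x. - g x) y v"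
      using g(1) unfolding bloch_iff_solves[OF gc] by blast
    have D: "solves {0..1} z (\<lambda>x. 0) (\<lambda>x. 0) (\<lambda>x. y x - e x) (\<lambda>x. v x - f x)"
      using solves_lincomb[OF v(2) ef(1), of 1 "-1"] by simp
    define a b where "a = y 0 - e 0" and "b = v 0 - f 0"
    have "y = restr e + ((\<lambda>x. a * restr (ysol z 1 0) x) + (\<lambda>x. b * restr (ysol z 0 1) x))"
    proof (rule ext)
      fix x
      show "y x = (restr e + ((\<lambda>x. a * restr (ysol z 1 0) x) + (\<lambda>x. b * restr (ysol z 0 1) x))) x"
      proof (cases "x \<in> {0..1}")
        case True
        have "y x - e x = ysol z a b x"
          using solves_hom_eq_fsol(1)[OF D _ True] by (simp add: a_def b_def)
        then show ?thesis using True fsol_decomp(1)[of z a b x] by (simp add: algebra_simps)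
      qed (use v(1) in simp)
    qed
    moreover have "restr (ysol z 1 0) \<in> cfun.span S'" "restr (ysol z 0 1) \<in> cfun.span S'"
      by (auto simp: S'_def intro!: cfun.span_base)
    ultimately show ?thesis
      using ef(2) by (auto intro!: cfun.span_add cfun.span_scale)
  qed
  moreover have "finite S'" using S(1) by (simp add: S'_def)
  moreover have "\<forall>s\<in>S'. continuous_on {0..1} s \<and> (\<forall>x. x \<notin> {0..1} \<longrightarrow> s x = 0)"
  proof -
    have c: "continuous_on {0..1} (restr y)" if "continuous_on {0..1} y" for y
      using that by (rule continuous_on_eq) simp
    have "continuous_on {0..1} (T s)" if "s \<in> S" for s using T[OF that] solves_cont(1) by blast
    then show ?thesis using c ysol_cont by (auto simp: S'_def)
  qed
  ultimately show ?case by (intro exI[of _ S']) blast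
qed

lemma root_space_chain:
  assumes "y \<in> root_space q t z" "y \<noteq> (\<lambda>x. 0)"
  obtains k f where "f 0 = y" "\<And>i. i < k \<Longrightarrow> (f i, f (Suc i)) \<in> shift_op (bloch_op q t) z" "f k = (\<lambda>x. 0)"
    "k > 0" "f (k - 1) \<noteq> (\<lambda>x. 0)"
proof -
  obtain n where "(y, \<lambda>x. 0) \<in> shift_op (bloch_op q t) z ^^ n" using assms(1) by (auto simp: root_space_def)
  then obtain f where f: "f 0 = y" "f n = (\<lambda>x. 0)" "\<And>i. i < n \<Longrightarrow> (f i, f (Suc i)) \<in> shift_op (bloch_op q t) z"
    unfolding relpow_fun_conv by blast
  define k where "k = (LEAST k. f k = (\<lambda>x. 0))"
  have fk: "f k = (\<lambda>x. 0)" unfolding k_def by (rule LeastI[of "\<lambda>k. f k = (\<lambda>x. 0)", OF f(2)])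
  have kn: "k \<le> n" unfolding k_def by (rule Least_le[of "\<lambda>k. f k = (\<lambda>x. 0)", OF f(2)])
  have k0: "k > 0" using fk f(1) assms(2) by (cases k) auto
  have "f (k - 1) \<noteq> (\<lambda>x. 0)"
    using not_less_Least[of "k - 1" "\<lambda>k. f k = (\<lambda>x. 0)"] k0 by (simp add: k_def)
  then show ?thesis using that[of f k] f fk kn k0 by auto
qed

lemma eigenvalue_if_alg_mult:
  assumes "alg_mult q t z \<noteq> 0"
  shows "eigenvalue q t z"
proof -
  have "\<exists>y\<in>root_space q t z. y \<noteq> (\<lambda>x. 0)"
  proof (rule ccontr)
    assume "\<not> ?thesis"
    then have "root_space q t z \<subseteq> cfun.span {}" using cfun.span_zero[of "{}"] by (auto simp: zero_fun_def)
    from cfun.dim_le_card[OF this] show False using assms by (simp add: alg_mult_def)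
  qed
  then obtain y where y: "y \<in> root_space q t z" "y \<noteq> (\<lambda>x. 0)" by blast
  from root_space_chain[OF this] obtain k f where
    f: "\<And>i. i < k \<Longrightarrow> (f i, f (Suc i)) \<in> shift_op (bloch_op q t) z" "f k = (\<lambda>x. 0)" "k > 0" "f (k - 1) \<noteq> (\<lambda>x. 0)"
    by metis
  have "(f (k - 1), \<lambda>x. 0) \<in> shift_op (bloch_op q t) z" using f(1)[of "k - 1"] f(2,3) by simp
  then show ?thesis using f(4) by (auto simp: eigenvalue_def shift_op_def)
qed

lemma eigenvector_in_root_space:
  "(y, \<lambda>x. 0) \<in> shift_op (bloch_op q t) z \<Longrightarrow> y \<in> root_space q t z"
  unfolding root_space_def mem_Collect_eq by (rule exI[of _ 1]) simp

text \<open>The dimension is the cardinality of a basis, which would read 0 for an infinite one; an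
  eigenvector alone therefore does not suffice. Bounded chain length puts the root space into
  finitely many iterated kernels, each inside a finite span.\<close>

lemma alg_mult_pos:
  assumes nonconst: "\<not> F constant_on UNIV" and ev: "eigenvalue q t z"
  shows "alg_mult q t z \<noteq> 0"
proof -
  obtain n where n: "\<forall>k f. (\<forall>i<k. (f i, f (Suc i)) \<in> shift_op (bloch_op q t) z) \<longrightarrow> f k = (\<lambda>x. 0) \<longrightarrow>
    k > 0 \<longrightarrow> f (k - 1) \<noteq> (\<lambda>x. 0) \<longrightarrow> k \<le> n"
    using chain_length_bounded[OF nonconst, of t z] by (rule exE)
  obtain S where S: "\<And>j. finite (S j)" "\<And>j. {y. (y, \<lambda>x. 0) \<in> shift_op (bloch_op q t) z ^^ j} \<subseteq> cfun.span (S j)"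
  proof -
    have "\<forall>j. \<exists>S. finite S \<and> {y. (y, \<lambda>x. 0) \<in> shift_op (bloch_op q t) z ^^ j} \<subseteq> cfun.span S"
      using iterated_kernel_in_span by blast
    from choice[OF this] show ?thesis using that by blast
  qed
  have V: "root_space q t z \<subseteq> cfun.span (\<Union>j\<le>n. S j)"
  proof
    fix y assume y: "y \<in> root_space q t z"
    show "y \<in> cfun.span (\<Union>j\<le>n. S j)"
    proof (cases "y = (\<lambda>x. 0)")
      case True
      then show ?thesis using cfun.span_zero by (simp add: zero_fun_def)
    next
      case False
      obtain k f where f: "f 0 = y" "\<And>i. i < k \<Longrightarrow> (f i, f (Suc i)) \<in> shift_op (bloch_op q t) z" "f k = (\<lambda>x. 0)"
        "k > 0" "f (k - 1) \<noteq> (\<lambda>x. 0)"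
        using root_space_chain[OF y False] by metis
      have "(y, \<lambda>x. 0) \<in> shift_op (bloch_op q t) z ^^ k"
        unfolding relpow_fun_conv using f by (intro exI[of _ f]) auto
      moreover have "k \<le> n" using n f(2-5) by blast
      ultimately show ?thesis
        using S(2)[of k] cfun.span_mono[of "S k" "\<Union>j\<le>n. S j"] by auto
    qed
  qed
  obtain B where B: "B \<subseteq> root_space q t z" "cfun.independent B" "root_space q t z \<subseteq> cfun.span B" "card B = cfun.dim (root_space q t z)"
    using cfun.basis_exists by metis
  have "finite B"
    using cfun.independent_span_bound[of "\<Union>j\<le>n. S j" B] S(1) B(1,2) V by auto
  moreover have "B \<noteq> {}"
  proof
    assume "B = {}"
    obtain y where y: "y \<noteq> (\<lambda>x. 0)" "(y, \<lambda>x. 0) \<in> shift_op (bloch_op q t) z"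
      using ev by (auto simp: eigenvalue_def shift_op_def)
    have "y \<in> cfun.span B" using B(3) eigenvector_in_root_space[OF y(2)] by blast
    then have "y = 0" using \<open>B = {}\<close> cfun.span_empty by simp
    then show False using y(1) by (simp add: zero_fun_def)
  qed
  ultimately show ?thesis unfolding alg_mult_def B(4)[symmetric] by (simp add: card_eq_0_iff)
qed

lemma alg_mult_ne_1:
  assumes y: "y \<in> root_space q t z" "y \<noteq> (\<lambda>x. 0)" and y': "y' \<in> root_space q t z" "\<And>c. y' \<noteq> (\<lambda>x. c * y x)"
  shows "alg_mult q t z \<noteq> 1"
proof
  assume "alg_mult q t z = 1"
  then obtain B where B: "B \<subseteq> root_space q t z" "root_space q t z \<subseteq> cfun.span B" "card B = 1"
    using cfun.basis_exists[of "root_space q t z"] unfolding alg_mult_def by metis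
  obtain b where b: "B = {b}" using B(3) by (auto simp: card_1_singleton_iff)
  have "\<exists>c. u = (\<lambda>x. c * b x)" if "u \<in> root_space q t z" for u
    using B(2) that by (auto simp: b cfun.span_singleton)
  then obtain c c' where c: "y = (\<lambda>x. c * b x)" "y' = (\<lambda>x. c' * b x)" using y y' by meson
  have "c \<noteq> 0" using c(1) y(2) by auto
  then have "y' = (\<lambda>x. (c' / c) * y x)" unfolding c by auto
  then show False using y'(2) by blast
qed

text \<open>If the monodromy matrix is \<open>cis t\<close> times the identity, there are two
  independent eigenfunctions. Otherwise the eigenfunction has a second Jordan vector above it: the
  solvability condition for that vector is the vanishing of the derivative of the characteristic
  determinant, that is, of \<open>F\<close>.\<close>

lemma alg_mult_ne_1_if_critical:
  assumes Fz: "F z = 2 * of_real (cos t)" and F': "(F has_field_derivative 0) (at z)"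
  shows "alg_mult q t z \<noteq> 1"
proof -
  obtain e1 f1 where e1: "solves {0..1} z (\<lambda>x. 0) (\<lambda>x. - ysol z 1 0 x) e1 f1" "e1 0 = 0" "f1 0 = 0"
    "((\<lambda>w. ysol w 1 0 1) has_field_derivative e1 1) (at z)" "((\<lambda>w. vsol w 1 0 1) has_field_derivative f1 1) (at z)"
    using fsol_param_derivative_ex by blast
  obtain e2 f2 where e2: "solves {0..1} z (\<lambda>x. 0) (\<lambda>x. - ysol z 0 1 x) e2 f2" "e2 0 = 0" "f2 0 = 0"
    "((\<lambda>w. ysol w 0 1 1) has_field_derivative e2 1) (at z)" "((\<lambda>w. vsol w 0 1 1) has_field_derivative f2 1) (at z)"
    using fsol_param_derivative_ex by blast
  define A B C D where "A = m11 z - cis t" and "B = m12 z" and "C = m21 z" and "D = m22 z - cis t"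
  have det: "A * D - B * C = 0"
    using monodromy_char[of z t] Fz by (simp add: A_def B_def C_def D_def)
  obtain a b where ab: "a \<noteq> 0 \<or> b \<noteq> 0" "A * a + B * b = 0" "C * a + D * b = 0"
    using det complex_2x2_singular_iff[of A B C D] by blast
  have bloch: "ysol z a b 1 = cis t * a \<and> vsol z a b 1 = cis t * b \<longleftrightarrow> A * a + B * b = 0 \<and> C * a + D * b = 0" for a b
    unfolding fsol_decomp[of z a b 1] by (auto simp: A_def B_def C_def D_def algebra_simps)
  have root: "restr (ysol z a b) \<in> root_space q t z" if "A * a + B * b = 0" "C * a + D * b = 0" for a b
  proof (rule eigenvector_in_root_space)
    have "ysol z a b 1 = cis t * a" "vsol z a b 1 = cis t * b" using bloch[of a b] that by auto
    then show "(restr (ysol z a b), \<lambda>x. 0) \<in> shift_op (bloch_op q t) z"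
      unfolding bloch_iff_solves[OF continuous_on_const]
      using solves_fsol'[of "{0..1}" z a b] by (auto intro!: exI[of _ "vsol z a b"])
  qed
  have zero: "a = 0 \<and> b = 0" if "restr (ysol z a b) = (\<lambda>x. 0)" for a b
  proof -
    have y: "ysol z a b x = 0" if "x \<in> {0..1}" for x
      using fun_cong[OF \<open>restr (ysol z a b) = (\<lambda>x. 0)\<close>, of x] that by simp
    have "solves {0..1} z (\<lambda>x. 0) (\<lambda>x. 0) (\<lambda>x. 0) (\<lambda>x. 0)" by (simp add: solves_def)
    from solves_v_unique[OF solves_fsol' this, of z a b 0] y have "vsol z a b 0 = 0" by simp
    then show ?thesis using y[of 0] by simp
  qed
  show ?thesis
  proof (cases "A = 0 \<and> B = 0 \<and> C = 0 \<and> D = 0")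
    case True
    show ?thesis
    proof (rule alg_mult_ne_1[of "restr (ysol z 1 0)" _ _ "restr (ysol z 0 1)"])
      show "restr (ysol z 1 0) \<in> root_space q t z" "restr (ysol z 0 1) \<in> root_space q t z"
        using root True by auto
      show "restr (ysol z 1 0) \<noteq> (\<lambda>x. 0)" using zero[of 1 0] by auto
      show "restr (ysol z 0 1) \<noteq> (\<lambda>x. c * restr (ysol z 1 0) x)" for c
      proof
        assume e: "restr (ysol z 0 1) = (\<lambda>x. c * restr (ysol z 1 0) x)"
        have "c = 0" using fun_cong[OF e, of 0] by simp
        then show False using e zero[of 0 1] by simp
      qed
    qed
  next
    case False
    \<comment> \<open>The variational solution with coefficients \<open>a\<close> and
      \<open>b\<close> starts at zero, so it violates the boundary condition by its values at 1. A
      homogeneous solution with data \<open>(a', b')\<close> has to compensate for this.\<close>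
    define p r where "p = - (a * e1 1 + b * e2 1)" and "r = - (a * f1 1 + b * f2 1)"
    have "((\<lambda>w. m11 w * m22 w - m12 w * m21 w) has_field_derivative (e1 1 * m22 z + m11 z * f2 1) - (e2 1 * m21 z + m12 z * f1 1)) (at z)"
      by (rule derivative_eq_intros e1(4,5) e2(4,5) refl | simp)+
    then have "((\<lambda>w. 1) has_field_derivative (e1 1 * m22 z + m11 z * f2 1) - (e2 1 * m21 z + m12 z * f1 1)) (at z)"
      unfolding monodromy_det .
    then have d1: "(e1 1 * m22 z + m11 z * f2 1) - (e2 1 * m21 z + m12 z * f1 1) = 0"
      using DERIV_unique DERIV_const by blast
    have d2: "e1 1 + f2 1 = 0"
      using DERIV_unique[OF F'] DERIV_add[OF e1(4) e2(5)] unfolding F_def[abs_def] by metis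
    \<comment> \<open>The derivative of \<open>A * D - B * C\<close>: that of the constant monodromy
      determinant minus \<open>cis t\<close> times that of \<open>F\<close>.\<close>
    have d3: "e1 1 * D + A * f2 1 - e2 1 * C - B * f1 1 = 0"
    proof -
      have "e1 1 * D + A * f2 1 - e2 1 * C - B * f1 1 = (e1 1 * m22 z + m11 z * f2 1) - (e2 1 * m21 z + m12 z * f1 1) - cis t * (e1 1 + f2 1)"
        by (simp add: A_def B_def C_def D_def algebra_simps)
      then show ?thesis using d1 d2 by simp
    qed
    have "D * p - B * r = - (e1 1 * D + A * f2 1 - e2 1 * C - B * f1 1) * a + f2 1 * (A * a + B * b) - e2 1 * (C * a + D * b)"
      by (simp add: p_def r_def algebra_simps)
    then have 1: "D * p - B * r = 0" using ab d3 by simp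
    have "A * r - C * p = - (e1 1 * D + A * f2 1 - e2 1 * C - B * f1 1) * b - f1 1 * (A * a + B * b) + e1 1 * (C * a + D * b)"
      by (simp add: p_def r_def algebra_simps)
    then have 2: "A * r - C * p = 0" using ab d3 by simp
    obtain a' b' where ab': "A * a' + B * b' = p" "C * a' + D * b' = r"
      using complex_2x2_range[OF _ det 1 2] False by blast
    define y where "y x = ysol z a' b' x + (a * e1 x + b * e2 x)" for x
    define v where "v x = vsol z a' b' x + (a * f1 x + b * f2 x)" for x
    have "solves {0..1} z (\<lambda>x. 0) (\<lambda>x. - ysol z a b x) (\<lambda>x. a * e1 x + b * e2 x) (\<lambda>x. a * f1 x + b * f2 x)"
      using solves_lincomb[OF e1(1) e2(1), of a b] by (simp add: fsol_decomp(1)[of z a b])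
    from solves_lincomb[OF solves_fsol'[of _ z a' b'] this, of 1 1]
    have S: "solves {0..1} z (\<lambda>x. 0) (\<lambda>x. - ysol z a b x) y v" by (simp add: y_def[abs_def] v_def[abs_def])
    have "(restr y, restr (ysol z a b)) \<in> shift_op (bloch_op q t) z"
    proof -
      have c: "continuous_on {0..1} (restr (ysol z a b))"
        using ysol_cont[of "{0..1}" z a b] by (rule continuous_on_eq) simp
      have "solves {0..1} z (\<lambda>x. 0) (\<lambda>x. - restr (ysol z a b) x) y v \<longleftrightarrow> solves {0..1} z (\<lambda>x. 0) (\<lambda>x. - ysol z a b x) y v"
        by (rule solves_cong) auto
      moreover have "y 1 = cis t * y 0" "v 1 = cis t * v 0"
        using ab' e1(2,3) e2(2,3) unfolding y_def v_def fsol_decomp[of z a' b' 1]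
        by (auto simp: p_def r_def A_def B_def C_def D_def algebra_simps)
      ultimately show ?thesis
        unfolding bloch_iff_solves[OF c] using S by (auto intro!: exI[of _ v])
    qed
    moreover have "(restr (ysol z a b), \<lambda>x. 0) \<in> shift_op (bloch_op q t) z"
      unfolding bloch_iff_solves[OF continuous_on_const]
      using solves_fsol'[of "{0..1}" z a b] bloch[of a b] ab by (auto intro!: exI[of _ "vsol z a b"])
    ultimately have "(restr y, \<lambda>x. 0) \<in> shift_op (bloch_op q t) z ^^ Suc 1"
      by (metis relpow_1 relpow_Suc_I2)
    then have yr: "restr y \<in> root_space q t z" unfolding root_space_def by blast
    show ?thesis
    proof (rule alg_mult_ne_1[OF root[OF ab(2,3)] _ yr])
      show "restr (ysol z a b) \<noteq> (\<lambda>x. 0)" using zero[of a b] ab(1) by auto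
      \<comment> \<open>A multiple of the eigenfunction would solve the homogeneous equation, while
        \<open>y\<close> solves it with the eigenfunction as right-hand side; comparing the two
        forms of \<open>v'\<close> would make the eigenfunction zero.\<close>
      show "restr y \<noteq> (\<lambda>x. c * restr (ysol z a b) x)" for c
      proof
        assume e: "restr y = (\<lambda>x. c * restr (ysol z a b) x)"
        have yc: "y x = c * ysol z a b x" if "x \<in> {0..1}" for x using fun_cong[OF e, of x] that by simp
        have S': "solves {0..1} z (\<lambda>x. 0) (\<lambda>x. 0) (\<lambda>x. c * ysol z a b x) (\<lambda>x. c * vsol z a b x)"
          using solves_lincomb[OF solves_fsol'[of "{0..1}" z a b] solves_fsol'[of "{0..1}" z a b], of c 0] by simp
        have vc: "v x = c * vsol z a b x" if "x \<in> {0..1}" for x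
          by (rule solves_v_unique[OF S S' yc that])
        have "ysol z a b x = 0" if x: "x \<in> {0..1}" for x
        proof -
          have "(v has_vector_derivative - (z + (Q x)\<^sup>2) * (c * ysol z a b x) - Q x * (c * vsol z a b x) + 0) (at x within {0..1})"
            by (rule has_vector_derivative_transform[OF x vc solvesD(2)[OF S' x]])
          then have "- (z + (Q x)\<^sup>2) * (c * ysol z a b x) - Q x * (c * vsol z a b x) + 0 = - (z + (Q x)\<^sup>2) * y x - Q x * v x + - ysol z a b x"
            by (rule vector_derivative_unique_within_closed_interval[of 0 1, unfolded box_real, OF zero_less_one x _ solvesD(2)[OF S x]])
          then show ?thesis using yc[OF x] vc[OF x] by simp
        qed
        then have "restr (ysol z a b) = (\<lambda>x. 0)" by (auto simp: restr_def)
        then show False using zero[of a b] ab(1) by auto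
      qed
    qed
  qed
qed

end

section \<open>Square-integrable functions on the line\<close>

lemma integrable_on_UNIV_if_bounded:
  fixes h :: "real \<Rightarrow> real"
  assumes i: "\<And>n::nat. h integrable_on {- real n..real n}" and h: "\<And>x. 0 \<le> h x"
    and B: "\<And>n::nat. integral {- real n..real n} h \<le> B"
  shows "h integrable_on UNIV" "integral UNIV h \<le> B"
proof -
  define f where "f n x = (if x \<in> {- real n..real n} then h x else 0)" for n x
  have int: "integral UNIV (f n) = integral {- real n..real n} h" for n
    unfolding f_def by (rule Henstock_Kurzweil_Integration.integral_restrict_UNIV)
  have *: "h integrable_on UNIV \<and> (\<lambda>n. integral UNIV (f n)) \<longlonglongrightarrow> integral UNIV h"
  proof (rule monotone_convergence_increasing)
    show "f n integrable_on UNIV" for n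
      unfolding f_def integrable_restrict_UNIV by (rule i)
    show "f n x \<le> f (Suc n) x" for n x using h[of x] by (auto simp: f_def)
    show "(\<lambda>n. f n x) \<longlonglongrightarrow> h x" for x
    proof (rule tendsto_eventually)
      obtain m where m: "\<bar>x\<bar> \<le> real m" using real_arch_simple by blast
      show "\<forall>\<^sub>F n in sequentially. f n x = h x"
        using eventually_ge_at_top[of m]
      proof eventually_elim
        case (elim n)
        then have "\<bar>x\<bar> \<le> real n" using m by linarith
        then show ?case by (auto simp: f_def)
      qed
    qed
    have "0 \<le> integral {- real n..real n} h" for n by (intro integral_nonneg i) (use h in auto)
    then show "bounded (range (\<lambda>n. integral UNIV (f n)))"
      unfolding int using B by (intro boundedI[of _ B]) auto
  qed
  then show "h integrable_on UNIV" by blast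
  show "integral UNIV h \<le> B"
    by (rule LIMSEQ_le_const2[OF conjunct2[OF *]]) (use B int in auto)
qed

lemma integral_Icc_le_integral_UNIV:
  fixes h :: "real \<Rightarrow> real"
  assumes "h integrable_on UNIV" "\<And>x. 0 \<le> h x"
  shows "h integrable_on {a..b}" "integral {a..b} h \<le> integral UNIV h"
proof -
  show "h integrable_on {a..b}"
    using assms(1) integrable_on_subcbox[of h UNIV a b] by simp
  then show "integral {a..b} h \<le> integral UNIV h"
    using assms by (intro integral_subset_le) auto
qed

lemma L2_on_UNIV_iff:
  "L2_on UNIV f \<longleftrightarrow> f \<in> borel_measurable lebesgue \<and> (\<lambda>x. (cmod (f x))\<^sup>2) integrable_on UNIV"
proof -
  have "integrable lebesgue (\<lambda>x. (cmod (f x))\<^sup>2) \<longleftrightarrow> (\<lambda>x. (cmod (f x))\<^sup>2) absolutely_integrable_on UNIV"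
    by (simp add: set_integrable_def)
  also have "\<dots> \<longleftrightarrow> (\<lambda>x. (cmod (f x))\<^sup>2) integrable_on UNIV"
    by (meson nonnegative_absolutely_integrable_1 set_lebesgue_integral_eq_integral(1) zero_le_power2)
  finally show ?thesis by (simp add: L2_on_def lebesgue_on_UNIV_eq)
qed

lemma L2_norm_eq:
  assumes "L2_on UNIV f"
  shows "L2_norm f = sqrt (integral UNIV (\<lambda>x. (cmod (f x))\<^sup>2))"
  using assms integral_lebesgue[of "\<lambda>x. (cmod (f x))\<^sup>2"] by (simp add: L2_on_def lebesgue_on_UNIV_eq L2_norm_def)

lemma L2_norm_power2:
  assumes "L2_on UNIV f"
  shows "(L2_norm f)\<^sup>2 = integral UNIV (\<lambda>x. (cmod (f x))\<^sup>2)" "0 \<le> L2_norm f"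
proof -
  have "0 \<le> integral UNIV (\<lambda>x. (cmod (f x))\<^sup>2)"
    using assms by (intro Henstock_Kurzweil_Integration.integral_nonneg) (auto simp: L2_on_UNIV_iff)
  then show "(L2_norm f)\<^sup>2 = integral UNIV (\<lambda>x. (cmod (f x))\<^sup>2)" "0 \<le> L2_norm f"
    unfolding L2_norm_eq[OF assms] by simp_all
qed

lemma continuous_imp_lebesgue_measurable:
  "continuous_on UNIV (f :: real \<Rightarrow> complex) \<Longrightarrow> f \<in> borel_measurable lebesgue"
  by (simp add: measurable_completion borel_measurable_continuous_onI)

lemma L2_on_imp_locally_integrable:
  assumes f: "L2_on UNIV f"
  shows "f absolutely_integrable_on {a..b}"
proof (rule measurable_bounded_by_integrable_imp_absolutely_integrable)
  show "f \<in> borel_measurable (lebesgue_on {a..b})"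
    using f by (simp add: L2_on_UNIV_iff measurable_restrict_space1)
  show "(\<lambda>x. 1 + (cmod (f x))\<^sup>2) integrable_on {a..b}"
    using f integral_Icc_le_integral_UNIV(1)[of "\<lambda>x. (cmod (f x))\<^sup>2" a b]
    by (intro integrable_add) (auto simp: L2_on_UNIV_iff)
  show "norm (f x) \<le> 1 + (cmod (f x))\<^sup>2" for x
  proof -
    have "2 * cmod (f x) \<le> 1 + (cmod (f x))\<^sup>2" using sum_squares_bound[of 1 "cmod (f x)"] by simp
    then show ?thesis using norm_ge_zero[of "f x"] by linarith
  qed
qed auto

text \<open>Cauchy-Schwarz on an interval of length one: the integral of
  \<open>(h - c)\<^sup>2\<close> with \<open>c\<close> the mean of \<open>h\<close> is
  nonnegative.\<close>

lemma integral_power2_le_unit_interval: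
  fixes h :: "real \<Rightarrow> real"
  assumes i: "h integrable_on {a..a + 1}" "(\<lambda>x. (h x)\<^sup>2) integrable_on {a..a + 1}"
  shows "(integral {a..a + 1} h)\<^sup>2 \<le> integral {a..a + 1} (\<lambda>x. (h x)\<^sup>2)"
proof -
  define c where "c = integral {a..a + 1} h"
  have "0 \<le> integral {a..a + 1} (\<lambda>x. (h x)\<^sup>2 - 2 * c * h x + c\<^sup>2)"
  proof (rule integral_nonneg)
    show "(\<lambda>x. (h x)\<^sup>2 - 2 * c * h x + c\<^sup>2) integrable_on {a..a + 1}"
      by (intro integrable_add integrable_diff i integrable_on_mult_right) auto
    show "0 \<le> (h x)\<^sup>2 - 2 * c * h x + c\<^sup>2" for x
      using zero_le_power2[of "h x - c"] by (simp add: power2_diff algebra_simps)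
  qed
  also have "\<dots> = integral {a..a + 1} (\<lambda>x. (h x)\<^sup>2) - 2 * c * c + c\<^sup>2"
  proof -
    have "((\<lambda>x. (h x)\<^sup>2 - 2 * c * h x + c\<^sup>2) has_integral
       integral {a..a + 1} (\<lambda>x. (h x)\<^sup>2) - 2 * c * c + c\<^sup>2) {a..a + 1}"
      using has_integral_const_real[of "c\<^sup>2" a "a + 1"] integrable_integral[OF i(1)]
      by (intro has_integral_add has_integral_diff integrable_integral[OF i(2)] has_integral_mult_right) (auto simp: c_def)
    then show ?thesis by (rule integral_unique)
  qed
  finally show ?thesis by (simp add: c_def power2_eq_square)
qed

lemma sum_integral_cells:
  fixes h :: "real \<Rightarrow> real"
  assumes i: "\<And>a b. h integrable_on {a..b}"
  shows "(\<Sum>k\<in>{- int n..int n}. integral {of_int k..of_int k + 1} h) = integral {- real n..real n + 1} h"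
proof (induction n)
  case (Suc n)
  have "{- int (Suc n)..int (Suc n)} = insert (- int (Suc n)) (insert (int (Suc n)) {- int n..int n})" by auto
  then have "(\<Sum>k\<in>{- int (Suc n)..int (Suc n)}. integral {of_int k..of_int k + 1} h) =
      integral {- real (Suc n)..- real n} h + (integral {real n + 1..real n + 2} h + integral {- real n..real n + 1} h)"
    using Suc by (simp add: add.commute)
  also have "\<dots> = integral {- real (Suc n)..real n + 2} h"
    using Henstock_Kurzweil_Integration.integral_combine[OF _ _ i, of "- real n" "real n + 1" "real n + 2"]
      Henstock_Kurzweil_Integration.integral_combine[OF _ _ i, of "- real (Suc n)" "- real n" "real n + 2"] by simp
  finally show ?case by (simp add: algebra_simps)
qed simp

section \<open>Square-summable solutions of a scalar recursion\<close>

text \<open>The solution is the convergent sum of \<open>\<rho> ^ i * b (k - 1 - i)\<close> over the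
  past. Sums over symmetric windows stand for the two-sided norm, and \<open>K\<close> depends on
  \<rho> only.\<close>

lemma contraction_recursion:
  fixes \<rho> :: complex
  assumes \<rho>: "cmod \<rho> < 1"
  shows "\<exists>K\<ge>0. \<forall>b B. (\<forall>n. (\<Sum>k\<in>{- int n..int n}. (cmod (b k))\<^sup>2) \<le> B) \<longrightarrow>
    (\<exists>p. (\<forall>k. p (k + 1) = \<rho> * p k + b k) \<and> (\<forall>n. (\<Sum>k\<in>{- int n..int n}. (cmod (p k))\<^sup>2) \<le> K * B))"
proof -
  define r where "r = cmod \<rho>"
  have r: "0 \<le> r" "r < 1" using \<rho> by (auto simp: r_def)
  define K where "K = (r / (1 - r)\<^sup>2 + 1 / (1 - r)) / (1 - r)"
  have K: "K \<ge> 0" using r by (auto simp: K_def)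
  have main: "\<exists>p. (\<forall>k. p (k + 1) = \<rho> * p k + b k) \<and> (\<forall>n. (\<Sum>k\<in>{- int n..int n}. (cmod (p k))\<^sup>2) \<le> K * B)"
    if bB: "\<And>n. (\<Sum>k\<in>{- int n..int n}. (cmod (b k))\<^sup>2) \<le> B" for b :: "int \<Rightarrow> complex" and B
  proof -
    have bk: "(cmod (b k))\<^sup>2 \<le> B" for k
    proof -
      have "(cmod (b k))\<^sup>2 \<le> (\<Sum>k\<in>{- int (nat \<bar>k\<bar>)..int (nat \<bar>k\<bar>)}. (cmod (b k))\<^sup>2)"
        by (rule member_le_sum) auto
      then show ?thesis using bB[of "nat \<bar>k\<bar>"] by linarith
    qed
    then have B0: "B \<ge> 0" by (meson order_trans zero_le_power2)
    have bk': "cmod (b k) \<le> sqrt B" for k using bk[of k] by (simp add: real_le_rsqrt)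
    define p where "p k = (\<Sum>i. \<rho> ^ i * b (k - 1 - int i))" for k
    have geo: "(\<lambda>i. r ^ i * sqrt B) sums (1 / (1 - r) * sqrt B)"
      using r by (intro sums_mult2 geometric_sums) auto
    have nb: "cmod (\<rho> ^ i * b (k - 1 - int i)) \<le> r ^ i * sqrt B" for i k
      unfolding norm_mult norm_power r_def[symmetric] using bk' r by (intro mult_left_mono) auto
    have sm: "summable (\<lambda>i. cmod (\<rho> ^ i * b (k - 1 - int i)))" for k
      by (rule summable_comparison_test'[OF sums_summable[OF geo], of 0]) (use nb in auto)
    have pb: "cmod (p k) \<le> sqrt B / (1 - r)" for k
    proof -
      have "cmod (p k) \<le> (\<Sum>i. cmod (\<rho> ^ i * b (k - 1 - int i)))"
        unfolding p_def by (rule summable_norm[OF sm])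
      also have "\<dots> \<le> (\<Sum>i. r ^ i * sqrt B)"
        by (rule suminf_le[OF nb sm sums_summable[OF geo]])
      also have "\<dots> = sqrt B / (1 - r)" using sums_unique[OF geo] by simp
      finally show ?thesis .
    qed
    have pb2: "(cmod (p k))\<^sup>2 \<le> B / (1 - r)\<^sup>2" for k
    proof -
      have "(cmod (p k))\<^sup>2 \<le> (sqrt B / (1 - r))\<^sup>2" using pb by (intro power_mono) auto
      then show ?thesis using B0 by (simp add: power_divide)
    qed
    have rec: "p (k + 1) = \<rho> * p k + b k" for k
    proof -
      have s: "summable (\<lambda>i. \<rho> ^ i * b (k - 1 - int i))" by (rule summable_norm_cancel[OF sm])
      have s': "summable (\<lambda>i. \<rho> ^ i * b (k + 1 - 1 - int i))" by (rule summable_norm_cancel[OF sm])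
      have "(\<Sum>i. \<rho> ^ Suc i * b (k + 1 - 1 - int (Suc i))) = p (k + 1) - b k"
        using suminf_split_head[OF s'] by (simp add: p_def)
      moreover have "(\<Sum>i. \<rho> ^ Suc i * b (k + 1 - 1 - int (Suc i))) = \<rho> * p k"
        unfolding p_def suminf_mult[OF s, symmetric] by (intro suminf_cong) (simp add: algebra_simps)
      ultimately show ?thesis by (metis diff_add_cancel)
    qed
    \<comment> \<open>Convexity of the square: \<open>r * x + (1 - r) * c\<close> is a convex
      combination once \<open>cmod (b k)\<close> is written as \<open>(1 - r) * c\<close>.\<close>
    have conv: "(cmod (p (k + 1)))\<^sup>2 \<le> r * (cmod (p k))\<^sup>2 + (cmod (b k))\<^sup>2 / (1 - r)" for k
    proof -
      define x c where "x = cmod (p k)" and "c = cmod (b k) / (1 - r)"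
      have cb: "cmod (b k) = (1 - r) * c" using r by (simp add: c_def)
      have "cmod (p (k + 1)) \<le> r * x + (1 - r) * c"
        unfolding rec x_def r_def cb[unfolded r_def, symmetric] using norm_triangle_ineq[of "\<rho> * p k" "b k"] by (simp add: norm_mult)
      then have "(cmod (p (k + 1)))\<^sup>2 \<le> (r * x + (1 - r) * c)\<^sup>2" by (intro power_mono) auto
      also have "\<dots> = r * x\<^sup>2 + (1 - r) * c\<^sup>2 - r * (1 - r) * (x - c)\<^sup>2"
        by (simp add: power2_eq_square algebra_simps)
      also have "\<dots> \<le> r * x\<^sup>2 + (1 - r) * c\<^sup>2" using r by simp
      also have "(1 - r) * c\<^sup>2 = (cmod (b k))\<^sup>2 / (1 - r)" using r by (simp add: c_def power2_eq_square)
      finally show ?thesis by (simp add: x_def)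
    qed
    have "(\<Sum>k\<in>{- int n..int n}. (cmod (p k))\<^sup>2) \<le> K * B" for n
    proof -
      define S where "S = (\<Sum>k\<in>{- int n..int n}. (cmod (p k))\<^sup>2)"
      \<comment> \<open>The recursion shifts the window by one. The new index \<open>- n - 1\<close>
        costs only the pointwise bound \<open>B / (1 - r)\<^sup>2\<close>, and the term
        \<open>r * S\<close> is absorbed on the left; solving for \<open>S\<close> gives
        \<open>K\<close>.\<close>
      have "S = (\<Sum>k\<in>{- int n - 1..int n - 1}. (cmod (p (k + 1)))\<^sup>2)"
        unfolding S_def by (rule sum.reindex_bij_witness[of _ "\<lambda>k. k + 1" "\<lambda>k. k - 1"]) auto
      also have "\<dots> \<le> (\<Sum>k\<in>{- int n - 1..int n - 1}. r * (cmod (p k))\<^sup>2 + (cmod (b k))\<^sup>2 / (1 - r))"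
        by (intro sum_mono conv)
      also have "\<dots> = r * (\<Sum>k\<in>{- int n - 1..int n - 1}. (cmod (p k))\<^sup>2) + (\<Sum>k\<in>{- int n - 1..int n - 1}. (cmod (b k))\<^sup>2) / (1 - r)"
        by (simp add: sum.distrib sum_distrib_left sum_divide_distrib)
      also have "\<dots> \<le> r * (S + B / (1 - r)\<^sup>2) + B / (1 - r)"
      proof (intro add_mono mult_left_mono divide_right_mono)
        have "(\<Sum>k\<in>{- int n - 1..int n - 1}. (cmod (p k))\<^sup>2) \<le> (\<Sum>k\<in>insert (- int n - 1) {- int n..int n}. (cmod (p k))\<^sup>2)"
          by (rule sum_mono2) auto
        also have "\<dots> = S + (cmod (p (- int n - 1)))\<^sup>2" by (simp add: S_def)
        finally show "(\<Sum>k\<in>{- int n - 1..int n - 1}. (cmod (p k))\<^sup>2) \<le> S + B / (1 - r)\<^sup>2"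
          using pb2[of "- int n - 1"] by linarith
        have "(\<Sum>k\<in>{- int n - 1..int n - 1}. (cmod (b k))\<^sup>2) \<le> (\<Sum>k\<in>{- int (Suc n)..int (Suc n)}. (cmod (b k))\<^sup>2)"
          by (rule sum_mono2) auto
        then show "(\<Sum>k\<in>{- int n - 1..int n - 1}. (cmod (b k))\<^sup>2) \<le> B" using bB[of "Suc n"] by linarith
      qed (use r in auto)
      finally have "(1 - r) * S \<le> (r / (1 - r)\<^sup>2 + 1 / (1 - r)) * B" by (simp add: algebra_simps)
      then have "S \<le> (r / (1 - r)\<^sup>2 + 1 / (1 - r)) * B / (1 - r)" using r by (simp add: pos_le_divide_eq mult.commute)
      then show ?thesis by (simp add: S_def K_def)
    qed
    then show ?thesis using rec by blast
  qed
  show ?thesis using K main by blast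
qed

lemma sl_equation_UNIV_iff:
  "sl_equation q UNIV y y1 f \<longleftrightarrow> (\<forall>n::nat. sl_equation q {- real n..real n} y y1 f)"
proof
  assume U: "sl_equation q UNIV y y1 f"
  show "\<forall>n::nat. sl_equation q {- real n..real n} y y1 f"
    using U unfolding sl_equation_def by (auto intro: has_vector_derivative_at_within)
next
  assume A: "\<forall>n::nat. sl_equation q {- real n..real n} y y1 f"
  show "sl_equation q UNIV y y1 f"
    unfolding sl_equation_def
  proof (intro conjI ballI allI impI)
    fix x :: real
    obtain n where n: "\<bar>x\<bar> < real n" using reals_Archimedean2 by blast
    then have "at x within {- real n..real n} = at x" by (intro at_within_Icc_at) auto
    moreover have "(y has_vector_derivative y1 x) (at x within {- real n..real n})"
      using A n unfolding sl_equation_def by (meson abs_le_iff atLeastAtMost_iff less_imp_le minus_le_iff)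
    ultimately show "(y has_vector_derivative y1 x) (at x within UNIV)" by simp
  next
    fix a b :: real assume ab: "a \<le> b"
    obtain n where n: "max \<bar>a\<bar> \<bar>b\<bar> \<le> real n" using real_arch_simple by blast
    then have "{a..b} \<subseteq> {- real n..real n}" by auto
    then show "(\<lambda>x. q x * y x - f x) absolutely_integrable_on {a..b}"
      "y1 b - y1 a = integral {a..b} (\<lambda>x. q x * y x - f x)"
      using A ab unfolding sl_equation_def by blast+
  qed
qed

context hill begin

subsection \<open>The spectrum of \<open>L\<close>\<close>

lemma Floquet_bounded:
  assumes a: "ysol z a b 1 = cis t * a" "vsol z a b 1 = cis t * b"
  obtains B where "B > 0" "\<And>x. cmod (ysol z a b x) \<le> B" "\<And>x. cmod (vsol z a b x) \<le> B"
proof -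
  have step: "ysol z a b (x + 1) = cis t * ysol z a b x" "vsol z a b (x + 1) = cis t * vsol z a b x" for x
  proof -
    have "ysol z a b (x + of_int 1) = ysol z (cis t * a) (cis t * b) x" "vsol z a b (x + of_int 1) = vsol z (cis t * a) (cis t * b) x"
      unfolding fsol_shift using a by simp_all
    moreover have "ysol z (cis t * a) (cis t * b) x = cis t * ysol z a b x" "vsol z (cis t * a) (cis t * b) x = cis t * vsol z a b x"
      unfolding fsol_decomp[of z a b x] fsol_decomp[of z "cis t * a" "cis t * b" x] by (simp_all add: algebra_simps)
    ultimately show "ysol z a b (x + 1) = cis t * ysol z a b x" "vsol z a b (x + 1) = cis t * vsol z a b x" by simp_all
  qed
  have per: "cmod (f (x + of_int k)) = cmod (f x)" if "\<And>x. f (x + 1) = cis t * f x" for f :: "real \<Rightarrow> complex" and x k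
  proof (induction k arbitrary: x rule: int_induct[of _ 0])
    case (step1 i)
    then show ?case using that[of "x + of_int i"] by (simp add: algebra_simps norm_mult)
  next
    case (step2 i)
    have "cmod (f (x + of_int (i - 1) + 1)) = cmod (f (x + of_int (i - 1)))"
      unfolding that by (simp add: norm_mult)
    then show ?case using step2 by (simp add: algebra_simps)
  qed simp
  define B where "B = exp (kap z) * (cmod a + cmod b) + 1"
  have fr: "frac x \<in> {0..1}" "frac x + of_int \<lfloor>x\<rfloor> = x" for x :: real
    using frac_ge_0[of x] frac_lt_1[of x] by (auto simp: frac_def)
  show ?thesis
  proof (rule that[of B])
    show "B > 0" by (simp add: B_def add_nonneg_pos)
    show "cmod (ysol z a b x) \<le> B" for x
      using per[of "ysol z a b", OF step(1), of "frac x" "\<lfloor>x\<rfloor>"] fsol_bound(1)[OF fr(1), of z a b x] unfolding fr(2) B_def by linarith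
    show "cmod (vsol z a b x) \<le> B" for x
      using per[of "vsol z a b", OF step(2), of "frac x" "\<lfloor>x\<rfloor>"] fsol_bound(2)[OF fr(1), of z a b x] unfolding fr(2) B_def by linarith
  qed
qed

lemma ysol_eq_0_imp:
  assumes "\<And>x. x \<in> {0..1} \<Longrightarrow> ysol z a b x = 0"
  shows "a = 0 \<and> b = 0"
proof -
  have "solves {0..1} z (\<lambda>x. 0) (\<lambda>x. 0) (\<lambda>x. 0) (\<lambda>x. 0)" by (simp add: solves_def)
  from solves_v_unique[OF solves_fsol' this, of z a b 0] assms have "vsol z a b 0 = 0" by simp
  then show ?thesis using assms[of 0] by simp
qed

text \<open>A bounded Floquet solution times the slowly varying cut-off \<open>c(x) = 1 / (1 + (e x)^2)\<close>
  is an approximate eigenfunction; the choice of \<open>c\<close> makes \<open>c'\<close> and \<open>c''\<close> of order \<open>e c\<close>.\<close>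

lemma in_spectrum_if_Floquet:
  assumes Fz: "F z = 2 * of_real (cos t)"
  shows "z \<in> hill_spectrum q"
proof (rule ccontr)
  assume "z \<notin> hill_spectrum q"
  then have "z \<in> hill_resolvent_set q" by (simp add: hill_spectrum_def)
  then obtain C where "\<forall>f. L2_on UNIV f \<longrightarrow> (\<exists>!y. (y, f) \<in> shift_op (hill_op q) z) \<and>
     (\<forall>y. (y, f) \<in> shift_op (hill_op q) z \<longrightarrow> L2_norm y \<le> C * L2_norm f)"
    unfolding hill_resolvent_set_def by blast
  then have C: "L2_norm y \<le> C * L2_norm f" if "L2_on UNIV f" "(y, f) \<in> shift_op (hill_op q) z" for f y
    using that by blast
  obtain a b where ab: "a \<noteq> 0 \<or> b \<noteq> 0" "ysol z a b 1 = cis t * a" "vsol z a b 1 = cis t * b"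
    using Fz Floquet_vector_iff by blast
  define y where "y = ysol z a b"
  define v where "v = vsol z a b"
  obtain B where B: "B > 0" "\<And>x. cmod (y x) \<le> B" "\<And>x. cmod (v x) \<le> B"
    using Floquet_bounded[OF ab(2,3)] unfolding y_def v_def by metis
  have yv: "solves UNIV z (\<lambda>x. 0) (\<lambda>x. 0) y v" unfolding y_def v_def by (rule solves_fsol)
  have yc: "continuous_on S y" "continuous_on S v" for S
    using solves_cont[OF solves_subset[OF yv, of S]] by auto
  define B1 where "B1 = (Qmax + 1) * B"
  have B1: "B1 > 0" using B(1) Qmax_pos by (simp add: B1_def)
  define y1 where "y1 x = Q x * y x + v x" for x
  have b1: "cmod (y1 x) \<le> B1" "cmod (y x) \<le> B1" for x
  proof -
    have "cmod (y1 x) \<le> cmod (Q x) * cmod (y x) + cmod (v x)" unfolding y1_def by (metis norm_mult norm_triangle_ineq)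
    also have "\<dots> \<le> Qmax * B + B" using B Q_le_Qmax Qmax_pos by (intro add_mono mult_mono) (auto intro: less_imp_le)
    finally show "cmod (y1 x) \<le> B1" by (simp add: B1_def algebra_simps)
    have "B \<le> B1" using B(1) Qmax_pos by (simp add: B1_def algebra_simps)
    then show "cmod (y x) \<le> B1" using B(2)[of x] by linarith
  qed
  define m where "m = integral {0..1} (\<lambda>x. (cmod (y x))\<^sup>2)"
  have m: "m > 0"
  proof -
    have c: "continuous_on {0..1} (\<lambda>x. (cmod (y x))\<^sup>2)" by (intro continuous_intros yc)
    have "m \<noteq> 0"
    proof
      assume "m = 0"
      then have "\<forall>x\<in>{0..1}. (cmod (y x))\<^sup>2 = 0"
        using integral_eq_0_iff[OF c] by (auto simp: m_def)
      then show False using ysol_eq_0_imp[of z a b] ab(1) by (auto simp: y_def)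
    qed
    moreover have "m \<ge> 0" unfolding m_def by (intro integral_nonneg integrable_continuous_interval c) auto
    ultimately show ?thesis by simp
  qed
  \<comment> \<open>On \<open>[0, 1]\<close> the cut-off is at least \<open>1 / 2\<close>, so the
    square norm of the approximate eigenfunction stays above \<open>m / 4\<close>, while that of its
    image is of order \<open>e\<close>. The factor 144 is \<open>(10 + 2)\<^sup>2\<close>, from the
    bounds of \<open>cut2\<close> and of \<open>2 * cut1\<close>.\<close>
  have key: "m / 4 \<le> C\<^sup>2 * (144 * B1\<^sup>2 * pi * e)" if e: "0 < e" "e \<le> 1" for e :: real
  proof -
    define cut where "cut x = 1 / (1 + (e * x)\<^sup>2)" for x
    define cut1 where "cut1 x = - 2 * e\<^sup>2 * x * (cut x)\<^sup>2" for x
    define cut2 where "cut2 x = - 2 * e\<^sup>2 * (cut x)\<^sup>2 + 8 * e ^ 4 * x\<^sup>2 * (cut x) ^ 3" for x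
    have den: "1 + (e * x)\<^sup>2 > 0" for x by (simp add: add_pos_nonneg)
    have cut0: "cut x > 0" "cut x \<le> 1" for x using den[of x] by (auto simp: cut_def)
    have dcut: "(cut has_real_derivative cut1 x) (at x)" for x
      unfolding cut_def[abs_def] cut1_def
      using den[of x] by (auto intro!: derivative_eq_intros simp: field_simps power2_eq_square)
    have dcut1: "(cut1 has_real_derivative cut2 x) (at x)" for x
      unfolding cut1_def[abs_def]
      by (rule derivative_eq_intros dcut refl)+ (simp add: cut1_def cut2_def algebra_simps eval_nat_numeral)
    have bcut1: "\<bar>cut1 x\<bar> \<le> e * cut x" for x
    proof -
      have "2 * (e * \<bar>x\<bar>) * cut x \<le> 1"
        using den[of x] sum_squares_bound[of 1 "e * \<bar>x\<bar>"] e by (simp add: cut_def power_mult_distrib)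
      then have "(2 * (e * \<bar>x\<bar>) * cut x) * (e * cut x) \<le> 1 * (e * cut x)"
        using cut0[of x] e by (intro mult_right_mono) auto
      then show ?thesis using e by (simp add: cut1_def abs_mult power2_eq_square mult_ac)
    qed
    have bcut2: "\<bar>cut2 x\<bar> \<le> 10 * (e * cut x)" for x
    proof -
      have ex: "e\<^sup>2 * x\<^sup>2 * cut x \<le> 1" using den[of x] by (simp add: cut_def power_mult_distrib)
      have ee: "e\<^sup>2 \<le> e" using e by (simp add: power2_eq_square mult_left_le)
      have 1: "2 * e\<^sup>2 * (cut x)\<^sup>2 \<le> 2 * (e * cut x)"
      proof -
        have "e\<^sup>2 * (cut x * cut x) \<le> e * (cut x * 1)"
          using ee cut0[of x] e by (intro mult_mono) auto
        then show ?thesis by (simp add: power2_eq_square)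
      qed
      have 2: "8 * e ^ 4 * x\<^sup>2 * (cut x) ^ 3 \<le> 8 * (e * cut x)"
      proof -
        have "(e\<^sup>2 * x\<^sup>2 * cut x) * (e\<^sup>2 * (cut x * cut x)) \<le> 1 * (e * (cut x * 1))"
          using ee cut0[of x] e ex by (intro mult_mono) auto
        then show ?thesis by (simp add: eval_nat_numeral mult_ac)
      qed
      have "0 \<le> 2 * e\<^sup>2 * (cut x)\<^sup>2" "0 \<le> 8 * e ^ 4 * x\<^sup>2 * (cut x) ^ 3" using cut0[of x] e by auto
      moreover have "cut2 x = 8 * e ^ 4 * x\<^sup>2 * (cut x) ^ 3 - 2 * e\<^sup>2 * (cut x)\<^sup>2" by (simp add: cut2_def)
      ultimately show ?thesis using 1 2 by linarith
    qed
    define u where "u x = of_real (cut x) * y x" for x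
    \<comment> \<open>This is \<open>(L - z) u\<close>: as \<open>y\<close> solves the equation,
      only the terms with a derivative of the cut-off survive.\<close>
    define g where "g x = - (of_real (cut2 x) * y x + 2 * of_real (cut1 x) * y1 x)" for x
    have ccut: "continuous_on S cut" "continuous_on S cut1" for S
      using dcut dcut1 by (auto intro!: continuous_at_imp_continuous_on DERIV_isCont)
    then have ccut2: "continuous_on S cut2" for S unfolding cut2_def[abs_def] by (intro continuous_intros) auto
    have uc: "continuous_on S u" "continuous_on S g" for S
      unfolding u_def[abs_def] g_def[abs_def] y1_def by (intro continuous_intros ccut ccut2 yc Q_cont)+
    have S: "solves UNIV z (\<lambda>x. 0) (\<lambda>x. - g x) u (\<lambda>x. of_real (cut1 x) * y x + of_real (cut x) * v x)"
      unfolding solves_def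
    proof (intro ballI conjI)
      fix x :: real
      have r: "((\<lambda>x. of_real (f x) :: complex) has_vector_derivative of_real f') (at x)"
        if "(f has_real_derivative f') (at x)" for f f'
        using bounded_linear.has_vector_derivative[OF bounded_linear_of_real] that
        by (simp add: has_real_derivative_iff_has_vector_derivative)
      note D = solvesD[OF yv UNIV_I[of x]] and R = r[OF dcut] r[OF dcut1]
      show "(u has_vector_derivative Q x * u x + (of_real (cut1 x) * y x + of_real (cut x) * v x) + 0) (at x within UNIV)"
        unfolding u_def[abs_def]
        by (rule has_vector_derivative_eq_rhs[OF has_vector_derivative_mult[OF R(1) D(1)]]) (simp add: algebra_simps)
      show "((\<lambda>x. of_real (cut1 x) * y x + of_real (cut x) * v x) has_vector_derivative
          - (z + (Q x)\<^sup>2) * u x - Q x * (of_real (cut1 x) * y x + of_real (cut x) * v x) + - g x) (at x within UNIV)"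
        by (rule has_vector_derivative_eq_rhs[OF has_vector_derivative_add[OF
              has_vector_derivative_mult[OF R(2) D(1)] has_vector_derivative_mult[OF R(1) D(2)]]])
          (simp add: g_def u_def y1_def algebra_simps)
    qed
    have bg: "cmod (g x) \<le> 12 * B1 * e * cut x" for x
    proof -
      have "cmod (g x) \<le> \<bar>cut2 x\<bar> * cmod (y x) + 2 * \<bar>cut1 x\<bar> * cmod (y1 x)"
        unfolding g_def norm_minus_cancel using norm_triangle_ineq[of "of_real (cut2 x) * y x" "2 * of_real (cut1 x) * y1 x"]
        by (simp add: norm_mult)
      also have "\<dots> \<le> 10 * (e * cut x) * B1 + 2 * (e * cut x) * B1"
        using bcut1[of x] bcut2[of x] b1[of x] cut0[of x] e B1 by (intro add_mono mult_mono) auto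
      finally show ?thesis by (simp add: algebra_simps)
    qed
    \<comment> \<open>The antiderivative \<open>arctan (e * x) / e\<close> shows that the integral
      of the cut-off grows only like \<open>1 / e\<close>, whereas the bound \<open>bg\<close>
      contributes \<open>e\<^sup>2\<close> to the square norm of \<open>g\<close>.\<close>
    have icut: "cut integrable_on UNIV" "integral UNIV cut \<le> pi / e"
    proof -
      have ft: "(cut has_integral arctan (e * real n) / e - arctan (e * - real n) / e) {- real n..real n}" for n
      proof (rule fundamental_theorem_of_calculus)
        show "((\<lambda>x. arctan (e * x) / e) has_vector_derivative cut x) (at x within {- real n..real n})" for x
        proof -
          have "((\<lambda>x. arctan (e * x) / e) has_real_derivative (e * inverse (1 + (e * x)\<^sup>2)) / e) (at x within {- real n..real n})"
            by (intro DERIV_cdivide) (auto intro!: derivative_eq_intros simp: mult.commute)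
          then show ?thesis
            using e by (simp add: has_real_derivative_iff_has_vector_derivative cut_def inverse_eq_divide)
        qed
      qed simp
      have "integral {- real n..real n} cut \<le> pi / e" for n
      proof -
        have "integral {- real n..real n} cut = (2 * arctan (e * real n)) / e"
          using ft[of n] by (simp add: integral_unique arctan_minus)
        also have "\<dots> \<le> pi / e" using arctan_ubound[of "e * real n"] e by (intro divide_right_mono) auto
        finally show ?thesis .
      qed
      moreover have "cut integrable_on {- real n..real n}" for n using ft by blast
      ultimately show "cut integrable_on UNIV" "integral UNIV cut \<le> pi / e"
        using integrable_on_UNIV_if_bounded[of cut "pi / e"] cut0(1) less_imp_le by blast+
    qed
    have dom: "(\<lambda>x. (cmod (f x))\<^sup>2) integrable_on UNIV \<and> integral UNIV (\<lambda>x. (cmod (f x))\<^sup>2) \<le> K\<^sup>2 * (pi / e)"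
      if "continuous_on UNIV f" "\<And>x. cmod (f x) \<le> K * cut x" for f K
    proof -
      have p: "(cmod (f x))\<^sup>2 \<le> K\<^sup>2 * cut x" for x
      proof -
        have "(cmod (f x))\<^sup>2 \<le> (K * cut x)\<^sup>2" using that(2) by (intro power_mono) auto
        also have "\<dots> = K\<^sup>2 * (cut x * cut x)" by (simp add: power2_eq_square)
        also have "\<dots> \<le> K\<^sup>2 * (cut x * 1)" using cut0[of x] by (intro mult_left_mono) auto
        finally show ?thesis by simp
      qed
      have m: "f \<in> borel_measurable lebesgue" by (rule continuous_imp_lebesgue_measurable[OF that(1)])
      have kc: "(\<lambda>x. K\<^sup>2 * cut x) integrable_on UNIV" by (intro integrable_on_mult_right icut(1))
      have i: "(\<lambda>x. (cmod (f x))\<^sup>2) integrable_on UNIV"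
      proof (rule measurable_bounded_by_integrable_imp_integrable[OF _ kc])
        show "(\<lambda>x. (cmod (f x))\<^sup>2) \<in> borel_measurable (lebesgue_on UNIV)"
          using m by (simp add: lebesgue_on_UNIV_eq)
      qed (use p in auto)
      have "integral UNIV (\<lambda>x. (cmod (f x))\<^sup>2) \<le> integral UNIV (\<lambda>x. K\<^sup>2 * cut x)"
        using p i kc by (intro integral_le) auto
      also have "\<dots> = K\<^sup>2 * integral UNIV cut" by simp
      also have "\<dots> \<le> K\<^sup>2 * (pi / e)" using icut(2) by (intro mult_left_mono) auto
      finally show ?thesis using i by blast
    qed
    have bu: "cmod (u x) \<le> B1 * cut x" for x
      using b1(2)[of x] cut0[of x] by (simp add: u_def norm_mult mult.commute[of B1] mult_left_mono)
    have bgu: "cmod (g x + z * u x) \<le> (12 * B1 * e + cmod z * B1) * cut x" for x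
    proof -
      have "cmod (g x + z * u x) \<le> cmod (g x) + cmod z * cmod (u x)" by (metis norm_mult norm_triangle_ineq)
      also have "\<dots> \<le> 12 * B1 * e * cut x + cmod z * (B1 * cut x)" using bg bu by (intro add_mono mult_left_mono) auto
      finally show ?thesis by (simp add: algebra_simps)
    qed
    have guc: "continuous_on UNIV (\<lambda>x. g x + z * u x)" by (intro continuous_intros uc)
    have L2: "L2_on UNIV u" "L2_on UNIV g" "L2_on UNIV (\<lambda>x. g x + z * u x)"
      unfolding L2_on_UNIV_iff
      using dom[OF uc(1) bu] dom[OF uc(2) bg] dom[OF guc bgu] continuous_imp_lebesgue_measurable uc guc
      by blast+
    have "(u, g) \<in> shift_op (hill_op q) z"
    proof -
      let ?u1 = "\<lambda>x. (of_real (cut1 x) * y x + of_real (cut x) * v x) + Q x * u x"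
      have e: "(\<lambda>x. ?u1 x - Q x * u x) = (\<lambda>x. of_real (cut1 x) * y x + of_real (cut x) * v x)" by (rule ext) simp
      have "sl_equation q {- real n..real n} u ?u1 (\<lambda>x. g x + z * u x)" for n
        unfolding sl_equation_iff_solves[OF uc(2)] e by (rule solves_subset[OF S]) simp
      then have "sl_equation q UNIV u ?u1 (\<lambda>x. g x + z * u x)" by (simp only: sl_equation_UNIV_iff) blast
      then show ?thesis using L2 by (auto simp: shift_op_def hill_op_def)
    qed
    from C[OF L2(2) this] have "L2_norm u \<le> C * L2_norm g" .
    then have "(L2_norm u)\<^sup>2 \<le> (C * L2_norm g)\<^sup>2" using L2_norm_power2(2)[OF L2(1)] by (intro power_mono)
    then have "integral UNIV (\<lambda>x. (cmod (u x))\<^sup>2) \<le> C\<^sup>2 * integral UNIV (\<lambda>x. (cmod (g x))\<^sup>2)"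
      unfolding power_mult_distrib L2_norm_power2(1)[OF L2(1)] L2_norm_power2(1)[OF L2(2)] .
    moreover have "integral UNIV (\<lambda>x. (cmod (g x))\<^sup>2) \<le> 144 * B1\<^sup>2 * pi * e"
      using dom[OF uc(2) bg] e by (simp add: power_mult_distrib power2_eq_square field_simps)
    moreover have "m / 4 \<le> integral UNIV (\<lambda>x. (cmod (u x))\<^sup>2)"
    proof -
      have "m / 4 = integral {0..1} (\<lambda>x. (cmod (y x))\<^sup>2 / 4)" by (simp add: m_def)
      also have "\<dots> \<le> integral {0..1} (\<lambda>x. (cmod (u x))\<^sup>2)"
      proof (rule integral_le)
        show "(\<lambda>x. (cmod (y x))\<^sup>2 / 4) integrable_on {0..1}" "(\<lambda>x. (cmod (u x))\<^sup>2) integrable_on {0..1}"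
          by (intro integrable_continuous_interval continuous_intros yc uc; simp)+
        fix x :: real assume x: "x \<in> {0..1}"
        have "(e * x)\<^sup>2 \<le> 1" using e x by (simp add: power_le_one mult_le_one)
        then have "1 / 2 \<le> cut x" using den[of x] by (simp add: cut_def field_simps)
        then have "(1 / 2)\<^sup>2 \<le> (cut x)\<^sup>2" by (intro power_mono) auto
        then have "(1 / 2)\<^sup>2 * (cmod (y x))\<^sup>2 \<le> (cut x)\<^sup>2 * (cmod (y x))\<^sup>2" by (intro mult_right_mono) auto
        then show "(cmod (y x))\<^sup>2 / 4 \<le> (cmod (u x))\<^sup>2"
          using cut0(1)[of x] by (simp add: u_def norm_mult power_mult_distrib power_divide)
      qed
      also have "\<dots> \<le> integral UNIV (\<lambda>x. (cmod (u x))\<^sup>2)"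
        using L2(1) by (intro integral_Icc_le_integral_UNIV) (auto simp: L2_on_UNIV_iff)
      finally show ?thesis .
    qed
    ultimately show ?thesis by (meson mult_left_mono order_trans zero_le_power2)
  qed
  define c where "c = C\<^sup>2 * (144 * B1\<^sup>2 * pi)"
  have c0: "c \<ge> 0" by (simp add: c_def)
  \<comment> \<open>Chosen so that \<open>c * e \<le> m / 8\<close>, against \<open>key\<close>;
    \<open>c + 1\<close> keeps the denominator positive.\<close>
  define e where "e = min 1 (m / (8 * (c + 1)))"
  have "e > 0" "e \<le> 1" using m c0 by (auto simp: e_def)
  from key[OF this] have "m / 4 \<le> c * e" by (simp add: c_def mult_ac)
  also have "\<dots> \<le> (c + 1) * (m / (8 * (c + 1)))" using c0 m by (intro mult_mono) (auto simp: e_def)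
  also have "\<dots> = m / 8" using c0 by (simp add: field_simps)
  finally show False using m by simp
qed

end

section \<open>The resolvent in the case of hyperbolic monodromy\<close>

text \<open>The matrix has the eigenvalues \<rho> and \<open>1 / \<rho>\<close>. Left eigenvectors
  split the recursion into two scalar ones; the component of \<rho> is summed over the past, that of
  \<open>1 / \<rho>\<close> over the future, and both are contractions.\<close>

lemma hyperbolic_recursion:
  fixes A B C D \<rho> :: complex
  assumes det: "A * D - B * C = 1" and tr: "A + D = \<rho> + 1 / \<rho>" and \<rho>: "\<rho> \<noteq> 0" "cmod \<rho> < 1"
  shows "\<exists>K\<ge>0. \<forall>b1 b2 J. (\<forall>n. (\<Sum>k\<in>{- int n..int n}. (cmod (b1 k))\<^sup>2 + (cmod (b2 k))\<^sup>2) \<le> J) \<longrightarrow>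
    (\<exists>Y V. (\<forall>k. Y (k + 1) = A * Y k + B * V k + b1 k \<and> V (k + 1) = C * Y k + D * V k + b2 k) \<and>
      (\<forall>n. (\<Sum>k\<in>{- int n..int n}. (cmod (Y k))\<^sup>2 + (cmod (V k))\<^sup>2) \<le> K * J))"
proof -
  have left_ev: "\<exists>a b. (a \<noteq> 0 \<or> b \<noteq> 0) \<and> a * A + b * C = s * a \<and> a * B + b * D = s * b"
    if "s * s - (A + D) * s + 1 = 0" for s
  proof -
    have "(A - s) * (D - s) - C * B = (A * D - B * C - 1) + (s * s - (A + D) * s + 1)"
      by (simp add: algebra_simps)
    then have "(A - s) * (D - s) - C * B = 0" unfolding that det by simp
    then obtain a b where "a \<noteq> 0 \<or> b \<noteq> 0" "(A - s) * a + C * b = 0" "B * a + (D - s) * b = 0"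
      using complex_2x2_singular_iff[of "A - s" C B "D - s"] by (auto simp: mult.commute)
    then show ?thesis by (intro exI[of _ a] exI[of _ b]) (auto simp: algebra_simps)
  qed
  obtain l1 l2 where l: "l1 \<noteq> 0 \<or> l2 \<noteq> 0" "l1 * A + l2 * C = \<rho> * l1" "l1 * B + l2 * D = \<rho> * l2"
    using left_ev[of \<rho>] tr \<rho>(1) by (auto simp: field_simps)
  obtain n1 n2 where n: "n1 \<noteq> 0 \<or> n2 \<noteq> 0" "n1 * A + n2 * C = 1 / \<rho> * n1" "n1 * B + n2 * D = 1 / \<rho> * n2"
    using left_ev[of "1 / \<rho>"] tr \<rho>(1) by (auto simp: field_simps)
  have \<rho>\<rho>: "\<rho> \<noteq> 1 / \<rho>"
  proof
    assume "\<rho> = 1 / \<rho>"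
    then have "\<rho> * \<rho> = 1" using \<rho>(1) by (simp add: field_simps)
    then have "cmod \<rho> * cmod \<rho> = 1" by (metis norm_mult norm_one)
    then show False using \<rho>(2) mult_strict_mono[of "cmod \<rho>" 1 "cmod \<rho>" 1] by simp
  qed
  define d where "d = l1 * n2 - l2 * n1"
  \<comment> \<open>Left eigenvectors to the different eigenvalues \<rho> and
    \<open>1 / \<rho>\<close> are independent, so the two components are coordinates.\<close>
  have d: "d \<noteq> 0"
  proof
    assume "d = 0"
    then have "l1 * n2 - n1 * l2 = 0" by (simp add: d_def mult.commute)
    then obtain a b where ab: "a \<noteq> 0 \<or> b \<noteq> 0" "l1 * a + n1 * b = 0" "l2 * a + n2 * b = 0"
      using complex_2x2_singular_iff[of l1 n1 l2 n2] by auto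
    have "(l1 * A + l2 * C) * a + (n1 * A + n2 * C) * b = A * (l1 * a + n1 * b) + C * (l2 * a + n2 * b)"
      "(l1 * B + l2 * D) * a + (n1 * B + n2 * D) * b = B * (l1 * a + n1 * b) + D * (l2 * a + n2 * b)"
      by (simp_all add: algebra_simps)
    then have e: "\<rho> * l1 * a + 1 / \<rho> * n1 * b = 0" "\<rho> * l2 * a + 1 / \<rho> * n2 * b = 0"
      unfolding l(2,3) n(2,3) ab(2,3) by simp_all
    have "(\<rho> - 1 / \<rho>) * (l1 * a) = (\<rho> * l1 * a + 1 / \<rho> * n1 * b) - 1 / \<rho> * (l1 * a + n1 * b)"
      "(\<rho> - 1 / \<rho>) * (l2 * a) = (\<rho> * l2 * a + 1 / \<rho> * n2 * b) - 1 / \<rho> * (l2 * a + n2 * b)"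
      by (simp_all add: algebra_simps)
    then have "l1 * a = 0" "l2 * a = 0" using e ab(2,3) \<rho>\<rho> by simp_all
    then show False using ab l(1) n(1) by auto
  qed
  obtain K where K: "K \<ge> 0" "\<And>b B. (\<And>n. (\<Sum>k\<in>{- int n..int n}. (cmod (b k))\<^sup>2) \<le> B) \<Longrightarrow>
    \<exists>p. (\<forall>k. p (k + 1) = \<rho> * p k + b k) \<and> (\<forall>n. (\<Sum>k\<in>{- int n..int n}. (cmod (p k))\<^sup>2) \<le> K * B)"
    using contraction_recursion[OF \<rho>(2)] by blast
  define s where "s = cmod l1 + cmod l2 + cmod n1 + cmod n2"
  have s0: "s \<ge> 0" by (simp add: s_def)
  define \<Lambda> where "\<Lambda> = s / cmod d"
  have \<Lambda>0: "\<Lambda> \<ge> 0" using s0 by (simp add: \<Lambda>_def)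
  have lin2: "(cmod (a * x + b * y))\<^sup>2 \<le> 2 * s\<^sup>2 * ((cmod x)\<^sup>2 + (cmod y)\<^sup>2)" if "cmod a \<le> s" "cmod b \<le> s" for a b x y
  proof -
    have "cmod (a * x + b * y) \<le> cmod a * cmod x + cmod b * cmod y" by (metis norm_mult norm_triangle_ineq)
    also have "\<dots> \<le> s * cmod x + s * cmod y" using that by (intro add_mono mult_right_mono) auto
    finally have "(cmod (a * x + b * y))\<^sup>2 \<le> (s * cmod x + s * cmod y)\<^sup>2" by (intro power_mono) auto
    also have "\<dots> = s\<^sup>2 * (2 * ((cmod x)\<^sup>2 + (cmod y)\<^sup>2) - (cmod x - cmod y)\<^sup>2)"
      by (simp add: power2_eq_square algebra_simps)
    also have "\<dots> \<le> s\<^sup>2 * (2 * ((cmod x)\<^sup>2 + (cmod y)\<^sup>2))" by (intro mult_left_mono) auto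
    finally show ?thesis by (simp add: algebra_simps)
  qed
  define K' where "K' = 4 * \<Lambda>\<^sup>2 * (2 * (K * (2 * s\<^sup>2)))"
  have "K' \<ge> 0" using K(1) by (simp add: K'_def)
  moreover have "\<exists>Y V. (\<forall>k. Y (k + 1) = A * Y k + B * V k + b1 k \<and> V (k + 1) = C * Y k + D * V k + b2 k) \<and>
      (\<forall>n. (\<Sum>k\<in>{- int n..int n}. (cmod (Y k))\<^sup>2 + (cmod (V k))\<^sup>2) \<le> K' * J)"
    if J: "\<And>n. (\<Sum>k\<in>{- int n..int n}. (cmod (b1 k))\<^sup>2 + (cmod (b2 k))\<^sup>2) \<le> J" for b1 b2 J
  proof -
    have bl: "(\<Sum>k\<in>{- int n..int n}. (cmod (a * b1 k + b * b2 k))\<^sup>2) \<le> 2 * s\<^sup>2 * J" if "cmod a \<le> s" "cmod b \<le> s" for a b n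
    proof -
      have "(\<Sum>k\<in>{- int n..int n}. (cmod (a * b1 k + b * b2 k))\<^sup>2) \<le> (\<Sum>k\<in>{- int n..int n}. 2 * s\<^sup>2 * ((cmod (b1 k))\<^sup>2 + (cmod (b2 k))\<^sup>2))"
        by (intro sum_mono lin2 that)
      also have "\<dots> = 2 * s\<^sup>2 * (\<Sum>k\<in>{- int n..int n}. (cmod (b1 k))\<^sup>2 + (cmod (b2 k))\<^sup>2)" by (simp add: sum_distrib_left)
      also have "\<dots> \<le> 2 * s\<^sup>2 * J" by (intro mult_left_mono J) auto
      finally show ?thesis .
    qed
    obtain p where p: "\<And>k. p (k + 1) = \<rho> * p k + (l1 * b1 k + l2 * b2 k)"
      "\<And>n. (\<Sum>k\<in>{- int n..int n}. (cmod (p k))\<^sup>2) \<le> K * (2 * s\<^sup>2 * J)"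
      using K(2)[OF bl[of l1 l2]] by (auto simp: s_def)
    have br: "(\<Sum>j\<in>{- int m..int m}. (cmod (- \<rho> * (n1 * b1 (- j - 1) + n2 * b2 (- j - 1))))\<^sup>2) \<le> 2 * s\<^sup>2 * J" for m
    proof -
      have "(\<Sum>j\<in>{- int m..int m}. (cmod (- \<rho> * (n1 * b1 (- j - 1) + n2 * b2 (- j - 1))))\<^sup>2)
         \<le> (\<Sum>j\<in>{- int m..int m}. (cmod (n1 * b1 (- j - 1) + n2 * b2 (- j - 1)))\<^sup>2)"
        using \<rho>(2) by (intro sum_mono power_mono) (auto simp: norm_mult mult_left_le_one_le)
      also have "\<dots> = (\<Sum>k\<in>{- int m - 1..int m - 1}. (cmod (n1 * b1 k + n2 * b2 k))\<^sup>2)"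
        by (rule sum.reindex_bij_witness[of _ "\<lambda>k. - k - 1" "\<lambda>k. - k - 1"]) auto
      also have "\<dots> \<le> (\<Sum>k\<in>{- int (Suc m)..int (Suc m)}. (cmod (n1 * b1 k + n2 * b2 k))\<^sup>2)"
        by (rule sum_mono2) auto
      also have "\<dots> \<le> 2 * s\<^sup>2 * J" by (rule bl) (auto simp: s_def)
      finally show ?thesis .
    qed
    \<comment> \<open>Reversing the direction, \<open>r k = r' (- k)\<close>, turns
      \<open>r (k + 1) = 1 / \<rho> * r k + b k\<close> into a contraction with factor \<rho> and
      forcing \<open>- \<rho> * b (- k - 1)\<close>.\<close>
    obtain r' where r': "\<And>k. r' (k + 1) = \<rho> * r' k + - \<rho> * (n1 * b1 (- k - 1) + n2 * b2 (- k - 1))"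
      "\<And>n. (\<Sum>k\<in>{- int n..int n}. (cmod (r' k))\<^sup>2) \<le> K * (2 * s\<^sup>2 * J)"
      using K(2)[OF br] by blast
    define r where "r k = r' (- k)" for k
    have r1: "r (k + 1) = 1 / \<rho> * r k + (n1 * b1 k + n2 * b2 k)" for k
    proof -
      have "- (k + 1) = - k - 1" by simp
      then show ?thesis using r'(1)[of "- k - 1"] \<rho>(1) unfolding r_def \<open>- (k + 1) = - k - 1\<close> by (simp add: field_simps)
    qed
    have r2: "(\<Sum>k\<in>{- int n..int n}. (cmod (r k))\<^sup>2) \<le> K * (2 * s\<^sup>2 * J)" for n
    proof -
      have "(\<Sum>k\<in>{- int n..int n}. (cmod (r k))\<^sup>2) = (\<Sum>k\<in>{- int n..int n}. (cmod (r' k))\<^sup>2)"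
        unfolding r_def by (rule sum.reindex_bij_witness[of _ uminus uminus]) auto
      then show ?thesis using r'(2) by simp
    qed
    define Y where "Y k = (n2 * p k - l2 * r k) / d" for k
    define V where "V k = (l1 * r k - n1 * p k) / d" for k
    have coords: "l1 * Y k + l2 * V k = p k" "n1 * Y k + n2 * V k = r k" for k
    proof -
      have "l1 * Y k + l2 * V k = (l1 * n2 - l2 * n1) * p k / d" "n1 * Y k + n2 * V k = (l1 * n2 - l2 * n1) * r k / d"
        by (simp_all add: Y_def V_def add_divide_distrib[symmetric] algebra_simps)
      then show "l1 * Y k + l2 * V k = p k" "n1 * Y k + n2 * V k = r k" using d by (simp_all add: d_def)
    qed
    have uniq: "x = x' \<and> y = y'" if "l1 * x + l2 * y = l1 * x' + l2 * y'" "n1 * x + n2 * y = n1 * x' + n2 * y'" for x y x' y'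
    proof -
      have "d * (x - x') = n2 * ((l1 * x + l2 * y) - (l1 * x' + l2 * y')) - l2 * ((n1 * x + n2 * y) - (n1 * x' + n2 * y'))"
        "d * (y - y') = l1 * ((n1 * x + n2 * y) - (n1 * x' + n2 * y')) - n1 * ((l1 * x + l2 * y) - (l1 * x' + l2 * y'))"
        by (simp_all add: d_def algebra_simps)
      then have "d * (x - x') = 0" "d * (y - y') = 0" unfolding that by simp_all
      then show ?thesis using d by simp
    qed
    have "Y (k + 1) = A * Y k + B * V k + b1 k \<and> V (k + 1) = C * Y k + D * V k + b2 k" for k
    proof (rule uniq)
      have "l1 * (A * Y k + B * V k + b1 k) + l2 * (C * Y k + D * V k + b2 k) =
        (l1 * A + l2 * C) * Y k + (l1 * B + l2 * D) * V k + (l1 * b1 k + l2 * b2 k)" by (simp add: algebra_simps)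
      also have "\<dots> = \<rho> * (l1 * Y k + l2 * V k) + (l1 * b1 k + l2 * b2 k)" unfolding l by (simp add: algebra_simps)
      finally show "l1 * Y (k + 1) + l2 * V (k + 1) = l1 * (A * Y k + B * V k + b1 k) + l2 * (C * Y k + D * V k + b2 k)"
        unfolding coords p(1) by simp
      have "n1 * (A * Y k + B * V k + b1 k) + n2 * (C * Y k + D * V k + b2 k) =
        (n1 * A + n2 * C) * Y k + (n1 * B + n2 * D) * V k + (n1 * b1 k + n2 * b2 k)" by (simp add: algebra_simps)
      also have "\<dots> = 1 / \<rho> * (n1 * Y k + n2 * V k) + (n1 * b1 k + n2 * b2 k)" unfolding n by (simp add: algebra_simps)
      finally show "n1 * Y (k + 1) + n2 * V (k + 1) = n1 * (A * Y k + B * V k + b1 k) + n2 * (C * Y k + D * V k + b2 k)"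
        unfolding coords r1 by simp
    qed
    moreover have "(\<Sum>k\<in>{- int m..int m}. (cmod (Y k))\<^sup>2 + (cmod (V k))\<^sup>2) \<le> K' * J" for m
    proof -
      have one: "(cmod (Y k))\<^sup>2 + (cmod (V k))\<^sup>2 \<le> 4 * \<Lambda>\<^sup>2 * ((cmod (p k))\<^sup>2 + (cmod (r k))\<^sup>2)" for k
      proof -
        have "(cmod (n2 * p k + (- l2) * r k))\<^sup>2 \<le> 2 * s\<^sup>2 * ((cmod (p k))\<^sup>2 + (cmod (r k))\<^sup>2)"
          "(cmod ((- n1) * p k + l1 * r k))\<^sup>2 \<le> 2 * s\<^sup>2 * ((cmod (p k))\<^sup>2 + (cmod (r k))\<^sup>2)"
          by (rule lin2; simp add: s_def)+
        then have "(cmod (n2 * p k + (- l2) * r k))\<^sup>2 / (cmod d)\<^sup>2 + (cmod ((- n1) * p k + l1 * r k))\<^sup>2 / (cmod d)\<^sup>2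
           \<le> 2 * s\<^sup>2 * ((cmod (p k))\<^sup>2 + (cmod (r k))\<^sup>2) / (cmod d)\<^sup>2 + 2 * s\<^sup>2 * ((cmod (p k))\<^sup>2 + (cmod (r k))\<^sup>2) / (cmod d)\<^sup>2"
          by (intro add_mono divide_right_mono) auto
        then show ?thesis by (simp add: Y_def V_def \<Lambda>_def norm_divide power_divide algebra_simps)
      qed
      have "(\<Sum>k\<in>{- int m..int m}. (cmod (Y k))\<^sup>2 + (cmod (V k))\<^sup>2) \<le> (\<Sum>k\<in>{- int m..int m}. 4 * \<Lambda>\<^sup>2 * ((cmod (p k))\<^sup>2 + (cmod (r k))\<^sup>2))"
        by (intro sum_mono one)
      also have "\<dots> = 4 * \<Lambda>\<^sup>2 * ((\<Sum>k\<in>{- int m..int m}. (cmod (p k))\<^sup>2) + (\<Sum>k\<in>{- int m..int m}. (cmod (r k))\<^sup>2))"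
        by (simp only: sum_distrib_left[symmetric] sum.distrib)
      also have "\<dots> \<le> 4 * \<Lambda>\<^sup>2 * (K * (2 * s\<^sup>2 * J) + K * (2 * s\<^sup>2 * J))"
        by (intro mult_left_mono add_mono p(2) r2) auto
      finally show ?thesis by (simp add: K'_def algebra_simps)
    qed
    ultimately show ?thesis by blast
  qed
  ultimately show ?thesis by (intro exI[of _ K']) blast
qed

context hill begin

text \<open>By Cayley-Hamilton, a matrix of determinant 1 plus its inverse is its trace times the
  identity; here it acts on the data of the solution at 0.\<close>

lemma fsol_Cayley_Hamilton:
  "ysol z a b (x + 1) + ysol z a b (x - 1) = F z * ysol z a b x"
proof -
  define a' b' where "a' = ysol z a b (- 1)" and "b' = vsol z a b (- 1)"
  have M: "m11 z * a' + m12 z * b' = a" "m21 z * a' + m22 z * b' = b"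
    using fsol_shift[of z a b 1 "- 1"] fsol_decomp[of z a' b' 1] by (simp_all add: a'_def b'_def mult.commute)
  have det: "m11 z * m22 z - m12 z * m21 z = 1" by (rule monodromy_det)
  have "(m11 z * m22 z - m12 z * m21 z) * a' = m22 z * (m11 z * a' + m12 z * b') - m12 z * (m21 z * a' + m22 z * b')"
    "(m11 z * m22 z - m12 z * m21 z) * b' = m11 z * (m21 z * a' + m22 z * b') - m21 z * (m11 z * a' + m12 z * b')"
    by (simp_all add: algebra_simps)
  then have ab': "a' = m22 z * a - m12 z * b" "b' = m11 z * b - m21 z * a"
    unfolding M det by simp_all
  have "ysol z a b (x + 1) = ysol z (ysol z a b 1) (vsol z a b 1) x"
    using fsol_shift(1)[of z a b x 1] by simp
  also have "\<dots> = (a * m11 z + b * m12 z) * ysol z 1 0 x + (a * m21 z + b * m22 z) * ysol z 0 1 x"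
    by (subst fsol_decomp(1)[of z "ysol z a b 1" "vsol z a b 1" x]) (simp only: fsol_decomp[of z a b 1])
  finally have 1: "ysol z a b (x + 1) = (a * m11 z + b * m12 z) * ysol z 1 0 x + (a * m21 z + b * m22 z) * ysol z 0 1 x" .
  have "ysol z a b (x - 1) = a' * ysol z 1 0 x + b' * ysol z 0 1 x"
    using fsol_shift(1)[of z a b x "- 1"] fsol_decomp(1)[of z a' b' x] by (simp add: a'_def b'_def)
  then show ?thesis
    unfolding 1 fsol_decomp(1)[of z a b x] ab' F_def by (simp add: algebra_simps)
qed

text \<open>From \<open>F z * w x = w (x + 1) + w (x - 1)\<close> and translation invariance the
  square norm \<open>I\<close> satisfies \<open>I \<le> 4 * I / (cmod (F z))\<^sup>2\<close>, which
  forces \<open>I = 0\<close>.\<close>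

lemma homogeneous_L2_eq_0:
  assumes w: "solves UNIV z (\<lambda>x. 0) (\<lambda>x. 0) w s" and L2: "(\<lambda>x. (cmod (w x))\<^sup>2) integrable_on UNIV"
    and F: "cmod (F z) > 2"
  shows "w x = 0"
proof -
  define h where "h x = (cmod (w x))\<^sup>2" for x
  have wy: "w x = ysol z (w 0) (s 0) x" for x
    using solves_unique_UNIV[OF w solves_fsol[of z "w 0" "s 0"], of 0 x] by simp
  have wc: "continuous_on S w" for S using solves_cont(1)[OF solves_subset[OF w]] by simp
  have hc: "continuous_on S h" for S unfolding h_def by (intro continuous_intros wc)
  have h0: "0 \<le> h x" for x by (simp add: h_def)
  have hU: "h integrable_on UNIV" using L2 by (simp add: h_def[abs_def])
  define I where "I = integral UNIV h"
  have I: "integral {a..b} h \<le> I" for a b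
    unfolding I_def by (rule integral_Icc_le_integral_UNIV(2)[OF hU h0])
  have pt: "(cmod (F z))\<^sup>2 * h x \<le> 2 * h (x + 1) + 2 * h (x - 1)" for x
  proof -
    have "F z * w x = w (x + 1) + w (x - 1)"
      using fsol_Cayley_Hamilton[of z "w 0" "s 0" x] wy[symmetric] by simp
    then have "(cmod (F z) * cmod (w x))\<^sup>2 \<le> (cmod (w (x + 1)) + cmod (w (x - 1)))\<^sup>2"
      by (intro power_mono) (metis norm_mult norm_triangle_ineq, simp)
    also have "\<dots> = 2 * h (x + 1) + 2 * h (x - 1) - (cmod (w (x + 1)) - cmod (w (x - 1)))\<^sup>2"
      by (simp add: h_def power2_eq_square algebra_simps)
    also have "\<dots> \<le> 2 * h (x + 1) + 2 * h (x - 1)" by simp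
    finally show ?thesis by (simp add: h_def power_mult_distrib)
  qed
  have bd: "integral {- real n..real n} h \<le> 4 * I / (cmod (F z))\<^sup>2" for n
  proof -
    have sh: "integral {- real n..real n} (\<lambda>x. h (x + c)) \<le> I" for c
      using integral_shift_Icc_real[of "- real n" "real n" h c] I[of "- real n + c" "real n + c"]
      by (simp add: o_def add.commute)
    have ic: "(\<lambda>x. h (x + c)) integrable_on {- real n..real n}" for c
      by (intro integrable_continuous_interval continuous_on_compose2[OF hc[of UNIV]] continuous_intros) auto
    have "(cmod (F z))\<^sup>2 * integral {- real n..real n} h = integral {- real n..real n} (\<lambda>x. (cmod (F z))\<^sup>2 * h x)" by simp
    also have "\<dots> \<le> integral {- real n..real n} (\<lambda>x. 2 * h (x + 1) + 2 * h (x + (- 1)))"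
      using pt by (intro integral_le integrable_add integrable_on_mult_right ic integrable_continuous_interval hc) auto
    also have "\<dots> = 2 * integral {- real n..real n} (\<lambda>x. h (x + 1)) + 2 * integral {- real n..real n} (\<lambda>x. h (x + (- 1)))"
      by (subst Henstock_Kurzweil_Integration.integral_add[OF integrable_on_mult_right[OF ic] integrable_on_mult_right[OF ic]]) simp
    also have "\<dots> \<le> 4 * I" using sh[of 1] sh[of "- 1"] by linarith
    finally have "integral {- real n..real n} h * (cmod (F z))\<^sup>2 \<le> 4 * I" by (simp only: mult.commute)
    moreover have "0 < (cmod (F z))\<^sup>2" using F by (intro zero_less_power) linarith
    ultimately show ?thesis by (simp only: pos_le_divide_eq)
  qed
  have I1: "I \<le> 4 * I / (cmod (F z))\<^sup>2"
    unfolding I_def using bd[unfolded I_def] h0 hU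
    by (intro integrable_on_UNIV_if_bounded(2) integral_Icc_le_integral_UNIV(1)) auto
  have I0: "I \<ge> 0" unfolding I_def by (intro integral_nonneg hU) (use h0 in auto)
  have F4: "(cmod (F z))\<^sup>2 > 4" using F power_strict_mono[of 2 "cmod (F z)" 2] by simp
  have "I = 0"
  proof (rule ccontr)
    assume "I \<noteq> 0"
    then have "I * 4 < I * (cmod (F z))\<^sup>2" using I0 F4 by (intro mult_strict_left_mono) auto
    moreover have "I * (cmod (F z))\<^sup>2 \<le> 4 * I"
    proof -
      have "0 < (cmod (F z))\<^sup>2" using F4 by linarith
      from I1[unfolded pos_le_divide_eq[OF this]] show ?thesis .
    qed
    ultimately show False by linarith
  qed
  then have "integral {x..x + 1} h = 0"
    using I[of x "x + 1"] integral_nonneg[OF integral_Icc_le_integral_UNIV(1)[OF hU h0], of x "x + 1"] h0 by simp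
  then have "h x = 0" using integral_eq_0_iff[OF hc, of x "x + 1"] h0 by auto
  then show ?thesis by (simp add: h_def)
qed

text \<open>An antiderivative is fixed only up to a constant, and \<open>v\<close> absorbs the
  change. Each cell can thus use the antiderivative that vanishes at its left end.\<close>

lemma solves_shift_\<Gamma>:
  assumes "solves S z (\<lambda>x. - \<Gamma> x) (\<lambda>x. Q x * \<Gamma> x) y v"
  shows "solves S z (\<lambda>x. - (\<Gamma> x - c)) (\<lambda>x. Q x * (\<Gamma> x - c)) y (\<lambda>x. v x - c)"
  unfolding solves_def
proof (intro ballI conjI)
  fix x assume x: "x \<in> S"
  show "(y has_vector_derivative Q x * y x + (v x - c) + - (\<Gamma> x - c)) (at x within S)"
    by (rule has_vector_derivative_eq_rhs[OF solvesD(1)[OF assms x]]) simp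
  show "((\<lambda>x. v x - c) has_vector_derivative - (z + (Q x)\<^sup>2) * y x - Q x * (v x - c) + Q x * (\<Gamma> x - c)) (at x within S)"
    by (rule has_vector_derivative_eq_rhs[OF has_vector_derivative_diff[OF solvesD(2)[OF assms x] has_vector_derivative_const]])
      (simp add: algebra_simps)
qed

text \<open>On \<open>[k, k + 1]\<close> the solution is compared with the homogeneous one having
  the same state at \<open>k\<close>: the state at \<open>k + 1\<close> is the monodromy image up to
  an error governed by the oscillation of \<Gamma> on the cell. Since \<open>Q\<close> vanishes at
  integers, \<open>V j\<close> is the derivative of \<open>y\<close> at \<open>j\<close>. The number
  \<beta> dominates both inhomogeneities, of sizes \<open>G\<close> and
  \<open>Qmax * G\<close>.\<close>

lemma cell_estimates:
  fixes k :: int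
  assumes sol: "solves UNIV z (\<lambda>x. - \<Gamma> x) (\<lambda>x. Q x * \<Gamma> x) y v"
    and G: "\<And>x. x \<in> {of_int k..of_int k + 1} \<Longrightarrow> cmod (\<Gamma> x - \<Gamma> (of_int k)) \<le> G"
  defines "\<beta> \<equiv> (1 + Qmax) * G" and "Y \<equiv> \<lambda>j::int. y (of_int j)" and "V \<equiv> \<lambda>j::int. v (of_int j) - \<Gamma> (of_int j)"
  shows "x \<in> {of_int k..of_int k + 1} \<Longrightarrow> (cmod (y x))\<^sup>2 \<le> exp (kap z) * ((cmod (Y k))\<^sup>2 + (cmod (V k))\<^sup>2 + \<beta>\<^sup>2)"
    and "cmod (Y (k + 1) - (m11 z * Y k + m12 z * V k)) \<le> (exp (kap z) + 1) * \<beta>"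
    and "cmod (V (k + 1) - (m21 z * Y k + m22 z * V k)) \<le> (exp (kap z) + 1) * \<beta>"
proof -
  let ?I = "{real_of_int k..real_of_int k + 1}"
  let ?v = "\<lambda>x. v x - \<Gamma> (of_int k)"
  let ?f = "\<lambda>x. - (\<Gamma> x - \<Gamma> (of_int k))" and ?g = "\<lambda>x. Q x * (\<Gamma> x - \<Gamma> (of_int k))"
  have S: "solves ?I z ?f ?g y ?v"
    by (rule solves_subset[OF solves_shift_\<Gamma>[OF sol]]) simp
  have G0: "G \<ge> 0" using G[of "of_int k"] by simp
  have G\<beta>: "G \<le> \<beta>" using G0 Qmax_pos by (simp add: \<beta>_def algebra_simps)
  have fg: "cmod (?f x) \<le> \<beta> \<and> cmod (?g x) \<le> \<beta>" if "x \<in> ?I" for x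
  proof
    show "cmod (?f x) \<le> \<beta>" using G[OF that] G\<beta> by (simp add: norm_minus_commute)
    have "cmod (?g x) \<le> Qmax * G" unfolding norm_mult using G[OF that] Q_le_Qmax[of x] Qmax_pos by (intro mult_mono) auto
    also have "\<dots> \<le> \<beta>" using G0 by (simp add: \<beta>_def algebra_simps)
    finally show "cmod (?g x) \<le> \<beta>" .
  qed
  have ends: "of_int k \<in> ?I" "of_int k + 1 \<in> ?I" by auto
  show "(cmod (y x))\<^sup>2 \<le> exp (kap z) * ((cmod (Y k))\<^sup>2 + (cmod (V k))\<^sup>2 + \<beta>\<^sup>2)" if x: "x \<in> ?I" for x
  proof -
    have "energy y ?v x + \<beta>\<^sup>2 \<le> exp (kap z * \<bar>x - of_int k\<bar>) * (energy y ?v (of_int k) + \<beta>\<^sup>2)"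
      by (rule energy_growth[OF S fg x ends(1)])
    also have "\<dots> \<le> exp (kap z) * (energy y ?v (of_int k) + \<beta>\<^sup>2)"
      using x kap_pos[of z] by (intro mult_right_mono) (auto simp: mult_le_cancel_left1)
    finally have "(cmod (y x))\<^sup>2 + (cmod (?v x))\<^sup>2 + \<beta>\<^sup>2 \<le> exp (kap z) * ((cmod (Y k))\<^sup>2 + (cmod (V k))\<^sup>2 + \<beta>\<^sup>2)"
      by (simp add: energy_def Y_def V_def)
    then show ?thesis using zero_le_power2[of "cmod (?v x)"] zero_le_power2[of \<beta>] by linarith
  qed
  let ?h = "\<lambda>x. ysol z (Y k) (V k) (x + of_int (- k))" and ?hv = "\<lambda>x. vsol z (Y k) (V k) (x + of_int (- k))"
  have H: "solves ?I z (\<lambda>x. 0) (\<lambda>x. 0) ?h ?hv"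
    by (rule solves_subset[OF solves_shift[OF solves_fsol]]) simp
  have D: "solves ?I z ?f ?g (\<lambda>x. y x - ?h x) (\<lambda>x. ?v x - ?hv x)"
    using solves_lincomb_hom[OF S H, of "- 1"] by simp
  have e0: "energy (\<lambda>x. y x - ?h x) (\<lambda>x. ?v x - ?hv x) (of_int k) = 0"
    by (simp add: energy_def Y_def V_def)
  have "energy (\<lambda>x. y x - ?h x) (\<lambda>x. ?v x - ?hv x) (of_int k + 1) + \<beta>\<^sup>2 \<le> exp (kap z) * \<beta>\<^sup>2"
    using energy_growth[OF D fg ends(2) ends(1)] unfolding e0 by simp
  also have "\<dots> \<le> (exp (kap z) * \<beta>)\<^sup>2"
    using kap_pos[of z] by (simp add: power_mult_distrib power2_eq_square[of "exp (kap z)"] mult_right_mono mult_le_cancel_left1)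
  finally have en: "(cmod (y (of_int k + 1) - ?h (of_int k + 1)))\<^sup>2 + (cmod (?v (of_int k + 1) - ?hv (of_int k + 1)))\<^sup>2 + \<beta>\<^sup>2 \<le> (exp (kap z) * \<beta>)\<^sup>2"
    by (simp add: energy_def)
  have \<beta>0: "\<beta> \<ge> 0" using G0 G\<beta> by linarith
  have "(cmod (y (of_int k + 1) - ?h (of_int k + 1)))\<^sup>2 \<le> (exp (kap z) * \<beta>)\<^sup>2"
    using en zero_le_power2[of \<beta>] zero_le_power2[of "cmod (?v (of_int k + 1) - ?hv (of_int k + 1))"] by linarith
  then have 1: "cmod (y (of_int k + 1) - ?h (of_int k + 1)) \<le> exp (kap z) * \<beta>"
    by (rule power2_le_imp_le) (simp add: \<beta>0)
  have "(cmod (?v (of_int k + 1) - ?hv (of_int k + 1)))\<^sup>2 \<le> (exp (kap z) * \<beta>)\<^sup>2"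
    using en zero_le_power2[of \<beta>] zero_le_power2[of "cmod (y (of_int k + 1) - ?h (of_int k + 1))"] by linarith
  then have 2: "cmod (?v (of_int k + 1) - ?hv (of_int k + 1)) \<le> exp (kap z) * \<beta>"
    by (rule power2_le_imp_le) (simp add: \<beta>0)
  have h1: "?h (of_int k + 1) = m11 z * Y k + m12 z * V k" "?hv (of_int k + 1) = m21 z * Y k + m22 z * V k"
  proof -
    have "real_of_int k + 1 + real_of_int (- k) = 1" by simp
    then show "?h (of_int k + 1) = m11 z * Y k + m12 z * V k" "?hv (of_int k + 1) = m21 z * Y k + m22 z * V k"
      using fsol_decomp[of z "Y k" "V k" 1] by (simp_all only: mult.commute[of "Y k"] mult.commute[of "V k"])
  qed
  show "cmod (Y (k + 1) - (m11 z * Y k + m12 z * V k)) \<le> (exp (kap z) + 1) * \<beta>"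
    using 1 \<beta>0 unfolding h1 by (simp add: Y_def algebra_simps)
  have "V (k + 1) - (m21 z * Y k + m22 z * V k) = (?v (of_int k + 1) - ?hv (of_int k + 1)) - (\<Gamma> (of_int k + 1) - \<Gamma> (of_int k))"
    unfolding h1 by (simp add: V_def)
  also have "cmod \<dots> \<le> exp (kap z) * \<beta> + \<beta>"
    using norm_triangle_ineq4[of "?v (of_int k + 1) - ?hv (of_int k + 1)" "\<Gamma> (of_int k + 1) - \<Gamma> (of_int k)"] 2 G[OF ends(2)] G\<beta> by linarith
  finally show "cmod (V (k + 1) - (m21 z * Y k + m22 z * V k)) \<le> (exp (kap z) + 1) * \<beta>" by (simp add: algebra_simps)
qed

text \<open>Any solution of the inhomogeneous equation satisfies the monodromy recursion at the
  integers with square-summable errors. A homogeneous solution is added so that the integer states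
  become the square-summable ones of \<open>hyperbolic_recursion\<close>; the cell estimates then
  make the corrected function square-integrable.\<close>

lemma inhomogeneous_L2_solution:
  assumes \<rho>: "\<rho> \<noteq> 0" "cmod \<rho> < 1" "F z = \<rho> + 1 / \<rho>"
  shows "\<exists>C. \<forall>g. L2_on UNIV g \<longrightarrow> (\<exists>y. (y, g) \<in> shift_op (hill_op q) z \<and> L2_norm y \<le> C * L2_norm g)"
proof -
  obtain K where K: "K \<ge> 0" "\<And>b1 b2 J. (\<And>n. (\<Sum>k\<in>{- int n..int n}. (cmod (b1 k))\<^sup>2 + (cmod (b2 k))\<^sup>2) \<le> J) \<Longrightarrow>
    (\<exists>Y V. (\<forall>k. Y (k + 1) = m11 z * Y k + m12 z * V k + b1 k \<and> V (k + 1) = m21 z * Y k + m22 z * V k + b2 k) \<and>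
      (\<forall>n. (\<Sum>k\<in>{- int n..int n}. (cmod (Y k))\<^sup>2 + (cmod (V k))\<^sup>2) \<le> K * J))"
    using hyperbolic_recursion[OF monodromy_det \<rho>(3)[unfolded F_def] \<rho>(1,2)] by blast
  define E where "E = exp (kap z)"
  have E: "E > 0" by (simp add: E_def)
  define W where "W = (1 + Qmax)\<^sup>2"
  \<comment> \<open>\<open>2 * (E + 1)\<^sup>2 * W\<close> bounds the errors of the recursion,
    \<open>K\<close> its solution, \<open>E\<close> the growth inside a cell, and the last
    \<open>W\<close> the forcing there.\<close>
  define C where "C = E * (K * (2 * (E + 1)\<^sup>2 * W) + W)"
  have C0: "C \<ge> 0" using E K(1) by (simp add: C_def W_def)
  have main: "\<exists>y. (y, g) \<in> shift_op (hill_op q) z \<and> L2_norm y \<le> sqrt C * L2_norm g" if g: "L2_on UNIV g" for g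
  proof -
    have gai: "g absolutely_integrable_on {a..b}" for a b by (rule L2_on_imp_locally_integrable[OF g])
    define h where "h x = (cmod (g x))\<^sup>2" for x
    have hU: "h integrable_on UNIV" using g by (simp add: L2_on_UNIV_iff h_def[abs_def])
    have h0: "0 \<le> h x" for x by (simp add: h_def)
    have hi: "h integrable_on {a..b}" for a b by (rule integral_Icc_le_integral_UNIV(1)[OF hU h0])
    define I where "I = integral UNIV h"
    define \<Gamma> where "\<Gamma> = prim g"
    have \<Gamma>d: "\<Gamma> t - \<Gamma> s = integral {s..t} g" if "s \<le> t" for s t
      unfolding \<Gamma>_def by (rule prim_diff[OF gai that])
    have \<Gamma>c: "continuous_on S \<Gamma>" for S
      unfolding \<Gamma>_def by (rule continuous_on_subset[OF prim_continuous[OF gai]]) simp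
    define G where "G k = integral {real_of_int k..real_of_int k + 1} (\<lambda>x. cmod (g x))" for k
    have ngi: "(\<lambda>x. cmod (g x)) integrable_on {a..b}" for a b
      using gai[of a b] by (simp add: absolutely_integrable_on_def)
    have G: "cmod (\<Gamma> x - \<Gamma> (of_int k)) \<le> G k" if x: "x \<in> {of_int k..of_int k + 1}" for x k
    proof -
      have "cmod (\<Gamma> x - \<Gamma> (of_int k)) \<le> integral {of_int k..x} (\<lambda>x. cmod (g x))"
        using \<Gamma>d[of "of_int k" x] x gai[of "of_int k" x]
        by (auto intro!: integral_norm_bound_integral ngi simp: absolutely_integrable_on_def)
      also have "\<dots> \<le> G k" unfolding G_def using x by (intro integral_subset_le ngi) auto
      finally show ?thesis .
    qed
    define \<beta> where "\<beta> k = (1 + Qmax) * G k" for k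
    \<comment> \<open>By Cauchy-Schwarz on cells of length one the squares of the cell integrals of
      \<open>g\<close> add up to at most its square norm \<open>I\<close>.\<close>
    have s\<beta>: "(\<Sum>k\<in>{- int n..int n}. (\<beta> k)\<^sup>2) \<le> W * I" for n
    proof -
      have "(\<Sum>k\<in>{- int n..int n}. (\<beta> k)\<^sup>2) \<le> (\<Sum>k\<in>{- int n..int n}. W * integral {of_int k..of_int k + 1} h)"
        unfolding \<beta>_def power_mult_distrib W_def G_def h_def
        by (intro sum_mono mult_left_mono integral_power2_le_unit_interval ngi hi[unfolded h_def]) auto
      also have "\<dots> = W * integral {- real n..real n + 1} h"
        by (simp add: sum_distrib_left[symmetric] sum_integral_cells[OF hi])
      also have "\<dots> \<le> W * I"
        unfolding I_def by (intro mult_left_mono integral_Icc_le_integral_UNIV(2)[OF hU h0]) (simp add: W_def)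
      finally show ?thesis .
    qed
    have "\<exists>y v. y 0 = 0 \<and> v 0 = 0 \<and> solves UNIV z (\<lambda>x. - \<Gamma> x) (\<lambda>x. Q x * \<Gamma> x) y v"
      by (rule solves_exists[of "\<lambda>x. - \<Gamma> x" "\<lambda>x. Q x * \<Gamma> x" 0 0 z]; (blast | intro continuous_intros \<Gamma>c Q_cont))
    then obtain y0 v0 where y0: "y0 0 = 0" "v0 0 = 0" "solves UNIV z (\<lambda>x. - \<Gamma> x) (\<lambda>x. Q x * \<Gamma> x) y0 v0" by blast
    define Y0 where "Y0 j = y0 (of_int j)" for j :: int
    define V0 where "V0 j = v0 (of_int j) - \<Gamma> (of_int j)" for j :: int
    define b1 where "b1 k = Y0 (k + 1) - (m11 z * Y0 k + m12 z * V0 k)" for k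
    define b2 where "b2 k = V0 (k + 1) - (m21 z * Y0 k + m22 z * V0 k)" for k
    have bb: "cmod (b1 k) \<le> (E + 1) * \<beta> k" "cmod (b2 k) \<le> (E + 1) * \<beta> k" for k
      using cell_estimates(2,3)[OF y0(3) G, of k] unfolding b1_def b2_def Y0_def V0_def E_def \<beta>_def by auto
    have "(\<Sum>k\<in>{- int n..int n}. (cmod (b1 k))\<^sup>2 + (cmod (b2 k))\<^sup>2) \<le> 2 * (E + 1)\<^sup>2 * W * I" for n
    proof -
      have "(cmod (b1 k))\<^sup>2 + (cmod (b2 k))\<^sup>2 \<le> 2 * (E + 1)\<^sup>2 * (\<beta> k)\<^sup>2" for k
        using power_mono[OF bb(1)[of k], of 2] power_mono[OF bb(2)[of k], of 2] by (simp add: power_mult_distrib)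
      then have "(\<Sum>k\<in>{- int n..int n}. (cmod (b1 k))\<^sup>2 + (cmod (b2 k))\<^sup>2) \<le> (\<Sum>k\<in>{- int n..int n}. 2 * (E + 1)\<^sup>2 * (\<beta> k)\<^sup>2)"
        by (rule sum_mono)
      also have "\<dots> = 2 * (E + 1)\<^sup>2 * (\<Sum>k\<in>{- int n..int n}. (\<beta> k)\<^sup>2)" by (simp add: sum_distrib_left)
      also have "\<dots> \<le> 2 * (E + 1)\<^sup>2 * (W * I)" by (intro mult_left_mono s\<beta>) auto
      finally show ?thesis by (simp add: mult.assoc)
    qed
    from K(2)[OF this] obtain Y V where YV: "\<And>k. Y (k + 1) = m11 z * Y k + m12 z * V k + b1 k"
      "\<And>k. V (k + 1) = m21 z * Y k + m22 z * V k + b2 k"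
      "\<And>n. (\<Sum>k\<in>{- int n..int n}. (cmod (Y k))\<^sup>2 + (cmod (V k))\<^sup>2) \<le> K * (2 * (E + 1)\<^sup>2 * W * I)"
      by blast
    define a b where "a = Y 0" and "b = V 0"
    define y where "y x = y0 x + ysol z a b x" for x
    define v where "v x = v0 x + vsol z a b x" for x
    have sol: "solves UNIV z (\<lambda>x. - \<Gamma> x) (\<lambda>x. Q x * \<Gamma> x) y v"
      using solves_lincomb_hom[OF y0(3) solves_fsol[of z a b], of 1] by (simp add: y_def[abs_def] v_def[abs_def])
    have rec: "y (of_int (k + 1)) = m11 z * y (of_int k) + m12 z * (v (of_int k) - \<Gamma> (of_int k)) + b1 k \<and>
       v (of_int (k + 1)) - \<Gamma> (of_int (k + 1)) = m21 z * y (of_int k) + m22 z * (v (of_int k) - \<Gamma> (of_int k)) + b2 k" for k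
      using fsol_shift[of z a b 1 k] fsol_decomp[of z "ysol z a b (of_int k)" "vsol z a b (of_int k)" 1]
      by (simp add: y_def v_def b1_def b2_def Y0_def V0_def algebra_simps)
    \<comment> \<open>Both sequences satisfy the same recursion and agree at 0. Going to the left
      needs that the monodromy matrix is invertible.\<close>
    have yY: "y (of_int k) = Y k \<and> v (of_int k) - \<Gamma> (of_int k) = V k" for k
    proof (induction k rule: int_induct[of _ 0])
      case base
      show ?case using y0 by (simp add: y_def v_def a_def b_def \<Gamma>_def)
    next
      case (step1 i)
      then show ?case using rec[of i] YV(1,2)[of i] by simp
    next
      case (step2 i)
      define x x' where "x = y (of_int (i - 1)) - Y (i - 1)" and "x' = v (of_int (i - 1)) - \<Gamma> (of_int (i - 1)) - V (i - 1)"
      have e1: "m11 z * x + m12 z * x' = 0"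
        using rec[of "i - 1"] YV(1)[of "i - 1"] step2 by (simp add: x_def x'_def algebra_simps)
      have e2: "m21 z * x + m22 z * x' = 0"
        using rec[of "i - 1"] YV(2)[of "i - 1"] step2 by (simp add: x_def x'_def algebra_simps)
      have "x = 0 \<and> x' = 0"
        using complex_2x2_singular_iff[of "m11 z" "m12 z" "m21 z" "m22 z"] e1 e2 monodromy_det[of z] by auto
      then show ?case by (simp add: x_def x'_def)
    qed
    have yc: "continuous_on S y" for S using solves_cont(1)[OF solves_subset[OF sol]] by simp
    define hy where "hy x = (cmod (y x))\<^sup>2" for x
    have hyc: "continuous_on S hy" for S unfolding hy_def by (intro continuous_intros yc)
    have hyi: "hy integrable_on {a..b}" for a b by (intro integrable_continuous_interval hyc)
    have cell: "integral {of_int k..of_int k + 1} hy \<le> E * ((cmod (Y k))\<^sup>2 + (cmod (V k))\<^sup>2 + (\<beta> k)\<^sup>2)" for k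
    proof -
      have "integral {of_int k..of_int k + 1} hy \<le> integral {of_int k..of_int k + 1} (\<lambda>x::real. E * ((cmod (Y k))\<^sup>2 + (cmod (V k))\<^sup>2 + (\<beta> k)\<^sup>2))"
        using cell_estimates(1)[OF sol G, of k] yY[of k]
        by (intro integral_le hyi) (auto simp: hy_def E_def \<beta>_def)
      then show ?thesis by simp
    qed
    have bd: "integral {- real n..real n} hy \<le> C * I" for n
    proof -
      have "integral {- real n..real n} hy \<le> integral {- real n..real n + 1} hy"
        by (intro integral_subset_le hyi) (auto simp: hy_def)
      also have "\<dots> = (\<Sum>k\<in>{- int n..int n}. integral {of_int k..of_int k + 1} hy)"
        by (rule sum_integral_cells[OF hyi, symmetric])
      also have "\<dots> \<le> (\<Sum>k\<in>{- int n..int n}. E * ((cmod (Y k))\<^sup>2 + (cmod (V k))\<^sup>2 + (\<beta> k)\<^sup>2))"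
        by (intro sum_mono cell)
      also have "\<dots> = E * ((\<Sum>k\<in>{- int n..int n}. (cmod (Y k))\<^sup>2 + (cmod (V k))\<^sup>2) + (\<Sum>k\<in>{- int n..int n}. (\<beta> k)\<^sup>2))"
        by (simp only: sum_distrib_left[symmetric] sum.distrib)
      also have "\<dots> \<le> E * (K * (2 * (E + 1)\<^sup>2 * W * I) + W * I)"
        using E by (intro mult_left_mono add_mono YV(3) s\<beta>) auto
      also have "\<dots> = C * I" by (simp add: C_def algebra_simps)
      finally show ?thesis .
    qed
    have hyU: "hy integrable_on UNIV" "integral UNIV hy \<le> C * I"
      using integrable_on_UNIV_if_bounded[of hy "C * I"] hyi bd by (auto simp: hy_def)
    have L2y: "L2_on UNIV y"
      unfolding L2_on_UNIV_iff using hyU(1) continuous_imp_lebesgue_measurable[OF yc] by (simp add: hy_def[abs_def])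
    have L2f: "L2_on UNIV (\<lambda>x. g x + z * y x)"
      unfolding L2_on_UNIV_iff
    proof
      show m: "(\<lambda>x. g x + z * y x) \<in> borel_measurable lebesgue"
        using g L2y by (auto simp: L2_on_UNIV_iff)
      show "(\<lambda>x. (cmod (g x + z * y x))\<^sup>2) integrable_on UNIV"
      proof (rule measurable_bounded_by_integrable_imp_integrable[of _ _ "\<lambda>x. 2 * h x + 2 * (cmod z)\<^sup>2 * hy x"])
        show "(\<lambda>x. (cmod (g x + z * y x))\<^sup>2) \<in> borel_measurable (lebesgue_on UNIV)"
          using m by (simp add: lebesgue_on_UNIV_eq)
        show "(\<lambda>x. 2 * h x + 2 * (cmod z)\<^sup>2 * hy x) integrable_on UNIV"
          by (intro integrable_add integrable_on_mult_right hU hyU)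
        fix x
        have "(cmod (g x + z * y x))\<^sup>2 \<le> (cmod (g x) + cmod (z * y x))\<^sup>2"
          by (intro power_mono norm_triangle_ineq) auto
        also have "\<dots> = 2 * h x + 2 * (cmod z)\<^sup>2 * hy x - (cmod (g x) - cmod (z * y x))\<^sup>2"
          by (simp add: h_def hy_def norm_mult power2_eq_square algebra_simps)
        also have "\<dots> \<le> 2 * h x + 2 * (cmod z)\<^sup>2 * hy x" by simp
        finally show "norm ((cmod (g x + z * y x))\<^sup>2) \<le> 2 * h x + 2 * (cmod z)\<^sup>2 * hy x" by simp
      qed simp
    qed
    have "sl_equation q {- real n..real n} y (\<lambda>x. Q x * y x + v x - \<Gamma> x) (\<lambda>x. g x + z * y x)" for n
      by (rule solves_imp_sl_equation[OF solves_subset[OF sol] gai]) (use \<Gamma>d in auto)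
    then have "sl_equation q UNIV y (\<lambda>x. Q x * y x + v x - \<Gamma> x) (\<lambda>x. g x + z * y x)"
      by (simp only: sl_equation_UNIV_iff) blast
    then have "(y, g) \<in> shift_op (hill_op q) z" using L2y L2f by (auto simp: shift_op_def hill_op_def)
    moreover have "L2_norm y \<le> sqrt C * L2_norm g"
    proof -
      have "L2_norm y = sqrt (integral UNIV hy)" unfolding hy_def[abs_def] by (rule L2_norm_eq[OF L2y])
      also have "\<dots> \<le> sqrt (C * I)" using hyU(2) by (rule real_sqrt_le_mono)
      also have "\<dots> = sqrt C * L2_norm g" unfolding real_sqrt_mult I_def h_def[abs_def] L2_norm_eq[OF g] ..
      finally show ?thesis .
    qed
    ultimately show ?thesis by blast
  qed
  then show ?thesis by blast
qed

lemma shift_hill_unique: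
  assumes F: "cmod (F z) > 2" and g: "L2_on UNIV g"
    and y: "(y, g) \<in> shift_op (hill_op q) z" "(y', g) \<in> shift_op (hill_op q) z"
  shows "y = y'"
proof -
  have gai: "g absolutely_integrable_on {a..b}" for a b by (rule L2_on_imp_locally_integrable[OF g])
  have \<Gamma>d: "prim g t - prim g s = integral {s..t} g" if "s \<le> t" for s t
    by (rule prim_diff[OF gai that])
  have S: "\<exists>v. solves UNIV z (\<lambda>x. - prim g x) (\<lambda>x. Q x * prim g x) y v" if "(y, g) \<in> shift_op (hill_op q) z" for y
  proof -
    obtain y1 where "sl_equation q UNIV y y1 (\<lambda>x. g x + z * y x)"
      using \<open>(y, g) \<in> shift_op (hill_op q) z\<close> by (auto simp: shift_op_def hill_op_def)
    then have "sl_equation q {- real n..real n} y y1 (\<lambda>x. g x + z * y x)" for n by (simp add: sl_equation_UNIV_iff)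
    then have "solves {- real n..real n} z (\<lambda>x. - prim g x) (\<lambda>x. Q x * prim g x) y (\<lambda>x. y1 x - Q x * y x + prim g x)" for n
      by (rule sl_equation_imp_solves(1)[OF _ gai \<Gamma>d])
    from solves_local[OF this] show ?thesis by blast
  qed
  obtain v where v: "solves UNIV z (\<lambda>x. - prim g x) (\<lambda>x. Q x * prim g x) y v" using S[OF y(1)] by blast
  obtain v' where v': "solves UNIV z (\<lambda>x. - prim g x) (\<lambda>x. Q x * prim g x) y' v'" using S[OF y(2)] by blast
  have D: "solves UNIV z (\<lambda>x. 0) (\<lambda>x. 0) (\<lambda>x. y x - y' x) (\<lambda>x. v x - v' x)"
    using solves_lincomb[OF v v', of 1 "- 1"] by simp
  have L2: "L2_on UNIV y" "L2_on UNIV y'" using y by (auto simp: shift_op_def hill_op_def)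
  have "(\<lambda>x. (cmod (y x - y' x))\<^sup>2) integrable_on UNIV"
  proof (rule measurable_bounded_by_integrable_imp_integrable[of _ _ "\<lambda>x. 2 * (cmod (y x))\<^sup>2 + 2 * (cmod (y' x))\<^sup>2"])
    show "(\<lambda>x. (cmod (y x - y' x))\<^sup>2) \<in> borel_measurable (lebesgue_on UNIV)"
      using L2 by (auto simp: lebesgue_on_UNIV_eq L2_on_UNIV_iff)
    show "(\<lambda>x. 2 * (cmod (y x))\<^sup>2 + 2 * (cmod (y' x))\<^sup>2) integrable_on UNIV"
      using L2 by (intro integrable_add integrable_on_mult_right) (auto simp: L2_on_UNIV_iff)
    fix x
    have "(cmod (y x - y' x))\<^sup>2 \<le> (cmod (y x) + cmod (y' x))\<^sup>2"
      by (intro power_mono norm_triangle_ineq4) auto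
    also have "\<dots> = 2 * (cmod (y x))\<^sup>2 + 2 * (cmod (y' x))\<^sup>2 - (cmod (y x) - cmod (y' x))\<^sup>2"
      by (simp add: power2_eq_square algebra_simps)
    also have "\<dots> \<le> 2 * (cmod (y x))\<^sup>2 + 2 * (cmod (y' x))\<^sup>2" by simp
    finally show "norm ((cmod (y x - y' x))\<^sup>2) \<le> 2 * (cmod (y x))\<^sup>2 + 2 * (cmod (y' x))\<^sup>2" by simp
  qed simp
  from homogeneous_L2_eq_0[OF D this F] show ?thesis by (simp add: fun_eq_iff)
qed

lemma in_resolvent_if_hyperbolic:
  assumes \<rho>: "\<rho> \<noteq> 0" "cmod \<rho> < 1" "F z = \<rho> + 1 / \<rho>" and F: "cmod (F z) > 2"
  shows "z \<notin> hill_spectrum q"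
proof -
  obtain C where C: "\<And>g. L2_on UNIV g \<Longrightarrow> \<exists>y. (y, g) \<in> shift_op (hill_op q) z \<and> L2_norm y \<le> C * L2_norm g"
    using inhomogeneous_L2_solution[OF \<rho>] by blast
  have "\<forall>f. L2_on UNIV f \<longrightarrow> (\<exists>!y. (y, f) \<in> shift_op (hill_op q) z) \<and>
     (\<forall>y. (y, f) \<in> shift_op (hill_op q) z \<longrightarrow> L2_norm y \<le> C * L2_norm f)"
    using C shift_hill_unique[OF F] by metis
  then show ?thesis unfolding hill_spectrum_def hill_resolvent_set_def by blast
qed

lemma Re_F: "F (of_real x) = of_real (Re (F (of_real x)))"
  using F_real by (simp add: of_real_Re)

text \<open>A real value \<open>f\<close> of the trace is \<open>2 cos t\<close> for some
  \<open>t\<close> if \<open>\<bar>f\<bar> \<le> 2\<close>, and otherwise \<open>r + 1 / r\<close>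
  with real \<open>r\<close>, \<open>\<bar>r\<bar> < 1\<close>. These are the elliptic or parabolic
  and the hyperbolic case of the monodromy matrix.\<close>

theorem real_spectrum_iff: "x \<in> re_part (hill_spectrum q) \<longleftrightarrow> \<bar>Re (F (of_real x))\<bar> \<le> 2"
proof -
  define f where "f = Re (F (of_real x))"
  have Ff: "F (of_real x) = of_real f" unfolding f_def by (rule Re_F)
  show ?thesis
  proof (cases "\<bar>f\<bar> \<le> 2")
    case True
    then have "2 * cos (arccos (f / 2)) = f" by (subst cos_arccos) auto
    then have "F (of_real x) = of_real (2 * cos (arccos (f / 2)))" by (simp only: Ff)
    then have "F (of_real x) = 2 * of_real (cos (arccos (f / 2)))" by simp
    from in_spectrum_if_Floquet[OF this] True show ?thesis by (simp add: re_part_def f_def)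
  next
    case False
    define d where "d = sqrt (f\<^sup>2 - 4)"
    \<comment> \<open>The root of smaller modulus of \<open>r\<^sup>2 - f * r + 1 = 0\<close>; the
      factor \<open>sgn f\<close> selects it for either sign of \<open>f\<close>.\<close>
    define r where "r = (f - sgn f * d) / 2"
    have f4: "f\<^sup>2 > 4" using False power_strict_mono[of 2 "\<bar>f\<bar>" 2] by simp
    have d: "d > 0" "d\<^sup>2 = f\<^sup>2 - 4" using f4 by (auto simp: d_def)
    have df: "d < \<bar>f\<bar>" using d f4 power2_less_imp_less[of d "\<bar>f\<bar>"] by simp
    have sg: "sgn f * sgn f = 1" "f = sgn f * \<bar>f\<bar>" using False by (auto simp: sgn_if)
    have r1: "r = sgn f * (\<bar>f\<bar> - d) / 2" using sg(2) by (simp add: r_def algebra_simps)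
    define s where "s = sgn f * (\<bar>f\<bar> + d) / 2"
    have rs: "r * s = 1"
    proof -
      have "(\<bar>f\<bar> - d) * (\<bar>f\<bar> + d) = \<bar>f\<bar>\<^sup>2 - d\<^sup>2" by (simp add: power2_eq_square algebra_simps)
      also have "\<dots> = 4" by (simp add: d(2))
      finally have "(\<bar>f\<bar> - d) * (\<bar>f\<bar> + d) = 4" .
      moreover have "r * s = (sgn f * sgn f) * ((\<bar>f\<bar> - d) * (\<bar>f\<bar> + d)) / 4" unfolding r1 s_def by (simp only: times_divide_times_eq mult_ac)
      ultimately show ?thesis using sg(1) by simp
    qed
    have "s = (f + sgn f * d) / 2" using sg(2) by (simp add: s_def distrib_left)
    then have "r + s = f" unfolding r_def by (simp add: field_simps)
    moreover have r0: "r \<noteq> 0" using rs by auto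
    moreover have "s = 1 / r" using rs r0 by (simp add: field_simps)
    ultimately have fr: "f = r + 1 / r" by simp
    have "f \<noteq> 0" using False by auto
    then have "\<bar>r\<bar> < \<bar>s\<bar>" using d df by (simp add: r1 s_def abs_mult sgn_if)
    then have "\<bar>r\<bar> * \<bar>r\<bar> < \<bar>r\<bar> * \<bar>s\<bar>" by (rule mult_strict_left_mono) (simp add: r0)
    also have "\<dots> = 1" using rs by (simp flip: abs_mult)
    finally have "\<bar>r\<bar> * \<bar>r\<bar> < 1" .
    then have "\<bar>r\<bar> < 1" using mult_mono[of 1 "\<bar>r\<bar>" 1 "\<bar>r\<bar>"] by (cases "1 \<le> \<bar>r\<bar>") auto
    moreover have "F (of_real x) = of_real r + 1 / of_real r"
      unfolding Ff using arg_cong[OF fr, of complex_of_real] by simp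
    moreover have "cmod (F (of_real x)) > 2" using False by (simp add: Ff)
    ultimately have "of_real x \<notin> hill_spectrum q"
      using in_resolvent_if_hyperbolic[of "of_real r" "of_real x"] r0 by simp
    then show ?thesis using False by (simp add: re_part_def f_def)
  qed
qed

end

subsection \<open>Collision of two eigenvalues\<close>

text \<open>\<open>\<mu>\<close> and \<open>\<nu>\<close> are the two solutions of \<open>G = 2 cos s\<close> near a bump of \<open>G\<close> over \<open>[c, d]\<close>. As \<open>s\<close>
  decreases to \<open>0\<close> they either stay apart, leaving a gap where \<open>G > 2\<close>, or collide below the level \<open>2\<close>.\<close>

lemma two_branch_alternative:
  fixes G G' :: "real \<Rightarrow> real" and \<mu> \<nu> :: "real \<Rightarrow> complex"
  assumes h: "0 < h" "h \<le> pi"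
    and G: "\<And>x. (G has_real_derivative G' x) (at x)"
    and cont: "continuous_on {0..h} \<mu>" "continuous_on {0..h} \<nu>"
    and cd: "c < d" "\<mu> h = of_real c" "\<nu> h = of_real d"
    and G\<mu>: "\<And>s x. s \<in> {0..h} \<Longrightarrow> \<mu> s = of_real x \<Longrightarrow> G x = 2 * cos s"
    and G\<nu>: "\<And>s x. s \<in> {0..h} \<Longrightarrow> \<nu> s = of_real x \<Longrightarrow> G x = 2 * cos s"
    and cover: "\<And>s x. s \<in> {0..h} \<Longrightarrow> x \<in> {c..d} \<Longrightarrow> G x = 2 * cos s \<Longrightarrow> \<mu> s = of_real x \<or> \<nu> s = of_real x"
    and crit: "\<And>x. \<mu> 0 \<noteq> \<nu> 0 \<Longrightarrow> \<mu> 0 = of_real x \<or> \<nu> 0 = of_real x \<Longrightarrow> G' x \<noteq> 0"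
    and G'c: "G' c > 0"
    and real0: "\<And>x. \<mu> 0 = of_real x \<or> \<nu> 0 = of_real x \<Longrightarrow> x \<in> {c..d}"
  obtains
    (gap) x1 x2 where "\<mu> 0 = of_real x1" "\<nu> 0 = of_real x2" "c < x1" "x1 < x2" "x2 < d"
      "\<And>x. x \<in> {x1<..<x2} \<Longrightarrow> G x > 2"
      "\<And>s. s \<in> {0..h} \<Longrightarrow> \<exists>y1 y2. \<mu> s = of_real y1 \<and> \<nu> s = of_real y2 \<and> y1 \<le> x1 \<and> x2 \<le> y2"
  | (no_gap) "\<And>x. x \<in> {c..d} \<Longrightarrow> 2 * cos h \<le> G x \<and> G x \<le> 2" "\<mu> 0 = \<nu> 0 \<or> \<mu> 0 \<notin> \<real> \<and> \<nu> 0 \<notin> \<real>"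
proof -
  have Gc: "G c = 2 * cos h" and Gd: "G d = 2 * cos h" using G\<mu>[of h c] G\<nu>[of h d] cd h by auto
  have cosh: "cos h < 1" using cos_monotone_0_pi[of 0 h] h by simp
  have Gcont: "continuous_on S G" for S
    using G by (meson DERIV_isCont continuous_at_imp_continuous_on)
  \<comment> \<open>Just to the right of \<open>c\<close> the function exceeds
    \<open>2 cos h\<close>. A dip below that level would produce a further solution strictly between
    \<open>c\<close> and \<open>d\<close>, but at \<open>s = h\<close> the branches only take the
    values \<open>c\<close> and \<open>d\<close>.\<close>
  have low: "2 * cos h \<le> G x" if x: "x \<in> {c..d}" for x
  proof (rule ccontr)
    assume n: "\<not> 2 * cos h \<le> G x"
    then have xs: "c < x" "x < d" using x Gc Gd by (auto simp: less_le)
    obtain e where e: "e > 0" "\<And>k. 0 < k \<Longrightarrow> k < e \<Longrightarrow> G c < G (c + k)"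
      using DERIV_pos_inc_right[OF G[of c] G'c] by blast
    define k where "k = min (e / 2) ((x - c) / 2)"
    have k: "0 < k" "k < e" "c + k < x" using e(1) xs by (auto simp: k_def min_def field_simps)
    have "\<exists>x'. c + k \<le> x' \<and> x' \<le> x \<and> G x' = 2 * cos h"
      using k e(2)[of k] n Gc by (intro IVT2' Gcont) auto
    then obtain x' where x': "c + k \<le> x'" "x' \<le> x" "G x' = 2 * cos h" by blast
    then have "\<mu> h = of_real x' \<or> \<nu> h = of_real x'"
      using cover[of h x'] h xs k by auto
    then show False using cd x' xs k by auto
  qed
  show ?thesis
  proof (cases "\<exists>x\<in>{c..d}. G x > 2")
    case True
    then obtain x0 where x0: "c < x0" "x0 < d" "G x0 > 2"
      using Gc Gd cosh by (metis atLeastAtMost_iff less_le mult_le_cancel_left_pos not_less zero_less_numeral mult.right_neutral)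
    \<comment> \<open>A point \<open>x0\<close> above level 2 separates two solutions of
      \<open>G = 2 cos s\<close>, one on each side. By \<open>cover\<close> these are the two
      branches, which are therefore real and distinct.\<close>
    have two: "\<exists>y1 y2. y1 \<in> {c..<x0} \<and> y2 \<in> {x0<..d} \<and> G y1 = 2 * cos s \<and> G y2 = 2 * cos s \<and>
       (\<mu> s = of_real y1 \<and> \<nu> s = of_real y2 \<or> \<mu> s = of_real y2 \<and> \<nu> s = of_real y1)" if s: "s \<in> {0..h}" for s
    proof -
      have cs: "cos h \<le> cos s" using s h by (intro cos_monotone_0_pi_le) auto
      have c1: "2 * cos s < G x0" using x0(3) cos_le_one[of s] by linarith
      have "\<exists>y. c \<le> y \<and> y \<le> x0 \<and> G y = 2 * cos s"
        using cs c1 x0 Gc by (intro IVT' Gcont) auto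
      moreover have "\<exists>y. x0 \<le> y \<and> y \<le> d \<and> G y = 2 * cos s"
        using cs c1 x0 Gd by (intro IVT2' Gcont) auto
      ultimately obtain y1 y2 where y: "c \<le> y1" "y1 \<le> x0" "G y1 = 2 * cos s" "x0 \<le> y2" "y2 \<le> d" "G y2 = 2 * cos s" by blast
      have ne: "y1 \<noteq> x0" "y2 \<noteq> x0" using y c1 by auto
      have "\<mu> s = of_real y1 \<or> \<nu> s = of_real y1" "\<mu> s = of_real y2 \<or> \<nu> s = of_real y2"
        using cover[OF s, of y1] cover[OF s, of y2] y x0 by auto
      moreover have "complex_of_real y1 \<noteq> of_real y2" using y ne by auto
      ultimately show ?thesis using y ne by (intro exI[of _ y1] exI[of _ y2]) auto
    qed
    \<comment> \<open>Neither branch can pass \<open>x0\<close>, so by continuity in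
      \<open>s\<close> each stays on the side where it is at \<open>s = h\<close>.\<close>
    have side: "Re (\<mu> s) < x0 \<and> x0 < Re (\<nu> s)" if s: "s \<in> {0..h}" for s
    proof -
      have nx: "Re (\<mu> r) \<noteq> x0 \<and> Re (\<nu> r) \<noteq> x0" if "r \<in> {0..h}" for r
        using two[OF that] by auto
      have cm: "continuous_on {s..h} (\<lambda>r. Re (\<mu> r))" "continuous_on {s..h} (\<lambda>r. Re (\<nu> r))"
        using s by (auto intro!: continuous_intros continuous_on_subset[OF cont(1)] continuous_on_subset[OF cont(2)])
      have "\<not> x0 < Re (\<mu> s)"
      proof
        assume "x0 < Re (\<mu> s)"
        then have "\<exists>r. s \<le> r \<and> r \<le> h \<and> Re (\<mu> r) = x0"
          using s cd x0 by (intro IVT2' cm) auto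
        then obtain r where "s \<le> r" "r \<le> h" "Re (\<mu> r) = x0" by blast
        then show False using nx[of r] s by simp
      qed
      moreover have "\<not> Re (\<nu> s) < x0"
      proof
        assume "Re (\<nu> s) < x0"
        then have "\<exists>r. s \<le> r \<and> r \<le> h \<and> Re (\<nu> r) = x0"
          using s cd x0 by (intro IVT' cm) auto
        then obtain r where "s \<le> r" "r \<le> h" "Re (\<nu> r) = x0" by blast
        then show False using nx[of r] s by simp
      qed
      ultimately show ?thesis using nx[OF s] by auto
    qed
    have real: "\<exists>y1 y2. y1 \<in> {c..<x0} \<and> y2 \<in> {x0<..d} \<and> G y1 = 2 * cos s \<and> G y2 = 2 * cos s \<and> \<mu> s = of_real y1 \<and> \<nu> s = of_real y2"
      if s: "s \<in> {0..h}" for s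
      using two[OF s] side[OF s] by fastforce
    have h0: "0 \<in> {0..h}" using h by auto
    obtain x1 x2 where x12: "x1 \<in> {c..<x0}" "x2 \<in> {x0<..d}" "G x1 = 2" "G x2 = 2" "\<mu> 0 = of_real x1" "\<nu> 0 = of_real x2"
      using real[OF h0] by auto
    have only: "x = x1 \<or> x = x2" if "x \<in> {c..d}" "G x = 2" for x
      using cover[OF h0 that(1)] that(2) x12 by auto
    have above: "G x > 2" if x: "x \<in> {x1<..<x2}" for x
    proof (rule ccontr)
      assume n: "\<not> G x > 2"
      consider "x < x0" | "x = x0" | "x0 < x" by linarith
      then show False
      proof cases
        case 1
        then have "\<exists>y. x \<le> y \<and> y \<le> x0 \<and> G y = 2" using n x0 by (intro IVT' Gcont) auto
        then obtain y where y: "x \<le> y" "y \<le> x0" "G y = 2" by blast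
        then show False using only[of y] x x0 x12 by auto
      next
        case 3
        then have "\<exists>y. x0 \<le> y \<and> y \<le> x \<and> G y = 2" using n x0 by (intro IVT2' Gcont) auto
        then obtain y where y: "x0 \<le> y" "y \<le> x" "G y = 2" by blast
        then show False using only[of y] x x0 x12 by auto
      qed (use n x0 in auto)
    qed
    show ?thesis
    proof (rule gap[OF x12(5,6)])
      show "c < x1" "x2 < d" using x12 Gc Gd cosh by (auto simp: less_le)
      show "x1 < x2" using x12 by auto
      show "G x > 2" if "x \<in> {x1<..<x2}" for x by (rule above[OF that])
      show "\<exists>y1 y2. \<mu> s = of_real y1 \<and> \<nu> s = of_real y2 \<and> y1 \<le> x1 \<and> x2 \<le> y2" if s: "s \<in> {0..h}" for s
      proof -
        obtain y1 y2 where y: "y1 \<in> {c..<x0}" "y2 \<in> {x0<..d}" "G y1 = 2 * cos s" "G y2 = 2 * cos s" "\<mu> s = of_real y1" "\<nu> s = of_real y2"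
          using real[OF s] by blast
        have "G y1 \<le> 2" "G y2 \<le> 2" using y cos_le_one[of s] by auto
        then have "y1 \<notin> {x1<..<x2}" "y2 \<notin> {x1<..<x2}" using above by force+
        then show ?thesis using y x12 by (intro exI[of _ y1] exI[of _ y2]) auto
      qed
    qed
  next
    case False
    then have up: "G x \<le> 2" if "x \<in> {c..d}" for x using that by (meson not_less)
    \<comment> \<open>A real end value lies at level 2, the maximum of \<open>G\<close> on
      \<open>[c, d]\<close>, in the interior. It would be critical, which \<open>crit\<close>
      excludes for distinct branches.\<close>
    have no: "\<not> (\<mu> 0 = of_real x \<or> \<nu> 0 = of_real x)" if ne: "\<mu> 0 \<noteq> \<nu> 0" for x
    proof
      assume a: "\<mu> 0 = of_real x \<or> \<nu> 0 = of_real x"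
      have x: "x \<in> {c..d}" by (rule real0[OF a])
      have Gx: "G x = 2" using a G\<mu>[of 0 x] G\<nu>[of 0 x] h by auto
      then have xs: "c < x" "x < d" using x Gc Gd cosh by (auto simp: less_le)
      have "G' x = 0"
      proof (rule DERIV_local_max[OF G])
        show "0 < min (x - c) (d - x)" using xs by simp
        show "\<forall>y. \<bar>x - y\<bar> < min (x - c) (d - x) \<longrightarrow> G y \<le> G x"
        proof (intro allI impI)
          fix y assume "\<bar>x - y\<bar> < min (x - c) (d - x)"
          then have "y \<in> {c..d}" by (auto simp: abs_less_iff)
          then show "G y \<le> G x" using up Gx by simp
        qed
      qed
      then show False using crit[OF ne a] by simp
    qed
    have "\<mu> 0 = \<nu> 0 \<or> \<mu> 0 \<notin> \<real> \<and> \<nu> 0 \<notin> \<real>"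
      using no unfolding Reals_def by blast
    then show ?thesis using no_gap low up by blast
  qed
qed

subsection \<open>Gaps between two real bands\<close>

text \<open>The interval is a component because its end points belong to the spectrum, so a
  connected set leaving it would meet one of them. Uniqueness: the bands contain \<open>x1\<close>
  and \<open>x2\<close>, hence a gap between them lies inside the interval, and components are
  maximal.\<close>

lemma gap_between_iff:
  assumes x: "x1 < x2" "x1 \<in> re_part (band lam m)" "x2 \<in> re_part (band lam n)"
    and b: "\<And>x. x \<in> re_part (band lam m) \<Longrightarrow> x \<le> x1" "\<And>x. x \<in> re_part (band lam n) \<Longrightarrow> x2 \<le> x"
    and S: "x1 \<in> re_part (hill_spectrum q)" "x2 \<in> re_part (hill_spectrum q)"
      "\<And>x. x \<in> {x1<..<x2} \<Longrightarrow> x \<notin> re_part (hill_spectrum q)"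
    and A: "band_start lam (- N) \<le> x1"
  shows "gap_between q lam N m n I \<longleftrightarrow> I = {x1<..<x2}"
proof -
  define H where "H = {band_start lam (- N)..}"
  define U where "U = H - (re_part (hill_spectrum q) \<inter> H)"
  have sub: "{x1<..<x2} \<subseteq> U" using S(3) A by (auto simp: U_def H_def)
  have nU: "x1 \<notin> U" "x2 \<notin> U" using S(1,2) by (auto simp: U_def)
  have comp: "{x1<..<x2} \<in> components U"
    unfolding in_components_maximal
  proof (intro conjI allI impI)
    show "{x1<..<x2} \<noteq> {}" using x(1) by simp
    show "{x1<..<x2} \<subseteq> U" by (rule sub)
    show "connected {x1<..<x2}" by (rule connected_Ioo)
    fix D assume D: "D \<noteq> {} \<and> {x1<..<x2} \<subseteq> D \<and> D \<subseteq> U \<and> connected D"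
    define mid where "mid = (x1 + x2) / 2"
    have "x1 < mid" "mid < x2" using x(1) by (auto simp: mid_def field_simps)
    with D have mid: "mid \<in> D" "x1 < mid" "mid < x2" by auto
    have "z \<in> {x1<..<x2}" if z: "z \<in> D" for z
    proof (rule ccontr)
      assume "z \<notin> {x1<..<x2}"
      then consider "z \<le> x1" | "x2 \<le> z" by force
      then show False
      proof cases
        case 1
        then have "{z..mid} \<subseteq> D" using D z mid by (intro connected_contains_Icc) auto
        moreover have "x1 \<in> {z..mid}" using 1 mid by simp
        ultimately have "x1 \<in> U" using D by blast
        then show False using nU by simp
      next
        case 2
        then have "{mid..z} \<subseteq> D" using D z mid by (intro connected_contains_Icc) auto
        moreover have "x2 \<in> {mid..z}" using 2 mid by simp
        ultimately have "x2 \<in> U" using D by blast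
        then show False using nU by simp
      qed
    qed
    then show "D = {x1<..<x2}" using D by blast
  qed
  have lb: "lies_between {x1<..<x2} (re_part (band lam m)) (re_part (band lam n))"
    unfolding lies_between_def using b by force
  have "I = {x1<..<x2}" if I: "I \<in> components U" "I \<noteq> {}" "lies_between I (re_part (band lam m)) (re_part (band lam n))" for I
  proof -
    have "I \<subseteq> {x1<..<x2}"
      using I(2,3) x unfolding lies_between_def by force
    moreover have "\<forall>D. D \<noteq> {} \<and> I \<subseteq> D \<and> D \<subseteq> U \<and> connected D \<longrightarrow> D = I"
      using I(1) unfolding in_components_maximal by blast
    ultimately show ?thesis using sub x(1) connected_Ioo by (metis greaterThanLessThan_empty_iff not_le)
  qed
  then show ?thesis
    using comp lb x(1) in_components_nonempty unfolding gap_between_def is_gap_def Let_def H_def[symmetric] U_def[symmetric] by blast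
qed

text \<open>The bands contain \<open>c\<close> and \<open>d\<close>, so a point of a gap between
  them would lie in \<open>[c, d]\<close>, which consists of spectrum.\<close>

lemma no_gap_between:
  assumes "c < d" "c \<in> re_part (band lam m)" "d \<in> re_part (band lam n)" "{c..d} \<subseteq> re_part (hill_spectrum q)"
  shows "\<not> gap_between q lam N m n I"
proof
  assume g: "gap_between q lam N m n I"
  define H where "H = {band_start lam (- N)..}"
  have I: "I \<in> components (H - (re_part (hill_spectrum q) \<inter> H))" "lies_between I (re_part (band lam m)) (re_part (band lam n))"
    using g by (auto simp: gap_between_def is_gap_def Let_def H_def)
  have ne: "I \<noteq> {}" and sub: "I \<subseteq> H - (re_part (hill_spectrum q) \<inter> H)"
    using in_components_nonempty[OF I(1)] in_components_subset[OF I(1)] by auto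
  obtain g where gI: "g \<in> I" using ne by blast
  have "c < g \<and> g < d" using I(2) gI assms(1-3) unfolding lies_between_def by force
  then have "g \<in> {c..d}" by simp
  then show False using gI sub assms(4) by blast
qed

lemma derivative_nonneg_if_max_left:
  fixes f :: "real \<Rightarrow> real"
  assumes "(f has_real_derivative D) (at c)" "p < c" "\<And>x. p < x \<Longrightarrow> x < c \<Longrightarrow> f x < f c"
  shows "D \<ge> 0"
proof (rule ccontr)
  assume "\<not> D \<ge> 0"
  then obtain e where e: "e > 0" "\<And>k. 0 < k \<Longrightarrow> k < e \<Longrightarrow> f c < f (c - k)"
    using DERIV_neg_dec_left[OF assms(1)] by auto
  define k where "k = min (e / 2) ((c - p) / 2)"
  have "0 < k" "k < e" "p < c - k" using e(1) assms(2) by (auto simp: k_def min_def field_simps)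
  then show False using e(2)[of k] assms(3)[of "c - k"] by simp
qed

section \<open>Numerical estimates for the positions of the eigenvalues\<close>

lemma hstep_bounds: "hstep > 0" "pi * hstep = 1 / 20" "hstep < 1 / 60" "hstep\<^sup>2 \<le> 1" "0 \<le> hstep\<^sup>2" "hstep < pi - hstep"
proof -
  show h0: "hstep > 0" and "pi * hstep = 1 / 20" by (auto simp: hstep_def)
  show h1: "hstep < 1 / 60" using pi_gt3 by (simp add: hstep_def field_simps)
  show "hstep\<^sup>2 \<le> 1" using h0 h1 by (simp add: power_le_one)
  show "0 \<le> hstep\<^sup>2" by simp
  show "hstep < pi - hstep" using h1 pi_gt3 by linarith
qed

text \<open>With \<open>pi * hstep = 1 / 20\<close> the mixed terms become rational, for instance
  \<open>X * hstep = m / 10\<close>. All later comparisons of squares are then linear in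
  \<open>X\<^sup>2\<close>, \<open>X * pi\<close>, \<open>m\<close>, \<open>pi\<^sup>2\<close> and
  \<open>hstep\<^sup>2\<close>.\<close>

lemma numeric_facts:
  fixes m :: real
  assumes "m \<ge> 1"
  defines "X \<equiv> 2 * pi * m"
  shows "X \<ge> 6" "X * pi \<ge> 18 * m" "X * pi \<ge> 2 * pi\<^sup>2" "pi\<^sup>2 \<ge> 9"
    "(X + hstep)\<^sup>2 = X\<^sup>2 + m / 5 + hstep\<^sup>2"
    "(X - hstep)\<^sup>2 = X\<^sup>2 - m / 5 + hstep\<^sup>2"
    "(X + pi - hstep)\<^sup>2 = X\<^sup>2 + 2 * (X * pi) - m / 5 + pi\<^sup>2 - 1 / 10 + hstep\<^sup>2"
    "(X + pi + hstep)\<^sup>2 = X\<^sup>2 + 2 * (X * pi) + m / 5 + pi\<^sup>2 + 1 / 10 + hstep\<^sup>2"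
    "(X - pi + hstep)\<^sup>2 = X\<^sup>2 - 2 * (X * pi) + m / 5 + pi\<^sup>2 - 1 / 10 + hstep\<^sup>2"
    "(X + 2 * pi - hstep)\<^sup>2 = X\<^sup>2 + 4 * (X * pi) - m / 5 + 4 * pi\<^sup>2 - 1 / 5 + hstep\<^sup>2"
    "(X + pi)\<^sup>2 = X\<^sup>2 + 2 * (X * pi) + pi\<^sup>2"
    "X\<^sup>2 \<ge> 36 * m" "2 * pi\<^sup>2 * m \<ge> 18 * m"
proof -
  have p3: "pi > 3" by (rule pi_gt3)
  have pp: "pi * pi \<ge> 9" using mult_mono[of 3 pi 3 pi] p3 by simp
  then show p9: "pi\<^sup>2 \<ge> 9" by (simp add: power2_eq_square)
  have ppm: "pi * pi * m \<ge> 9 * m" using pp assms(1) by (intro mult_right_mono) auto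
  show "X \<ge> 6" using mult_mono[of 3 pi 1 m] p3 assms(1) by (simp add: X_def)
  have W: "X * pi = 2 * (pi * pi * m)" by (simp add: X_def)
  show "X * pi \<ge> 18 * m" using ppm W by linarith
  show "2 * pi\<^sup>2 * m \<ge> 18 * m" using ppm by (simp add: power2_eq_square)
  have "pi * pi * 1 \<le> pi * pi * m" using assms(1) pp by (intro mult_left_mono) auto
  then show "X * pi \<ge> 2 * pi\<^sup>2" using W by (simp add: power2_eq_square)
  have "pi * pi * m * 1 \<le> pi * pi * m * m" using assms(1) pp by (intro mult_left_mono) auto
  moreover have "X\<^sup>2 = 4 * (pi * pi * m * m)" by (simp add: X_def power2_eq_square)
  ultimately show "X\<^sup>2 \<ge> 36 * m" using ppm by linarith
  have Xh: "X * hstep = m / 10" using hstep_bounds(2) by (simp add: X_def mult_ac)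
  note e = Xh hstep_bounds(2)
  have expand: "(X + a * pi + b * hstep)\<^sup>2 = X\<^sup>2 + 2 * a * (X * pi) + 2 * b * (X * hstep) + a\<^sup>2 * pi\<^sup>2 + 2 * a * b * (pi * hstep) + b\<^sup>2 * hstep\<^sup>2" for a b
    by (simp add: power2_eq_square algebra_simps)
  show "(X + hstep)\<^sup>2 = X\<^sup>2 + m / 5 + hstep\<^sup>2" using expand[of 0 1] unfolding e by simp
  show "(X - hstep)\<^sup>2 = X\<^sup>2 - m / 5 + hstep\<^sup>2" using expand[of 0 "-1"] unfolding e by simp
  show "(X + pi - hstep)\<^sup>2 = X\<^sup>2 + 2 * (X * pi) - m / 5 + pi\<^sup>2 - 1 / 10 + hstep\<^sup>2" using expand[of 1 "-1"] unfolding e by simp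
  show "(X + pi + hstep)\<^sup>2 = X\<^sup>2 + 2 * (X * pi) + m / 5 + pi\<^sup>2 + 1 / 10 + hstep\<^sup>2" using expand[of 1 1] unfolding e by simp
  show "(X - pi + hstep)\<^sup>2 = X\<^sup>2 - 2 * (X * pi) + m / 5 + pi\<^sup>2 - 1 / 10 + hstep\<^sup>2" using expand[of "-1" 1] unfolding e by simp
  show "(X + 2 * pi - hstep)\<^sup>2 = X\<^sup>2 + 4 * (X * pi) - m / 5 + 4 * pi\<^sup>2 - 1 / 5 + hstep\<^sup>2" using expand[of 2 "-1"] unfolding e by simp
  show "(X + pi)\<^sup>2 = X\<^sup>2 + 2 * (X * pi) + pi\<^sup>2" using expand[of 1 0] unfolding e by simp
qed

subsection \<open>Bands with large index\<close>

locale hill_bands = hill +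
  fixes lam :: "int \<Rightarrow> real \<Rightarrow> complex" and N :: int
  assumes numbering: "hill_numbering q lam"
    and threshold: "numbering_threshold q lam N"
begin

definition f :: "real \<Rightarrow> real" where "f x = Re (F (of_real x))"

definition f' :: "real \<Rightarrow> real" where "f' x = Re (deriv F (of_real x))"

definition L :: "int \<Rightarrow> real \<Rightarrow> real" where "L k t = Re (lam k t)"

lemma F_of_real: "F (of_real x) = of_real (f x)"
  unfolding f_def by (rule Re_F)

lemma F_derivative: "(F has_field_derivative deriv F z) (at z)"
  using F_holomorphic[of UNIV] holomorphic_derivI[of F UNIV z] by simp

lemma f_derivative: "(f has_real_derivative f' x) (at x)"
  and deriv_F_real: "deriv F (of_real x) = of_real (f' x)"
proof -
  have "((\<lambda>x. F (of_real x)) has_vector_derivative deriv F (of_real x)) (at x)"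
    using has_vector_derivative_real_field[OF F_derivative] by (simp add: o_def)
  then have D: "((\<lambda>x. complex_of_real (f x)) has_vector_derivative deriv F (of_real x)) (at x)"
    by (simp add: F_of_real)
  have "((\<lambda>x. Re (complex_of_real (f x))) has_vector_derivative Re (deriv F (of_real x))) (at x)"
    by (rule bounded_linear.has_vector_derivative[OF bounded_linear_Re D])
  then show "(f has_real_derivative f' x) (at x)"
    by (simp add: f'_def has_real_derivative_iff_has_vector_derivative)
  have "((\<lambda>x. Im (complex_of_real (f x))) has_vector_derivative Im (deriv F (of_real x))) (at x)"
    by (rule bounded_linear.has_vector_derivative[OF bounded_linear_Im D])
  then have "Im (deriv F (of_real x)) = 0"
    using vector_derivative_unique_at[of "\<lambda>x. 0::real" _ x 0] by simp
  then show "deriv F (of_real x) = of_real (f' x)"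
    by (simp add: f'_def complex_eq_iff)
qed

lemma
  assumes "t \<in> {0..pi}"
  shows finite_index: "finite {n. lam n t = z}" and card_index: "card {n. lam n t = z} = alg_mult q t z"
proof -
  have "t \<in> {- pi<..pi}" using assms pi_gt_zero by (auto intro: less_le_trans[of _ 0])
  then show "finite {n. lam n t = z}" "card {n. lam n t = z} = alg_mult q t z"
    using numbering unfolding hill_numbering_def by blast+
qed

lemma lam_cont: "continuous_on {0..pi} (lam n)"
  using numbering by (auto simp: hill_numbering_def)

lemma eigenvalue_lam: "t \<in> {0..pi} \<Longrightarrow> eigenvalue q t (lam k t)"
  using finite_index[of t "lam k t"] card_index[of t "lam k t"]
  by (intro eigenvalue_if_alg_mult) (metis (mono_tags) card_eq_0_iff empty_iff mem_Collect_eq)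

lemma F_lam: "t \<in> {0..pi} \<Longrightarrow> F (lam k t) = 2 * of_real (cos t)"
  using eigenvalue_lam eigenvalue_iff by blast

lemma f_lam: "t \<in> {0..pi} \<Longrightarrow> lam k t = of_real x \<Longrightarrow> f x = 2 * cos t"
  using F_lam[of t k] by (simp add: f_def)

text \<open>The numbering provides eigenvalues at \<open>t = 0\<close> and at \<open>t = pi\<close>,
  where \<open>F\<close> takes the values 2 and \<open>- 2\<close>.\<close>

lemma F_nonconstant: "\<not> F constant_on UNIV"
proof
  assume "F constant_on UNIV"
  then have "F (lam 0 0) = F (lam 0 pi)" by (auto simp: constant_on_def)
  then show False using F_lam[of 0 0] F_lam[of pi 0] by simp
qed

text \<open>A number occurs in the list as often as its multiplicity says, so completeness of the
  list is positivity of the multiplicity.\<close>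

lemma lam_exists:
  assumes "t \<in> {0..pi}" "f x = 2 * cos t"
  shows "\<exists>k. lam k t = of_real x"
proof -
  have "F (of_real x) = 2 * of_real (cos t)" using F_of_real[of x] assms(2) by simp
  then have "alg_mult q t (of_real x) \<noteq> 0" using alg_mult_pos[OF F_nonconstant] eigenvalue_iff by blast
  then show ?thesis using card_index[OF assms(1), of "of_real x"] by (metis (mono_tags) Collect_empty_eq card.empty)
qed

lemma SR_lam_iff:
  assumes t: "t \<in> {0..pi}"
  shows "SR_eigenvalue q t (lam k t) \<longleftrightarrow> lam k t \<in> \<real> \<and> (\<forall>j. j \<noteq> k \<longrightarrow> lam j t \<noteq> lam k t)"
proof -
  have "alg_mult q t (lam k t) = 1 \<longleftrightarrow> {n. lam n t = lam k t} = {k}"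
  proof -
    have "(card {n. lam n t = lam k t} = 1) = (\<exists>x. {n. lam n t = lam k t} = {x})" by (simp add: card_1_singleton_iff)
    moreover have "k \<in> {n. lam n t = lam k t}" by simp
    ultimately show ?thesis unfolding card_index[OF t, symmetric] by (metis singletonD)
  qed
  also have "\<dots> \<longleftrightarrow> (\<forall>j. j \<noteq> k \<longrightarrow> lam j t \<noteq> lam k t)" by auto
  finally show ?thesis using eigenvalue_lam[OF t] by (auto simp: SR_eigenvalue_def)
qed

lemma SR_imp_lam:
  assumes t: "t \<in> {0..pi}" and z: "SR_eigenvalue q t z"
  shows "\<exists>k. lam k t = z"
proof -
  have "card {n. lam n t = z} = 1" using z card_index[OF t] by (simp add: SR_eigenvalue_def)
  then show ?thesis by (metis (mono_tags) Collect_empty_eq card.empty zero_neq_one)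
qed

lemma simple_derivative:
  assumes t: "t \<in> {0..pi}" and k: "lam k t = of_real x" and s: "\<And>j. j \<noteq> k \<Longrightarrow> lam j t \<noteq> lam k t"
  shows "f' x \<noteq> 0"
proof
  assume "f' x = 0"
  then have "(F has_field_derivative 0) (at (of_real x))" using F_derivative[of "of_real x"] deriv_F_real[of x] by simp
  then have "alg_mult q t (of_real x) \<noteq> 1"
    using F_lam[OF t, of k] k by (intro alg_mult_ne_1_if_critical) simp_all
  moreover have "{n. lam n t = of_real x} = {k}" using s k by auto
  ultimately show False using card_index[OF t, of "of_real x"] by simp
qed

lemma spectrum_f: "x \<in> re_part (hill_spectrum q) \<longleftrightarrow> \<bar>f x\<bar> \<le> 2"
  unfolding f_def by (rule real_spectrum_iff)

lemma N_pos: "N > 0" using threshold by (simp add: numbering_threshold_def)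

lemma mid:
  assumes "\<bar>n\<bar> \<ge> N" "t \<in> {hstep..pi - hstep}"
  shows "SR_eigenvalue q t (lam n t)" "lam n t = of_real (L n t)"
    "\<bar>L n t - (2 * pi * of_int n + t)\<^sup>2\<bar> \<le> 1"
proof -
  show S: "SR_eigenvalue q t (lam n t)" using assms threshold by (simp add: numbering_threshold_def)
  then show e: "lam n t = of_real (L n t)" by (simp add: SR_eigenvalue_def L_def of_real_Re)
  have "cmod (lam n t - of_real ((2 * pi * of_int n + t)\<^sup>2)) \<le> real_of_int \<bar>n\<bar> powr (- 1 / 2)"
    using assms threshold by (simp add: numbering_threshold_def)
  also have "\<dots> \<le> 1"
  proof -
    have "1 \<le> real_of_int \<bar>n\<bar>" using assms(1) N_pos by linarith
    then have "real_of_int \<bar>n\<bar> powr (- 1 / 2) \<le> real_of_int \<bar>n\<bar> powr 0" by (intro powr_mono) auto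
    then show ?thesis using N_pos assms(1) by (simp split: if_splits)
  qed
  finally have "cmod (of_real (L n t - (2 * pi * of_int n + t)\<^sup>2)) \<le> 1" unfolding e by simp
  then show "\<bar>L n t - (2 * pi * of_int n + t)\<^sup>2\<bar> \<le> 1" unfolding norm_of_real .
qed

lemma near_0:
  assumes "\<bar>n\<bar> \<ge> N" "t \<in> {0..hstep}"
  shows "{k. cmod (lam k t - of_real ((2 * pi * of_int n + t)\<^sup>2)) < of_int \<bar>n\<bar>} = {n, - n}"
    "k \<notin> {n, - n} \<Longrightarrow> cmod (lam n t - lam k t) > 2 * pi\<^sup>2 * of_int \<bar>n\<bar>"
    "k \<notin> {n, - n} \<Longrightarrow> cmod (lam (- n) t - lam k t) > 2 * pi\<^sup>2 * of_int \<bar>n\<bar>"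
  using assms threshold by (simp_all add: numbering_threshold_def)

lemma near_pi:
  assumes "\<bar>n\<bar> \<ge> N" "t \<in> {pi - hstep..pi}"
  shows "{k. cmod (lam k t - of_real ((2 * pi * of_int n + t)\<^sup>2)) < of_int \<bar>n\<bar>} = {n, - n - 1}"
    "k \<notin> {n, - n - 1} \<Longrightarrow> cmod (lam n t - lam k t) > 2 * pi\<^sup>2 * of_int \<bar>n\<bar>"
    "k \<notin> {n, - n - 1} \<Longrightarrow> cmod (lam (- n - 1) t - lam k t) > 2 * pi\<^sup>2 * of_int \<bar>n\<bar>"
  using assms threshold by (simp_all add: numbering_threshold_def)

lemma near_0_real:
  assumes "\<bar>n\<bar> \<ge> N" "t \<in> {0..hstep}" "k \<in> {n, - n}" "lam k t = of_real x"
  shows "\<bar>x - (2 * pi * of_int n + t)\<^sup>2\<bar> < of_int \<bar>n\<bar>"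
proof -
  have "k \<in> {k. cmod (lam k t - of_real ((2 * pi * of_int n + t)\<^sup>2)) < of_int \<bar>n\<bar>}"
    unfolding near_0(1)[OF assms(1,2)] by (rule assms(3))
  then have "cmod (of_real (x - (2 * pi * of_int n + t)\<^sup>2)) < of_int \<bar>n\<bar>" using assms(4) by simp
  then show ?thesis unfolding norm_of_real .
qed

lemma near_pi_real:
  assumes "\<bar>n\<bar> \<ge> N" "t \<in> {pi - hstep..pi}" "k \<in> {n, - n - 1}" "lam k t = of_real x"
  shows "\<bar>x - (2 * pi * of_int n + t)\<^sup>2\<bar> < of_int \<bar>n\<bar>"
proof -
  have "k \<in> {k. cmod (lam k t - of_real ((2 * pi * of_int n + t)\<^sup>2)) < of_int \<bar>n\<bar>}"
    unfolding near_pi(1)[OF assms(1,2)] by (rule assms(3))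
  then have "cmod (of_real (x - (2 * pi * of_int n + t)\<^sup>2)) < of_int \<bar>n\<bar>" using assms(4) by simp
  then show ?thesis unfolding norm_of_real .
qed

lemma L_cont: "S \<subseteq> {0..pi} \<Longrightarrow> continuous_on S (L n)"
  unfolding L_def[abs_def] by (intro continuous_intros continuous_on_subset[OF lam_cont])

text \<open>The band is real for these \<open>t\<close>, so by connectedness it fills the interval
  between any two of its values; every point there thus gets a level \<open>2 cos s\<close> with a
  known range of \<open>s\<close>.\<close>

lemma mid_range:
  assumes n: "\<bar>n\<bar> \<ge> N" and st: "s1 \<in> {hstep..pi - hstep}" "s2 \<in> {hstep..pi - hstep}"
    and x: "x \<in> {min (L n s1) (L n s2)..max (L n s1) (L n s2)}"
  shows "\<exists>s\<in>{min s1 s2..max s1 s2}. lam n s = of_real x \<and> f x = 2 * cos s"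
proof -
  have sub: "{min s1 s2..max s1 s2} \<subseteq> {hstep..pi - hstep}" "{hstep..pi - hstep} \<subseteq> {0..pi}"
    using st hstep_bounds(1) by auto
  have "connected (L n ` {min s1 s2..max s1 s2})"
    using sub by (intro connected_continuous_image L_cont) auto
  moreover have "L n s1 \<in> L n ` {min s1 s2..max s1 s2}" "L n s2 \<in> L n ` {min s1 s2..max s1 s2}" by auto
  ultimately have "{min (L n s1) (L n s2)..max (L n s1) (L n s2)} \<subseteq> L n ` {min s1 s2..max s1 s2}"
    by (intro connected_contains_Icc) (auto simp: min_def max_def)
  then obtain s where s: "s \<in> {min s1 s2..max s1 s2}" "x = L n s" using x by blast
  have "lam n s = of_real x" using mid(2)[OF n, of s] s sub(1) by (metis subsetD)
  then show ?thesis using s sub f_lam[of s n x] by blast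
qed

lemma cos_inj: "s \<in> {0..pi} \<Longrightarrow> t \<in> {0..pi} \<Longrightarrow> cos s = cos t \<Longrightarrow> s = t"
  using cos_inj_pi by auto

lemma h_in: "hstep \<in> {hstep..pi - hstep}" "pi - hstep \<in> {hstep..pi - hstep}"
  "hstep \<in> {0..pi}" "pi - hstep \<in> {0..pi}" "hstep \<in> {0..hstep}" "pi - hstep \<in> {pi - hstep..pi}"
  "{hstep..pi - hstep} \<subseteq> {0..pi}" "{0..hstep} \<subseteq> {0..pi}" "{pi - hstep..pi} \<subseteq> {0..pi}"
  using hstep_bounds by auto

text \<open>The band is injective in \<open>t\<close> on this range, as the value determines
  \<open>cos t\<close> through \<open>f\<close>; a continuous injective function takes its extreme
  values at the end points.\<close>

lemma mid_between:
  assumes n: "\<bar>n\<bar> \<ge> N" and t: "t \<in> {hstep..pi - hstep}"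
  shows "L n t \<in> {min (L n hstep) (L n (pi - hstep))..max (L n hstep) (L n (pi - hstep))}"
proof (rule ccontr)
  assume c: "\<not> ?thesis"
  have inj: "L n s = L n s' \<Longrightarrow> s = s'" if "s \<in> {hstep..pi - hstep}" "s' \<in> {hstep..pi - hstep}" for s s'
    using that mid(2)[OF n that(1)] mid(2)[OF n that(2)] f_lam[of s n] f_lam[of s' n] h_in(7) cos_inj[of s s'] by auto
  have m: "min hstep t = hstep" "max hstep t = t" "min t (pi - hstep) = t" "max t (pi - hstep) = pi - hstep"
    using t by auto
  have e: "hstep \<noteq> pi - hstep" using hstep_bounds(6) by simp
  have lt: "x \<in> {min (L n s1) (L n s2)..max (L n s1) (L n s2)} \<Longrightarrow> \<exists>s\<in>{min s1 s2..max s1 s2}. L n s = x"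
    if "s1 \<in> {hstep..pi - hstep}" "s2 \<in> {hstep..pi - hstep}" for x s1 s2
    using mid_range[OF n that, of x] unfolding L_def by (metis Re_complex_of_real)
  \<comment> \<open>If the value at \<open>t\<close> were outside, one of the two end values would
    lie between the other one and the value at \<open>t\<close>, and would be attained a second
    time.\<close>
  consider "L n (pi - hstep) \<in> {min (L n hstep) (L n t)..max (L n hstep) (L n t)}"
    | "L n hstep \<in> {min (L n t) (L n (pi - hstep))..max (L n t) (L n (pi - hstep))}"
    using c by (fastforce simp: min_def max_def split: if_splits)
  then show False
  proof cases
    case 1
    then obtain s where s: "s \<in> {hstep..t}" "L n s = L n (pi - hstep)" using lt[OF h_in(1) t 1] m by metis
    then have "s = pi - hstep" using inj[of s "pi - hstep"] t h_in by auto
    then have "t = pi - hstep" using s t by auto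
    then show False using c by (simp add: min_le_iff_disj le_max_iff_disj)
  next
    case 2
    then obtain s where s: "s \<in> {t..pi - hstep}" "L n s = L n hstep" using lt[OF t h_in(2) 2] m by metis
    then have "s = hstep" using inj[of s hstep] t h_in by auto
    then have "t = hstep" using s t by auto
    then show False using c by (simp add: min_le_iff_disj le_max_iff_disj)
  qed
qed

text \<open>The values at \<open>h\<close> and \<open>\<pi> - h\<close>, in the order in which they lie on the real line:
  \<open>P n < C0 n < D0 n < C1 n < D1 n < E n = C0 (n + 1)\<close>.\<close>

abbreviation "P n \<equiv> L (- n) (pi - hstep)"
abbreviation "C0 n \<equiv> L (- n) hstep"
abbreviation "D0 n \<equiv> L n hstep"
abbreviation "C1 n \<equiv> L n (pi - hstep)"
abbreviation "D1 n \<equiv> L (- n - 1) (pi - hstep)"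
abbreviation "E n \<equiv> L (- n - 1) hstep"

lemma endpoints:
  assumes n: "n \<ge> N"
  defines "X \<equiv> 2 * pi * of_int n"
  shows "\<bar>P n - (X - pi + hstep)\<^sup>2\<bar> \<le> 1" "\<bar>C0 n - (X - hstep)\<^sup>2\<bar> \<le> 1" "\<bar>D0 n - (X + hstep)\<^sup>2\<bar> \<le> 1"
    "\<bar>C1 n - (X + pi - hstep)\<^sup>2\<bar> \<le> 1" "\<bar>D1 n - (X + pi + hstep)\<^sup>2\<bar> \<le> 1" "\<bar>E n - (X + 2 * pi - hstep)\<^sup>2\<bar> \<le> 1"
proof -
  have a: "\<bar>n\<bar> \<ge> N" "\<bar>- n\<bar> \<ge> N" "\<bar>- n - 1\<bar> \<ge> N" using n N_pos by auto
  have sq: "(2 * pi * of_int (- n) + (pi - hstep))\<^sup>2 = (X - pi + hstep)\<^sup>2"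
    "(2 * pi * of_int (- n) + hstep)\<^sup>2 = (X - hstep)\<^sup>2"
    "(2 * pi * of_int n + hstep)\<^sup>2 = (X + hstep)\<^sup>2"
    "(2 * pi * of_int n + (pi - hstep))\<^sup>2 = (X + pi - hstep)\<^sup>2"
    "(2 * pi * of_int (- n - 1) + (pi - hstep))\<^sup>2 = (X + pi + hstep)\<^sup>2"
    "(2 * pi * of_int (- n - 1) + hstep)\<^sup>2 = (X + 2 * pi - hstep)\<^sup>2"
    by (simp_all add: X_def power2_eq_square algebra_simps)
  show "\<bar>P n - (X - pi + hstep)\<^sup>2\<bar> \<le> 1" using mid(3)[OF a(2) h_in(2)] unfolding sq .
  show "\<bar>C0 n - (X - hstep)\<^sup>2\<bar> \<le> 1" using mid(3)[OF a(2) h_in(1)] unfolding sq .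
  show "\<bar>D0 n - (X + hstep)\<^sup>2\<bar> \<le> 1" using mid(3)[OF a(1) h_in(1)] unfolding sq .
  show "\<bar>C1 n - (X + pi - hstep)\<^sup>2\<bar> \<le> 1" using mid(3)[OF a(1) h_in(2)] unfolding sq .
  show "\<bar>D1 n - (X + pi + hstep)\<^sup>2\<bar> \<le> 1" using mid(3)[OF a(3) h_in(2)] unfolding sq .
  show "\<bar>E n - (X + 2 * pi - hstep)\<^sup>2\<bar> \<le> 1" using mid(3)[OF a(3) h_in(1)] unfolding sq .
qed

text \<open>Each of the six values is within 1 of the square given by \<open>endpoints\<close>. The
  margins \<open>M\<close> and \<open>M + 1\<close> make room for the discs of radius
  \<open>n\<close> and \<open>n + 1\<close>. The margin \<open>M + 3\<close> covers the error 1 and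
  the change of the square over a short \<open>t\<close>-range, at most
  \<open>2 * M / 5 + 1 / 5\<close>. By the last inequality two such deviations stay below the
  distance to all other eigenvalues.\<close>

lemma order:
  assumes n: "n \<ge> N"
  defines "X \<equiv> 2 * pi * of_int n" and "M \<equiv> real_of_int n"
  shows "M \<ge> 1" "(X - pi + hstep)\<^sup>2 + M < C0 n" "P n < C0 n" "P n < X\<^sup>2 - M" "C0 n < C1 n"
    "(X + hstep)\<^sup>2 + M < C1 n" "D0 n < C1 n" "D0 n < D1 n" "D0 n < (X + pi - hstep)\<^sup>2 - M"
    "D0 n < (X + pi)\<^sup>2 - M" "(X + pi)\<^sup>2 + M < E n" "D1 n < E n" "D1 n < (X + 2 * pi - hstep)\<^sup>2 - (M + 1)"
    "X\<^sup>2 + M < C1 n" "M < C0 n"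
    "D0 n - (X - hstep)\<^sup>2 < M + 3" "(X + hstep)\<^sup>2 - C0 n < M + 3"
    "D1 n - (X + pi - hstep)\<^sup>2 < M + 3" "(X + pi)\<^sup>2 - C1 n < M + 3" "M + (M + 3) < 2 * pi\<^sup>2 * M"
proof -
  have M: "M \<ge> 1" using n N_pos by (simp add: M_def)
  then show "M \<ge> 1" .
  have X: "X = 2 * pi * M" by (simp add: X_def M_def)
  note nf = numeric_facts[OF M, folded X]
  note ep = endpoints[OF n, folded X_def]
  note base = M nf(2-4,12,13) hstep_bounds(4,5)
  show "(X - pi + hstep)\<^sup>2 + M < C0 n" using ep(2) base unfolding nf(5-11) by linarith
  show "P n < C0 n" using ep(1,2) base unfolding nf(5-11) by linarith
  show "P n < X\<^sup>2 - M" using ep(1) base unfolding nf(5-11) by linarith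
  show "C0 n < C1 n" using ep(2,4) base unfolding nf(5-11) by linarith
  show "(X + hstep)\<^sup>2 + M < C1 n" using ep(4) base unfolding nf(5-11) by linarith
  show "D0 n < C1 n" using ep(3,4) base unfolding nf(5-11) by linarith
  show "D0 n < D1 n" using ep(3,5) base unfolding nf(5-11) by linarith
  show "D0 n < (X + pi - hstep)\<^sup>2 - M" using ep(3) base unfolding nf(5-11) by linarith
  show "D0 n < (X + pi)\<^sup>2 - M" using ep(3) base unfolding nf(5-11) by linarith
  show "(X + pi)\<^sup>2 + M < E n" using ep(6) base unfolding nf(5-11) by linarith
  show "D1 n < E n" using ep(5,6) base unfolding nf(5-11) by linarith
  show "D1 n < (X + 2 * pi - hstep)\<^sup>2 - (M + 1)" using ep(5) base unfolding nf(5-11) by linarith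
  show "X\<^sup>2 + M < C1 n" using ep(4) base unfolding nf(5-11) by linarith
  show "M < C0 n" using ep(2) base unfolding nf(5-11) by linarith
  show "D0 n - (X - hstep)\<^sup>2 < M + 3" using ep(3) base unfolding nf(5-11) by linarith
  show "(X + hstep)\<^sup>2 - C0 n < M + 3" using ep(2) base unfolding nf(5-11) by linarith
  show "D1 n - (X + pi - hstep)\<^sup>2 < M + 3" using ep(5) base unfolding nf(5-11) by linarith
  show "(X + pi)\<^sup>2 - C1 n < M + 3" using ep(4) base unfolding nf(5-11) by linarith
  show "M + (M + 3) < 2 * pi\<^sup>2 * M" using base by linarith
qed

text \<open>The two centres differ by \<open>2 * n / 5\<close> only, which may be less than the
  errors, so estimates do not decide. If the order were reversed, \<open>C0 n\<close> would lie on
  the real band \<open>n\<close> between \<open>D0 n\<close> and \<open>C1 n\<close>; its level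
  \<open>2 cos h\<close> forces parameter \<open>h\<close>, and the eigenvalue would not be
  simple.\<close>

lemma C0_less_D0:
  assumes n: "n \<ge> N"
  shows "C0 n < D0 n"
proof (rule ccontr)
  assume c: "\<not> C0 n < D0 n"
  have a: "\<bar>n\<bar> \<ge> N" "\<bar>- n\<bar> \<ge> N" using n N_pos by auto
  have "C0 n \<in> {min (D0 n) (C1 n)..max (D0 n) (C1 n)}" using c order[OF n] by auto
  from mid_range[OF a(1) h_in(1,2) this] obtain s where
    s: "s \<in> {hstep..pi - hstep}" "lam n s = of_real (C0 n)" "f (C0 n) = 2 * cos s"
    using hstep_bounds(6) by auto
  have e: "lam (- n) hstep = of_real (C0 n)" by (rule mid(2)[OF a(2) h_in(1)])
  have "f (C0 n) = 2 * cos hstep" by (rule f_lam[OF h_in(3) e])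
  then have "s = hstep" using s cos_inj[of s hstep] h_in by auto
  then have "lam n hstep = lam (- n) hstep" using s e by simp
  then show False using mid(1)[OF a(2) h_in(1)] SR_lam_iff[OF h_in(3), of "- n"] n N_pos by auto
qed

lemma C1_less_D1:
  assumes n: "n \<ge> N"
  shows "C1 n < D1 n"
proof (rule ccontr)
  assume c: "\<not> C1 n < D1 n"
  have a: "\<bar>n\<bar> \<ge> N" "\<bar>- n - 1\<bar> \<ge> N" using n N_pos by auto
  have "D1 n \<in> {min (D0 n) (C1 n)..max (D0 n) (C1 n)}" using c order[OF n] by auto
  from mid_range[OF a(1) h_in(1,2) this] obtain s where
    s: "s \<in> {hstep..pi - hstep}" "lam n s = of_real (D1 n)" "f (D1 n) = 2 * cos s"
    using hstep_bounds(6) by auto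
  have e: "lam (- n - 1) (pi - hstep) = of_real (D1 n)" by (rule mid(2)[OF a(2) h_in(2)])
  have "f (D1 n) = 2 * cos (pi - hstep)" by (rule f_lam[OF h_in(4) e])
  then have "s = pi - hstep" using s cos_inj[of s "pi - hstep"] h_in by auto
  then have "lam n (pi - hstep) = lam (- n - 1) (pi - hstep)" using s e by simp
  then show False using mid(1)[OF a(2) h_in(2)] SR_lam_iff[OF h_in(4), of "- n - 1"] n N_pos by auto
qed

text \<open>All other indices are kept at distance more than \<open>2 * pi\<^sup>2 * n\<close> from
  the pair, so only the two members can coincide.\<close>

lemma simple_at_0:
  assumes n: "n \<ge> N" and k: "k \<in> {n, - n}"
  shows "(\<forall>j. j \<noteq> k \<longrightarrow> lam j 0 \<noteq> lam k 0) \<longleftrightarrow> lam n 0 \<noteq> lam (- n) 0"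
proof -
  have a: "\<bar>n\<bar> \<ge> N" using n N_pos by auto
  have t: "0 \<in> {0..hstep}" using hstep_bounds(1) by simp
  have ne: "y \<noteq> z" if "2 * pi\<^sup>2 * of_int \<bar>n\<bar> < cmod (y - z)" for y z
  proof
    assume "y = z"
    then have "2 * pi\<^sup>2 * of_int \<bar>n\<bar> < 0" using that by simp
    moreover have "0 \<le> 2 * pi\<^sup>2 * of_int \<bar>n\<bar>" by simp
    ultimately show False by linarith
  qed
  have A: "lam j 0 \<noteq> lam n 0" "lam j 0 \<noteq> lam (- n) 0" if "j \<noteq> n" "j \<noteq> - n" for j
    using ne[OF near_0(2)[OF a t, of j]] ne[OF near_0(3)[OF a t, of j]] that by auto
  have "n \<noteq> - n" using n N_pos by auto
  with A k show ?thesis by (metis (no_types, lifting) empty_iff insert_iff)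
qed

lemma simple_at_pi:
  assumes n: "n \<ge> N" and k: "k \<in> {n, - n - 1}"
  shows "(\<forall>j. j \<noteq> k \<longrightarrow> lam j pi \<noteq> lam k pi) \<longleftrightarrow> lam n pi \<noteq> lam (- n - 1) pi"
proof -
  have a: "\<bar>n\<bar> \<ge> N" using n N_pos by auto
  have t: "pi \<in> {pi - hstep..pi}" using hstep_bounds(1) by simp
  have ne: "y \<noteq> z" if "2 * pi\<^sup>2 * of_int \<bar>n\<bar> < cmod (y - z)" for y z
  proof
    assume "y = z"
    then have "2 * pi\<^sup>2 * of_int \<bar>n\<bar> < 0" using that by simp
    moreover have "0 \<le> 2 * pi\<^sup>2 * of_int \<bar>n\<bar>" by simp
    ultimately show False by linarith
  qed
  have A: "lam j pi \<noteq> lam n pi" "lam j pi \<noteq> lam (- n - 1) pi" if "j \<noteq> n" "j \<noteq> - n - 1" for j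
    using ne[OF near_pi(2)[OF a t, of j]] ne[OF near_pi(3)[OF a t, of j]] that by auto
  have "n \<noteq> - n - 1" using n N_pos by auto
  with A k show ?thesis by (metis (no_types, lifting) empty_iff insert_iff)
qed

text \<open>The supremum lies in \<open>[pi - h, pi]\<close>, where the disc of radius
  \<open>N\<close> bounds the real part by \<open>(2 * pi * N - pi + h)\<^sup>2 + N\<close>. This
  puts the gaps above \<open>C0 n\<close> inside the half-line.\<close>

lemma band_start_less:
  assumes n: "n \<ge> N"
  shows "band_start lam (- N) < C0 n"
proof -
  define T where "T = {t \<in> {pi - hstep..pi}. lam (- N) t \<in> \<real>}"
  define a where "a = Sup T"
  have N1: "\<bar>- N\<bar> \<ge> N" "\<bar>N\<bar> = N" using N_pos by auto
  have "lam (- N) (pi - hstep) \<in> \<real>" using mid(2)[OF N1(1) h_in(2)] by (metis Reals_of_real)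
  then have T: "pi - hstep \<in> T" using h_in(6) by (simp add: T_def)
  have "bdd_above T" by (rule bdd_aboveI[of _ pi]) (auto simp: T_def)
  then have "pi - hstep \<le> a" unfolding a_def using T by (intro cSup_upper)
  moreover have "a \<le> pi" unfolding a_def using T by (intro cSup_least) (use T_def in auto)
  ultimately have a: "a \<in> {pi - hstep..pi}" by simp
  have "- N \<in> {k. cmod (lam k a - of_real ((2 * pi * of_int (- N) + a)\<^sup>2)) < of_int \<bar>- N\<bar>}"
    unfolding near_pi(1)[OF N1(1) a] by simp
  then have "cmod (lam (- N) a - of_real ((2 * pi * of_int (- N) + a)\<^sup>2)) < of_int N" using N1 by simp
  then have "\<bar>Re (lam (- N) a - of_real ((2 * pi * of_int (- N) + a)\<^sup>2))\<bar> < of_int N"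
    using abs_Re_le_cmod order_le_less_trans by blast
  then have 1: "band_start lam (- N) < (2 * pi * of_int (- N) + a)\<^sup>2 + of_int N"
    by (simp add: band_start_def a_def T_def)
  have X: "2 * pi * of_int N \<ge> 6" using numeric_facts(1)[of "of_int N"] N_pos by simp
  have XX: "2 * pi * of_int N \<le> 2 * pi * of_int n" using n by simp
  have "(2 * pi * of_int (- N) + a)\<^sup>2 = (2 * pi * of_int N - a)\<^sup>2" by (simp add: power2_eq_square algebra_simps)
  also have "\<dots> \<le> (2 * pi * of_int n - pi + hstep)\<^sup>2"
  proof (rule power_mono)
    show "2 * pi * of_int N - a \<le> 2 * pi * of_int n - pi + hstep" using XX a unfolding atLeastAtMost_iff by linarith
    show "0 \<le> 2 * pi * of_int N - a" using X a pi_less_4 unfolding atLeastAtMost_iff by linarith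
  qed
  finally have "(2 * pi * of_int (- N) + a)\<^sup>2 + of_int N \<le> (2 * pi * of_int n - pi + hstep)\<^sup>2 + of_int n" using n by simp
  then show ?thesis using 1 order(2)[OF n] by linarith
qed

lemma in_band: "t \<in> {0..pi} \<Longrightarrow> lam n t = of_real x \<Longrightarrow> x \<in> re_part (band lam n)"
  unfolding re_part_def band_def by (metis image_eqI mem_Collect_eq)

lemma band_cases:
  assumes "x \<in> re_part (band lam n)"
  obtains t where "t \<in> {0..hstep}" "lam n t = of_real x" | t where "t \<in> {hstep..pi - hstep}" "lam n t = of_real x"
    | t where "t \<in> {pi - hstep..pi}" "lam n t = of_real x"
proof -
  obtain t where t: "t \<in> {0..pi}" "lam n t = of_real x" using assms by (auto simp: re_part_def band_def)
  then consider "t \<in> {0..hstep}" | "t \<in> {hstep..pi - hstep}" | "t \<in> {pi - hstep..pi}" by fastforce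
  then show ?thesis using that t(2) by cases blast+
qed

section \<open>Gap or no gap at the two ends of the parameter interval\<close>

text \<open>The two-branch alternative with the branches \<open>- n\<close> and \<open>n\<close>,
  which start at \<open>C0 n\<close> and \<open>D0 n\<close>. In the second case the lower bound
  \<open>2 cos h\<close> becomes \<open>- 2\<close>, so that \<open>[C0 n, D0 n]\<close> is
  spectrum.\<close>

lemma collision_0:
  assumes n: "n \<ge> N"
  obtains
    (gap) x1 x2 where "lam (- n) 0 = of_real x1" "lam n 0 = of_real x2" "C0 n < x1" "x1 < x2" "x2 < D0 n"
      "\<And>x. x \<in> {x1<..<x2} \<Longrightarrow> f x > 2"
      "\<And>s. s \<in> {0..hstep} \<Longrightarrow> \<exists>y1 y2. lam (- n) s = of_real y1 \<and> lam n s = of_real y2 \<and> y1 \<le> x1 \<and> x2 \<le> y2"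
  | (no_gap) "\<And>x. x \<in> {C0 n..D0 n} \<Longrightarrow> \<bar>f x\<bar> \<le> 2" "lam (- n) 0 = lam n 0 \<or> lam (- n) 0 \<notin> \<real> \<and> lam n 0 \<notin> \<real>"
proof -
  define X where "X = 2 * pi * real_of_int n"
  have a: "\<bar>n\<bar> \<ge> N" "\<bar>- n\<bar> \<ge> N" "\<bar>n\<bar> = n" using n N_pos by auto
  note ord = order[OF n, folded X_def]
  have h0: "0 < hstep" "hstep \<le> pi" using hstep_bounds by auto
  have X0: "X \<ge> 6" using numeric_facts(1)[OF ord(1)] by (simp add: X_def)
  have ec: "lam (- n) hstep = of_real (C0 n)" "lam n hstep = of_real (D0 n)"
    by (rule mid(2)[OF a(2) h_in(1)], rule mid(2)[OF a(1) h_in(1)])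
  have ne0: "cos s \<noteq> 1" if "s \<in> {hstep..pi - hstep}" for s
    using cos_inj[of s 0] that h0 hstep_bounds(1) h_in(7) by auto
  have no_gap': thesis
    if "\<And>x. x \<in> {C0 n..D0 n} \<Longrightarrow> 2 * cos hstep \<le> f x \<and> f x \<le> 2" "lam (- n) 0 = lam n 0 \<or> lam (- n) 0 \<notin> \<real> \<and> lam n 0 \<notin> \<real>"
  proof (rule no_gap)
    show "\<bar>f x\<bar> \<le> 2" if x: "x \<in> {C0 n..D0 n}" for x
      using \<open>\<And>x. x \<in> {C0 n..D0 n} \<Longrightarrow> 2 * cos hstep \<le> f x \<and> f x \<le> 2\<close>[OF x] cos_ge_minus_one[of hstep] by linarith
  qed (rule that(2))
  show ?thesis
  proof (rule two_branch_alternative[of hstep f f' "lam (- n)" "lam n" "C0 n" "D0 n"])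
    show "0 < hstep" "hstep \<le> pi" by (rule h0)+
    show "(f has_real_derivative f' x) (at x)" for x by (rule f_derivative)
    show "continuous_on {0..hstep} (lam (- n))" "continuous_on {0..hstep} (lam n)"
      by (rule continuous_on_subset[OF lam_cont h_in(8)])+
    show "C0 n < D0 n" by (rule C0_less_D0[OF n])
    show "lam (- n) hstep = of_real (C0 n)" "lam n hstep = of_real (D0 n)" by (rule ec)+
    show "f x = 2 * cos s" if "s \<in> {0..hstep}" "lam (- n) s = of_real x" for s x using f_lam that h_in(8) by blast
    show "f x = 2 * cos s" if "s \<in> {0..hstep}" "lam n s = of_real x" for s x using f_lam that h_in(8) by blast
    \<comment> \<open>Both \<open>lam n s\<close> and \<open>x\<close> are close to
      \<open>(X + s)\<^sup>2\<close>, at distances below \<open>n\<close> and \<open>n + 3\<close>;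
      an eigenvalue of another index would be farther from \<open>lam n s\<close> than these add up
      to.\<close>
    show "lam (- n) s = of_real x \<or> lam n s = of_real x"
      if s: "s \<in> {0..hstep}" and x: "x \<in> {C0 n..D0 n}" and fx: "f x = 2 * cos s" for s x
    proof -
      obtain k where k: "lam k s = of_real x" using lam_exists[of s x] s fx h_in(8) by blast
      have "k \<in> {n, - n}"
      proof (rule ccontr)
        assume "k \<notin> {n, - n}"
        from near_0(2)[OF a(1) s this] have g: "2 * pi\<^sup>2 * of_int n < cmod (lam n s - of_real x)" using a(3) k by simp
        have "n \<in> {k. cmod (lam k s - of_real ((2 * pi * of_int n + s)\<^sup>2)) < of_int \<bar>n\<bar>}"
          unfolding near_0(1)[OF a(1) s] by simp
        then have "cmod (lam n s - of_real ((X + s)\<^sup>2)) < of_int n" using a(3) by (simp add: X_def)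
        moreover have "cmod (of_real ((X + s)\<^sup>2) - of_real x) < of_int n + 3"
        proof -
          have "(X - hstep)\<^sup>2 \<le> (X + s)\<^sup>2" "(X + s)\<^sup>2 \<le> (X + hstep)\<^sup>2"
            using s X0 hstep_bounds(1,3) by (auto intro!: power_mono)
          then have "\<bar>(X + s)\<^sup>2 - x\<bar> < of_int n + 3" using ord(16,17) x by auto
          then show ?thesis unfolding of_real_diff[symmetric] norm_of_real .
        qed
        ultimately have "cmod (lam n s - of_real x) < of_int n + (of_int n + 3)"
          using norm_triangle_ineq[of "lam n s - of_real ((X + s)\<^sup>2)" "of_real ((X + s)\<^sup>2) - of_real x"] by simp
        then show False using g ord(20) by linarith
      qed
      then show ?thesis using k by auto
    qed
    show "f' x \<noteq> 0" if ne: "lam (- n) 0 \<noteq> lam n 0" and x: "lam (- n) 0 = of_real x \<or> lam n 0 = of_real x" for x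
      using x simple_derivative[of 0 _ x] simple_at_0[OF n, of n] simple_at_0[OF n, of "- n"] ne by fastforce
    \<comment> \<open>To the left of \<open>C0 n\<close> runs the band \<open>- n\<close> with
      parameters beyond \<open>h\<close>, hence with smaller values of \<open>f\<close>; simplicity
      excludes a vanishing derivative.\<close>
    show "f' (C0 n) > 0"
    proof -
      have fc: "f (C0 n) = 2 * cos hstep" by (rule f_lam[OF h_in(3) ec(1)])
      have "f' (C0 n) \<ge> 0"
      proof (rule derivative_nonneg_if_max_left[OF f_derivative ord(3)])
        fix x assume x: "P n < x" "x < C0 n"
        have "x \<in> {min (C0 n) (P n)..max (C0 n) (P n)}" using x by auto
        from mid_range[OF a(2) h_in(1,2) this] obtain s where
          s: "s \<in> {hstep..pi - hstep}" "f x = 2 * cos s" "lam (- n) s = of_real x" using hstep_bounds(6) by auto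
        have "s \<noteq> hstep" using s ec(1) x by auto
        then have "cos s < cos hstep" using s hstep_bounds(1) by (intro cos_monotone_0_pi) auto
        then show "f x < f (C0 n)" using s fc by simp
      qed
      moreover have "f' (C0 n) \<noteq> 0"
        using mid(1)[OF a(2) h_in(1)] SR_lam_iff[OF h_in(3)] by (intro simple_derivative[OF h_in(3) ec(1)]) blast
      ultimately show ?thesis by simp
    qed
    \<comment> \<open>Within distance \<open>n\<close> of \<open>X\<^sup>2\<close> but outside
      \<open>[C0 n, D0 n]\<close> the line is covered by the middle parts of the bands
      \<open>- n\<close> and \<open>n\<close>, where \<open>f\<close> does not reach 2.\<close>
    show "x \<in> {C0 n..D0 n}" if x: "lam (- n) 0 = of_real x \<or> lam n 0 = of_real x" for x
    proof -
      have t: "0 \<in> {0..hstep}" "0 \<in> {0..pi}" using h0 by auto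
      have b: "\<bar>x - X\<^sup>2\<bar> < of_int n"
        using x near_0_real[OF a(1) t(1), of n x] near_0_real[OF a(1) t(1), of "- n" x] a(3) by (auto simp: X_def)
      have fx: "f x = 2" using x f_lam[OF t(2)] by fastforce
      have "\<not> x < C0 n"
      proof
        assume "x < C0 n"
        then have "x \<in> {min (C0 n) (P n)..max (C0 n) (P n)}" using b ord(4) by auto
        from mid_range[OF a(2) h_in(1,2) this] obtain s where "s \<in> {hstep..pi - hstep}" "f x = 2 * cos s"
          using hstep_bounds(6) by auto
        then show False using ne0 fx by auto
      qed
      moreover have "\<not> D0 n < x"
      proof
        assume "D0 n < x"
        then have "x \<in> {min (D0 n) (C1 n)..max (D0 n) (C1 n)}" using b ord(14) by auto
        from mid_range[OF a(1) h_in(1,2) this] obtain s where "s \<in> {hstep..pi - hstep}" "f x = 2 * cos s"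
          using hstep_bounds(6) by auto
        then show False using ne0 fx by auto
      qed
      ultimately show ?thesis by auto
    qed
    show thesis
      if "lam (- n) 0 = of_real x1" "lam n 0 = of_real x2" "C0 n < x1" "x1 < x2" "x2 < D0 n"
        "\<And>x. x \<in> {x1<..<x2} \<Longrightarrow> f x > 2"
        "\<And>s. s \<in> {0..hstep} \<Longrightarrow> \<exists>y1 y2. lam (- n) s = of_real y1 \<and> lam n s = of_real y2 \<and> y1 \<le> x1 \<and> x2 \<le> y2" for x1 x2
      by (rule gap[of x1 x2]) (rule that; assumption)+
    show thesis
      if "\<And>x. x \<in> {C0 n..D0 n} \<Longrightarrow> 2 * cos hstep \<le> f x \<and> f x \<le> 2" "lam (- n) 0 = lam n 0 \<or> lam (- n) 0 \<notin> \<real> \<and> lam n 0 \<notin> \<real>"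
      by (rule no_gap') (rule that; assumption)+
  qed
qed

text \<open>Reduced to the same alternative by \<open>t = pi - s\<close> and the sign change
  \<open>cos (pi - s) = - cos s\<close>: the function is \<open>- f\<close>, the branches are
  \<open>n\<close> and \<open>- n - 1\<close>.\<close>

lemma collision_pi:
  assumes n: "n \<ge> N"
  obtains
    (gap) x1 x2 where "lam n pi = of_real x1" "lam (- n - 1) pi = of_real x2" "C1 n < x1" "x1 < x2" "x2 < D1 n"
      "\<And>x. x \<in> {x1<..<x2} \<Longrightarrow> f x < - 2"
      "\<And>s. s \<in> {pi - hstep..pi} \<Longrightarrow> \<exists>y1 y2. lam n s = of_real y1 \<and> lam (- n - 1) s = of_real y2 \<and> y1 \<le> x1 \<and> x2 \<le> y2"
  | (no_gap) "\<And>x. x \<in> {C1 n..D1 n} \<Longrightarrow> \<bar>f x\<bar> \<le> 2" "lam n pi = lam (- n - 1) pi \<or> lam n pi \<notin> \<real> \<and> lam (- n - 1) pi \<notin> \<real>"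
proof -
  define X where "X = 2 * pi * real_of_int n"
  define \<mu> where "\<mu> s = lam n (pi - s)" for s
  define \<nu> where "\<nu> s = lam (- n - 1) (pi - s)" for s
  have a: "\<bar>n\<bar> \<ge> N" "\<bar>- n - 1\<bar> \<ge> N" "\<bar>n\<bar> = n" using n N_pos by auto
  note ord = order[OF n, folded X_def]
  have h0: "0 < hstep" "hstep \<le> pi" using hstep_bounds by auto
  have X0: "X \<ge> 6" using numeric_facts(1)[OF ord(1)] by (simp add: X_def)
  have ec: "lam n (pi - hstep) = of_real (C1 n)" "lam (- n - 1) (pi - hstep) = of_real (D1 n)"
    by (rule mid(2)[OF a(1) h_in(2)], rule mid(2)[OF a(2) h_in(2)])
  have ne0: "cos s \<noteq> - 1" if "s \<in> {hstep..pi - hstep}" for s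
    using cos_inj[of s pi] that h0 hstep_bounds(1) h_in(7) by auto
  have refl: "pi - s \<in> {pi - hstep..pi}" "pi - s \<in> {0..pi}" if "s \<in> {0..hstep}" for s
    using that h0 by auto
  have contr: "continuous_on {0..hstep} (\<lambda>s. lam k (pi - s))" for k
    by (rule continuous_on_compose2[OF lam_cont]) (use h0 in \<open>auto intro!: continuous_intros\<close>)
  have gap': thesis
    if "\<mu> 0 = of_real x1" "\<nu> 0 = of_real x2" "C1 n < x1" "x1 < x2" "x2 < D1 n"
      "\<And>x. x \<in> {x1<..<x2} \<Longrightarrow> - f x > 2"
      "\<And>s. s \<in> {0..hstep} \<Longrightarrow> \<exists>y1 y2. \<mu> s = of_real y1 \<and> \<nu> s = of_real y2 \<and> y1 \<le> x1 \<and> x2 \<le> y2" for x1 x2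
  proof (rule gap[of x1 x2])
    show "\<exists>y1 y2. lam n s = of_real y1 \<and> lam (- n - 1) s = of_real y2 \<and> y1 \<le> x1 \<and> x2 \<le> y2"
      if s: "s \<in> {pi - hstep..pi}" for s
      using \<open>\<And>s. s \<in> {0..hstep} \<Longrightarrow> \<exists>y1 y2. \<mu> s = of_real y1 \<and> \<nu> s = of_real y2 \<and> y1 \<le> x1 \<and> x2 \<le> y2\<close>[of "pi - s"] s
      by (simp add: \<mu>_def \<nu>_def)
    show "f x < - 2" if x: "x \<in> {x1<..<x2}" for x
      using \<open>\<And>x. x \<in> {x1<..<x2} \<Longrightarrow> - f x > 2\<close>[OF x] by linarith
  qed (use that in \<open>simp_all add: \<mu>_def \<nu>_def\<close>)
  have no_gap': thesis
    if "\<And>x. x \<in> {C1 n..D1 n} \<Longrightarrow> 2 * cos hstep \<le> - f x \<and> - f x \<le> 2" "\<mu> 0 = \<nu> 0 \<or> \<mu> 0 \<notin> \<real> \<and> \<nu> 0 \<notin> \<real>"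
  proof (rule no_gap)
    show "\<bar>f x\<bar> \<le> 2" if x: "x \<in> {C1 n..D1 n}" for x
      using \<open>\<And>x. x \<in> {C1 n..D1 n} \<Longrightarrow> 2 * cos hstep \<le> - f x \<and> - f x \<le> 2\<close>[OF x] cos_ge_minus_one[of hstep] by linarith
  qed (use that(2) in \<open>simp add: \<mu>_def \<nu>_def\<close>)
  show ?thesis
  proof (rule two_branch_alternative[of hstep "\<lambda>x. - f x" "\<lambda>x. - f' x" \<mu> \<nu> "C1 n" "D1 n"])
    show "0 < hstep" "hstep \<le> pi" by (rule h0)+
    show "((\<lambda>x. - f x) has_real_derivative - f' x) (at x)" for x by (rule DERIV_minus[OF f_derivative])
    show "continuous_on {0..hstep} \<mu>" "continuous_on {0..hstep} \<nu>"
      unfolding \<mu>_def[abs_def] \<nu>_def[abs_def] by (rule contr)+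
    show "C1 n < D1 n" by (rule C1_less_D1[OF n])
    show "\<mu> hstep = of_real (C1 n)" "\<nu> hstep = of_real (D1 n)" unfolding \<mu>_def \<nu>_def by (rule ec)+
    show "- f x = 2 * cos s" if "s \<in> {0..hstep}" "\<mu> s = of_real x" for s x
      using f_lam[OF refl(2)[OF that(1)], of n x] that(2) by (simp add: \<mu>_def)
    show "- f x = 2 * cos s" if "s \<in> {0..hstep}" "\<nu> s = of_real x" for s x
      using f_lam[OF refl(2)[OF that(1)], of "- n - 1" x] that(2) by (simp add: \<nu>_def)
    show "\<mu> s = of_real x \<or> \<nu> s = of_real x"
      if s: "s \<in> {0..hstep}" and x: "x \<in> {C1 n..D1 n}" and fx: "- f x = 2 * cos s" for s x
    proof -
      define t where "t = pi - s"
      have t: "t \<in> {pi - hstep..pi}" "t \<in> {0..pi}" using refl[OF s] by (auto simp: t_def)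
      have ft: "f x = 2 * cos t" using fx by (simp add: t_def)
      obtain k where k: "lam k t = of_real x" using lam_exists[OF t(2) ft] by blast
      have "k \<in> {n, - n - 1}"
      proof (rule ccontr)
        assume "k \<notin> {n, - n - 1}"
        from near_pi(2)[OF a(1) t(1) this] have g: "2 * pi\<^sup>2 * of_int n < cmod (lam n t - of_real x)" using a(3) k by simp
        have "n \<in> {k. cmod (lam k t - of_real ((2 * pi * of_int n + t)\<^sup>2)) < of_int \<bar>n\<bar>}"
          unfolding near_pi(1)[OF a(1) t(1)] by simp
        then have "cmod (lam n t - of_real ((X + t)\<^sup>2)) < of_int n" using a(3) by (simp add: X_def)
        moreover have "cmod (of_real ((X + t)\<^sup>2) - of_real x) < of_int n + 3"
        proof -
          have "(X + pi - hstep)\<^sup>2 \<le> (X + t)\<^sup>2" "(X + t)\<^sup>2 \<le> (X + pi)\<^sup>2"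
            using t X0 h0 hstep_bounds(3) pi_gt3 by (auto intro!: power_mono)
          then have "\<bar>(X + t)\<^sup>2 - x\<bar> < of_int n + 3" using ord(18,19) x by auto
          then show ?thesis unfolding of_real_diff[symmetric] norm_of_real .
        qed
        ultimately have "cmod (lam n t - of_real x) < of_int n + (of_int n + 3)"
          using norm_triangle_ineq[of "lam n t - of_real ((X + t)\<^sup>2)" "of_real ((X + t)\<^sup>2) - of_real x"] by simp
        then show False using g ord(20) by linarith
      qed
      then show ?thesis using k by (auto simp: \<mu>_def \<nu>_def t_def)
    qed
    show "- f' x \<noteq> 0" if ne: "\<mu> 0 \<noteq> \<nu> 0" and x: "\<mu> 0 = of_real x \<or> \<nu> 0 = of_real x" for x
      using x simple_derivative[of pi _ x] simple_at_pi[OF n, of n] simple_at_pi[OF n, of "- n - 1"] ne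
      by (fastforce simp: \<mu>_def \<nu>_def)
    show "- f' (C1 n) > 0"
    proof -
      have fc: "f (C1 n) = 2 * cos (pi - hstep)" by (rule f_lam[OF h_in(4) ec(1)])
      have "- f' (C1 n) \<ge> 0"
      proof (rule derivative_nonneg_if_max_left[OF DERIV_minus[OF f_derivative] ord(7)])
        fix x assume x: "D0 n < x" "x < C1 n"
        have "x \<in> {min (D0 n) (C1 n)..max (D0 n) (C1 n)}" using x by auto
        from mid_range[OF a(1) h_in(1,2) this] obtain s where
          s: "s \<in> {hstep..pi - hstep}" "f x = 2 * cos s" "lam n s = of_real x" using hstep_bounds(6) by auto
        have "s \<noteq> pi - hstep" using s ec(1) x by auto
        then have "cos (pi - hstep) < cos s" using s hstep_bounds(1) by (intro cos_monotone_0_pi) auto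
        then show "- f x < - f (C1 n)" using s fc by simp
      qed
      moreover have "f' (C1 n) \<noteq> 0"
        using mid(1)[OF a(1) h_in(2)] SR_lam_iff[OF h_in(4)] by (intro simple_derivative[OF h_in(4) ec(1)]) blast
      ultimately show ?thesis by simp
    qed
    show "x \<in> {C1 n..D1 n}" if x: "\<mu> 0 = of_real x \<or> \<nu> 0 = of_real x" for x
    proof -
      have x': "lam n pi = of_real x \<or> lam (- n - 1) pi = of_real x" using x by (simp add: \<mu>_def \<nu>_def)
      have t: "pi \<in> {pi - hstep..pi}" "pi \<in> {0..pi}" using h0 by auto
      have b: "\<bar>x - (X + pi)\<^sup>2\<bar> < of_int n"
        using x' near_pi_real[OF a(1) t(1), of n x] near_pi_real[OF a(1) t(1), of "- n - 1" x] a(3) by (auto simp: X_def)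
      have fx: "f x = - 2" using x' f_lam[OF t(2)] by fastforce
      have "\<not> x < C1 n"
      proof
        assume "x < C1 n"
        then have "x \<in> {min (D0 n) (C1 n)..max (D0 n) (C1 n)}" using b ord(10) by auto
        from mid_range[OF a(1) h_in(1,2) this] obtain s where "s \<in> {hstep..pi - hstep}" "f x = 2 * cos s"
          using hstep_bounds(6) by auto
        then show False using ne0 fx by auto
      qed
      moreover have "\<not> D1 n < x"
      proof
        assume "D1 n < x"
        then have "x \<in> {min (E n) (D1 n)..max (E n) (D1 n)}" using b ord(11) by auto
        from mid_range[OF a(2) h_in(1,2) this] obtain s where "s \<in> {hstep..pi - hstep}" "f x = 2 * cos s"
          using hstep_bounds(6) by auto
        then show False using ne0 fx by auto
      qed
      ultimately show ?thesis by auto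
    qed
    show thesis
      if "\<mu> 0 = of_real x1" "\<nu> 0 = of_real x2" "C1 n < x1" "x1 < x2" "x2 < D1 n"
        "\<And>x. x \<in> {x1<..<x2} \<Longrightarrow> - f x > 2"
        "\<And>s. s \<in> {0..hstep} \<Longrightarrow> \<exists>y1 y2. \<mu> s = of_real y1 \<and> \<nu> s = of_real y2 \<and> y1 \<le> x1 \<and> x2 \<le> y2" for x1 x2
      by (rule gap'[of x1 x2]) (rule that; assumption)+
    show thesis
      if "\<And>x. x \<in> {C1 n..D1 n} \<Longrightarrow> 2 * cos hstep \<le> - f x \<and> - f x \<le> 2" "\<mu> 0 = \<nu> 0 \<or> \<mu> 0 \<notin> \<real> \<and> \<nu> 0 \<notin> \<real>"
      by (rule no_gap') (rule that; assumption)+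
  qed
qed

lemma in_spectrum_if_level: "f x = 2 * cos t \<Longrightarrow> x \<in> re_part (hill_spectrum q)"
  unfolding spectrum_f using cos_le_one[of t] cos_ge_minus_one[of t] by linarith

text \<open>Everything is read off the alternative of \<open>collision_0\<close>, the pair being
  separated from all other eigenvalues. The point \<open>x > n\<close> outside the spectrum and the
  inclusion of \<open>[C0 n, D0 n]\<close> are carried along for the finite-zone criterion.\<close>

lemma at_0:
  assumes n: "n \<ge> N"
  shows "SR_eigenvalue q 0 (lam n 0) \<longleftrightarrow> SR_eigenvalue q 0 (lam (- n) 0)"
    and "SR_eigenvalue q 0 (lam n 0) \<Longrightarrow> Re (lam (- n) 0) < Re (lam n 0) \<and>
      (\<forall>I. gap_between q lam N (- n) n I \<longleftrightarrow> I = {Re (lam (- n) 0)<..<Re (lam n 0)}) \<and>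
      (\<exists>x>of_int n. x \<notin> re_part (hill_spectrum q))"
    and "\<not> SR_eigenvalue q 0 (lam n 0) \<Longrightarrow>
      {C0 n..D0 n} \<subseteq> re_part (hill_spectrum q) \<and> (\<forall>I. \<not> gap_between q lam N (- n) n I)"
proof -
  define X where "X = 2 * pi * real_of_int n"
  have a: "\<bar>n\<bar> \<ge> N" "\<bar>- n\<bar> \<ge> N" "\<bar>n\<bar> = n" "\<bar>- n\<bar> = n" using n N_pos by auto
  note ord = order[OF n, folded X_def]
  have X0: "X \<ge> 6" using numeric_facts(1)[OF ord(1)] by (simp add: X_def)
  have t0: "0 \<in> {0..pi}" by simp
  have SR: "SR_eigenvalue q 0 (lam k 0) \<longleftrightarrow> lam k 0 \<in> \<real> \<and> lam n 0 \<noteq> lam (- n) 0" if "k \<in> {n, - n}" for k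
    unfolding SR_lam_iff[OF t0] simple_at_0[OF n that] ..
  have "(SR_eigenvalue q 0 (lam n 0) \<longleftrightarrow> SR_eigenvalue q 0 (lam (- n) 0)) \<and>
    (SR_eigenvalue q 0 (lam n 0) \<longrightarrow> Re (lam (- n) 0) < Re (lam n 0) \<and>
      (\<forall>I. gap_between q lam N (- n) n I \<longleftrightarrow> I = {Re (lam (- n) 0)<..<Re (lam n 0)}) \<and>
      (\<exists>x>of_int n. x \<notin> re_part (hill_spectrum q))) \<and>
    (\<not> SR_eigenvalue q 0 (lam n 0) \<longrightarrow>
      {C0 n..D0 n} \<subseteq> re_part (hill_spectrum q) \<and> (\<forall>I. \<not> gap_between q lam N (- n) n I))"
  proof (cases rule: collision_0[OF n])
    case (1 x1 x2)
    have sr: "SR_eigenvalue q 0 (lam n 0)" "SR_eigenvalue q 0 (lam (- n) 0)"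
      using 1(1,2,4) SR[of n] SR[of "- n"] by auto
    have out: "x \<notin> re_part (hill_spectrum q)" if "x \<in> {x1<..<x2}" for x
      unfolding spectrum_f using 1(6)[OF that] by simp
    have "gap_between q lam N (- n) n I \<longleftrightarrow> I = {x1<..<x2}" for I
    proof (rule gap_between_iff[OF 1(4) in_band[OF t0 1(1)] in_band[OF t0 1(2)]])
      fix x assume "x \<in> re_part (band lam (- n))"
      then show "x \<le> x1"
      proof (cases rule: band_cases)
        case (1 t)
        then obtain y1 where "lam (- n) t = of_real y1" "y1 \<le> x1" using \<open>\<And>s. s \<in> {0..hstep} \<Longrightarrow> \<exists>y1 y2. lam (- n) s = of_real y1 \<and> lam n s = of_real y2 \<and> y1 \<le> x1 \<and> x2 \<le> y2\<close> by blast
        then show ?thesis using 1 by simp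
      next
        case (2 t)
        then have "L (- n) t = x" by (simp add: L_def)
        then show ?thesis using mid_between[OF a(2) 2(1)] ord(3) \<open>C0 n < x1\<close> by auto
      next
        \<comment> \<open>Near \<open>t = pi\<close> the band \<open>- n\<close> need not be real;
          its real points lie in discs around \<open>(X - t)\<^sup>2\<close>, far below
          \<open>C0 n\<close>.\<close>
        case (3 t)
        have "\<bar>x - (2 * pi * of_int (- n) + t)\<^sup>2\<bar> < of_int \<bar>- n\<bar>"
          by (rule near_pi_real[OF a(2) 3(1) _ 3(2)]) simp
        then have "\<bar>x - (X - t)\<^sup>2\<bar> < of_int n" using a(4) by (simp add: X_def power2_eq_square algebra_simps)
        moreover have "(X - t)\<^sup>2 \<le> (X - pi + hstep)\<^sup>2"
          using 3(1) X0 pi_less_4 by (intro power_mono) auto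
        ultimately show ?thesis using ord(2) \<open>C0 n < x1\<close> by linarith
      qed
    next
      fix x assume "x \<in> re_part (band lam n)"
      then show "x2 \<le> x"
      proof (cases rule: band_cases)
        case (1 t)
        then obtain y2 where "lam n t = of_real y2" "x2 \<le> y2" using \<open>\<And>s. s \<in> {0..hstep} \<Longrightarrow> \<exists>y1 y2. lam (- n) s = of_real y1 \<and> lam n s = of_real y2 \<and> y1 \<le> x1 \<and> x2 \<le> y2\<close> by blast
        then show ?thesis using 1 by simp
      next
        case (2 t)
        then have "L n t = x" by (simp add: L_def)
        then show ?thesis using mid_between[OF a(1) 2(1)] ord(7) \<open>x2 < D0 n\<close> by auto
      next
        case (3 t)
        have "\<bar>x - (2 * pi * of_int n + t)\<^sup>2\<bar> < of_int \<bar>n\<bar>"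
          by (rule near_pi_real[OF a(1) 3(1) _ 3(2)]) simp
        then have "\<bar>x - (X + t)\<^sup>2\<bar> < of_int n" using a(3) by (simp add: X_def)
        moreover have "(X + pi - hstep)\<^sup>2 \<le> (X + t)\<^sup>2"
          using 3(1) X0 hstep_bounds(3) pi_gt3 by (intro power_mono) auto
        ultimately show ?thesis using ord(9) \<open>x2 < D0 n\<close> by linarith
      qed
    next
      show "x1 \<in> re_part (hill_spectrum q)" "x2 \<in> re_part (hill_spectrum q)"
        by (rule in_spectrum_if_level[OF f_lam[OF t0 1(1)]], rule in_spectrum_if_level[OF f_lam[OF t0 1(2)]])
      show "band_start lam (- N) \<le> x1" using band_start_less[OF n] 1(3) by linarith
    qed (rule out)
    moreover have "\<exists>x>of_int n. x \<notin> re_part (hill_spectrum q)"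
      using out[of "(x1 + x2) / 2"] 1(3,4) ord(15) by (intro exI[of _ "(x1 + x2) / 2"]) (auto simp: field_simps)
    ultimately show ?thesis using sr 1(1,2,4) by simp
  next
    case 2
    have sr: "\<not> SR_eigenvalue q 0 (lam n 0)" "\<not> SR_eigenvalue q 0 (lam (- n) 0)"
      using 2(2) SR[of n] SR[of "- n"] by auto
    have sub: "{C0 n..D0 n} \<subseteq> re_part (hill_spectrum q)"
      using 2(1) unfolding spectrum_f subset_iff by blast
    have "\<not> gap_between q lam N (- n) n I" for I
      by (rule no_gap_between[OF C0_less_D0[OF n] in_band[OF h_in(3) mid(2)[OF a(2) h_in(1)]]
            in_band[OF h_in(3) mid(2)[OF a(1) h_in(1)]] sub])
    then show ?thesis using sr sub by blast
  qed
  then show "SR_eigenvalue q 0 (lam n 0) \<longleftrightarrow> SR_eigenvalue q 0 (lam (- n) 0)"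
    "SR_eigenvalue q 0 (lam n 0) \<Longrightarrow> Re (lam (- n) 0) < Re (lam n 0) \<and>
      (\<forall>I. gap_between q lam N (- n) n I \<longleftrightarrow> I = {Re (lam (- n) 0)<..<Re (lam n 0)}) \<and>
      (\<exists>x>of_int n. x \<notin> re_part (hill_spectrum q))"
    "\<not> SR_eigenvalue q 0 (lam n 0) \<Longrightarrow>
      {C0 n..D0 n} \<subseteq> re_part (hill_spectrum q) \<and> (\<forall>I. \<not> gap_between q lam N (- n) n I)"
    by blast+
qed

lemma at_pi:
  assumes n: "n \<ge> N"
  shows "SR_eigenvalue q pi (lam n pi) \<longleftrightarrow> SR_eigenvalue q pi (lam (- n - 1) pi)"
    and "SR_eigenvalue q pi (lam n pi) \<Longrightarrow> Re (lam n pi) < Re (lam (- n - 1) pi) \<and>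
      (\<forall>I. gap_between q lam N n (- n - 1) I \<longleftrightarrow> I = {Re (lam n pi)<..<Re (lam (- n - 1) pi)}) \<and>
      (\<exists>x>of_int n. x \<notin> re_part (hill_spectrum q))"
    and "\<not> SR_eigenvalue q pi (lam n pi) \<Longrightarrow>
      {C1 n..D1 n} \<subseteq> re_part (hill_spectrum q) \<and> (\<forall>I. \<not> gap_between q lam N n (- n - 1) I)"
proof -
  define X where "X = 2 * pi * real_of_int n"
  have a: "\<bar>n\<bar> \<ge> N" "\<bar>- n - 1\<bar> \<ge> N" "\<bar>n\<bar> = n" "\<bar>- n - 1\<bar> = n + 1" using n N_pos by auto
  note ord = order[OF n, folded X_def]
  have X0: "X \<ge> 6" using numeric_facts(1)[OF ord(1)] by (simp add: X_def)
  have t0: "pi \<in> {0..pi}" by simp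
  have SR: "SR_eigenvalue q pi (lam k pi) \<longleftrightarrow> lam k pi \<in> \<real> \<and> lam n pi \<noteq> lam (- n - 1) pi" if "k \<in> {n, - n - 1}" for k
    unfolding SR_lam_iff[OF t0] simple_at_pi[OF n that] ..
  have "(SR_eigenvalue q pi (lam n pi) \<longleftrightarrow> SR_eigenvalue q pi (lam (- n - 1) pi)) \<and>
    (SR_eigenvalue q pi (lam n pi) \<longrightarrow> Re (lam n pi) < Re (lam (- n - 1) pi) \<and>
      (\<forall>I. gap_between q lam N n (- n - 1) I \<longleftrightarrow> I = {Re (lam n pi)<..<Re (lam (- n - 1) pi)}) \<and>
      (\<exists>x>of_int n. x \<notin> re_part (hill_spectrum q))) \<and>
    (\<not> SR_eigenvalue q pi (lam n pi) \<longrightarrow>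
      {C1 n..D1 n} \<subseteq> re_part (hill_spectrum q) \<and> (\<forall>I. \<not> gap_between q lam N n (- n - 1) I))"
  proof (cases rule: collision_pi[OF n])
    case (1 x1 x2)
    have sr: "SR_eigenvalue q pi (lam n pi)" "SR_eigenvalue q pi (lam (- n - 1) pi)"
      using 1(1,2,4) SR[of n] SR[of "- n - 1"] by auto
    have out: "x \<notin> re_part (hill_spectrum q)" if "x \<in> {x1<..<x2}" for x
      unfolding spectrum_f using 1(6)[OF that] by simp
    have "gap_between q lam N n (- n - 1) I \<longleftrightarrow> I = {x1<..<x2}" for I
    proof (rule gap_between_iff[OF 1(4) in_band[OF t0 1(1)] in_band[OF t0 1(2)]])
      fix x assume "x \<in> re_part (band lam n)"
      then show "x \<le> x1"
      proof (cases rule: band_cases)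
        case (1 t)
        have "\<bar>x - (2 * pi * of_int n + t)\<^sup>2\<bar> < of_int \<bar>n\<bar>"
          by (rule near_0_real[OF a(1) 1(1) _ 1(2)]) simp
        then have "\<bar>x - (X + t)\<^sup>2\<bar> < of_int n" using a(3) by (simp add: X_def)
        moreover have "(X + t)\<^sup>2 \<le> (X + hstep)\<^sup>2"
          using 1(1) X0 by (intro power_mono) auto
        ultimately show ?thesis using ord(6) \<open>C1 n < x1\<close> by linarith
      next
        case (2 t)
        then have "L n t = x" by (simp add: L_def)
        then show ?thesis using mid_between[OF a(1) 2(1)] ord(7) \<open>C1 n < x1\<close> by auto
      next
        case (3 t)
        then obtain y1 where "lam n t = of_real y1" "y1 \<le> x1" using \<open>\<And>s. s \<in> {pi - hstep..pi} \<Longrightarrow> \<exists>y1 y2. lam n s = of_real y1 \<and> lam (- n - 1) s = of_real y2 \<and> y1 \<le> x1 \<and> x2 \<le> y2\<close> by blast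
        then show ?thesis using 3 by simp
      qed
    next
      fix x assume "x \<in> re_part (band lam (- n - 1))"
      then show "x2 \<le> x"
      proof (cases rule: band_cases)
        case (1 t)
        have "\<bar>x - (2 * pi * of_int (- n - 1) + t)\<^sup>2\<bar> < of_int \<bar>- n - 1\<bar>"
          by (rule near_0_real[OF a(2) 1(1) _ 1(2)]) simp
        then have "\<bar>x - (X + 2 * pi - t)\<^sup>2\<bar> < of_int n + 1" unfolding a(4) by (simp add: X_def power2_eq_square algebra_simps)
        moreover have "(X + 2 * pi - hstep)\<^sup>2 \<le> (X + 2 * pi - t)\<^sup>2"
          using 1(1) X0 hstep_bounds(3) pi_gt3 by (intro power_mono) auto
        ultimately show ?thesis using ord(13) \<open>x2 < D1 n\<close> by linarith
      next
        case (2 t)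
        then have "L (- n - 1) t = x" by (simp add: L_def)
        then show ?thesis using mid_between[OF a(2) 2(1)] ord(12) \<open>x2 < D1 n\<close> by auto
      next
        case (3 t)
        then obtain y2 where "lam (- n - 1) t = of_real y2" "x2 \<le> y2" using \<open>\<And>s. s \<in> {pi - hstep..pi} \<Longrightarrow> \<exists>y1 y2. lam n s = of_real y1 \<and> lam (- n - 1) s = of_real y2 \<and> y1 \<le> x1 \<and> x2 \<le> y2\<close> by blast
        then show ?thesis using 3 by simp
      qed
    next
      show "x1 \<in> re_part (hill_spectrum q)" "x2 \<in> re_part (hill_spectrum q)"
        by (rule in_spectrum_if_level[OF f_lam[OF t0 1(1)]], rule in_spectrum_if_level[OF f_lam[OF t0 1(2)]])
      show "band_start lam (- N) \<le> x1" using band_start_less[OF n] ord(5) 1(3) by linarith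
    qed (rule out)
    moreover have "\<exists>x>of_int n. x \<notin> re_part (hill_spectrum q)"
      using out[of "(x1 + x2) / 2"] 1(3,4) ord(5,15) by (intro exI[of _ "(x1 + x2) / 2"]) (auto simp: field_simps)
    ultimately show ?thesis using sr 1(1,2,4) by simp
  next
    case 2
    have sr: "\<not> SR_eigenvalue q pi (lam n pi)" "\<not> SR_eigenvalue q pi (lam (- n - 1) pi)"
      using 2(2) SR[of n] SR[of "- n - 1"] by auto
    have sub: "{C1 n..D1 n} \<subseteq> re_part (hill_spectrum q)"
      using 2(1) unfolding spectrum_f subset_iff by blast
    have "\<not> gap_between q lam N n (- n - 1) I" for I
      by (rule no_gap_between[OF C1_less_D1[OF n] in_band[OF h_in(4) mid(2)[OF a(1) h_in(2)]]
            in_band[OF h_in(4) mid(2)[OF a(2) h_in(2)]] sub])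
    then show ?thesis using sr sub by blast
  qed
  then show "SR_eigenvalue q pi (lam n pi) \<longleftrightarrow> SR_eigenvalue q pi (lam (- n - 1) pi)"
    "SR_eigenvalue q pi (lam n pi) \<Longrightarrow> Re (lam n pi) < Re (lam (- n - 1) pi) \<and>
      (\<forall>I. gap_between q lam N n (- n - 1) I \<longleftrightarrow> I = {Re (lam n pi)<..<Re (lam (- n - 1) pi)}) \<and>
      (\<exists>x>of_int n. x \<notin> re_part (hill_spectrum q))"
    "\<not> SR_eigenvalue q pi (lam n pi) \<Longrightarrow>
      {C1 n..D1 n} \<subseteq> re_part (hill_spectrum q) \<and> (\<forall>I. \<not> gap_between q lam N n (- n - 1) I)"
    by blast+
qed

section \<open>Finite-zone potentials\<close>

lemma mid_in_spectrum:
  assumes "\<bar>n\<bar> \<ge> N"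
  shows "{min (L n hstep) (L n (pi - hstep))..max (L n hstep) (L n (pi - hstep))} \<subseteq> re_part (hill_spectrum q)"
  using mid_range[OF assms h_in(1,2)] in_spectrum_if_level by blast

text \<open>The intervals \<open>[C0 n, D0 n]\<close>, \<open>[D0 n, C1 n]\<close>,
  \<open>[C1 n, D1 n]\<close>, \<open>[D1 n, E n]\<close> join up, since
  \<open>E n = C0 (n + 1)\<close>, and \<open>C0 n > n\<close> makes them exhaust the half-line. The
  second and fourth always belong to the spectrum, the other two when no SR eigenvalue
  occurs.\<close>

lemma half_line_in_spectrum:
  assumes M: "M \<ge> N" and no: "\<And>n. n \<ge> M \<Longrightarrow> \<not> SR_eigenvalue q 0 (lam n 0) \<and> \<not> SR_eigenvalue q pi (lam n pi)"
  shows "{C0 M..} \<subseteq> re_part (hill_spectrum q)"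
proof -
  have step: "{C0 n..C0 (n + 1)} \<subseteq> re_part (hill_spectrum q)" if n: "n \<ge> M" for n
  proof -
    have nN: "n \<ge> N" using n M by simp
    have a: "\<bar>n\<bar> \<ge> N" "\<bar>- n - 1\<bar> \<ge> N" using nN N_pos by auto
    have "C0 (n + 1) = E n" by simp
    then have "{C0 n..C0 (n + 1)} \<subseteq> {C0 n..D0 n} \<union> {min (D0 n) (C1 n)..max (D0 n) (C1 n)} \<union> {C1 n..D1 n} \<union> {min (E n) (D1 n)..max (E n) (D1 n)}"
      by auto
    also have "\<dots> \<subseteq> re_part (hill_spectrum q)"
    proof (intro Un_least)
      show "{C0 n..D0 n} \<subseteq> re_part (hill_spectrum q)" "{C1 n..D1 n} \<subseteq> re_part (hill_spectrum q)"
        using at_0(3)[OF nN] at_pi(3)[OF nN] no[OF n] by blast+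
    qed (rule mid_in_spectrum[OF a(1)], rule mid_in_spectrum[OF a(2)])
    finally show ?thesis .
  qed
  have all: "{C0 M..C0 (M + int k)} \<subseteq> re_part (hill_spectrum q)" for k
  proof (induction k)
    case 0
    have "C0 M < C0 (M + 1)" using order(5)[OF M] C1_less_D1[OF M] order(12)[OF M] by simp
    then show ?case using step[of M] by auto
  next
    case (Suc k)
    have e: "M + int (Suc k) = M + int k + 1" by simp
    have "x \<in> re_part (hill_spectrum q)" if x: "x \<in> {C0 M..C0 (M + int k + 1)}" for x
    proof (cases "x \<le> C0 (M + int k)")
      case True
      then show ?thesis using Suc x unfolding atLeastAtMost_iff subset_iff by blast
    next
      case False
      then have "x \<in> {C0 (M + int k)..C0 (M + int k + 1)}" using x unfolding atLeastAtMost_iff by linarith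
      moreover have "M + int k \<ge> M" by simp
      ultimately show ?thesis using step by blast
    qed
    then show ?case unfolding e by (rule subsetI)
  qed
  show ?thesis
  proof
    fix x assume x: "x \<in> {C0 M..}"
    obtain k where k: "x \<le> real k" using real_arch_simple by blast
    have "real_of_int (M + int k) < C0 (M + int k)" using order(15)[of "M + int k"] M by simp
    then have "x \<in> {C0 M..C0 (M + int k)}" using x k M N_pos by auto
    then show "x \<in> re_part (hill_spectrum q)" using all by blast
  qed
qed

lemma bounded_indices:
  assumes R: "{R..} \<subseteq> re_part (hill_spectrum q)" and n: "n \<ge> N"
    and S: "SR_eigenvalue q 0 (lam n 0) \<or> SR_eigenvalue q pi (lam n pi)"
  shows "of_int n < R"
proof -
  obtain x where x: "x > of_int n" "x \<notin> re_part (hill_spectrum q)"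
    using S at_0(2)[OF n] at_pi(2)[OF n] by blast
  then have "\<not> R \<le> x" using R by auto
  then show ?thesis using x by linarith
qed

text \<open>An SR eigenvalue of large index brings a point beyond that index outside the spectrum,
  so a half-line of spectrum bounds the indices. Conversely, past the last SR index the spectrum has
  no holes.\<close>

lemma finite_zone_iff:
  "finite_zone q \<longleftrightarrow> finite {z. SR_eigenvalue q 0 z} \<and> finite {z. SR_eigenvalue q pi z}"
proof
  assume "finite_zone q"
  then obtain R where R: "{R..} \<subseteq> re_part (hill_spectrum q)" by (auto simp: finite_zone_def)
  define K where "K = max N \<lceil>R\<rceil> + 1"
  have KN: "N < K" "R \<le> of_int K" by (auto simp: K_def) linarith
  have "{z. SR_eigenvalue q 0 z} \<subseteq> (\<lambda>k. lam k 0) ` {- K..K}"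
  proof
    fix z assume "z \<in> {z. SR_eigenvalue q 0 z}"
    then have z: "SR_eigenvalue q 0 z" by simp
    then obtain k where k: "lam k 0 = z" using SR_imp_lam[of 0 z] by auto
    have "\<bar>k\<bar> \<le> K"
    proof (rule ccontr)
      assume "\<not> \<bar>k\<bar> \<le> K"
      then have n: "\<bar>k\<bar> \<ge> N" "R < of_int \<bar>k\<bar>" using KN by linarith+
      have "k = \<bar>k\<bar> \<or> k = - \<bar>k\<bar>" by linarith
      then have "SR_eigenvalue q 0 (lam \<bar>k\<bar> 0)" using z k at_0(1)[OF n(1)] by metis
      then show False using bounded_indices[OF R n(1)] n(2) by auto
    qed
    then show "z \<in> (\<lambda>k. lam k 0) ` {- K..K}" using k by (intro image_eqI[of _ _ k]) auto
  qed
  moreover have "{z. SR_eigenvalue q pi z} \<subseteq> (\<lambda>k. lam k pi) ` {- K - 1..K}"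
  proof
    fix z assume "z \<in> {z. SR_eigenvalue q pi z}"
    then have z: "SR_eigenvalue q pi z" by simp
    then obtain k where k: "lam k pi = z" using SR_imp_lam[of pi z] by auto
    have "k \<in> {- K - 1..K}"
    proof (rule ccontr)
      assume c: "k \<notin> {- K - 1..K}"
      \<comment> \<open>At \<open>t = pi\<close> the indices pair up as \<open>n\<close> and
        \<open>- n - 1\<close>; this is the nonnegative member of the pair containing
        \<open>k\<close>.\<close>
      define n where "n = (if k \<ge> 0 then k else - k - 1)"
      have n: "n \<ge> N" "R < of_int n" "k = n \<or> k = - n - 1" using KN c N_pos by (auto simp: n_def split: if_splits)
      then have "SR_eigenvalue q pi (lam n pi)" using z k at_pi(1)[OF n(1)] by metis
      then show False using bounded_indices[OF R n(1)] n(2) by auto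
    qed
    then show "z \<in> (\<lambda>k. lam k pi) ` {- K - 1..K}" using k by (intro image_eqI[of _ _ k]) auto
  qed
  ultimately show "finite {z. SR_eigenvalue q 0 z} \<and> finite {z. SR_eigenvalue q pi z}"
    by (meson finite_atLeastAtMost_int finite_imageI finite_subset)
next
  assume fin: "finite {z. SR_eigenvalue q 0 z} \<and> finite {z. SR_eigenvalue q pi z}"
  \<comment> \<open>A simple eigenvalue has only one index, so finitely many eigenvalues mean
    finitely many indices.\<close>
  have "finite {n. SR_eigenvalue q t (lam n t)}" if t: "t \<in> {0..pi}" and f: "finite {z. SR_eigenvalue q t z}" for t
  proof (rule inj_on_finite[OF _ _ f])
    show "inj_on (\<lambda>n. lam n t) {n. SR_eigenvalue q t (lam n t)}"
      using SR_lam_iff[OF t] by (auto simp: inj_on_def)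
  qed auto
  then have "finite ({n. SR_eigenvalue q 0 (lam n 0)} \<union> {n. SR_eigenvalue q pi (lam n pi)})" using fin by simp
  from bdd_above_finite[OF this] obtain B where
    "\<forall>n\<in>{n. SR_eigenvalue q 0 (lam n 0)} \<union> {n. SR_eigenvalue q pi (lam n pi)}. n \<le> B"
    unfolding bdd_above_def by blast
  then have B: "\<And>n. SR_eigenvalue q 0 (lam n 0) \<or> SR_eigenvalue q pi (lam n pi) \<Longrightarrow> n \<le> B" by blast
  have "{C0 (max N (B + 1))..} \<subseteq> re_part (hill_spectrum q)"
  proof (rule half_line_in_spectrum)
    fix n assume "max N (B + 1) \<le> n"
    then have "\<not> n \<le> B" by simp
    then show "\<not> SR_eigenvalue q 0 (lam n 0) \<and> \<not> SR_eigenvalue q pi (lam n pi)" using B by blast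
  qed simp
  then show "finite_zone q" unfolding finite_zone_def by blast
qed

end

theorem theorem3:
  fixes q :: "real \<Rightarrow> complex" and lam :: "int \<Rightarrow> real \<Rightarrow> complex" and N :: int
  assumes "q absolutely_integrable_on {0..1}"
    and "integral {0..1} q = 0"
    and "\<forall>x. q (x + 1) = q x"
    and "\<forall>x. cnj (q (- x)) = q x"
    and "hill_numbering q lam"
    and "numbering_threshold q lam N"
  shows "(\<forall>n\<ge>N.
      (SR_eigenvalue q 0 (lam n 0) \<longrightarrow>
         SR_eigenvalue q 0 (lam (- n) 0) \<and>
         Re (lam (- n) 0) < Re (lam n 0) \<and>
         (\<forall>I. gap_between q lam N (- n) n I \<longleftrightarrow> I = {Re (lam (- n) 0)<..<Re (lam n 0)})) \<and>
      (SR_eigenvalue q pi (lam n pi) \<longrightarrow>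
         SR_eigenvalue q pi (lam (- n - 1) pi) \<and>
         Re (lam n pi) < Re (lam (- n - 1) pi) \<and>
         (\<forall>I. gap_between q lam N n (- n - 1) I \<longleftrightarrow> I = {Re (lam n pi)<..<Re (lam (- n - 1) pi)})) \<and>
      (\<not> SR_eigenvalue q 0 (lam n 0) \<longrightarrow> \<not> (\<exists>I. gap_between q lam N (- n) n I)) \<and>
      (\<not> SR_eigenvalue q pi (lam n pi) \<longrightarrow> \<not> (\<exists>I. gap_between q lam N n (- n - 1) I))) \<and>
    (finite_zone q \<longleftrightarrow>
       finite {z. SR_eigenvalue q 0 z} \<and> finite {z. SR_eigenvalue q pi z})"
proof -
  interpret hill_bands q lam N
    by unfold_locales (use assms in auto)
  show ?thesis
  proof (rule conjI, intro allI impI)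
    fix n assume "n \<ge> N"
    note at = at_0[OF this] at_pi[OF this]
    show "(SR_eigenvalue q 0 (lam n 0) \<longrightarrow>
         SR_eigenvalue q 0 (lam (- n) 0) \<and>
         Re (lam (- n) 0) < Re (lam n 0) \<and>
         (\<forall>I. gap_between q lam N (- n) n I \<longleftrightarrow> I = {Re (lam (- n) 0)<..<Re (lam n 0)})) \<and>
      (SR_eigenvalue q pi (lam n pi) \<longrightarrow>
         SR_eigenvalue q pi (lam (- n - 1) pi) \<and>
         Re (lam n pi) < Re (lam (- n - 1) pi) \<and>
         (\<forall>I. gap_between q lam N n (- n - 1) I \<longleftrightarrow> I = {Re (lam n pi)<..<Re (lam (- n - 1) pi)})) \<and>
      (\<not> SR_eigenvalue q 0 (lam n 0) \<longrightarrow> \<not> (\<exists>I. gap_between q lam N (- n) n I)) \<and>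
      (\<not> SR_eigenvalue q pi (lam n pi) \<longrightarrow> \<not> (\<exists>I. gap_between q lam N n (- n - 1) I))"
      using at by (intro conjI impI) simp_all
  qed (rule finite_zone_iff)
qed

end
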